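(* Let $\omega_1,\omega_2$ be nonzero real numbers, which may be equal. Consider the holomorphic system $$\dot x=i\omega_1x+y+f,\quad \dot y=i\omega_1y+g,\quad \dot z=i\omega_2z+h,$$ where $f,g,h$ are holomorphic near $0\in\mathbb{C}^3$ and vanish to order at least $2$. Then: 1) The system has no $y$-invariant holomorphic center manifold at the origin. 2) If $\omega_2/\omega_1\notin\mathbb{N}$, it has a unique $x$-invariant holomorphic center manifold at the origin, containing an isochronous center family of period $2\pi/|\omega_1|$. 3) If $\omega_1/\omega_2\notin\mathbb{N}$, it has a unique $z$-invariant holomorphic center manifold at the origin, containing an isochronous center family of period $2\pi/|\omega_2|$. 4) If $\omega_1=\omega_2$, it has a unique $(x,z)$-invariant holomorphic center manifold at the origin, containing an isochronous center family of period $2\pi/|\omega_1|$. 5) Suppose $\omega_2/\omega_1=k\in\mathbb{N}\setminus\{1\}$. Apply $k-2$ reduction steps to the Briot–Bouquet system in the $x$-direction, and let $\bar r_x$ be the second component of the resulting constant vector. If $\bar r_x=0$, there are infinitely many $x$-invariant holomorphic center manifolds at the origin, each containing an isochronous center family of period $2\pi/|\omega_1|$. If $\bar r_x\neq0$, there is none. 6) Suppose $\omega_1/\omega_2=k\in\mathbb{N}\setminus\{1\}$. Apply $k-2$ reduction steps to the Briot–Bouquet system in the $z$-direction, and let $\bar r_z$ be the second component of the resulting constant vector. If $\bar r_z=0$, there are infinitely many $z$-invariant holomorphic center manifolds at the origin, each containing an isochronous center family of period $2\pi/|\omega_2|$. If $\bar r_z\neq0$, there is none.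
   Context: A (two-dimensional) Briot–Bouquet system is a system $x\,w'(x)=x\,a+Mw+F(x,w)$ for $w=(u,v)$. Here $a\in\mathbb{C}^2$ is called its constant vector, $M$ is a complex $2\times2$ matrix called its linear matrix, and $F$ is holomorphic near $0\in\mathbb{C}^3$ with $F(0)=0$ and $DF(0)=0$. Reduction step: take such a system and a vector $c\in\mathbb{C}^2$ with $(I-M)c=a$. The substitution $w=x(\tilde w+c)$ transforms the system into the Briot–Bouquet system $x\tilde w'=x\tilde a+(M-I)\tilde w+\tilde F(x,\tilde w)$. Here $\tilde a=F_2(1,c)$, where $F_2$ is the homogeneous quadratic part of $F$, and $\tilde F(x,\tilde w)=x^{-1}F(x,x(\tilde w+c))-x\tilde a$. If $1$ is not an eigenvalue of $M$, then $c=(I-M)^{-1}a$ is unique and this is called the reduction step. "Applying $k$ reduction steps" means iterating it $k$ times; zero steps leaves the system unchanged. For a system $\dot x=P$, $\dot y=Q$, $\dot z=R$: - The Briot–Bouquet system in the $x$-direction is $x u'=\frac{Q(x,xu,xv)}{P(x,xu,xv)}-u$, $x v'=\frac{R(x,xu,xv)}{P(x,xu,xv)}-v$, with $u=y/x$, $v=z/x$. - The Briot–Bouquet system in the $z$-direction is $z u'=\frac{P(zu,zv,z)}{R(zu,zv,z)}-u$, $z v'=\frac{Q(zu,zv,z)}{R(zu,zv,z)}-v$, with $u=x/z$, $v=y/z$. Their right-hand sides are holomorphic near the origin and vanish there. An $x$-invariant (resp. $y$-, $z$-invariant) holomorphic center manifold at the origin is a germ at $0$ of a one-dimensional complex submanifold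 of $\mathbb{C}^3$ through $0$ that is invariant under the system and tangent at $0$ to the $x$-axis (resp. $y$-, $z$-axis). An $(x,z)$-invariant one is such a germ of a two-dimensional complex invariant submanifold tangent at $0$ to the $(x,z)$-plane. Such a manifold $S$ contains an isochronous center family of period $T$ if every real-time trajectory of the system starting at a point of $S\setminus\{0\}$ sufficiently close to $0$ is periodic of period $T$. $\mathbb{N}=\{1,2,3,\dots\}$. *)

theory Defs
  imports "HOL-Analysis.Analysis"
begin

type_synonym C3 = "complex \<times> complex \<times> complex"

definition cmul3 :: "complex \<Rightarrow> C3 \<Rightarrow> C3" where
  "cmul3 c p = (c * fst p, c * fst (snd p), c * snd (snd p))"

definition holo3 :: "C3 set \<Rightarrow> (C3 \<Rightarrow> complex) \<Rightarrow> bool" where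
  "holo3 W f \<longleftrightarrow> open W \<and>
     (\<forall>p\<in>W. \<exists>L. (f has_derivative L) (at p) \<and> (\<forall>c v. L (cmul3 c v) = c * L v))"

abbreviation D3 :: "(C3 \<Rightarrow> complex) \<Rightarrow> C3 \<Rightarrow> C3 \<Rightarrow> complex" where
  "D3 G p \<equiv> frechet_derivative G (at p)"

definition sysP :: "real \<Rightarrow> (C3 \<Rightarrow> complex) \<Rightarrow> C3 \<Rightarrow> complex" where
  "sysP w1 f p = \<i> * of_real w1 * fst p + fst (snd p) + f p"
definition sysQ :: "real \<Rightarrow> (C3 \<Rightarrow> complex) \<Rightarrow> C3 \<Rightarrow> complex" where
  "sysQ w1 g p = \<i> * of_real w1 * fst (snd p) + g p"
definition sysR :: "real \<Rightarrow> (C3 \<Rightarrow> complex) \<Rightarrow> C3 \<Rightarrow> complex" where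
  "sysR w2 h p = \<i> * of_real w2 * snd (snd p) + h p"

definition field3 :: "(C3 \<Rightarrow> complex) \<Rightarrow> (C3 \<Rightarrow> complex) \<Rightarrow> (C3 \<Rightarrow> complex) \<Rightarrow> C3 \<Rightarrow> C3" where
  "field3 P Q R p = (P p, Q p, R p)"

definition xaxis :: "C3 set" where "xaxis = {(t, 0, 0) | t. True}"
definition yaxis :: "C3 set" where "yaxis = {(0, t, 0) | t. True}"
definition zaxis :: "C3 set" where "zaxis = {(0, 0, t) | t. True}"
definition xzplane :: "C3 set" where "xzplane = {(s, 0, t) | s t. True}"

text \<open>S represents (near 0) an invariant one-dimensional complex submanifold
  through 0, tangent at 0 to the complex line E: near 0 it is the regular zero set
  of a holomorphic submersion (G1,G2) : C^3 -> C^2, its tangent space at 0 (kernel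
  of the derivative) is E, and the vector field V is tangent to it.\<close>
definition curve_cm :: "(C3 \<Rightarrow> C3) \<Rightarrow> C3 set \<Rightarrow> C3 set \<Rightarrow> bool" where
  "curve_cm V E S \<longleftrightarrow> 0 \<in> S \<and>
     (\<exists>U G1 G2. open U \<and> 0 \<in> U \<and> holo3 U G1 \<and> holo3 U G2 \<and>
        S \<inter> U = {p \<in> U. G1 p = 0 \<and> G2 p = 0} \<and>
        (\<forall>p\<in>U. surj (\<lambda>v. (D3 G1 p v, D3 G2 p v))) \<and>
        {v. D3 G1 0 v = 0 \<and> D3 G2 0 v = 0} = E \<and>
        (\<forall>p \<in> S \<inter> U. D3 G1 p (V p) = 0 \<and> D3 G2 p (V p) = 0))"

definition surf_cm :: "(C3 \<Rightarrow> C3) \<Rightarrow> C3 set \<Rightarrow> C3 set \<Rightarrow> bool" where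
  "surf_cm V E S \<longleftrightarrow> 0 \<in> S \<and>
     (\<exists>U G. open U \<and> 0 \<in> U \<and> holo3 U G \<and>
        S \<inter> U = {p \<in> U. G p = 0} \<and>
        (\<forall>p\<in>U. surj (D3 G p)) \<and>
        {v. D3 G 0 v = 0} = E \<and>
        (\<forall>p \<in> S \<inter> U. D3 G p (V p) = 0))"

definition germ_eq :: "C3 set \<Rightarrow> C3 set \<Rightarrow> bool" where
  "germ_eq S S' \<longleftrightarrow> (\<exists>N. open N \<and> 0 \<in> N \<and> S \<inter> N = S' \<inter> N)"

definition iso_family :: "(C3 \<Rightarrow> C3) \<Rightarrow> C3 set \<Rightarrow> C3 set \<Rightarrow> real \<Rightarrow> bool" where
  "iso_family V W S T \<longleftrightarrow> (\<exists>r>0. \<forall>p\<in>S. p \<noteq> 0 \<and> norm p < r \<longrightarrow>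
     (\<exists>\<gamma> :: real \<Rightarrow> C3. \<gamma> 0 = p \<and> (\<forall>t. \<gamma> t \<in> W) \<and>
        (\<forall>t. (\<gamma> has_vector_derivative V (\<gamma> t)) (at t)) \<and>
        (\<forall>t. \<gamma> (t + T) = \<gamma> t) \<and> (\<forall>s. 0 < s \<and> s < T \<longrightarrow> \<gamma> s \<noteq> p)))"

text \<open>A Briot--Bouquet system x w' = x a + M w + F(x,w) is stored as (a, M, F).\<close>
type_synonym bbsys = "(complex^2) \<times> (complex^2^2) \<times> (complex \<Rightarrow> complex^2 \<Rightarrow> complex^2)"

definition bb_const :: "bbsys \<Rightarrow> complex^2" where
  "bb_const s = fst s"

definition bb_of :: "(complex \<Rightarrow> complex^2 \<Rightarrow> complex^2) \<Rightarrow> bbsys" where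
  "bb_of Phi = (let a = (\<chi> i. deriv (\<lambda>x. Phi x 0 $ i) 0);
                    M = (\<chi> i j. deriv (\<lambda>s. Phi 0 (s *s axis j 1) $ i) 0)
                in (a, M, \<lambda>x w. Phi x w - x *s a - M *v w))"

text \<open>Homogeneous quadratic part F_2 evaluated at (1,c):
  F_2(1,c) = (1/2) d^2/dt^2 F(t, t c) at t = 0.\<close>
definition quad_part :: "(complex \<Rightarrow> complex^2 \<Rightarrow> complex^2) \<Rightarrow> complex^2 \<Rightarrow> complex^2" where
  "quad_part F c = (\<chi> i. deriv (deriv (\<lambda>t. F t (t *s c) $ i)) 0 / 2)"

text \<open>The reduction step (F~ extended holomorphically by 0 at x = 0).\<close>
definition reduce :: "bbsys \<Rightarrow> bbsys" where
  "reduce s = (case s of (a, M, F) \<Rightarrow>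
     (let c = (THE c. (mat 1 - M) *v c = a); a' = quad_part F c
      in (a', M - mat 1,
          \<lambda>x w. if x = 0 then 0 else inverse x *s F x (x *s (w + c)) - x *s a')))"

definition bbx_raw :: "(C3 \<Rightarrow> complex) \<Rightarrow> (C3 \<Rightarrow> complex) \<Rightarrow> (C3 \<Rightarrow> complex)
    \<Rightarrow> complex \<Rightarrow> complex^2 \<Rightarrow> complex^2" where
  "bbx_raw P Q R x w = (let p = (x, x * w$1, x * w$2) in
     vector [Q p / P p - w$1, R p / P p - w$2])"

definition bbx_rhs :: "(C3 \<Rightarrow> complex) \<Rightarrow> (C3 \<Rightarrow> complex) \<Rightarrow> (C3 \<Rightarrow> complex)
    \<Rightarrow> complex \<Rightarrow> complex^2 \<Rightarrow> complex^2" where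
  "bbx_rhs P Q R x w = (if x = 0 then Lim (at 0) (\<lambda>s. bbx_raw P Q R s w) else bbx_raw P Q R x w)"

definition bbz_raw :: "(C3 \<Rightarrow> complex) \<Rightarrow> (C3 \<Rightarrow> complex) \<Rightarrow> (C3 \<Rightarrow> complex)
    \<Rightarrow> complex \<Rightarrow> complex^2 \<Rightarrow> complex^2" where
  "bbz_raw P Q R z w = (let p = (z * w$1, z * w$2, z) in
     vector [P p / R p - w$1, Q p / R p - w$2])"

definition bbz_rhs :: "(C3 \<Rightarrow> complex) \<Rightarrow> (C3 \<Rightarrow> complex) \<Rightarrow> (C3 \<Rightarrow> complex)
    \<Rightarrow> complex \<Rightarrow> complex^2 \<Rightarrow> complex^2" where
  "bbz_rhs P Q R z w = (if z = 0 then Lim (at 0) (\<lambda>s. bbz_raw P Q R s w) else bbz_raw P Q R z w)"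

end

theory Submission
  imports Defs "HOL-Complex_Analysis.Complex_Analysis"
begin

text \<open>
  An invariant curve tangent to a coordinate axis is, after blowing up, the same as a holomorphic solution of the
  Briot--Bouquet system in that direction. Each reduction step peels off one Taylor coefficient of the solution and shifts
  the linear matrix by \<open>-1\<close>; the coefficient is unique unless \<open>1\<close> is an eigenvalue, which happens exactly at the last
  step of the resonant cases, where solvability is the vanishing of the second entry of the constant vector. Once the
  linear matrix has been shifted far to the left the system is solved by a contraction. A one-dimensional field
  with linear part \<open>i \<omega> x\<close> is linearizable, whence the periods.

  For \<open>\<omega>\<^sub>1 = \<omega>\<^sub>2\<close> one solves directly, again by a contraction, for a map \<open>\<Phi>\<close> from the plane \<open>y = 0\<close> which conjugates
  \<open>i \<omega> q\<close> to the given field; its image is the surface. The difference of two invariant graphs is nearly an eigenfunction with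
  eigenvalue \<open>1\<close> of a field close to the Euler field but vanishes to second order, hence is zero.
\<close>

no_notation fps_nth (infixl "$" 75)

section \<open>Holomorphic functions and maps in three variables\<close>

text \<open>In the x-direction the linear matrix is diagonal with eigenvalues \<open>0\<close> and
  \<open>w2/w1 - 1\<close>; in the z-direction it has the single eigenvalue \<open>w1/w2 - 1\<close>
  and a nonzero off-diagonal entry. Order n of a Taylor solution can be obstructed only if n is an
  eigenvalue, so a ratio k produces one critical order, k - 1, reached after k - 2 uniquely solvable
  steps. There the second row of \<open>mat 1 - M\<close> vanishes and its kernel is a line: in the
  diagonal case the second coefficient is free, in the Jordan case the first. Either way the second
  entry of the constant vector is the obstruction, and its vanishing leaves one free parameter. A
  cyclic rotation of the coordinates turns the z-direction into an x-direction, so a single locale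
  with parameters treats both.

  For the surface all eigenvalues equal l, and a term of order d >= 2 meets the divisor d l - l,
  which is never 0. Integration along rays halves quadratic bounds; a contraction results once the
  nilpotent entry has been scaled down.

  \<open>iso_family\<close> asks for the minimal period, which is why the flow is conjugated to an
  exact rotation rather than merely shown to close up.\<close>

lemma cmul3_simps [simp]:
  "cmul3 c (x, y, z) = (c * x, c * y, c * z)" "cmul3 0 p = 0" "cmul3 1 p = p" "cmul3 c 0 = 0"
  by (auto simp: cmul3_def zero_prod_def)

lemma cmul3_cmul3 [simp]: "cmul3 a (cmul3 b p) = cmul3 (a * b) p"
  by (simp add: cmul3_def mult.assoc)

lemma norm_cmul3 [simp]: "norm (cmul3 c p) = norm c * norm p"
proof -
  have "norm (cmul3 c p) ^ 2 = (norm c * norm p) ^ 2"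
    by (cases p) (auto simp: norm_Pair norm_mult power_mult_distrib algebra_simps)
  then show ?thesis
    by (meson norm_ge_zero mult_nonneg_nonneg power2_eq_imp_eq)
qed

lemma bounded_bilinear_cmul3: "bounded_bilinear cmul3"
proof
  show "\<exists>K. \<forall>a b. norm (cmul3 a b) \<le> norm a * norm b * K"
    by (rule exI[of _ 1]) simp
qed (auto simp: cmul3_def algebra_simps scaleR_conv_of_real)

lemma holo3_open: "holo3 W f \<Longrightarrow> open W"
  by (simp add: holo3_def)

lemma holo3_D:
  assumes "holo3 W f" "p \<in> W"
  shows "(f has_derivative D3 f p) (at p)" "D3 f p (cmul3 c v) = c * D3 f p v"
proof -
  obtain L where L: "(f has_derivative L) (at p)" "\<forall>c v. L (cmul3 c v) = c * L v"
    using assms unfolding holo3_def by blast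
  then have "L = D3 f p" using frechet_derivative_at by blast
  with L show "(f has_derivative D3 f p) (at p)" "D3 f p (cmul3 c v) = c * D3 f p v" by blast+
qed

lemma D3_eq: "(f has_derivative L) (at p) \<Longrightarrow> D3 f p = L"
  using frechet_derivative_at by force

lemma holo3_subset: "holo3 W f \<Longrightarrow> open S \<Longrightarrow> S \<subseteq> W \<Longrightarrow> holo3 S f"
  unfolding holo3_def by blast

lemma holo3_continuous_on: "holo3 W f \<Longrightarrow> continuous_on W f"
  by (meson continuous_at_imp_continuous_on has_derivative_continuous holo3_D(1))

lemma holo3I:
  assumes "open W" "\<And>p. p \<in> W \<Longrightarrow> (f has_derivative L p) (at p)"
    "\<And>p c v. p \<in> W \<Longrightarrow> L p (cmul3 c v) = c * L p v"
  shows "holo3 W f"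
  using assms unfolding holo3_def by blast

lemma holo3_const: "open W \<Longrightarrow> holo3 W (\<lambda>p. c)"
  by (rule holo3I[where L="\<lambda>_ _. 0"]) auto

lemma holo3_fst: "open W \<Longrightarrow> holo3 W (\<lambda>p. fst p)"
  by (rule holo3I[where L="\<lambda>_ v. fst v"]) (auto intro!: derivative_eq_intros simp: cmul3_def)

lemma holo3_fst_snd: "open W \<Longrightarrow> holo3 W (\<lambda>p. fst (snd p))"
  by (rule holo3I[where L="\<lambda>_ v. fst (snd v)"]) (auto intro!: derivative_eq_intros simp: cmul3_def)

lemma holo3_snd_snd: "open W \<Longrightarrow> holo3 W (\<lambda>p. snd (snd p))"
  by (rule holo3I[where L="\<lambda>_ v. snd (snd v)"]) (auto intro!: derivative_eq_intros simp: cmul3_def)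

lemma holo3_add:
  assumes "holo3 W f" "holo3 W g" shows "holo3 W (\<lambda>p. f p + g p)"
  by (rule holo3I[where L="\<lambda>p v. D3 f p v + D3 g p v"])
    (use assms in \<open>auto intro!: derivative_intros holo3_D(1) holo3_open simp: holo3_D(2) algebra_simps\<close>)

lemma holo3_diff:
  assumes "holo3 W f" "holo3 W g" shows "holo3 W (\<lambda>p. f p - g p)"
  by (rule holo3I[where L="\<lambda>p v. D3 f p v - D3 g p v"])
    (use assms in \<open>auto intro!: derivative_intros holo3_D(1) holo3_open simp: holo3_D(2) algebra_simps\<close>)

lemma holo3_mult:
  assumes "holo3 W f" "holo3 W g" shows "holo3 W (\<lambda>p. f p * g p)"
proof (rule holo3I[where L="\<lambda>p v. f p * D3 g p v + D3 f p v * g p"])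
  show "((\<lambda>p. f p * g p) has_derivative (\<lambda>v. f p * D3 g p v + D3 f p v * g p)) (at p)" if "p \<in> W" for p
    using that assms by (intro has_derivative_mult holo3_D(1))
qed (use assms in \<open>auto intro: holo3_open simp: holo3_D(2) algebra_simps\<close>)

lemma holo3_compose_holomorphic:
  assumes f: "holo3 W f" and h: "h holomorphic_on T" "open T" and sub: "f ` W \<subseteq> T"
  shows "holo3 W (\<lambda>p. h (f p))"
proof (rule holo3I[where L="\<lambda>p v. D3 f p v * deriv h (f p)"])
  fix p assume p: "p \<in> W"
  have "(h has_field_derivative deriv h (f p)) (at (f p))"
    using h sub p holomorphic_derivI by blast
  then have "(h has_derivative (\<lambda>u. u * deriv h (f p))) (at (f p))"
    unfolding has_field_derivative_def by (simp add: mult.commute[of _ "deriv h (f p)"])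
  from has_derivative_compose[OF holo3_D(1)[OF f p] this]
  show "((\<lambda>p. h (f p)) has_derivative (\<lambda>v. D3 f p v * deriv h (f p))) (at p)" .
qed (use f in \<open>auto simp: holo3_D(2) holo3_open\<close>)

text \<open>Complex linearity of \<open>D3 f\<close> turns the real derivative of the composite into
  multiplication by one complex number. This chain rule carries questions in three variables over to
  one-variable theory.\<close>

lemma holo3_curve:
  assumes f: "holo3 W f" and p: "(g1 \<zeta>, g2 \<zeta>, g3 \<zeta>) \<in> W"
    and g: "(g1 has_field_derivative a1) (at \<zeta>)" "(g2 has_field_derivative a2) (at \<zeta>)"
      "(g3 has_field_derivative a3) (at \<zeta>)"
  shows "((\<lambda>\<zeta>. f (g1 \<zeta>, g2 \<zeta>, g3 \<zeta>)) has_field_derivative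
      D3 f (g1 \<zeta>, g2 \<zeta>, g3 \<zeta>) (a1, a2, a3)) (at \<zeta>)"
proof -
  have "((\<lambda>\<zeta>. (g1 \<zeta>, g2 \<zeta>, g3 \<zeta>)) has_derivative (\<lambda>h. (a1 * h, a2 * h, a3 * h))) (at \<zeta>)"
    using g by (auto intro!: has_derivative_Pair simp: has_field_derivative_def)
  from has_derivative_compose[OF this holo3_D(1)[OF f p]]
  have "((\<lambda>\<zeta>. f (g1 \<zeta>, g2 \<zeta>, g3 \<zeta>)) has_derivative
      (\<lambda>h. D3 f (g1 \<zeta>, g2 \<zeta>, g3 \<zeta>) (a1 * h, a2 * h, a3 * h))) (at \<zeta>)" .
  moreover have "D3 f (g1 \<zeta>, g2 \<zeta>, g3 \<zeta>) (a1 * h, a2 * h, a3 * h)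
      = D3 f (g1 \<zeta>, g2 \<zeta>, g3 \<zeta>) (a1, a2, a3) * h" for h
    using holo3_D(2)[OF f p, of h "(a1, a2, a3)"] by (simp add: mult.commute)
  ultimately show ?thesis
    by (simp add: has_field_derivative_def)
qed

lemma holo3_curve_holomorphic:
  assumes f: "holo3 W f" and S: "open S" and g: "g1 holomorphic_on S" "g2 holomorphic_on S" "g3 holomorphic_on S"
    and W: "\<And>\<zeta>. \<zeta> \<in> S \<Longrightarrow> (g1 \<zeta>, g2 \<zeta>, g3 \<zeta>) \<in> W"
  shows "(\<lambda>\<zeta>. f (g1 \<zeta>, g2 \<zeta>, g3 \<zeta>)) holomorphic_on S"
proof (rule holomorphic_onI)
  fix \<zeta> assume z: "\<zeta> \<in> S"
  show "(\<lambda>\<zeta>. f (g1 \<zeta>, g2 \<zeta>, g3 \<zeta>)) field_differentiable at \<zeta> within S"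
    using holo3_curve[OF f W[OF z] holomorphic_derivI[OF g(1) S z] holomorphic_derivI[OF g(2) S z] holomorphic_derivI[OF g(3) S z]]
    by (meson field_differentiable_at_within field_differentiable_def)
qed

section \<open>Cauchy estimates and their consequences\<close>

text \<open>On the complex line through \<open>p\<close> in direction \<open>v\<close> this is the
  one-variable Cauchy inequality, for the disc of radius \<open>r / norm v\<close>, the largest
  whose image stays in the ball.\<close>

lemma holo3_cauchy:
  assumes f: "holo3 W f" and r: "r > 0" "cball p r \<subseteq> W" and B: "\<And>q. q \<in> cball p r \<Longrightarrow> norm (f q) \<le> B"
  shows "norm (D3 f p v) \<le> B / r * norm v"
proof (cases "v = 0")
  case True
  have "linear (D3 f p)"
    using holo3_D(1)[OF f, of p] r by (meson centre_in_cball has_derivative_linear less_imp_le subsetD)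
  then show ?thesis using True by (simp add: linear_0)
next
  case False
  define \<rho> where "\<rho> = r / norm v"
  have rho: "\<rho> > 0" using r False by (simp add: \<rho>_def)
  obtain p1 p2 p3 v1 v2 v3 where pv: "p = (p1, p2, p3)" "v = (v1, v2, v3)"
    by (metis prod.exhaust)
  define h where "h = (\<lambda>\<zeta>. f (p1 + \<zeta> * v1, p2 + \<zeta> * v2, p3 + \<zeta> * v3))"
  have in_ball: "(p1 + \<zeta> * v1, p2 + \<zeta> * v2, p3 + \<zeta> * v3) \<in> cball p r" if "norm \<zeta> \<le> \<rho>" for \<zeta>
  proof -
    have "(p1 + \<zeta> * v1, p2 + \<zeta> * v2, p3 + \<zeta> * v3) = p + cmul3 \<zeta> v" by (simp add: pv)
    moreover have "norm \<zeta> * norm v \<le> r"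
      using that False by (simp add: \<rho>_def field_simps)
    ultimately show ?thesis by (simp add: dist_norm)
  qed
  have der: "(h has_field_derivative D3 f (p1 + \<zeta> * v1, p2 + \<zeta> * v2, p3 + \<zeta> * v3) v) (at \<zeta>)" if "norm \<zeta> \<le> \<rho>" for \<zeta>
    unfolding h_def pv(2)
    by (rule holo3_curve[OF f]) (use in_ball[OF that] r in \<open>auto intro!: derivative_eq_intros\<close>)
  have "norm ((deriv ^^ 1) h 0) \<le> fact 1 * B / \<rho> ^ 1"
  proof (rule Cauchy_inequality)
    show "h holomorphic_on ball 0 \<rho>"
      using der by (intro holomorphic_onI) (metis field_differentiable_def has_field_derivative_at_within mem_ball_0 less_imp_le)
    show "continuous_on (cball 0 \<rho>) h"
      using der by (intro continuous_at_imp_continuous_on ballI) (metis DERIV_isCont mem_cball_0)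
    show "norm (h \<zeta>) \<le> B" if "norm (0 - \<zeta>) = \<rho>" for \<zeta>
      unfolding h_def by (rule B[OF in_ball]) (use that in simp)
  qed (rule rho)
  moreover have "deriv h 0 = D3 f p v"
    using DERIV_imp_deriv[OF der[of 0]] rho by (simp add: pv)
  ultimately show ?thesis by (simp add: \<rho>_def)
qed

lemma holo3_shift:
  assumes "holo3 W f" shows "holo3 {q. q + a \<in> W} (\<lambda>q. f (q + a))" "q + a \<in> W \<Longrightarrow> D3 (\<lambda>q. f (q + a)) q = D3 f (q + a)"
proof -
  have der: "((\<lambda>q. f (q + a)) has_derivative D3 f (q + a)) (at q)" if "q + a \<in> W" for q
    by (rule has_derivative_compose[where f="\<lambda>q. q + a" and f'="\<lambda>v. v" and g=f])
      (use holo3_D(1)[OF assms that] in \<open>auto intro!: derivative_eq_intros\<close>)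
  then show "q + a \<in> W \<Longrightarrow> D3 (\<lambda>q. f (q + a)) q = D3 f (q + a)"
    by (rule D3_eq)
  have "open {q. q + a \<in> W}"
    using open_vimage[OF holo3_open[OF assms], of "\<lambda>q. q + a"] by (simp add: vimage_def continuous_on_add)
  then show "holo3 {q. q + a \<in> W} (\<lambda>q. f (q + a))"
    by (rule holo3I[where L="\<lambda>q. D3 f (q + a)"]) (auto simp: der holo3_D(2)[OF assms])
qed

lemma holo3_lipschitz_from_D:
  assumes f: "holo3 W f" and S: "convex S" "S \<subseteq> W" and B: "\<And>q v. q \<in> S \<Longrightarrow> norm (D3 f q v) \<le> B * norm v"
    and "p \<in> S" "q \<in> S"
  shows "norm (f p - f q) \<le> B * norm (p - q)"
proof (rule differentiable_bound[where S=S and f'="D3 f"])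
  show "(f has_derivative D3 f x) (at x within S)" if "x \<in> S" for x
    using holo3_D(1)[OF f] that S by (meson has_derivative_at_withinI subsetD)
  have "B \<ge> 0"
    using B[OF \<open>p \<in> S\<close>, of "(1,0,0)"] by (simp add: norm_Pair) (meson norm_ge_zero order_trans)
  then show "onorm (D3 f x) \<le> B" if "x \<in> S" for x
    using B[OF that] by (intro onorm_bound) auto
qed (use assms in auto)

text \<open>Second derivatives are avoided: the increment \<open>f (s + (q - p)) - f s\<close> is of
  size \<open>norm (q - p)\<close> throughout a ball about \<open>p\<close>, so a Cauchy estimate
  bounds its derivative at \<open>p\<close>, which is the difference of the two derivatives.\<close>

lemma holo3_D_lipschitz:
  assumes f: "holo3 W f" and r: "r > 0" "cball p (2 * r) \<subseteq> W"
  shows "\<exists>C\<ge>0. \<forall>q\<in>cball p (r / 2). \<forall>v. norm (D3 f q v - D3 f p v) \<le> C * norm (q - p) * norm v"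
proof -
  have "compact (f ` cball p (2 * r))"
    by (rule compact_continuous_image) (use holo3_continuous_on[OF f] r in \<open>auto intro: continuous_on_subset\<close>)
  then obtain B where B: "\<And>q. q \<in> cball p (2 * r) \<Longrightarrow> norm (f q) \<le> B"
    by (meson bounded_iff compact_imp_bounded imageI)
  have "norm (f p) \<le> B" using B r by simp
  then have B0: "B \<ge> 0" using norm_ge_zero order_trans by blast
  have cb: "cball q r \<subseteq> cball p (2 * r)" if "q \<in> cball p r" for q
    using that by (intro cball_subset_cball_iff[THEN iffD2]) (auto simp: dist_commute)
  have D: "norm (D3 f q v) \<le> B / r * norm v" if "q \<in> cball p r" for q v
    by (rule holo3_cauchy[OF f r(1)]) (use cb[OF that] r B in auto)
  have sub: "cball p r \<subseteq> W" using cb[of p] r by auto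
  have L: "norm (f q - f q') \<le> B / r * norm (q - q')" if "q \<in> cball p r" "q' \<in> cball p r" for q q'
    by (rule holo3_lipschitz_from_D[OF f _ sub D]) (use that in auto)
  show ?thesis
  proof (intro exI[of _ "B / r / (r/2)"] conjI ballI allI)
    show "B / r / (r/2) \<ge> 0" using B0 r by simp
    fix q v assume q: "q \<in> cball p (r/2)"
    let ?F = "\<lambda>s. f (s + (q - p)) - f s"
    let ?V = "{s. s + (q - p) \<in> W} \<inter> W"
    have oV: "open ?V"
      by (intro open_Int holo3_open[OF holo3_shift(1)[OF f]] holo3_open[OF f])
    have F1: "holo3 ?V (\<lambda>s. f (s + (q - p)))"
      by (rule holo3_subset[OF holo3_shift(1)[OF f] oV]) auto
    have F2: "holo3 ?V f" by (rule holo3_subset[OF f oV]) auto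
    have inr: "s \<in> cball p r" "s + (q - p) \<in> cball p r" if "s \<in> cball p (r/2)" for s
    proof -
      show "s \<in> cball p r" using that r by auto
      have "norm (p - (s + (q - p))) \<le> norm (p - s) + norm (p - q)"
        using norm_triangle_ineq[of "p - s" "p - q"] by (simp add: algebra_simps)
      then show "s + (q - p) \<in> cball p r" using that q by (auto simp: dist_norm)
    qed
    have "norm (D3 ?F p v) \<le> (B / r * norm (q - p)) / (r/2) * norm v"
    proof (rule holo3_cauchy[OF holo3_diff[OF F1 F2]])
      show "cball p (r/2) \<subseteq> ?V" using inr sub by blast
      show "norm (?F s) \<le> B / r * norm (q - p)" if "s \<in> cball p (r/2)" for s
        using L[of "s + (q - p)" s] inr[OF that] by simp
    qed (use r in auto)
    moreover have "D3 ?F p v = D3 f q v - D3 f p v"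
    proof -
      have pV: "p \<in> ?V" using inr[of p] sub r by auto
      have "(?F has_derivative (\<lambda>v. D3 (\<lambda>s. f (s + (q - p))) p v - D3 f p v)) (at p)"
        by (intro derivative_intros holo3_D(1)[OF F1 pV] holo3_D(1)[OF F2 pV])
      then show ?thesis using holo3_shift(2)[OF f, of p "q - p"] pV by (simp add: D3_eq)
    qed
    ultimately show "norm (D3 f q v - D3 f p v) \<le> B / r / (r/2) * norm (q - p) * norm v"
      by (simp add: mult_ac)
  qed
qed

lemma holo3_D_bounded_linear: "holo3 W f \<Longrightarrow> p \<in> W \<Longrightarrow> bounded_linear (D3 f p)"
  using holo3_D(1) has_derivative_bounded_linear by blast

lemma open_contains_cball2:
  assumes "open (W :: 'a::metric_space set)" "p \<in> W"
  obtains r where "r > 0" "cball p (2 * r) \<subseteq> W"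
proof -
  obtain e where "e > 0" "cball p e \<subseteq> W" using assms open_contains_cball by blast
  then show thesis using that[of "e/2"] by simp
qed

text \<open>The inverse function theorem and the Leibniz rule want the derivative as a continuous
  map into bounded linear maps; the Lipschitz bound on derivatives supplies the continuity.\<close>

lemma holo3_blinfun:
  assumes f: "holo3 W f"
  obtains f' where "\<And>p. p \<in> W \<Longrightarrow> blinfun_apply (f' p) = D3 f p" "continuous_on W f'"
proof
  let ?f' = "\<lambda>p. Blinfun (D3 f p)"
  show app: "blinfun_apply (?f' p) = D3 f p" if "p \<in> W" for p
    by (rule bounded_linear_Blinfun_apply[OF holo3_D_bounded_linear[OF f that]])
  show "continuous_on W ?f'"
    unfolding continuous_on_iff
  proof (intro ballI allI impI)
    fix p and e :: real assume p: "p \<in> W" and e: "e > 0"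
    obtain r where r: "r > 0" "cball p (2 * r) \<subseteq> W"
      using open_contains_cball2[OF holo3_open[OF f] p] .
    obtain C where C: "C \<ge> 0" "\<And>q v. q \<in> cball p (r/2) \<Longrightarrow> norm (D3 f q v - D3 f p v) \<le> C * norm (q - p) * norm v"
      using holo3_D_lipschitz[OF f r] by blast
    show "\<exists>d>0. \<forall>x'\<in>W. dist x' p < d \<longrightarrow> dist (?f' x') (?f' p) < e"
    proof (intro exI[of _ "min (r/2) (e / (C + 1))"] conjI ballI impI)
      show "min (r/2) (e / (C + 1)) > 0" using r e C by simp
      fix q assume q: "q \<in> W" "dist q p < min (r/2) (e / (C + 1))"
      then have qb: "q \<in> cball p (r/2)" by (simp add: dist_commute)
      have "dist (?f' q) (?f' p) \<le> C * norm (q - p)"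
        unfolding dist_norm
      proof (rule norm_blinfun_bound)
        show "norm (blinfun_apply (?f' q - ?f' p) v) \<le> C * norm (q - p) * norm v" for v
          using C(2)[OF qb] by (simp add: blinfun.diff_left app q p)
      qed (use C in simp)
      also have "\<dots> \<le> (C + 1) * norm (q - p)" by (simp add: distrib_right)
      also have "\<dots> < e" using q C by (simp add: dist_norm field_simps)
      finally show "dist (?f' q) (?f' p) < e" .
    qed
  qed
qed

text \<open>A Lipschitz derivative that vanishes at 0 is at most \<open>C * d\<close> on the ball of
  radius \<open>d\<close>, so the mean value inequality applies with that constant. The quadratic
  bound is the case of the closed ball of radius \<open>norm p\<close> and the points
  \<open>p\<close> and 0.\<close>

lemma holo3_flat_bounds:
  assumes f: "holo3 W f" and 0: "0 \<in> W" "f 0 = 0" "(f has_derivative (\<lambda>_. 0)) (at 0)"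
  obtains r C where "r > 0" "C \<ge> 0" "ball 0 r \<subseteq> W"
    "\<And>d p q. d \<le> r \<Longrightarrow> p \<in> ball 0 d \<Longrightarrow> q \<in> ball 0 d \<Longrightarrow> norm (f p - f q) \<le> C * d * norm (p - q)"
    "\<And>p. p \<in> ball 0 r \<Longrightarrow> norm (f p) \<le> C * norm p ^ 2"
proof -
  obtain r where r: "r > 0" "cball 0 (2 * r) \<subseteq> W"
    using open_contains_cball2[OF holo3_open[OF f] 0(1)] .
  obtain C where C: "C \<ge> 0" "\<And>q v. q \<in> cball 0 (r/2) \<Longrightarrow> norm (D3 f q v - D3 f 0 v) \<le> C * norm (q - 0) * norm v"
    using holo3_D_lipschitz[OF f r] by blast
  have D0: "D3 f 0 = (\<lambda>_. 0)" by (rule D3_eq[OF 0(3)])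
  have b: "cball 0 (r/2) \<subseteq> W" using r by (intro order_trans[OF _ r(2)] subset_cball) auto
  have L: "norm (f p - f q) \<le> (C * d) * norm (p - q)" if "d \<le> r/2" "p \<in> cball 0 d" "q \<in> cball 0 d" for d p q
  proof (rule holo3_lipschitz_from_D[OF f, where S="cball 0 d"])
    show "cball 0 d \<subseteq> W" using that b by auto
    fix s :: C3 and v :: C3 assume s: "s \<in> cball 0 d"
    have "norm (D3 f s v) \<le> C * norm s * norm v" using C(2)[of s v] D0 s that by simp
    also have "\<dots> \<le> (C * d) * norm v" using s C by (intro mult_right_mono mult_left_mono) auto
    finally show "norm (D3 f s v) \<le> (C * d) * norm v" .
  qed (use that in auto)
  show thesis
  proof (rule that[of "r/2" C])
    show "norm (f p - f q) \<le> C * d * norm (p - q)" if "d \<le> r/2" "p \<in> ball 0 d" "q \<in> ball 0 d" for d p q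
      using L[OF that(1)] that by auto
    show "norm (f p) \<le> C * norm p ^ 2" if "p \<in> ball 0 (r/2)" for p
      using L[of "norm p" p 0] that 0 by (simp add: power2_eq_square mult.assoc)
  qed (use r C b in auto)
qed

text \<open>Weierstrass's theorem: Cauchy estimates for the differences \<open>f m - f n\<close>
  make the derivatives uniformly Cauchy on a smaller ball, and complex linearity passes to their
  pointwise limit.\<close>

lemma holo3_uniform_limit:
  assumes h: "\<And>n::nat. holo3 W (f n)" and u: "uniform_limit W f g sequentially"
  shows "holo3 W g"
  unfolding holo3_def
proof (intro conjI ballI)
  show W: "open W" using h holo3_open by blast
  fix p assume p: "p \<in> W"
  obtain r where r: "r > 0" "cball p (2 * r) \<subseteq> W"
    using open_contains_cball2[OF W p] .
  have cb: "cball q r \<subseteq> W" if "q \<in> ball p r" for q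
    using that by (intro order_trans[OF _ r(2)] cball_subset_cball_iff[THEN iffD2]) (auto simp: dist_commute)
  have near: "norm (D3 (f m) q v - D3 (f n) q v) \<le> 2 * e / r * norm v"
    if "q \<in> ball p r" "\<forall>x\<in>W. dist (f m x) (g x) < e" "\<forall>x\<in>W. dist (f n x) (g x) < e" for q v e m n
  proof -
    have qW: "q \<in> W" using cb[OF that(1)] r by auto
    have "((\<lambda>s. f m s - f n s) has_derivative (\<lambda>v. D3 (f m) q v - D3 (f n) q v)) (at q)"
      by (intro derivative_intros holo3_D(1)[OF h qW])
    then have "D3 (f m) q v - D3 (f n) q v = D3 (\<lambda>s. f m s - f n s) q v"
      by (simp add: D3_eq)
    moreover have "norm (D3 (\<lambda>s. f m s - f n s) q v) \<le> 2 * e / r * norm v"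
    proof (rule holo3_cauchy[OF holo3_diff[OF h h] r(1) cb[OF that(1)]])
      fix s assume "s \<in> cball q r"
      then have "s \<in> W" using cb[OF that(1)] by blast
      then have "dist (f m s) (g s) < e" "dist (f n s) (g s) < e" using that by auto
      then have "dist (f m s) (f n s) < 2 * e" using dist_triangle2[of "f m s" "f n s" "g s"] by linarith
      then show "norm (f m s - f n s) \<le> 2 * e" by (simp add: dist_norm)
    qed
    ultimately show ?thesis by simp
  qed
  define g' where "g' = (\<lambda>q v. lim (\<lambda>n. D3 (f n) q v))"
  have unif: "\<forall>\<^sub>F n in sequentially. \<forall>x\<in>W. dist (f n x) (g x) < e" if "e > 0" for e
    using u that by (simp add: uniform_limit_iff)
  have conv: "(\<lambda>n. D3 (f n) q v) \<longlonglongrightarrow> g' q v" if q: "q \<in> ball p r" for q v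
  proof -
    have "Cauchy (\<lambda>n. D3 (f n) q v)"
      unfolding Cauchy_def
    proof (intro allI impI)
      fix e :: real assume e: "e > 0"
      \<comment> \<open>With this accuracy the Cauchy bound \<open>2 * ?d / r * norm v\<close> is
        below \<open>e\<close>; the added 1 covers \<open>v = 0\<close>.\<close>
      let ?d = "e * r / (4 * (norm v + 1))"
      have d: "?d > 0" using e r by (simp add: add_nonneg_pos)
      obtain N where N: "\<And>n. n \<ge> N \<Longrightarrow> \<forall>x\<in>W. dist (f n x) (g x) < ?d"
        using unif[OF d] unfolding eventually_sequentially by blast
      have "dist (D3 (f m) q v) (D3 (f n) q v) < e" if "m \<ge> N" "n \<ge> N" for m n
      proof -
        have "norm (D3 (f m) q v - D3 (f n) q v) \<le> 2 * ?d / r * norm v"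
          by (rule near[OF q N[OF that(1)] N[OF that(2)]])
        also have "\<dots> = e * (norm v / (2 * (norm v + 1)))"
        proof -
          have "norm v + 1 \<noteq> 0" "r \<noteq> 0" using r by (auto simp: add_nonneg_pos less_imp_neq[symmetric])
          then show ?thesis by (simp add: divide_simps)
        qed
        also have "norm v / (2 * (norm v + 1)) < 1"
          using norm_ge_zero[of v] by (simp add: divide_less_eq_1 add_nonneg_pos)
        then have "e * (norm v / (2 * (norm v + 1))) < e * 1" using e by (intro mult_strict_left_mono)
        finally show ?thesis by (simp add: dist_norm)
      qed
      then show "\<exists>M. \<forall>m\<ge>M. \<forall>n\<ge>M. dist (D3 (f m) q v) (D3 (f n) q v) < e" by blast
    qed
    then show ?thesis unfolding g'_def by (simp add: Cauchy_convergent_iff convergent_LIMSEQ_iff)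
  qed
  have "\<exists>g0. \<forall>x\<in>ball p r. (\<lambda>n. f n x) \<longlonglongrightarrow> g0 x \<and> (g0 has_derivative g' x) (at x within ball p r)"
  proof (rule has_derivative_sequence)
    show "(f n has_derivative D3 (f n) x) (at x within ball p r)" if "x \<in> ball p r" for n x
      using holo3_D(1)[OF h, of x n] cb[OF that] r by (meson centre_in_cball has_derivative_at_withinI less_imp_le subsetD)
    show "\<forall>\<^sub>F n in sequentially. \<forall>x\<in>ball p r. \<forall>v. norm (D3 (f n) x v - g' x v) \<le> e * norm v" if e: "e > 0" for e
    proof -
      let ?d = "e * r / 2"
      have d: "?d > 0" using e r by simp
      obtain N where N: "\<And>n. n \<ge> N \<Longrightarrow> \<forall>x\<in>W. dist (f n x) (g x) < ?d"
        using unif[OF d] unfolding eventually_sequentially by blast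
      have "norm (D3 (f n) x v - g' x v) \<le> e * norm v" if n: "n \<ge> N" and x: "x \<in> ball p r" for n x v
      proof (rule Lim_bounded[where f="\<lambda>m. norm (D3 (f n) x v - D3 (f m) x v)" and M=N])
        show "(\<lambda>m. norm (D3 (f n) x v - D3 (f m) x v)) \<longlonglongrightarrow> norm (D3 (f n) x v - g' x v)"
          by (intro tendsto_intros conv[OF x])
        show "\<forall>m\<ge>N. norm (D3 (f n) x v - D3 (f m) x v) \<le> e * norm v"
          using near[OF x N[OF n] N] r by simp
      qed
      then show ?thesis unfolding eventually_sequentially by blast
    qed
    show "p \<in> ball p r" "convex (ball p r)" using r by auto
    show "(\<lambda>n. f n p) \<longlonglongrightarrow> g p" using tendsto_uniform_limitI[OF u p] .
  qed
  then obtain g0 where g0: "\<And>x. x \<in> ball p r \<Longrightarrow> (\<lambda>n. f n x) \<longlonglongrightarrow> g0 x"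
    "\<And>x. x \<in> ball p r \<Longrightarrow> (g0 has_derivative g' x) (at x within ball p r)" by blast
  have g0g: "g0 x = g x" if "x \<in> ball p r" for x
  proof -
    have "x \<in> W" using cb[OF that] r by auto
    then show ?thesis using LIMSEQ_unique[OF g0(1)[OF that] tendsto_uniform_limitI[OF u]] by blast
  qed
  have "(g has_derivative g' p) (at p)"
  proof -
    have "(g0 has_derivative g' p) (at p)"
      using g0(2)[of p] r at_within_open[of p "ball p r"] by simp
    then show ?thesis
      by (rule has_derivative_transform_within_open[where s="ball p r"]) (use r g0g in auto)
  qed
  moreover have "g' p (cmul3 c v) = c * g' p v" for c v
  proof (rule LIMSEQ_unique)
    show "(\<lambda>n. D3 (f n) p (cmul3 c v)) \<longlonglongrightarrow> g' p (cmul3 c v)" using conv[of p] r by simp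
    have "(\<lambda>n. c * D3 (f n) p v) \<longlonglongrightarrow> c * g' p v" using conv[of p] r by (intro tendsto_intros) simp
    then show "(\<lambda>n. D3 (f n) p (cmul3 c v)) \<longlonglongrightarrow> c * g' p v" using holo3_D(2)[OF h p] by simp
  qed
  ultimately show "\<exists>L. (g has_derivative L) (at p) \<and> (\<forall>c v. L (cmul3 c v) = c * L v)" by blast
qed

section \<open>Holomorphic maps and their local inverses\<close>

definition hmap :: "C3 set \<Rightarrow> (C3 \<Rightarrow> C3) \<Rightarrow> bool" where
  "hmap W F \<longleftrightarrow> open W \<and>
     (\<forall>p\<in>W. \<exists>L. (F has_derivative L) (at p) \<and> (\<forall>c v. L (cmul3 c v) = cmul3 c (L v)))"

abbreviation DM :: "(C3 \<Rightarrow> C3) \<Rightarrow> C3 \<Rightarrow> C3 \<Rightarrow> C3" where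
  "DM F p \<equiv> frechet_derivative F (at p)"

lemma DM_eq: "(F has_derivative L) (at p) \<Longrightarrow> DM F p = L"
  using frechet_derivative_at by force

lemma hmap_D:
  assumes "hmap W F" "p \<in> W"
  shows "(F has_derivative DM F p) (at p)" "DM F p (cmul3 c v) = cmul3 c (DM F p v)"
proof -
  obtain L where L: "(F has_derivative L) (at p)" "\<forall>c v. L (cmul3 c v) = cmul3 c (L v)"
    using assms unfolding hmap_def by blast
  then have "L = DM F p" using frechet_derivative_at by blast
  with L show "(F has_derivative DM F p) (at p)" "DM F p (cmul3 c v) = cmul3 c (DM F p v)" by blast+
qed

lemma hmapI:
  assumes "open W" "\<And>p. p \<in> W \<Longrightarrow> (F has_derivative L p) (at p)"
    "\<And>p c v. p \<in> W \<Longrightarrow> L p (cmul3 c v) = cmul3 c (L p v)"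
  shows "hmap W F"
  using assms unfolding hmap_def by blast

lemma holo3_compose_hmap:
  assumes f: "holo3 T f" and F: "hmap W F" and sub: "\<And>p. p \<in> W \<Longrightarrow> F p \<in> T"
  shows "holo3 W (\<lambda>p. f (F p))" "p \<in> W \<Longrightarrow> D3 (\<lambda>p. f (F p)) p v = D3 f (F p) (DM F p v)"
proof -
  have der: "((\<lambda>p. f (F p)) has_derivative (\<lambda>v. D3 f (F p) (DM F p v))) (at p)" if "p \<in> W" for p
    by (rule has_derivative_compose[OF hmap_D(1)[OF F that] holo3_D(1)[OF f sub[OF that]]])
  show "p \<in> W \<Longrightarrow> D3 (\<lambda>p. f (F p)) p v = D3 f (F p) (DM F p v)"
    using D3_eq[OF der] by simp
  show "holo3 W (\<lambda>p. f (F p))"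
    by (rule holo3I[OF _ der]) (use F in \<open>auto simp only: hmap_D(2)[OF F] holo3_D(2)[OF f sub] hmap_def\<close>)
qed

lemma hmap_triple:
  assumes "holo3 W f" "holo3 W g" "holo3 W h"
  shows "hmap W (\<lambda>p. (f p, g p, h p))"
    "p \<in> W \<Longrightarrow> DM (\<lambda>p. (f p, g p, h p)) p v = (D3 f p v, D3 g p v, D3 h p v)"
proof -
  have der: "((\<lambda>p. (f p, g p, h p)) has_derivative (\<lambda>v. (D3 f p v, D3 g p v, D3 h p v))) (at p)" if "p \<in> W" for p
    by (intro has_derivative_Pair holo3_D(1)[OF assms(1) that] holo3_D(1)[OF assms(2) that] holo3_D(1)[OF assms(3) that])
  show "p \<in> W \<Longrightarrow> DM (\<lambda>p. (f p, g p, h p)) p v = (D3 f p v, D3 g p v, D3 h p v)"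
    using DM_eq[OF der] by simp
  show "hmap W (\<lambda>p. (f p, g p, h p))"
    by (rule hmapI[OF _ der]) (use assms in \<open>auto simp only: holo3_D(2) cmul3_simps holo3_open\<close>)
qed

lemma hmap_components:
  assumes F: "hmap W F"
  shows "holo3 W (\<lambda>p. fst (F p))" "holo3 W (\<lambda>p. fst (snd (F p)))" "holo3 W (\<lambda>p. snd (snd (F p)))"
proof -
  have W: "open W" using F by (simp add: hmap_def)
  show "holo3 W (\<lambda>p. fst (F p))" "holo3 W (\<lambda>p. fst (snd (F p)))" "holo3 W (\<lambda>p. snd (snd (F p)))"
    using holo3_compose_hmap(1)[OF holo3_fst[OF open_UNIV] F] holo3_compose_hmap(1)[OF holo3_fst_snd[OF open_UNIV] F]
      holo3_compose_hmap(1)[OF holo3_snd_snd[OF open_UNIV] F] by auto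
qed

lemma hmap_blinfun:
  assumes F: "hmap W F"
  obtains F' where "\<And>p. p \<in> W \<Longrightarrow> blinfun_apply (F' p) = DM F p" "continuous_on W F'"
proof -
  obtain f1 where f1: "\<And>p. p \<in> W \<Longrightarrow> blinfun_apply (f1 p) = D3 (\<lambda>p. fst (F p)) p" "continuous_on W f1"
    using holo3_blinfun[OF hmap_components(1)[OF F]] by blast
  obtain f2 where f2: "\<And>p. p \<in> W \<Longrightarrow> blinfun_apply (f2 p) = D3 (\<lambda>p. fst (snd (F p))) p" "continuous_on W f2"
    using holo3_blinfun[OF hmap_components(2)[OF F]] by blast
  obtain f3 where f3: "\<And>p. p \<in> W \<Longrightarrow> blinfun_apply (f3 p) = D3 (\<lambda>p. snd (snd (F p))) p" "continuous_on W f3"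
    using holo3_blinfun[OF hmap_components(3)[OF F]] by blast
  have b1: "bounded_linear (\<lambda>x::complex. (x, 0::complex, 0::complex))"
    and b2: "bounded_linear (\<lambda>x::complex. (0::complex, x, 0::complex))"
    and b3: "bounded_linear (\<lambda>x::complex. (0::complex, 0::complex, x))"
    by (intro bounded_linear_Pair bounded_linear_ident bounded_linear_zero)+
  define F' where "F' = (\<lambda>p. (Blinfun (\<lambda>x::complex. (x, 0::complex, 0::complex)) o\<^sub>L f1 p)
     + (Blinfun (\<lambda>x::complex. (0::complex, x, 0::complex)) o\<^sub>L f2 p) + (Blinfun (\<lambda>x::complex. (0::complex, 0::complex, x)) o\<^sub>L f3 p))"
  show thesis
  proof (rule that)
    show "continuous_on W F'"
      unfolding F'_def by (intro continuous_intros f1 f2 f3)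
    fix p assume p: "p \<in> W"
    have "(F has_derivative (\<lambda>v. (D3 (\<lambda>p. fst (F p)) p v, D3 (\<lambda>p. fst (snd (F p))) p v, D3 (\<lambda>p. snd (snd (F p))) p v))) (at p)"
      using has_derivative_Pair[OF holo3_D(1)[OF hmap_components(1)[OF F] p]
          has_derivative_Pair[OF holo3_D(1)[OF hmap_components(2)[OF F] p] holo3_D(1)[OF hmap_components(3)[OF F] p]]]
      by simp
    from DM_eq[OF this] show "blinfun_apply (F' p) = DM F p"
      by (simp add: F'_def blinfun.add_left f1(1) f2(1) f3(1) p
          bounded_linear_Blinfun_apply[OF b1] bounded_linear_Blinfun_apply[OF b2] bounded_linear_Blinfun_apply[OF b3] fun_eq_iff)
  qed
qed

text \<open>In finite dimension injectivity of the derivative is invertibility, so the real inverse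
  function theorem applies. The inverse is again holomorphic because the inverse of a complex linear
  bijection is complex linear.\<close>

lemma hmap_local_inverse:
  assumes F: "hmap W F" and 0: "0 \<in> W" and inj0: "\<And>v. DM F 0 v = 0 \<Longrightarrow> v = 0"
  obtains U V g where "open U" "U \<subseteq> W" "0 \<in> U" "open V" "F 0 \<in> V" "homeomorphism U V F g" "hmap V g"
    "\<And>p. p \<in> U \<Longrightarrow> inj (DM F p)" "\<And>q v. q \<in> V \<Longrightarrow> DM F (g q) (DM g q v) = v"
proof -
  obtain F' where F': "\<And>p. p \<in> W \<Longrightarrow> blinfun_apply (F' p) = DM F p" "continuous_on W F'"
    using hmap_blinfun[OF F] by blast
  have lin: "linear (DM F 0)" using hmap_D(1)[OF F 0] has_derivative_linear by blast
  have "inj (DM F 0)" using linear_injective_0[OF lin] inj0 by blast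
  then obtain i where i: "linear i" "i \<circ> DM F 0 = id"
    using linear_injective_left_inverse[OF lin] by blast
  have bi: "bounded_linear i" using i linear_conv_bounded_linear by blast
  have inv: "Blinfun i o\<^sub>L F' 0 = id_blinfun"
    using fun_cong[OF i(2)] by (intro blinfun_eqI) (simp add: bounded_linear_Blinfun_apply[OF bi] F'(1)[OF 0])
  have W: "open W" using F by (simp add: hmap_def)
  have der: "(F has_derivative blinfun_apply (F' x)) (at x)" if "x \<in> W" for x
    using hmap_D(1)[OF F that] F'(1)[OF that] by simp
  obtain U V g g' where g: "open U" "U \<subseteq> W" "0 \<in> U" "open V" "F 0 \<in> V" "homeomorphism U V F g"
    "\<And>y. y \<in> V \<Longrightarrow> (g has_derivative (g' y)) (at y)"
    "\<And>y. y \<in> V \<Longrightarrow> g' y = Hilbert_Choice.inv (blinfun_apply (F'(g y)))"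
    "\<And>y. y \<in> V \<Longrightarrow> bij (blinfun_apply (F'(g y)))"
    using inverse_function_theorem[OF W der F'(2) 0 inv] by metis
  have gU: "g y \<in> U" if "y \<in> V" for y using g(6) that by (auto simp: homeomorphism_def)
  have gW: "g y \<in> W" if "y \<in> V" for y using gU[OF that] g(2) by blast
  have bij: "bij (DM F (g y))" if "y \<in> V" for y
    using g(9)[OF that] F'(1)[OF gW[OF that]] by simp
  have g': "g' y = Hilbert_Choice.inv (DM F (g y))" if "y \<in> V" for y
    using g(8)[OF that] F'(1)[OF gW[OF that]] by simp
  have right: "DM F (g y) (g' y v) = v" if "y \<in> V" for y v
    using bij[OF that] g'[OF that] by (simp add: bij_is_surj surj_f_inv_f)
  have hg: "hmap V g"
  proof (rule hmapI[OF g(4) g(7)])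
    fix y c v assume y: "y \<in> V"
    have "DM F (g y) (g' y (cmul3 c v)) = DM F (g y) (cmul3 c (g' y v))"
      by (simp add: right[OF y] hmap_D(2)[OF F gW[OF y]])
    then show "g' y (cmul3 c v) = cmul3 c (g' y v)"
      using bij[OF y] by (meson bij_is_inj injD)
  qed
  show thesis
  proof (rule that[OF g(1-6) hg])
    fix p assume "p \<in> U"
    then have "F p \<in> V" "g (F p) = p" using g(6) by (auto simp: homeomorphism_def)
    then show "inj (DM F p)" using bij[of "F p"] by (simp add: bij_is_inj)
  next
    fix q v assume "q \<in> V"
    then show "DM F (g q) (DM g q v) = v" using DM_eq[OF g(7)] right by simp
  qed
qed

lemma inj_linear_eq:
  assumes "inj (DM F p)" "DM F p u = DM F p v" shows "u = v"
  using assms by (rule injD)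

section \<open>Invariant manifolds as graphs\<close>

text \<open>Adjoining the coordinate x to the two defining functions gives a map \<open>F\<close>
  with injective derivative at 0, since the common kernel is the x-axis. Its inverse along the
  points \<open>(x, 0, 0)\<close> parametrises the curve. Invariance says that \<open>DM F\<close>
  sends \<open>V\<close> to a multiple of \<open>(1, 0, 0)\<close>, the image of the tangent vector
  of the graph, and injectivity identifies the two vectors.\<close>

lemma curve_cm_graph:
  assumes S: "curve_cm V xaxis S"
  obtains r \<alpha> \<beta> N where "r > 0" "\<alpha> holomorphic_on ball 0 r" "\<beta> holomorphic_on ball 0 r"
    "\<alpha> 0 = 0" "\<beta> 0 = 0" "deriv \<alpha> 0 = 0" "deriv \<beta> 0 = 0" "open N" "0 \<in> N"
    "S \<inter> N = {(x, \<alpha> x, \<beta> x) | x. x \<in> ball 0 r}"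
    "\<And>x. x \<in> ball 0 r \<Longrightarrow> V (x, \<alpha> x, \<beta> x) = cmul3 (fst (V (x, \<alpha> x, \<beta> x))) (1, deriv \<alpha> x, deriv \<beta> x)"
proof -
  obtain W G1 G2 where W: "open W" "0 \<in> W" and G: "holo3 W G1" "holo3 W G2"
    and SW: "S \<inter> W = {p \<in> W. G1 p = 0 \<and> G2 p = 0}"
    and ker: "{v. D3 G1 0 v = 0 \<and> D3 G2 0 v = 0} = xaxis"
    and inv: "\<And>p. p \<in> S \<inter> W \<Longrightarrow> D3 G1 p (V p) = 0 \<and> D3 G2 p (V p) = 0"
    and S0: "0 \<in> S"
    using S unfolding curve_cm_def by blast
  have fst_D: "D3 (\<lambda>p::C3. fst p) p v = fst v" for p v
    using D3_eq[of "\<lambda>p. fst p" "\<lambda>v. fst v"] by (simp add: has_derivative_fst)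
  define F where "F = (\<lambda>p. (fst p, G1 p, G2 p))"
  have F: "hmap W F" unfolding F_def by (rule hmap_triple(1)[OF holo3_fst[OF W(1)] G])
  have DF: "DM F p v = (fst v, D3 G1 p v, D3 G2 p v)" if "p \<in> W" for p v
    unfolding F_def by (subst hmap_triple(2)[OF holo3_fst[OF W(1)] G that]) (simp add: fst_D)
  have "v = 0" if v: "DM F 0 v = 0" for v
  proof -
    have "fst v = 0" "D3 G1 0 v = 0" "D3 G2 0 v = 0" using v unfolding DF[OF W(2)] by (simp_all add: zero_prod_def)
    then have "v \<in> xaxis" "fst v = 0" using ker by blast+
    then show ?thesis by (auto simp: xaxis_def zero_prod_def)
  qed
  then obtain U Y g where U: "open U" "U \<subseteq> W" "0 \<in> U" "open Y" "F 0 \<in> Y" "homeomorphism U Y F g" "hmap Y g"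
    and injU: "\<And>p. p \<in> U \<Longrightarrow> inj (DM F p)" and DFg: "\<And>q v. q \<in> Y \<Longrightarrow> DM F (g q) (DM g q v) = v"
    using hmap_local_inverse[OF F W(2)] by metis
  have F0: "F 0 = 0" using S0 W SW by (auto simp: F_def zero_prod_def)
  have gF: "g (F p) = p" "F p \<in> Y" if "p \<in> U" for p using U(6) that by (auto simp: homeomorphism_def)
  have Fg: "F (g q) = q" "g q \<in> U" if "q \<in> Y" for q using U(6) that by (auto simp: homeomorphism_def)
  obtain r where r: "r > 0" "ball 0 r \<subseteq> Y" using U(4,5) F0 open_contains_ball by metis
  have line: "(x, 0, 0) \<in> Y" if "x \<in> ball 0 r" for x
    using that r by (intro subsetD[OF r(2)]) (simp add: norm_Pair)
  define \<alpha> where "\<alpha> = (\<lambda>x. fst (snd (g (x, 0, 0))))"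
  define \<beta> where "\<beta> = (\<lambda>x. snd (snd (g (x, 0, 0))))"
  have fst_g: "fst (g q) = fst q" if "q \<in> Y" for q using arg_cong[OF Fg(1)[OF that], of fst] by (simp add: F_def)
  have g_eq: "g (x, 0, 0) = (x, \<alpha> x, \<beta> x)" if "x \<in> ball 0 r" for x
    using fst_g[OF line[OF that]] by (simp add: \<alpha>_def \<beta>_def prod_eq_iff)
  have hol: "\<alpha> holomorphic_on ball 0 r" "\<beta> holomorphic_on ball 0 r"
    unfolding \<alpha>_def \<beta>_def
    by (rule holo3_curve_holomorphic[OF hmap_components(2)[OF U(7)]], use line in \<open>auto intro!: holomorphic_intros\<close>)
       (rule holo3_curve_holomorphic[OF hmap_components(3)[OF U(7)]], use line in \<open>auto intro!: holomorphic_intros\<close>)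
  \<comment> \<open>Differentiates \<open>F (x, \<alpha> x, \<beta> x) = (x, 0, 0)\<close>; the last
    two components are constant along the curve.\<close>
  have der: "DM F (x, \<alpha> x, \<beta> x) (1, deriv \<alpha> x, deriv \<beta> x) = (1, 0, 0)" if x: "x \<in> ball 0 r" for x
  proof -
    have pU: "(x, \<alpha> x, \<beta> x) \<in> W" using Fg(2)[OF line[OF x]] g_eq[OF x] U(2) by auto
    have GG: "((\<lambda>x. G (x, \<alpha> x, \<beta> x)) has_field_derivative D3 G (x, \<alpha> x, \<beta> x) (1, deriv \<alpha> x, deriv \<beta> x)) (at x)"
      if "holo3 W G" for G
      by (rule holo3_curve[OF that, of "\<lambda>x. x" x \<alpha> \<beta>]) (use pU hol x in \<open>auto intro!: derivative_eq_intros holomorphic_derivI\<close>)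
    have z: "D3 G (x, \<alpha> x, \<beta> x) (1, deriv \<alpha> x, deriv \<beta> x) = 0" if "holo3 W G"
      and "\<And>x. x \<in> ball 0 r \<Longrightarrow> G (x, \<alpha> x, \<beta> x) = 0" for G
    proof -
      have "((\<lambda>x. 0) has_field_derivative D3 G (x, \<alpha> x, \<beta> x) (1, deriv \<alpha> x, deriv \<beta> x)) (at x)"
        by (rule has_field_derivative_transform_within_open[OF GG[OF that(1)], where S="ball 0 r"]) (use x that in auto)
      then show ?thesis using DERIV_unique DERIV_const by metis
    qed
    have "F (y, \<alpha> y, \<beta> y) = (y, 0, 0)" if "y \<in> ball 0 r" for y
      using Fg(1)[OF line[OF that]] g_eq[OF that] by simp
    then have "G1 (y, \<alpha> y, \<beta> y) = 0" "G2 (y, \<alpha> y, \<beta> y) = 0" if "y \<in> ball 0 r" for y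
      using that by (auto simp: F_def)
    then show ?thesis using z G by (simp add: DF[OF pU])
  qed
  define N where "N = U \<inter> {p. fst p \<in> ball 0 r}"
  have SN: "S \<inter> N = {(x, \<alpha> x, \<beta> x) | x. x \<in> ball 0 r}"
  proof (intro equalityI subsetI)
    fix p assume p: "p \<in> S \<inter> N"
    then have "p \<in> U" "p \<in> W" "fst p \<in> ball 0 r" "G1 p = 0" "G2 p = 0" using U(2) SW by (auto simp: N_def)
    then have "F p = (fst p, 0, 0)" by (simp add: F_def)
    then have "p = (fst p, \<alpha> (fst p), \<beta> (fst p))"
      using gF(1)[OF \<open>p \<in> U\<close>] g_eq[OF \<open>fst p \<in> ball 0 r\<close>] by simp
    then show "p \<in> {(x, \<alpha> x, \<beta> x) | x. x \<in> ball 0 r}" using \<open>fst p \<in> ball 0 r\<close> by blast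
  next
    fix p assume "p \<in> {(x, \<alpha> x, \<beta> x) | x. x \<in> ball 0 r}"
    then obtain x where x: "x \<in> ball 0 r" "p = (x, \<alpha> x, \<beta> x)" by blast
    then have p: "p = g (x, 0, 0)" using g_eq by simp
    then have "p \<in> U" "F p = (x, 0, 0)" using Fg line[OF x(1)] by auto
    then have "p \<in> W" "G1 p = 0" "G2 p = 0" using U(2) by (auto simp: F_def)
    then show "p \<in> S \<inter> N" using SW \<open>p \<in> U\<close> x by (auto simp: N_def)
  qed
  have g0: "(0, \<alpha> 0, \<beta> 0) = 0"
    using g_eq[of 0] gF(1)[OF U(3)] F0 r by (simp add: zero_prod_def)
  have d0: "(1, deriv \<alpha> 0, deriv \<beta> 0) \<in> xaxis"
  proof -
    have "DM F 0 (1, deriv \<alpha> 0, deriv \<beta> 0) = (1, 0, 0)" using der[of 0] r unfolding g0 by simp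
    then show ?thesis using ker unfolding DF[OF W(2)] by blast
  qed
  show thesis
  proof (rule that[OF r(1) hol])
    show "\<alpha> 0 = 0" "\<beta> 0 = 0" using g0 by (auto simp: zero_prod_def)
    show "deriv \<alpha> 0 = 0" "deriv \<beta> 0 = 0" using d0 by (auto simp: xaxis_def)
    have "open ((fst :: C3 \<Rightarrow> complex) -` ball 0 r)"
      by (intro open_vimage continuous_intros) auto
    then show "open N" unfolding N_def vimage_def by (rule open_Int[OF U(1)])
    show "0 \<in> N" using U(3) r by (simp add: N_def)
    fix x :: complex assume x: "x \<in> ball 0 r"
    let ?p = "(x, \<alpha> x, \<beta> x)"
    have pN: "?p \<in> S \<inter> N" using SN x by blast
    then have pU: "?p \<in> U" "?p \<in> W" using U(2) by (auto simp: N_def)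
    have "DM F ?p (V ?p) = (fst (V ?p), 0, 0)"
      using inv[of ?p] pN pU by (simp add: DF[OF pU(2)])
    also have "\<dots> = DM F ?p (cmul3 (fst (V ?p)) (1, deriv \<alpha> x, deriv \<beta> x))"
      using hmap_D(2)[OF F pU(2), of "fst (V ?p)" "(1, deriv \<alpha> x, deriv \<beta> x)"] der[OF x] by simp
    finally show "V ?p = cmul3 (fst (V ?p)) (1, deriv \<alpha> x, deriv \<beta> x)"
      by (rule inj_linear_eq[OF injU[OF pU(1)]])
  qed (rule SN)
qed

text \<open>As for curves, with the defining function \<open>G\<close> now replacing the coordinate
  y: since the kernel of \<open>D3 G 0\<close> is the plane y = 0, the map (x, G, z) is locally
  invertible.\<close>

lemma surf_cm_graph:
  assumes S: "surf_cm V xzplane S"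
  obtains r \<phi> N where "r > 0" "holo3 (ball 0 r) \<phi>" "\<phi> 0 = 0" "(\<phi> has_derivative (\<lambda>_. 0)) (at 0)" "open N" "0 \<in> N"
    "S \<inter> N = {(x, \<phi> (x, 0, z), z) | x z. (x, 0::complex, z) \<in> ball 0 r}"
    "\<And>x z. (x, 0::complex, z) \<in> ball 0 r \<Longrightarrow>
       fst (snd (V (x, \<phi> (x, 0, z), z))) = D3 \<phi> (x, 0, z) (fst (V (x, \<phi> (x, 0, z), z)), 0, snd (snd (V (x, \<phi> (x, 0, z), z))))"
proof -
  obtain W G where W: "open W" "0 \<in> W" and G: "holo3 W G"
    and SW: "S \<inter> W = {p \<in> W. G p = 0}"
    and ker: "{v. D3 G 0 v = 0} = xzplane"
    and inv: "\<And>p. p \<in> S \<inter> W \<Longrightarrow> D3 G p (V p) = 0"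
    and S0: "0 \<in> S"
    using S unfolding surf_cm_def by blast
  have fst_D: "D3 (\<lambda>p::C3. fst p) p v = fst v" for p v
    using D3_eq[of "\<lambda>p. fst p" "\<lambda>v. fst v"] by (simp add: has_derivative_fst)
  have snd_D: "D3 (\<lambda>p::C3. snd (snd p)) p v = snd (snd v)" for p v
    using D3_eq[of "\<lambda>p. snd (snd p)" "\<lambda>v. snd (snd v)"] by (simp add: has_derivative_snd)
  define F where "F = (\<lambda>p. (fst p, G p, snd (snd p)))"
  have F: "hmap W F" unfolding F_def by (rule hmap_triple(1)[OF holo3_fst[OF W(1)] G holo3_snd_snd[OF W(1)]])
  have DF: "DM F p v = (fst v, D3 G p v, snd (snd v))" if "p \<in> W" for p v
    unfolding F_def by (subst hmap_triple(2)[OF holo3_fst[OF W(1)] G holo3_snd_snd[OF W(1)] that]) (simp add: fst_D snd_D)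
  have "v = 0" if v: "DM F 0 v = 0" for v
  proof -
    have "fst v = 0" "D3 G 0 v = 0" "snd (snd v) = 0" using v unfolding DF[OF W(2)] by (simp_all add: zero_prod_def)
    then have "v \<in> xzplane" "fst v = 0" "snd (snd v) = 0" using ker by blast+
    then show ?thesis by (auto simp: xzplane_def zero_prod_def)
  qed
  then obtain U Y g where U: "open U" "U \<subseteq> W" "0 \<in> U" "open Y" "F 0 \<in> Y" "homeomorphism U Y F g" "hmap Y g"
    and injU: "\<And>p. p \<in> U \<Longrightarrow> inj (DM F p)" and DFg: "\<And>q v. q \<in> Y \<Longrightarrow> DM F (g q) (DM g q v) = v"
    using hmap_local_inverse[OF F W(2)] by metis
  have F0: "F 0 = 0" using S0 W SW by (auto simp: F_def zero_prod_def)
  have gF: "g (F p) = p" "F p \<in> Y" if "p \<in> U" for p using U(6) that by (auto simp: homeomorphism_def)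
  have Fg: "F (g q) = q" "g q \<in> U" if "q \<in> Y" for q using U(6) that by (auto simp: homeomorphism_def)
  obtain r where r: "r > 0" "ball 0 r \<subseteq> Y" using U(4,5) F0 open_contains_ball by metis
  define \<phi> where "\<phi> = (\<lambda>q. fst (snd (g q)))"
  have g_eq: "g q = (fst q, \<phi> q, snd (snd q))" if "q \<in> Y" for q
    using Fg(1)[OF that] by (simp add: \<phi>_def F_def prod_eq_iff)
  have hY: "holo3 Y \<phi>" unfolding \<phi>_def by (rule hmap_components(2)[OF U(7)])
  have h: "holo3 (ball 0 r) \<phi>" by (rule holo3_subset[OF hY]) (use r in auto)
  have Dg: "DM g q v = (fst v, D3 \<phi> q v, snd (snd v))" if q: "q \<in> Y" for q v
  proof -
    have "((\<lambda>q. (fst q, \<phi> q, snd (snd q))) has_derivative (\<lambda>v. (fst v, D3 \<phi> q v, snd (snd v)))) (at q)"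
      by (intro has_derivative_Pair has_derivative_fst has_derivative_snd has_derivative_ident holo3_D(1)[OF hY q])
    then have "(g has_derivative (\<lambda>v. (fst v, D3 \<phi> q v, snd (snd v)))) (at q)"
      by (rule has_derivative_transform_within_open[OF _ U(4) q]) (simp add: g_eq)
    then show ?thesis using DM_eq by simp
  qed
  define N where "N = U \<inter> {p. (fst p, 0::complex, snd (snd p)) \<in> ball 0 r}"
  have SN: "S \<inter> N = {(x, \<phi> (x, 0, z), z) | x z. (x, 0::complex, z) \<in> ball 0 r}"
  proof (intro equalityI subsetI)
    fix p assume p: "p \<in> S \<inter> N"
    then have pp: "p \<in> U" "p \<in> W" "(fst p, 0::complex, snd (snd p)) \<in> ball 0 r" "G p = 0" using U(2) SW unfolding N_def by blast+
    then have "F p = (fst p, 0, snd (snd p))" by (simp add: F_def)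
    then have "p = (fst p, \<phi> (fst p, 0, snd (snd p)), snd (snd p))"
      using gF(1)[OF \<open>p \<in> U\<close>] g_eq pp(3) r by auto
    then show "p \<in> {(x, \<phi> (x, 0, z), z) | x z. (x, 0::complex, z) \<in> ball 0 r}" using pp(3) by blast
  next
    fix p assume "p \<in> {(x, \<phi> (x, 0, z), z) | x z. (x, 0::complex, z) \<in> ball 0 r}"
    then obtain x z where x: "(x, 0::complex, z) \<in> ball 0 r" "p = (x, \<phi> (x, 0, z), z)" by blast
    then have p: "p = g (x, 0, z)" using g_eq r by auto
    then have "p \<in> U" "F p = (x, 0, z)" using Fg x(1) r by auto
    then have "p \<in> W" "G p = 0" using U(2) by (auto simp: F_def)
    then show "p \<in> S \<inter> N" using SW \<open>p \<in> U\<close> x by (auto simp: N_def)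
  qed
  have g0: "g 0 = 0" using gF(1)[OF U(3)] F0 by simp
  have Y0: "0 \<in> Y" using r by auto
  let ?pr = "\<lambda>p::C3. (fst p, 0::complex, snd (snd p))"
  have pr: "?pr p \<in> ball 0 r" if "p \<in> ball 0 r" for p
  proof -
    have "norm (?pr p) \<le> norm p" by (cases p) (simp add: norm_Pair)
    then show ?thesis using that by simp
  qed
  have hpr: "hmap (ball 0 r) ?pr" "DM ?pr p = ?pr" for p
  proof -
    have d: "(?pr has_derivative ?pr) (at p)" for p
      by (intro has_derivative_Pair has_derivative_fst has_derivative_snd has_derivative_ident has_derivative_const)
    show "hmap (ball 0 r) ?pr" by (rule hmapI[OF _ d]) (auto simp: cmul3_def)
    show "DM ?pr p = ?pr" by (rule DM_eq[OF d])
  qed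
  \<comment> \<open>The middle component \<open>\<phi>\<close> of the inverse has a nonzero
    derivative in the second variable at 0. Composing with the projection to y = 0 keeps its values
    on the plane and makes the full derivative at 0 vanish.\<close>
  define \<psi> where "\<psi> = (\<lambda>q. \<phi> (?pr q))"
  have hpsi: "holo3 (ball 0 r) \<psi>" unfolding \<psi>_def by (rule holo3_compose_hmap(1)[OF h hpr(1) pr])
  have Dpsi: "D3 \<psi> q v = D3 \<phi> (?pr q) (?pr v)" if "q \<in> ball 0 r" for q v
    unfolding \<psi>_def using holo3_compose_hmap(2)[OF h hpr(1) pr that] by (simp add: hpr(2))
  have b0: "0 \<in> ball 0 r" using r by simp
  show thesis
  proof (rule that[OF r(1) hpsi])
    show "\<psi> 0 = 0" using g0 by (simp add: \<phi>_def \<psi>_def zero_prod_def)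
    have "D3 \<psi> 0 v = 0" for v
    proof -
      obtain a b c where v: "v = (a, b, c)" by (metis prod.exhaust)
      have "DM F 0 (DM g 0 (a, 0, c)) = (a, 0, c)" using DFg[OF Y0] g0 by simp
      then have "D3 G 0 (a, D3 \<phi> 0 (a, 0, c), c) = 0" by (simp add: DF[OF W(2)] Dg[OF Y0])
      then have "(a, D3 \<phi> 0 (a, 0, c), c) \<in> xzplane" using ker by blast
      then have "D3 \<phi> 0 (a, 0, c) = 0" by (simp add: xzplane_def)
      then show ?thesis using Dpsi[OF b0] v by (simp add: zero_prod_def)
    qed
    then have "D3 \<psi> 0 = (\<lambda>_. 0)" by blast
    then show "(\<psi> has_derivative (\<lambda>_. 0)) (at 0)"
      using holo3_D(1)[OF hpsi b0] by simp
    have "open (?pr -` ball 0 r)"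
      by (intro open_vimage continuous_intros) auto
    then show "open N" unfolding N_def vimage_def by (rule open_Int[OF U(1)])
    show "0 \<in> N" using U(3) r by (simp add: N_def norm_Pair)
    show "S \<inter> N = {(x, \<psi> (x, 0, z), z) | x z. (x, 0::complex, z) \<in> ball 0 r}"
      using SN by (simp add: \<psi>_def)
    fix x z :: complex assume x: "(x, 0::complex, z) \<in> ball 0 r"
    let ?p = "(x, \<phi> (x, 0, z), z)"
    have qY: "(x, 0, z) \<in> Y" using x r by blast
    have pN: "?p \<in> S \<inter> N" using SN x by blast
    then have pU: "?p \<in> U" "?p \<in> W" using U(2) by (auto simp: N_def)
    have "DM F ?p (V ?p) = (fst (V ?p), 0, snd (snd (V ?p)))"
      using inv[of ?p] pN pU by (simp add: DF[OF pU(2)])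
    also have "\<dots> = DM F ?p (DM g (x, 0, z) (fst (V ?p), 0, snd (snd (V ?p))))"
      using DFg[OF qY] g_eq[OF qY] by simp
    finally have "V ?p = DM g (x, 0, z) (fst (V ?p), 0, snd (snd (V ?p)))"
      by (rule inj_linear_eq[OF injU[OF pU(1)]])
    then have "fst (snd (V ?p)) = fst (snd (DM g (x, 0, z) (fst (V ?p), 0, snd (snd (V ?p)))))"
      by (rule arg_cong)
    then show "fst (snd (V (x, \<psi> (x, 0, z), z))) = D3 \<psi> (x, 0, z) (fst (V (x, \<psi> (x, 0, z), z)), 0, snd (snd (V (x, \<psi> (x, 0, z), z))))"
      by (simp add: Dg[OF qY] Dpsi[OF x]) (simp add: \<psi>_def)
  qed
qed

section \<open>Picard iteration\<close>

text \<open>The contraction principle for distances measured relative to the weight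
  \<open>\<rho>\<close>, which is constant for curves and \<open>norm q ^ 2\<close> for the surface.
  Boundedness of the weight by \<open>R\<close> turns weighted closeness into uniform convergence.
  Functions matter only on \<open>B\<close>, so the fixed point equation is asserted there
  only.\<close>

lemma picard_fixed_point:
  fixes T :: "('a \<Rightarrow> 'b::banach) \<Rightarrow> 'a \<Rightarrow> 'b" and X :: "('a \<Rightarrow> 'b) set"
  assumes \<theta>: "0 \<le> \<theta>" "\<theta> < 1" and \<rho>: "\<And>q. q \<in> B \<Longrightarrow> 0 \<le> \<rho> q" "\<And>q. q \<in> B \<Longrightarrow> \<rho> q \<le> R"
    and wz: "wz \<in> X" and TX: "\<And>w. w \<in> X \<Longrightarrow> T w \<in> X"
    and Kz: "\<And>q. q \<in> B \<Longrightarrow> norm (T wz q - wz q) \<le> Kz * \<rho> q"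
    and contr: "\<And>u v K q. u \<in> X \<Longrightarrow> v \<in> X \<Longrightarrow> K \<ge> 0 \<Longrightarrow> (\<And>q. q \<in> B \<Longrightarrow> norm (u q - v q) \<le> K * \<rho> q) \<Longrightarrow>
        q \<in> B \<Longrightarrow> norm (T u q - T v q) \<le> \<theta> * K * \<rho> q"
    and closed: "\<And>s w. (\<And>n. s n \<in> X) \<Longrightarrow> uniform_limit B s w sequentially \<Longrightarrow> w \<in> X"
  obtains w where "w \<in> X" "\<And>q. q \<in> B \<Longrightarrow> T w q = w q"
proof -
  define s where "s = (\<lambda>n. (T ^^ n) wz)"
  have sS: "s (Suc n) = T (s n)" for n by (simp add: s_def)
  have sX: "s n \<in> X" for n by (induction n) (auto simp: sS TX, simp add: s_def wz)
  define K1 where "K1 = \<bar>Kz\<bar>"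
  have step: "norm (s (Suc n) q - s n q) \<le> (K1 * \<theta> ^ n) * \<rho> q" if "q \<in> B" for n q
    using that
  proof (induction n arbitrary: q)
    case 0
    have "norm (T wz q - wz q) \<le> Kz * \<rho> q" by (rule Kz[OF 0])
    also have "\<dots> \<le> K1 * \<rho> q" unfolding K1_def by (intro mult_right_mono \<rho>(1)[OF 0]) auto
    finally show ?case by (simp add: s_def)
  next
    case (Suc n)
    have "norm (T (s (Suc n)) q - T (s n) q) \<le> \<theta> * (K1 * \<theta> ^ n) * \<rho> q"
      by (rule contr[OF sX sX _ Suc.IH Suc.prems]) (use \<theta> in \<open>simp add: K1_def\<close>)
    then show ?case by (simp add: sS mult_ac)
  qed
  have tail: "norm (s (n + m) q - s n q) \<le> K1 * \<theta> ^ n / (1 - \<theta>) * \<rho> q" if q: "q \<in> B" for n m q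
  proof -
    have "norm (s (n + m) q - s n q) \<le> K1 * \<theta> ^ n * (\<Sum>i<m. \<theta> ^ i) * \<rho> q"
    proof (induction m)
      case (Suc m)
      have "norm (s (n + Suc m) q - s n q) \<le> norm (s (Suc (n + m)) q - s (n + m) q) + norm (s (n + m) q - s n q)"
        using norm_triangle_ineq[of "s (Suc (n + m)) q - s (n + m) q" "s (n + m) q - s n q"] by simp
      also have "\<dots> \<le> (K1 * \<theta> ^ (n + m)) * \<rho> q + K1 * \<theta> ^ n * (\<Sum>i<m. \<theta> ^ i) * \<rho> q"
        by (intro add_mono step[OF q] Suc)
      also have "\<dots> = K1 * \<theta> ^ n * (\<Sum>i<Suc m. \<theta> ^ i) * \<rho> q" by (simp add: algebra_simps power_add)
      finally show ?case .
    qed simp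
    also have "\<dots> \<le> K1 * \<theta> ^ n * (1 / (1 - \<theta>)) * \<rho> q"
    proof (intro mult_right_mono mult_left_mono \<rho>(1)[OF q])
      have "(\<Sum>i<m. \<theta> ^ i) = (1 - \<theta> ^ m) / (1 - \<theta>)" using \<theta> by (simp add: sum_gp_strict)
      also have "\<dots> \<le> 1 / (1 - \<theta>)" using \<theta> by (intro divide_right_mono) auto
      finally show "(\<Sum>i<m. \<theta> ^ i) \<le> 1 / (1 - \<theta>)" .
    qed (use \<theta> in \<open>auto simp: K1_def\<close>)
    finally show ?thesis by simp
  qed
  have tend: "(\<lambda>n. K1 * \<theta> ^ n / (1 - \<theta>) * c) \<longlonglongrightarrow> 0" for c
    using \<theta> by (auto intro!: tendsto_eq_intros LIMSEQ_power_zero)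
  have Rb: "K1 * \<theta> ^ n / (1 - \<theta>) * \<rho> q \<le> K1 * \<theta> ^ n / (1 - \<theta>) * R" if "q \<in> B" for n q
    using \<rho>(2)[OF that] \<theta> by (intro mult_left_mono) (auto simp: K1_def)
  have uC: "uniformly_Cauchy_on B s"
    unfolding uniformly_Cauchy_on_def
  proof (intro allI impI)
    fix e :: real assume e: "e > 0"
    then obtain M where M: "\<And>n. n \<ge> M \<Longrightarrow> norm (K1 * \<theta> ^ n / (1 - \<theta>) * R - 0) < e / 2"
      using LIMSEQ_D[OF tend, of "e/2" R] by auto
    have "dist (s m x) (s n x) < e" if "x \<in> B" "m \<ge> M" "n \<ge> M" for x m n
    proof -
      have *: "dist (s k x) (s M x) < e / 2" if "k \<ge> M" for k
      proof -
        have "norm (s k x - s M x) \<le> K1 * \<theta> ^ M / (1 - \<theta>) * R"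
          using tail[OF \<open>x \<in> B\<close>, of M "k - M"] Rb[OF \<open>x \<in> B\<close>, of M] that by simp
        moreover have "K1 * \<theta> ^ M / (1 - \<theta>) * R < e / 2"
          using M[OF order_refl] unfolding real_norm_def diff_0_right by (rule le_less_trans[OF abs_ge_self])
        ultimately show ?thesis unfolding dist_norm by linarith
      qed
      show ?thesis using *[OF that(2)] *[OF that(3)] dist_triangle2[of "s m x" "s n x" "s M x"] by linarith
    qed
    then show "\<exists>M. \<forall>x\<in>B. \<forall>m\<ge>M. \<forall>n\<ge>M. dist (s m x) (s n x) < e" by blast
  qed
  then obtain w where w: "uniform_limit B s w sequentially"
    using Cauchy_uniformly_convergent uniformly_convergent_on_def by blast
  have wX: "w \<in> X" by (rule closed[OF sX w])
  \<comment> \<open>The limit is approached in the weighted sense too; \<open>contr\<close> accepts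
    only weighted distances, so uniform convergence alone would not yield the fixed point
    equation.\<close>
  have near: "norm (s n q - w q) \<le> K1 * \<theta> ^ n / (1 - \<theta>) * \<rho> q" if q: "q \<in> B" for n q
  proof (rule Lim_bounded[where f="\<lambda>m. norm (s n q - s m q)" and M=n])
    show "(\<lambda>m. norm (s n q - s m q)) \<longlonglongrightarrow> norm (s n q - w q)"
      by (intro tendsto_intros tendsto_uniform_limitI[OF w q])
    show "\<forall>m\<ge>n. norm (s n q - s m q) \<le> K1 * \<theta> ^ n / (1 - \<theta>) * \<rho> q"
      using tail[OF q, of n] by (metis le_Suc_ex norm_minus_commute)
  qed
  have "T w q = w q" if q: "q \<in> B" for q
  proof -
    have "norm (s (Suc n) q - T w q) \<le> \<theta> * (K1 * \<theta> ^ n / (1 - \<theta>)) * \<rho> q" for n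
      unfolding sS by (rule contr[OF sX wX _ near q]) (use \<theta> in \<open>auto simp: K1_def\<close>)
    then have "norm (s (Suc n) q - T w q) \<le> K1 * \<theta> ^ n / (1 - \<theta>) * (\<theta> * \<rho> q)" for n
      by (metis mult.assoc mult.commute)
    then have "\<forall>\<^sub>F n in sequentially. norm (s (Suc n) q - T w q) \<le> K1 * \<theta> ^ n / (1 - \<theta>) * (\<theta> * \<rho> q)"
      by (rule always_eventually[OF allI])
    from Lim_null_comparison[OF this tend] have "(\<lambda>n. s (Suc n) q - T w q) \<longlonglongrightarrow> 0" .
    then have "(\<lambda>n. s (Suc n) q) \<longlonglongrightarrow> T w q" by (simp add: LIM_zero_iff)
    moreover have "(\<lambda>n. s (Suc n) q) \<longlonglongrightarrow> w q"
      using tendsto_uniform_limitI[OF w q] by (rule LIMSEQ_Suc)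
    ultimately show ?thesis by (rule LIMSEQ_unique)
  qed
  with wX show thesis by (rule that)
qed

text \<open>The kernel \<open>s^j\<close> inverts the operator \<open>x d/dx + (j + 1)\<close>.\<close>

definition euler_inv :: "nat \<Rightarrow> (complex \<Rightarrow> complex) \<Rightarrow> complex \<Rightarrow> complex" where
  "euler_inv j g x = integral {0..1} (\<lambda>s. of_real (s ^ j) * g (of_real s * x))"

lemma euler_inv:
  assumes g: "g holomorphic_on ball 0 r"
  shows "euler_inv j g holomorphic_on ball 0 r"
    "x \<in> ball 0 r \<Longrightarrow> x * deriv (euler_inv j g) x + of_nat (j + 1) * euler_inv j g x = g x"
proof -
  have sx: "of_real s * x \<in> ball 0 r" if "x \<in> ball 0 r" "s \<in> {0..1}" for s and x :: complex
  proof -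
    have "norm (of_real s * x) \<le> norm x" using that by (simp add: norm_mult mult_left_le_one_le)
    then show ?thesis using that by simp
  qed
  have cont: "continuous_on (ball 0 r) g" and cont': "continuous_on (ball 0 r) (deriv g)"
    using g by (auto intro!: holomorphic_on_imp_continuous_on holomorphic_deriv)
  have cs: "continuous_on {0..1} (\<lambda>s. k (of_real s * x))" if "continuous_on (ball 0 r) k" "x \<in> ball 0 r" for k :: "complex \<Rightarrow> complex" and x
    by (rule continuous_on_compose2[OF that(1)]) (use sx that in \<open>auto intro!: continuous_intros\<close>)
  have der: "(euler_inv j g has_field_derivative
       integral {0..1} (\<lambda>s. of_real (s ^ (j+1)) * deriv g (of_real s * x))) (at x)" if x: "x \<in> ball 0 r" for x
  proof -
    have "((\<lambda>x. integral (cbox 0 1) (\<lambda>s. of_real (s ^ j) * g (of_real s * x))) has_field_derivative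
        integral (cbox 0 1) ((\<lambda>x s. of_real (s ^ (j+1)) * deriv g (of_real s * x)) x)) (at x within ball 0 r)"
    proof (rule leibniz_rule_field_derivative)
      fix y :: complex and t assume y: "y \<in> ball 0 r" and t: "t \<in> cbox (0::real) 1"
      have "(g has_field_derivative deriv g (of_real t * y)) (at (of_real t * y))"
        by (rule holomorphic_derivI[OF g]) (use sx y t in auto)
      then have "((\<lambda>y. g (of_real t * y)) has_field_derivative deriv g (of_real t * y) * of_real t) (at y within ball 0 r)"
        by (rule DERIV_chain2[where g="\<lambda>y. of_real t * y"]) (auto intro!: derivative_eq_intros)
      from DERIV_cmult[OF this, of "of_real (t^j)"]
      show "((\<lambda>y. of_real (t ^ j) * g (of_real t * y)) has_field_derivative of_real (t ^ (j+1)) * deriv g (of_real t * y)) (at y within ball 0 r)"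
        by (simp add: mult_ac)
    next
      fix y :: complex assume y: "y \<in> ball 0 r"
      show "(\<lambda>s. of_real (s ^ j) * g (of_real s * y)) integrable_on cbox (0::real) 1"
        by (intro integrable_continuous) (use cs[OF cont y] in \<open>auto intro!: continuous_intros\<close>)
    next
      have "continuous_on (ball 0 r \<times> cbox (0::real) 1) (\<lambda>z. deriv g (of_real (snd z) * fst z))"
        by (rule continuous_on_compose2[OF cont']) (use sx in \<open>auto intro!: continuous_intros\<close>)
      then show "continuous_on (ball 0 r \<times> cbox (0::real) 1) (\<lambda>(y, s). of_real (s ^ (j+1)) * deriv g (of_real s * y))"
        by (auto simp: case_prod_unfold intro!: continuous_intros)
    qed (use x in auto)
    then have "((\<lambda>x. integral {0..1} (\<lambda>s. of_real (s ^ j) * g (of_real s * x))) has_field_derivative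
        integral {0..1} (\<lambda>s. of_real (s ^ (j+1)) * deriv g (of_real s * x))) (at x)"
      unfolding at_within_open[OF x open_ball] cbox_interval .
    then show ?thesis unfolding euler_inv_def[abs_def] .
  qed
  then have "\<exists>D. (euler_inv j g has_field_derivative D) (at x)" if "x \<in> ball 0 r" for x using that by blast
  then show "euler_inv j g holomorphic_on ball 0 r"
    unfolding holomorphic_on_def field_differentiable_def using has_field_derivative_at_within by blast
  assume x: "x \<in> ball 0 r"
  let ?a = "\<lambda>s. of_real (s ^ (j+1)) * deriv g (of_real s * x)" and ?b = "\<lambda>s. of_real (s ^ j) * g (of_real s * x)"
  have ia: "?a integrable_on {0..1}" and ib: "?b integrable_on {0..1}"
    using cs[OF cont x] cs[OF cont' x] by (auto intro!: integrable_continuous_interval continuous_intros)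
  \<comment> \<open>The integrand is the derivative in s of \<open>s ^ (j + 1) * g (s x)\<close>, so
    its integral over the unit interval is \<open>g x\<close>.\<close>
  have "((\<lambda>s. x * ?a s + of_nat (j+1) * ?b s) has_integral (of_real (1 ^ (j+1)) * g (of_real 1 * x) - of_real (0 ^ (j+1)) * g (of_real 0 * x))) {0..1}"
  proof (rule fundamental_theorem_of_calculus)
    fix s :: real assume s: "s \<in> {0..1}"
    have "(g has_field_derivative deriv g (of_real s * x)) (at (of_real s * x))"
      by (rule holomorphic_derivI[OF g]) (use sx x s in auto)
    moreover have "((\<lambda>s. of_real s * x) has_vector_derivative x) (at s within {0..1})"
      by (auto intro!: derivative_eq_intros)
    ultimately have "((g \<circ> (\<lambda>s. of_real s * x)) has_vector_derivative x * deriv g (of_real s * x)) (at s within {0..1})"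
      by (rule field_vector_diff_chain_within[OF _ has_field_derivative_at_within, rotated])
    moreover have "((\<lambda>s. of_real (s ^ (j+1)) :: complex) has_vector_derivative of_nat (j+1) * of_real (s ^ j)) (at s within {0..1})"
    proof -
      have "((\<lambda>s. s ^ (j+1)) has_real_derivative real (j+1) * s ^ j) (at s within {0..1})"
        using DERIV_subset[OF DERIV_pow[of "j + 1" s] subset_UNIV] by simp
      from has_vector_derivative_of_real[OF this] show ?thesis by simp
    qed
    ultimately show "((\<lambda>s. of_real (s ^ (j+1)) * g (of_real s * x)) has_vector_derivative x * ?a s + of_nat (j+1) * ?b s) (at s within {0..1})"
      using has_vector_derivative_mult[of "\<lambda>s. of_real (s ^ (j+1))" _ s "{0..1}" "g \<circ> (\<lambda>s. of_real s * x)"]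
      by (force simp: o_def algebra_simps)
  qed simp
  then have "integral {0..1} (\<lambda>s. x * ?a s + of_nat (j+1) * ?b s) = g x"
    by (simp add: integral_unique)
  moreover have "integral {0..1} (\<lambda>s. x * ?a s + of_nat (j+1) * ?b s) = x * integral {0..1} ?a + of_nat (j+1) * integral {0..1} ?b"
    using ia ib by (subst integral_add) (auto intro!: integrable_on_mult_right)
  ultimately show "x * deriv (euler_inv j g) x + of_nat (j + 1) * euler_inv j g x = g x"
    using DERIV_imp_deriv[OF der[OF x]] by (simp add: euler_inv_def)
qed

text \<open>The gain \<open>1 / (j + 1)\<close> is the integral of \<open>s ^ j\<close>. It makes
  the inverse operator small when the linear matrix is shifted far, and thereby produces the
  contraction.\<close>

lemma euler_inv_bound:
  assumes g: "g holomorphic_on ball 0 r" and x: "x \<in> ball 0 r"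
    and B: "\<And>s. s \<in> {0..1} \<Longrightarrow> norm (g (of_real s * x)) \<le> B"
  shows "norm (euler_inv j g x) \<le> B / real (j + 1)"
proof -
  have sx: "of_real s * x \<in> ball 0 r" if "s \<in> {0..1}" for s
  proof -
    have "norm (of_real s * x) \<le> norm x" using that by (simp add: norm_mult mult_left_le_one_le)
    then show ?thesis using x by simp
  qed
  have "continuous_on {0..1} (\<lambda>s. g (of_real s * x))"
    by (rule continuous_on_compose2[OF holomorphic_on_imp_continuous_on[OF g]]) (use sx in \<open>auto intro!: continuous_intros\<close>)
  then have ig: "(\<lambda>s. of_real (s ^ j) * g (of_real s * x)) integrable_on {0..1}"
    by (intro integrable_continuous_interval continuous_intros)
  have hi: "((\<lambda>s. B * s ^ j) has_integral B / real (j + 1)) {0..1}"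
  proof -
    have "((\<lambda>s. B * s ^ j) has_integral (B * (1 ^ (j + 1) / real (j + 1)) - B * (0 ^ (j + 1) / real (j + 1)))) {0..1::real}"
    proof (rule fundamental_theorem_of_calculus)
      fix s :: real assume "s \<in> {0..1}"
      have "((\<lambda>s. B * (s ^ (j + 1) / real (j + 1))) has_field_derivative B * s ^ j) (at s within {0..1})"
        by (rule DERIV_subset[OF _ subset_UNIV], rule DERIV_cong, rule DERIV_cmult, rule DERIV_cdivide, rule DERIV_pow) simp
      then show "((\<lambda>s. B * (s ^ (j + 1) / real (j + 1))) has_vector_derivative B * s ^ j) (at s within {0..1})"
        by (rule has_real_derivative_iff_has_vector_derivative[THEN iffD1])
    qed simp
    then show ?thesis by simp
  qed
  have "norm (integral {0..1} (\<lambda>s. of_real (s ^ j) * g (of_real s * x))) \<le> integral {0..1} (\<lambda>s. B * s ^ j)"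
  proof (rule integral_norm_bound_integral[OF ig])
    show "(\<lambda>s. B * s ^ j) integrable_on {0..1}" using hi by blast
    fix s :: real assume s: "s \<in> {0..1}"
    have "norm (of_real (s ^ j) * g (of_real s * x)) = s ^ j * norm (g (of_real s * x))"
      using s by (simp add: norm_mult norm_power)
    also have "\<dots> \<le> s ^ j * B" using s B[OF s] by (intro mult_left_mono) auto
    finally show "norm (of_real (s ^ j) * g (of_real s * x)) \<le> B * s ^ j" by (simp add: mult.commute)
  qed
  then show ?thesis unfolding euler_inv_def integral_unique[OF hi] .
qed

section \<open>Briot--Bouquet systems\<close>

text \<open>Nonlinearities are only required to be Lipschitz in \<open>w\<close> with small constant and holomorphic along
  holomorphic curves \<open>x \<mapsto> w x\<close>: both properties visibly survive the reduction step, whereas joint holomorphy would need a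
  removable singularity theorem in several variables.\<close>

definition holcurve :: "real \<Rightarrow> (complex \<Rightarrow> complex^2) \<Rightarrow> bool" where
  "holcurve r w \<longleftrightarrow> (\<forall>i. (\<lambda>x. w x $ i) holomorphic_on ball 0 r)"

definition lipw :: "real \<Rightarrow> real \<Rightarrow> (complex \<Rightarrow> complex^2 \<Rightarrow> complex) \<Rightarrow> bool" where
  "lipw \<delta> C \<phi> \<longleftrightarrow> (\<forall>x w w'. norm x < \<delta> \<longrightarrow> norm w < \<delta> \<longrightarrow> norm w' < \<delta> \<longrightarrow> norm (\<phi> x w - \<phi> x w') \<le> C * norm (w - w'))"

definition cholo :: "real \<Rightarrow> (complex \<Rightarrow> complex^2 \<Rightarrow> complex) \<Rightarrow> bool" where
  "cholo \<delta> \<phi> \<longleftrightarrow> (\<forall>r w. 0 < r \<longrightarrow> r \<le> \<delta> \<longrightarrow> holcurve r w \<longrightarrow> (\<forall>x\<in>ball 0 r. norm (w x) < \<delta>) \<longrightarrow>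
     (\<lambda>x. \<phi> x (w x)) holomorphic_on ball 0 r)"

text \<open>Lipschitz constants that shrink with the radius stand for the vanishing of the
  w-derivative at 0; the last clause is the vanishing of the x-derivative. Together they encode
  DF(0) = 0.\<close>

definition bb_good :: "(complex \<Rightarrow> complex^2 \<Rightarrow> complex^2) \<Rightarrow> bool" where
  "bb_good F \<longleftrightarrow> (\<exists>\<delta>>0. \<forall>i. cholo \<delta> (\<lambda>x w. F x w $ i)) \<and> (\<forall>e>0. \<exists>\<delta>>0. \<forall>i. lipw \<delta> e (\<lambda>x w. F x w $ i)) \<and>
     F 0 0 = 0 \<and> (\<forall>i. deriv (\<lambda>x. F x 0 $ i) 0 = 0)"

definition bbsol :: "bbsys \<Rightarrow> (complex \<Rightarrow> complex^2) \<Rightarrow> bool" where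
  "bbsol s w \<longleftrightarrow> (case s of (a, M, F) \<Rightarrow> \<exists>r>0. holcurve r w \<and> w 0 = 0 \<and>
     (\<forall>x\<in>ball 0 r. \<forall>i. x * deriv (\<lambda>x. w x $ i) x = x * a $ i + (M *v w x) $ i + F x (w x) $ i))"

text \<open>The reduction step with the coefficient \<open>c\<close> as a parameter. In the resonant
  step several \<open>c\<close> are admissible and each of them starts its own branch of
  solutions.\<close>

definition redc :: "complex^2 \<Rightarrow> bbsys \<Rightarrow> bbsys" where
  "redc c s = (case s of (a, M, F) \<Rightarrow> (quad_part F c, M - mat 1,
     \<lambda>x w. if x = 0 then 0 else inverse x *s F x (x *s (w + c)) - x *s quad_part F c))"

lemma reduce_redc: "reduce (a, M, F) = redc (THE c. (mat 1 - M) *v c = a) (a, M, F)"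
  by (simp add: reduce_def redc_def Let_def)

lemma holcurve_mono: "holcurve r w \<Longrightarrow> r' \<le> r \<Longrightarrow> holcurve r' w"
  unfolding holcurve_def by (auto intro: holomorphic_on_subset[OF _ subset_ball])

lemma norm_vec2_le: "norm (v :: complex^2) \<le> norm (v $ 1) + norm (v $ 2)"
  by (simp add: norm_vec_def L2_set_def sum_2 sqrt_sum_squares_le_sum)

lemma norm_vs: "norm (x *s (v :: complex^2)) = norm x * norm v"
  by (simp add: norm_vec_def norm_mult L2_set_right_distrib)

lemma cholo_mono: "cholo \<delta> \<phi> \<Longrightarrow> \<delta>' \<le> \<delta> \<Longrightarrow> cholo \<delta>' \<phi>"
  unfolding cholo_def
proof (intro allI impI)
  fix r w assume a: "\<forall>r w. 0 < r \<longrightarrow> r \<le> \<delta> \<longrightarrow> holcurve r w \<longrightarrow> (\<forall>x\<in>ball 0 r. norm (w x) < \<delta>) \<longrightarrow>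
     (\<lambda>x. \<phi> x (w x)) holomorphic_on ball 0 r" and le: "\<delta>' \<le> \<delta>"
    and r: "0 < r" "r \<le> \<delta>'" "holcurve r w" "\<forall>x\<in>ball 0 r. norm (w x) < \<delta>'"
  have "\<forall>x\<in>ball 0 r. norm (w x) < \<delta>" using r(4) le by (meson less_le_trans)
  moreover have "r \<le> \<delta>" using r(2) le by simp
  ultimately show "(\<lambda>x. \<phi> x (w x)) holomorphic_on ball 0 r" using a r(1,3) by blast
qed

lemma lipw_mono: "lipw \<delta> C \<phi> \<Longrightarrow> \<delta>' \<le> \<delta> \<Longrightarrow> C \<le> C' \<Longrightarrow> lipw \<delta>' C' \<phi>"
  unfolding lipw_def
proof (intro allI impI)
  fix x :: complex and w w' :: "complex^2" assume a: "\<forall>x w w'. norm x < \<delta> \<longrightarrow> norm w < \<delta> \<longrightarrow> norm w' < \<delta> \<longrightarrow> norm (\<phi> x w - \<phi> x w') \<le> C * norm (w - w')"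
    and le: "\<delta>' \<le> \<delta>" "C \<le> C'" and x: "norm x < \<delta>'" "norm w < \<delta>'" "norm w' < \<delta>'"
  have "norm (\<phi> x w - \<phi> x w') \<le> C * norm (w - w')" using a x le by auto
  also have "\<dots> \<le> C' * norm (w - w')" using le by (intro mult_right_mono) auto
  finally show "norm (\<phi> x w - \<phi> x w') \<le> C' * norm (w - w')" .
qed

lemma cholo_D:
  assumes "cholo \<delta> \<phi>" "0 < r" "r \<le> \<delta>" "holcurve r w" "\<And>x. x \<in> ball 0 r \<Longrightarrow> norm (w x) < \<delta>"
  shows "(\<lambda>x. \<phi> x (w x)) holomorphic_on ball 0 r"
  using assms(1)[unfolded cholo_def, rule_format, OF assms(2-4)] assms(5) by blast

lemma lipw_D: "lipw \<delta> C \<phi> \<Longrightarrow> norm x < \<delta> \<Longrightarrow> norm w < \<delta> \<Longrightarrow> norm w' < \<delta> \<Longrightarrow> norm (\<phi> x w - \<phi> x w') \<le> C * norm (w - w')"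
  unfolding lipw_def by simp

lemma bb_good_D:
  assumes "bb_good F" "e > 0"
  obtains \<delta> where "\<delta> > 0" "\<And>i. cholo \<delta> (\<lambda>x w. F x w $ i)" "\<And>i. lipw \<delta> e (\<lambda>x w. F x w $ i)"
proof -
  obtain d1 where d1: "d1 > 0" "\<And>i. cholo d1 (\<lambda>x w. F x w $ i)" using assms(1) unfolding bb_good_def by blast
  obtain d2 where d2: "d2 > 0" "\<And>i. lipw d2 e (\<lambda>x w. F x w $ i)" using assms unfolding bb_good_def by blast
  show thesis
    by (rule that[of "min d1 d2"]) (use d1(1) d2(1) cholo_mono[OF d1(2)] lipw_mono[OF d2(2)] in auto)
qed

lemma holcurve_isCont: "holcurve r w \<Longrightarrow> r > 0 \<Longrightarrow> isCont w 0"
proof -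
  assume a: "holcurve r w" "r > 0"
  have "(w \<longlongrightarrow> w 0) (at 0)"
  proof (rule vec_tendstoI)
    fix i
    have "continuous_on (ball 0 r) (\<lambda>x. w x $ i)"
      using a by (auto simp: holcurve_def intro: holomorphic_on_imp_continuous_on)
    then show "((\<lambda>x. w x $ i) \<longlongrightarrow> w 0 $ i) (at 0)"
      using a(2) continuous_on_eq_continuous_at[of "ball 0 r"] isContD by fastforce
  qed
  then show ?thesis by (simp add: isCont_def)
qed

lemma holcurve_small:
  assumes w: "holcurve r w" "r > 0" "w 0 = 0" and e: "\<delta> > 0"
  obtains r' where "0 < r'" "r' \<le> r" "r' \<le> \<delta>" "\<And>x. x \<in> ball 0 r' \<Longrightarrow> norm (w x) < \<delta>"
proof -
  obtain d where d: "d > 0" "\<And>x. dist x 0 < d \<Longrightarrow> dist (w x) (w 0) < \<delta>"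
    using holcurve_isCont[OF w(1,2)] e unfolding continuous_at_eps_delta by blast
  show thesis by (rule that[of "min d (min r \<delta>)"]) (use d w e in \<open>auto simp: dist_norm\<close>)
qed

lemma has_field_derivative_0I:
  fixes k :: "complex \<Rightarrow> complex"
  assumes "k 0 = 0" and "\<And>e. e > 0 \<Longrightarrow> \<exists>d>0. \<forall>x. norm x < d \<longrightarrow> norm (k x) \<le> e * norm x"
  shows "(k has_field_derivative 0) (at 0)"
  unfolding has_field_derivative_iff
proof (rule tendstoI)
  fix e :: real assume e: "e > 0"
  then obtain d where d: "d > 0" "\<And>x. norm x < d \<Longrightarrow> norm (k x) \<le> e/2 * norm x" using assms(2)[of "e/2"] by auto
  have "dist ((k x - k 0) / (x - 0)) 0 < e" if "x \<noteq> 0" "dist x 0 < d" for x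
  proof -
    have "norm (k x) / norm x \<le> e/2" using d(2)[of x] that by (simp add: divide_le_eq)
    then have "norm (k x) / norm x < e" using e by linarith
    then show ?thesis using assms(1) by (simp add: norm_divide)
  qed
  then show "\<forall>\<^sub>F x in at 0. dist ((k x - k 0) / (x - 0)) 0 < e"
    unfolding eventually_at using d(1) by blast
qed

lemma holomorphic_linear_bound:
  fixes k :: "complex \<Rightarrow> complex"
  assumes "k holomorphic_on ball 0 r" "r > 0" "k 0 = 0" "deriv k 0 = 0" "e > 0"
  shows "\<exists>d>0. \<forall>x. norm x < d \<longrightarrow> norm (k x) \<le> e * norm x"
proof -
  have "(k has_field_derivative 0) (at 0)"
    using holomorphic_derivI[OF assms(1), of 0] assms by simp
  then have "((\<lambda>x. (k x - k 0) / (x - 0)) \<longlongrightarrow> 0) (at 0)" by (simp add: has_field_derivative_iff)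
  then have "\<forall>\<^sub>F x in at 0. dist ((k x - k 0) / (x - 0)) 0 < e" using assms(5) by (rule tendstoD)
  then obtain d where d: "d > 0" "\<And>x. x \<noteq> 0 \<Longrightarrow> dist x (0::complex) < d \<Longrightarrow> dist ((k x - k 0) / (x - 0)) 0 < e"
    unfolding eventually_at by blast
  show ?thesis
  proof (intro exI[of _ d] conjI allI impI)
    fix x :: complex assume x: "norm x < d"
    show "norm (k x) \<le> e * norm x"
    proof (cases "x = 0")
      case False
      then have "norm (k x) / norm x < e" using d(2)[of x] x assms by (simp add: norm_divide)
      then show ?thesis using False by (simp add: divide_less_eq)
    qed (use assms in simp)
  qed (rule d)
qed

lemma holcurve_const: "holcurve r (\<lambda>x. v)"
  by (simp add: holcurve_def)

text \<open>A holomorphic curve with \<open>w 0 = 0\<close> grows at most linearly, so small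
  Lipschitz constants make \<open>F x (w x) - F x 0\<close> of order o(x), and \<open>F x 0\<close>
  has a double zero. This is what allows the division by x in the reduction step.\<close>

lemma bb_flat_along:
  assumes F: "bb_good F" and w: "holcurve r w" "r > 0" "w 0 = 0"
  shows "((\<lambda>x. F x (w x) $ i) has_field_derivative 0) (at 0)"
proof (rule has_field_derivative_0I)
  show "F 0 (w 0) $ i = 0" using F w by (simp add: bb_good_def)
  fix e :: real assume e: "e > 0"
  have "(\<lambda>x. w x $ j) holomorphic_on ball 0 r" for j using w by (simp add: holcurve_def)
  then have dw: "((\<lambda>x. w x $ j) has_field_derivative deriv (\<lambda>x. w x $ j) 0) (at 0)" for j
    by (rule holomorphic_derivI) (use w in auto)
  have "\<exists>d>0. \<forall>x. norm x < d \<longrightarrow> norm (w x $ j) \<le> (norm (deriv (\<lambda>x. w x $ j) 0) + 1) * norm x" for j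
  proof -
    have "\<exists>d>0. \<forall>x. norm x < d \<longrightarrow> norm (w x $ j - deriv (\<lambda>x. w x $ j) 0 * x) \<le> 1 * norm x"
    proof (rule holomorphic_linear_bound[where r=r])
      show "(\<lambda>x. w x $ j - deriv (\<lambda>x. w x $ j) 0 * x) holomorphic_on ball 0 r"
        using w by (auto simp: holcurve_def intro!: holomorphic_intros)
      have "((\<lambda>x. w x $ j - deriv (\<lambda>x. w x $ j) 0 * x) has_field_derivative deriv (\<lambda>x. w x $ j) 0 - deriv (\<lambda>x. w x $ j) 0 * 1) (at 0)"
        by (intro DERIV_diff dw DERIV_cmult DERIV_ident)
      then show "deriv (\<lambda>x. w x $ j - deriv (\<lambda>x. w x $ j) 0 * x) 0 = 0" by (simp add: DERIV_imp_deriv)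
    qed (use w in auto)
    then obtain d where d: "d > 0" "\<And>x. norm x < d \<Longrightarrow> norm (w x $ j - deriv (\<lambda>x. w x $ j) 0 * x) \<le> norm x" by auto
    have "norm (w x $ j) \<le> (norm (deriv (\<lambda>x. w x $ j) 0) + 1) * norm x" if "norm x < d" for x
      using d(2)[OF that] norm_triangle_sub[of "w x $ j" "deriv (\<lambda>x. w x $ j) 0 * x"] by (simp add: norm_mult algebra_simps)
    with d show ?thesis by blast
  qed
  then obtain d where dC': "\<And>j. d j > 0"
    "\<And>j x. norm x < d j \<Longrightarrow> norm (w x $ j) \<le> (norm (deriv (\<lambda>x. w x $ j) 0) + 1) * norm x" by metis
  define C where "C = (\<lambda>j. norm (deriv (\<lambda>x. w x $ j) 0) + 1)"
  have dC: "\<And>j. d j > 0" "\<And>j x. norm x < d j \<Longrightarrow> norm (w x $ j) \<le> C j * norm x"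
    using dC' by (auto simp: C_def)
  have C0: "C j \<ge> 0" for j by (simp add: C_def)
  define C' where "C' = C 1 + C 2 + 1"
  have C': "C' > 0" using C0[of 1] C0[of 2] by (simp add: C'_def)
  have wb: "norm (w x) \<le> C' * norm x" if "norm x < min (d 1) (d 2)" for x
  proof -
    have "norm (w x) \<le> norm (w x $ 1) + norm (w x $ 2)" by (rule norm_vec2_le)
    also have "\<dots> \<le> C 1 * norm x + C 2 * norm x" using that by (intro add_mono dC(2)) auto
    also have "\<dots> \<le> C' * norm x" by (simp add: C'_def algebra_simps)
    finally show ?thesis .
  qed
  \<comment> \<open>Half of \<open>e\<close> pays for the dependence on \<open>w\<close>, after
    multiplication by the growth constant \<open>C'\<close>; the other half pays for
    \<open>F x 0\<close>.\<close>
  obtain \<delta> where \<delta>: "\<delta> > 0" "\<And>i. cholo \<delta> (\<lambda>x w. F x w $ i)" "\<And>i. lipw \<delta> (e/(2*C')) (\<lambda>x w. F x w $ i)"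
    using bb_good_D[OF F, of "e/(2*C')"] e C' by auto
  have "(\<lambda>x. F x 0 $ i) holomorphic_on ball 0 \<delta>"
    by (rule cholo_D[OF \<delta>(2) \<delta>(1) order_refl holcurve_const]) (use \<delta> in auto)
  then obtain d0 where d0: "d0 > 0" "\<And>x. norm x < d0 \<Longrightarrow> norm (F x 0 $ i) \<le> e/2 * norm x"
    using holomorphic_linear_bound[of "\<lambda>x. F x 0 $ i" \<delta> "e/2"] F \<delta>(1) e by (auto simp: bb_good_def)
  obtain r' where r': "0 < r'" "r' \<le> r" "r' \<le> \<delta>" "\<And>x. x \<in> ball 0 r' \<Longrightarrow> norm (w x) < \<delta>"
    using holcurve_small[OF w \<delta>(1)] by metis
  show "\<exists>d>0. \<forall>x. norm x < d \<longrightarrow> norm (F x (w x) $ i) \<le> e * norm x"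
  proof (intro exI[of _ "min (min (d 1) (d 2)) (min d0 r')"] conjI allI impI)
    show "min (min (d 1) (d 2)) (min d0 r') > 0" using dC d0 r' by simp
    fix x :: complex assume x: "norm x < min (min (d 1) (d 2)) (min d0 r')"
    have "norm (F x (w x) $ i - F x 0 $ i) \<le> e/(2*C') * norm (w x - 0)"
      by (rule lipw_D[OF \<delta>(3)]) (use x r' \<delta> in auto)
    also have "\<dots> \<le> e/(2*C') * (C' * norm x)" using x e C' wb[of x] by (intro mult_left_mono) auto
    also have "\<dots> = e/2 * norm x" using C' by simp
    finally have "norm (F x (w x) $ i - F x 0 $ i) \<le> e/2 * norm x" .
    moreover have "norm (F x 0 $ i) \<le> e/2 * norm x" using d0 x by simp
    ultimately show "norm (F x (w x) $ i) \<le> e * norm x"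
      using norm_triangle_sub[of "F x (w x) $ i" "F x 0 $ i"] by simp
  qed
qed

lemma holomorphic_div_x:
  assumes k: "k holomorphic_on ball 0 r" "(k has_field_derivative 0) (at 0)" "k 0 = 0"
  shows "(\<lambda>x. if x = 0 then 0 else k x / x) holomorphic_on ball 0 r"
proof -
  have "(\<lambda>x. if x = 0 then deriv k 0 else (k x - k 0) / (x - 0)) = (\<lambda>x. if x = 0 then 0 else k x / x)"
    by (simp only: DERIV_imp_deriv[OF k(2)] k(3) diff_0_right)
  with pole_lemma_open[OF k(1), of 0] show ?thesis by (simp only: open_ball simp_thms)
qed

text \<open>\<open>quad_part\<close> is a halved second derivative of \<open>F t (t c)\<close>.
  Writing that function as t times its quotient by t identifies \<open>quad_part\<close> with the
  slope of the quotient.\<close>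

lemma deriv2_of_x_mult:
  assumes h: "h holomorphic_on ball 0 r" "r > 0" and k: "\<And>x. x \<in> ball 0 r \<Longrightarrow> k x = x * h x"
  shows "deriv (deriv k) 0 = 2 * deriv h 0"
proof -
  have dk: "deriv k x = h x + x * deriv h x" if x: "x \<in> ball 0 r" for x
  proof -
    have "((\<lambda>x. x * h x) has_field_derivative 1 * h x + deriv h x * x) (at x)"
      by (intro DERIV_mult DERIV_ident holomorphic_derivI[OF h(1) open_ball x])
    then have "(k has_field_derivative 1 * h x + deriv h x * x) (at x)"
      by (rule has_field_derivative_transform_within_open[OF _ open_ball x]) (simp add: k)
    then show ?thesis by (simp add: DERIV_imp_deriv mult.commute)
  qed
  have 0: "0 \<in> ball 0 r" using h by simp
  have h': "deriv h holomorphic_on ball 0 r" by (rule holomorphic_deriv[OF h(1) open_ball])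
  have "((\<lambda>x. h x + x * deriv h x) has_field_derivative deriv h 0 + (1 * deriv h 0 + deriv (deriv h) 0 * 0)) (at 0)"
    by (intro DERIV_add DERIV_mult DERIV_ident holomorphic_derivI[OF h(1) open_ball 0] holomorphic_derivI[OF h' open_ball 0])
  then have "(deriv k has_field_derivative deriv h 0 + (1 * deriv h 0 + deriv (deriv h) 0 * 0)) (at 0)"
    by (rule has_field_derivative_transform_within_open[OF _ open_ball 0]) (simp add: dk)
  then show ?thesis by (simp add: DERIV_imp_deriv)
qed

section \<open>The reduction step acting on systems and solutions\<close>

lemma holcurve_lift:
  assumes "holcurve r w" shows "holcurve r (\<lambda>x. x *s (w x + c))"
  unfolding holcurve_def
proof
  fix i
  have "(\<lambda>x. x * (w x $ i + c $ i)) holomorphic_on ball 0 r"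
    using assms by (intro holomorphic_intros) (simp add: holcurve_def)
  then show "(\<lambda>x. (x *s (w x + c)) $ i) holomorphic_on ball 0 r" by (simp only: vector_smult_component vector_add_component)
qed

text \<open>The substitution multiplies differences in \<open>w\<close> by x and the division by x
  removes that factor, so Lipschitz constants are preserved. The radius
  \<open>min 1 (\<delta> / (norm c + 1))\<close> keeps \<open>x *s (w + c)\<close> inside the old
  domain, as \<open>norm (w + c)\<close> is then at most \<open>1 + norm c\<close>.\<close>

lemma redc_good:
  assumes F: "bb_good F" and eq: "redc c (a, M, F) = (a', M', F')"
  shows "bb_good F'"
proof -
  define q where "q = quad_part F c"
  have F': "F' = (\<lambda>x w. if x = 0 then 0 else inverse x *s F x (x *s (w + c)) - x *s q)"
    using eq unfolding redc_def q_def by auto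
  have xsmall: "norm (x *s (w + c)) < \<delta>" if "\<delta> > 0" "norm x < min 1 (\<delta> / (norm c + 1))" "norm w < min 1 (\<delta> / (norm c + 1))" for x w \<delta>
  proof -
    have "norm (x *s (w + c)) \<le> norm x * (norm w + norm c)"
      unfolding norm_vs by (intro mult_left_mono norm_triangle_ineq) auto
    also have "\<dots> \<le> norm x * (1 + norm c)" using that by (intro mult_left_mono) auto
    also have "\<dots> < \<delta> / (norm c + 1) * (1 + norm c)"
      using that by (intro mult_strict_right_mono) (auto simp: add_pos_nonneg)
    also have "\<dots> = \<delta>" by (simp add: add.commute add_nonneg_eq_0_iff)
    finally show ?thesis .
  qed
  have small_pos: "min 1 (\<delta> / (norm c + 1)) > 0" "min 1 (\<delta> / (norm c + 1)) \<le> \<delta>" if "\<delta> > 0" for \<delta> :: real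
  proof -
    have p: "norm c + 1 > 0" using norm_ge_zero[of c] by linarith
    then show "min 1 (\<delta> / (norm c + 1)) > 0" using that by simp
    have "\<delta> / (norm c + 1) \<le> \<delta>" using that p by (simp add: divide_le_eq)
    then show "min 1 (\<delta> / (norm c + 1)) \<le> \<delta>" by simp
  qed
  have hol: "(\<lambda>x. F' x (w x) $ i) holomorphic_on ball 0 r"
    if \<delta>: "\<delta> > 0" "\<And>i. cholo \<delta> (\<lambda>x w. F x w $ i)" and w: "0 < r" "r \<le> min 1 (\<delta> / (norm c + 1))" "holcurve r w"
     "\<And>x. x \<in> ball 0 r \<Longrightarrow> norm (w x) < min 1 (\<delta> / (norm c + 1))" for \<delta> r w i
  proof -
    let ?k = "\<lambda>x. F x (x *s (w x + c)) $ i"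
    have k: "?k holomorphic_on ball 0 r"
      by (rule cholo_D[OF \<delta>(2) w(1) _ holcurve_lift[OF w(3)]]) (use w xsmall[OF \<delta>(1)] small_pos[OF \<delta>(1)] in auto)
    have "(\<lambda>x. if x = 0 then 0 else ?k x / x) holomorphic_on ball 0 r"
    proof (rule holomorphic_div_x[OF k])
      show "(?k has_field_derivative 0) (at 0)"
        by (rule bb_flat_along[OF F holcurve_lift[OF w(3)] w(1)]) simp
    qed (use F in \<open>simp add: bb_good_def\<close>)
    then have "(\<lambda>x. (if x = 0 then 0 else ?k x / x) - x * q $ i) holomorphic_on ball 0 r"
      by (intro holomorphic_intros)
    then show ?thesis
      by (rule holomorphic_transform) (auto simp: F' divide_inverse mult.commute)
  qed
  obtain \<delta>0 where \<delta>0: "\<delta>0 > 0" "\<And>i. cholo \<delta>0 (\<lambda>x w. F x w $ i)" using F unfolding bb_good_def by blast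
  show ?thesis
    unfolding bb_good_def
  proof (intro conjI allI impI)
    show "\<exists>\<delta>>0. \<forall>i. cholo \<delta> (\<lambda>x w. F' x w $ i)"
    proof (intro exI[of _ "min 1 (\<delta>0 / (norm c + 1))"] conjI allI small_pos(1)[OF \<delta>0(1)])
      show "cholo (min 1 (\<delta>0 / (norm c + 1))) (\<lambda>x w. F' x w $ i)" for i
        unfolding cholo_def by (intro allI impI, rule hol[OF \<delta>0]) auto
    qed
  next
    fix e :: real assume e: "e > 0"
    then obtain \<delta> where \<delta>: "\<delta> > 0" "\<And>i. lipw \<delta> e (\<lambda>x w. F x w $ i)" using F unfolding bb_good_def by blast
    show "\<exists>\<delta>>0. \<forall>i. lipw \<delta> e (\<lambda>x w. F' x w $ i)"
    proof (intro exI[of _ "min 1 (\<delta> / (norm c + 1))"] conjI allI, unfold lipw_def, safe)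
      fix i and x :: complex and w w' :: "complex^2"
      assume x: "norm x < min 1 (\<delta> / (norm c + 1))" "norm w < min 1 (\<delta> / (norm c + 1))" "norm w' < min 1 (\<delta> / (norm c + 1))"
      show "norm (F' x w $ i - F' x w' $ i) \<le> e * norm (w - w')"
      proof (cases "x = 0")
        case False
        have "norm (F x (x *s (w + c)) $ i - F x (x *s (w' + c)) $ i) \<le> e * norm (x *s (w + c) - x *s (w' + c))"
          by (rule lipw_D[OF \<delta>(2)]) (use xsmall[OF \<delta>(1)] x small_pos[OF \<delta>(1)] in auto)
        also have "x *s (w + c) - x *s (w' + c) = x *s (w - w')" by (simp add: vec_eq_iff algebra_simps)
        finally have 1: "norm (F x (x *s (w + c)) $ i - F x (x *s (w' + c)) $ i) \<le> e * (norm x * norm (w - w'))"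
          by (simp only: norm_vs)
        have "F' x w $ i - F' x w' $ i = inverse x * (F x (x *s (w + c)) $ i - F x (x *s (w' + c)) $ i)"
          using False by (simp add: F' algebra_simps)
        then have "norm (F' x w $ i - F' x w' $ i) = inverse (norm x) * norm (F x (x *s (w + c)) $ i - F x (x *s (w' + c)) $ i)"
          by (simp add: norm_mult norm_inverse)
        also have "\<dots> \<le> inverse (norm x) * (e * (norm x * norm (w - w')))" using 1 by (intro mult_left_mono) auto
        also have "\<dots> = e * norm (w - w')" using False by simp
        finally show ?thesis .
      qed (use e in \<open>simp add: F'\<close>)
    qed (use small_pos[OF \<delta>(1)] in auto)
  next
    show "F' 0 0 = 0" by (simp add: F')
  next
    fix i
    let ?k = "\<lambda>x. F x (x *s c) $ i"
    define r where "r = min 1 (\<delta>0 / (norm c + 1))"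
    have r: "r > 0" "r \<le> \<delta>0" using small_pos[OF \<delta>0(1)] by (auto simp: r_def)
    have hc: "holcurve r (\<lambda>x. x *s c)" using holcurve_lift[OF holcurve_const[of r 0], of c] by simp
    have k: "?k holomorphic_on ball 0 r"
      by (rule cholo_D[OF \<delta>0(2) r hc]) (use xsmall[OF \<delta>0(1), of _ 0] r in \<open>auto simp: r_def\<close>)
    define h where "h = (\<lambda>x. if x = 0 then 0 else ?k x / x)"
    have h: "h holomorphic_on ball 0 r"
      unfolding h_def
    proof (rule holomorphic_div_x[OF k])
      show "(?k has_field_derivative 0) (at 0)"
        by (rule bb_flat_along[OF F hc r(1)]) simp
    qed (use F in \<open>simp add: bb_good_def\<close>)
    have "deriv (deriv ?k) 0 = 2 * deriv h 0"
      by (rule deriv2_of_x_mult[OF h r(1)]) (use F in \<open>auto simp: h_def bb_good_def\<close>)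
    \<comment> \<open>The subtracted term \<open>x *s q\<close> is exactly the linear part of F(x, x
      c)/x, so nothing of first order in x is left in the new nonlinearity.\<close>
    then have qi: "q $ i = deriv h 0" by (simp add: q_def quad_part_def)
    have "((\<lambda>x. h x - q $ i * x) has_field_derivative deriv h 0 - q $ i * 1) (at 0)"
      by (intro DERIV_diff DERIV_cmult DERIV_ident holomorphic_derivI[OF h]) (use r in auto)
    moreover have "(\<lambda>x. F' x 0 $ i) = (\<lambda>x. h x - q $ i * x)"
      by (auto simp: F' h_def fun_eq_iff divide_inverse mult.commute)
    ultimately show "deriv (\<lambda>x. F' x 0 $ i) 0 = 0" by (simp add: qi DERIV_imp_deriv)
  qed
qed

text \<open>Every solution \<open>c\<close> of the linear equation works, whether or not it is the
  only one; this freedom later yields the resonant families. The term \<open>- w\<close> from the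
  shifted matrix cancels the extra \<open>w\<close> produced by the product rule.\<close>

lemma bbsol_lift:
  assumes c: "(mat 1 - M) *v c = a" and w: "bbsol (redc c (a, M, F)) w" and F0: "F 0 0 = 0"
  shows "bbsol (a, M, F) (\<lambda>x. x *s (w x + c))"
proof -
  define q where "q = quad_part F c"
  define F' where "F' = (\<lambda>x w. if x = 0 then 0 else inverse x *s F x (x *s (w + c)) - x *s q)"
  obtain r where r: "r > 0" "holcurve r w" "w 0 = 0"
    and eq: "\<And>x i. x \<in> ball 0 r \<Longrightarrow> x * deriv (\<lambda>x. w x $ i) x = x * q $ i + ((M - mat 1) *v w x) $ i + F' x (w x) $ i"
    using w unfolding bbsol_def redc_def q_def F'_def by auto
  have xF': "x * F' x v $ i = F x (x *s (v + c)) $ i - x * x * q $ i" for x v i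
    using F0 by (cases "x = 0") (auto simp: F'_def algebra_simps)
  have ci: "c $ i = a $ i + (M *v c) $ i" for i
  proof -
    have "c - M *v c = a" using c by (simp add: matrix_vector_mult_diff_rdistrib)
    then show ?thesis by (metis add.commute diff_add_cancel vector_add_component)
  qed
  have "x * deriv (\<lambda>x. (x *s (w x + c)) $ i) x = x * a $ i + (M *v (x *s (w x + c))) $ i + F x (x *s (w x + c)) $ i"
    if x: "x \<in> ball 0 r" for x i
  proof -
    have "(\<lambda>x. w x $ i) holomorphic_on ball 0 r" using r by (simp add: holcurve_def)
    from holomorphic_derivI[OF this open_ball x]
    have "((\<lambda>x. x * (w x $ i + c $ i)) has_field_derivative 1 * (w x $ i + c $ i) + (deriv (\<lambda>x. w x $ i) x + 0) * x) (at x)"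
      by (intro DERIV_mult DERIV_ident DERIV_add DERIV_const)
    then have "deriv (\<lambda>x. (x *s (w x + c)) $ i) x = (w x $ i + c $ i) + x * deriv (\<lambda>x. w x $ i) x"
      by (simp only: vector_smult_component vector_add_component) (simp add: DERIV_imp_deriv mult.commute)
    then have "x * deriv (\<lambda>x. (x *s (w x + c)) $ i) x = x * (w x $ i + c $ i) + x * (x * q $ i + ((M - mat 1) *v w x) $ i + F' x (w x) $ i)"
      by (simp only: eq[OF x] distrib_left)
    also have "((M - mat 1) *v w x) $ i = (M *v w x) $ i - w x $ i" by (simp add: matrix_vector_mult_diff_rdistrib)
    also have "x * (w x $ i + c $ i) + x * (x * q $ i + ((M *v w x) $ i - w x $ i) + F' x (w x) $ i)
       = x * c $ i + x * (M *v w x) $ i + (x * x * q $ i + x * F' x (w x) $ i)" by (simp only: algebra_simps)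
    also have "\<dots> = x * (a $ i + (M *v c) $ i) + x * (M *v w x) $ i + F x (x *s (w x + c)) $ i"
      by (simp only: xF' ci[symmetric]) (simp add: algebra_simps)
    also have "\<dots> = x * a $ i + (M *v (x *s (w x + c))) $ i + F x (x *s (w x + c)) $ i"
      by (simp add: matrix_vector_mult_def sum_2 algebra_simps)
    finally show ?thesis .
  qed
  then show ?thesis unfolding bbsol_def using r holcurve_lift[OF r(2), of c] by auto
qed

text \<open>The first Taylor coefficient of a solution must satisfy the linear equation. This
  necessity is the source of nonexistence in the resonant case, and of the equality of coefficients
  in the uniqueness proof.\<close>

lemma bbsol_drop:
  assumes F: "bb_good F" and w: "bbsol (a, M, F) w"
  defines "c \<equiv> \<chi> i. deriv (\<lambda>x. w x $ i) 0"
  shows "(mat 1 - M) *v c = a" "bbsol (redc c (a, M, F)) (\<lambda>x. if x = 0 then 0 else inverse x *s w x - c)"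
proof -
  obtain r where r: "r > 0" "holcurve r w" "w 0 = 0"
    and eq: "\<And>x i. x \<in> ball 0 r \<Longrightarrow> x * deriv (\<lambda>x. w x $ i) x = x * a $ i + (M *v w x) $ i + F x (w x) $ i"
    using w unfolding bbsol_def by auto
  have 0: "0 \<in> ball 0 r" using r by simp
  have hw: "(\<lambda>x. w x $ i) holomorphic_on ball 0 r" for i using r by (simp add: holcurve_def)
  have dw: "((\<lambda>x. w x $ i) has_field_derivative c $ i) (at 0)" for i
    using holomorphic_derivI[OF hw open_ball 0] by (simp add: c_def)
  have Mi: "(M *v v) $ i = M $ i $ 1 * v $ 1 + M $ i $ 2 * v $ 2" for v i
    by (simp add: matrix_vector_mult_def sum_2)
  \<comment> \<open>Both sides of the equation are differentiated at 0: the left side x w'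
    contributes w'(0), and the nonlinear term contributes nothing by flatness along the
    curve.\<close>
  have ci: "c $ i = a $ i + (M *v c) $ i" for i
  proof -
    have "((\<lambda>x. x * deriv (\<lambda>x. w x $ i) x) has_field_derivative (1 * deriv (\<lambda>x. w x $ i) 0 + deriv (deriv (\<lambda>x. w x $ i)) 0 * 0)) (at 0)"
      by (intro DERIV_mult DERIV_ident holomorphic_derivI[OF holomorphic_deriv[OF hw open_ball] open_ball 0])
    then have 1: "((\<lambda>x. x * deriv (\<lambda>x. w x $ i) x) has_field_derivative c $ i) (at 0)"
      by (simp add: c_def)
    have "((\<lambda>x. x * a $ i + (M $ i $ 1 * w x $ 1 + M $ i $ 2 * w x $ 2) + F x (w x) $ i) has_field_derivative
       (1 * a $ i + (M $ i $ 1 * c $ 1 + M $ i $ 2 * c $ 2) + 0)) (at 0)"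
      by (intro DERIV_add DERIV_cmult_right DERIV_cmult DERIV_ident dw bb_flat_along[OF F r(2,1,3)])
    then have "((\<lambda>x. x * deriv (\<lambda>x. w x $ i) x) has_field_derivative (1 * a $ i + (M $ i $ 1 * c $ 1 + M $ i $ 2 * c $ 2) + 0)) (at 0)"
      by (rule has_field_derivative_transform_within_open[OF _ open_ball 0]) (simp add: eq Mi)
    from DERIV_unique[OF 1 this] show ?thesis by (simp add: Mi)
  qed
  show "(mat 1 - M) *v c = a"
    using ci by (simp add: vec_eq_iff matrix_vector_mult_diff_rdistrib)
  define q where "q = quad_part F c"
  define F' where "F' = (\<lambda>x w. if x = 0 then 0 else inverse x *s F x (x *s (w + c)) - x *s q)"
  define w' where "w' = (\<lambda>x. if x = 0 then 0 else inverse x *s w x - c)"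
  have w'i: "w' x $ i = (if x = 0 then deriv (\<lambda>x. w x $ i) 0 else (w x $ i - w 0 $ i) / (x - 0)) - c $ i" for x i
    using r(3) by (simp add: w'_def c_def divide_inverse mult.commute)
  have hol': "(\<lambda>x. w' x $ i) holomorphic_on ball 0 r" for i
    unfolding w'i by (intro holomorphic_intros pole_lemma_open[OF hw open_ball])
  have w'0: "w' 0 = 0" by (simp add: w'_def)
  have ww': "w x = x *s (w' x + c)" for x
    using r(3) by (cases "x = 0") (auto simp: w'_def vec_eq_iff)
  have eq': "x * deriv (\<lambda>x. w' x $ i) x = x * q $ i + ((M - mat 1) *v w' x) $ i + F' x (w' x) $ i" if x: "x \<in> ball 0 r" for x i
  proof (cases "x = 0")
    case True
    then show ?thesis by (simp add: w'0 F'_def)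
  next
    case False
    from holomorphic_derivI[OF hol' open_ball x]
    have "((\<lambda>x. x * (w' x $ i + c $ i)) has_field_derivative 1 * (w' x $ i + c $ i) + (deriv (\<lambda>x. w' x $ i) x + 0) * x) (at x)"
      by (intro DERIV_mult DERIV_ident DERIV_add DERIV_const)
    moreover have "(\<lambda>x. x * (w' x $ i + c $ i)) = (\<lambda>x. w x $ i)"
      by (subst ww') (simp only: vector_smult_component vector_add_component)
    ultimately have "deriv (\<lambda>x. w x $ i) x = (w' x $ i + c $ i) + deriv (\<lambda>x. w' x $ i) x * x"
      by (simp add: DERIV_imp_deriv)
    then have 1: "x * (w' x $ i + c $ i) + x * (x * deriv (\<lambda>x. w' x $ i) x) = x * a $ i + (M *v w x) $ i + F x (w x) $ i"
      using eq[OF x, of i] by (simp add: algebra_simps)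
    have 2: "(M *v w x) $ i = x * (M *v w' x) $ i + x * (M *v c) $ i"
      unfolding ww'[of x] by (simp add: Mi algebra_simps)
    have 3: "F x (w x) $ i = x * F' x (w' x) $ i + x * (x * q $ i)"
      unfolding F'_def ww'[of x, symmetric] using False by (simp add: right_diff_distrib)
    have 4: "((M - mat 1) *v w' x) $ i = (M *v w' x) $ i - w' x $ i" by (simp add: matrix_vector_mult_diff_rdistrib)
    have "x * (x * deriv (\<lambda>x. w' x $ i) x) = x * (x * q $ i + ((M *v w' x) $ i - w' x $ i) + F' x (w' x) $ i)"
      using 1 unfolding 2 3 ci[of i] by (simp add: algebra_simps)
    then show ?thesis using False unfolding 4 by simp
  qed
  have "bbsol (q, M - mat 1, F') w'"
    unfolding bbsol_def using r(1) hol' w'0 eq' by (auto simp: holcurve_def)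
  then show "bbsol (redc c (a, M, F)) (\<lambda>x. if x = 0 then 0 else inverse x *s w x - c)"
    unfolding redc_def q_def F'_def w'_def by simp
qed

section \<open>Existence of solutions\<close>

text \<open>After moving the shift to the left the equation reads x w' + N w = x a + M w + F(x, w),
  and the left side is inverted with norm 1/N. The right side has Lipschitz constant at most K + 1
  in each component; adding two components costs a factor 2, so \<open>4 * (K + 2)\<close>
  guarantees the contraction factor 1/2 and also the invariance of the ball of radius
  \<open>\<delta>/2\<close>.\<close>

lemma bb_contraction:
  assumes F: "bb_good F" and K: "K \<ge> 0" "\<And>v i. norm ((M *v v) $ i) \<le> K * norm v" and N: "real N \<ge> 4 * (K + 2)"
  shows "\<exists>w. bbsol (a, M - mat (of_nat N), F) w"
proof -
  obtain \<delta> where \<delta>: "\<delta> > 0" "\<And>i. cholo \<delta> (\<lambda>x w. F x w $ i)" "\<And>i. lipw \<delta> 1 (\<lambda>x w. F x w $ i)"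
    using bb_good_D[OF F zero_less_one] by blast
  have "0 < 4 * (K + 2)" using K(1) by simp
  then have "real N > 0" using N by (rule less_le_trans)
  \<comment> \<open>The kernel \<open>s ^ j\<close> belongs to the shift \<open>j + 1\<close>, hence
    the offset by one.\<close>
  then obtain j where j: "N = j + 1" by (metis Suc_eq_plus1 gr0_implies_Suc of_nat_0_less_iff)
  let ?N = "real (j + 1)"
  have N': "?N \<ge> 4 * (K + 2)" "?N > 0" using N j by auto
  have "\<exists>r>0. r \<le> \<delta> \<and> (\<forall>x\<in>ball 0 r. norm (x * a $ i) + norm (F x 0 $ i) \<le> \<delta>/2)" for i
  proof -
    have "(\<lambda>x. F x 0 $ i) holomorphic_on ball 0 \<delta>"
      by (rule cholo_D[OF \<delta>(2) \<delta>(1) order_refl holcurve_const]) (use \<delta> in auto)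
    then have "continuous_on (ball 0 \<delta>) (\<lambda>x. norm (x * a $ i) + norm (F x 0 $ i))"
      by (intro continuous_intros holomorphic_on_imp_continuous_on)
    then have "isCont (\<lambda>x. norm (x * a $ i) + norm (F x 0 $ i)) 0"
      using continuous_on_eq_continuous_at[OF open_ball] \<delta>(1) centre_in_ball by blast
    then have "\<exists>s>0. \<forall>x. dist x 0 < s \<longrightarrow> dist (norm (x * a $ i) + norm (F x 0 $ i)) (norm (0 * a $ i) + norm (F 0 0 $ i)) < \<delta>/2"
      unfolding continuous_at_eps_delta using \<delta>(1) half_gt_zero by blast
    then obtain s where s: "s > 0" "\<And>x. norm x < s \<Longrightarrow> norm (x * a $ i) + norm (F x 0 $ i) < \<delta>/2"
      using F by (auto simp: bb_good_def dist_norm)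
    show ?thesis by (rule exI[of _ "min s \<delta>"]) (use s \<delta> in \<open>auto intro: less_imp_le\<close>)
  qed
  then obtain rr where rr: "\<And>i. rr i > 0" "\<And>i. rr i \<le> \<delta>"
    "\<And>i x. x \<in> ball 0 (rr i) \<Longrightarrow> norm (x * a $ i) + norm (F x 0 $ i) \<le> \<delta>/2" by metis
  define r where "r = min (rr 1) (rr 2)"
  have r: "r > 0" "r \<le> \<delta>" using rr by (auto simp: r_def min_le_iff_disj)
  have rb: "norm (x * a $ i) + norm (F x 0 $ i) \<le> \<delta>/2" if "x \<in> ball 0 r" for x i
  proof -
    have "i = 1 \<or> i = 2" by (rule exhaust_2)
    then have "x \<in> ball 0 (rr i)" using that by (auto simp: r_def)
    then show ?thesis by (rule rr(3))
  qed
  \<comment> \<open>\<open>g w\<close> collects everything except the shift, and \<open>T w\<close>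
    solves x u' + N u = \<open>g w\<close> componentwise.\<close>
  define g where "g = (\<lambda>w i x. x * a $ i + (M *v w x) $ i + F x (w x) $ i)"
  define T where "T = (\<lambda>w x. \<chi> i. euler_inv j (g w i) x)"
  define X where "X = {w. holcurve r w \<and> w 0 = 0 \<and> (\<forall>x\<in>ball 0 r. norm (w x) \<le> \<delta>/2)}"
  have Mi: "(M *v v) $ i = M $ i $ 1 * v $ 1 + M $ i $ 2 * v $ 2" for v i
    by (simp add: matrix_vector_mult_def sum_2)
  have Xs: "norm (w x) < \<delta>" if "w \<in> X" "x \<in> ball 0 r" for w x
    using that \<delta>(1) unfolding X_def by fastforce
  have g: "g w i holomorphic_on ball 0 r" if w: "w \<in> X" for w i
  proof -
    have "(\<lambda>x. F x (w x) $ i) holomorphic_on ball 0 r"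
      by (rule cholo_D[OF \<delta>(2) r]) (use w Xs in \<open>auto simp: X_def\<close>)
    then show ?thesis unfolding g_def Mi using w
      by (intro holomorphic_intros) (auto simp: X_def holcurve_def)
  qed
  have sx: "of_real s * x \<in> ball 0 r" if "s \<in> {0..1}" "x \<in> ball 0 r" for s :: real and x :: complex
  proof -
    have "norm (of_real s * x) \<le> norm x" using that by (simp add: norm_mult mult_left_le_one_le)
    then show ?thesis using that by simp
  qed
  have x\<delta>: "norm x < \<delta>" if "x \<in> ball 0 r" for x :: complex using that r by simp
  have gb: "norm (g w i x) \<le> (K + 2) * (\<delta>/2)" if w: "w \<in> X" and x: "x \<in> ball 0 r" for w i x
  proof -
    have wx: "norm (w x) \<le> \<delta>/2" using w x by (auto simp: X_def)
    have "norm (F x (w x) $ i - F x 0 $ i) \<le> 1 * norm (w x - 0)"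
      by (rule lipw_D[OF \<delta>(3) x\<delta>[OF x] Xs[OF w x]]) (use \<delta> in simp)
    then have "norm (F x (w x) $ i) \<le> norm (F x 0 $ i) + \<delta>/2"
      using norm_triangle_sub[of "F x (w x) $ i" "F x 0 $ i"] wx by simp
    moreover have "norm ((M *v w x) $ i) \<le> K * (\<delta>/2)"
      by (rule order_trans[OF K(2)]) (use wx K(1) in \<open>intro mult_left_mono, auto\<close>)
    moreover have "norm (g w i x) \<le> norm (x * a $ i) + norm ((M *v w x) $ i) + norm (F x (w x) $ i)"
      unfolding g_def by (intro norm_triangle_le norm_triangle_ineq add_mono order_refl)
    ultimately have "norm (g w i x) \<le> \<delta>/2 + K * (\<delta>/2) + \<delta>/2" using rb[OF x, of i] by linarith
    then show ?thesis by (simp add: algebra_simps)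
  qed
  obtain w where w: "w \<in> X" "\<And>x. x \<in> ball 0 r \<Longrightarrow> T w x = w x"
  proof (rule picard_fixed_point[where \<theta>="1/2" and B="ball 0 r" and \<rho>="\<lambda>_. 1" and R=1 and wz="\<lambda>_. 0" and X=X and T=T and Kz="\<delta>/2"])
    show w0: "(\<lambda>_. 0) \<in> X" using \<delta> by (auto simp: X_def holcurve_const)
    show TX: "T w \<in> X" if w: "w \<in> X" for w
      unfolding X_def
    proof (intro CollectI conjI ballI)
      show "holcurve r (T w)" using euler_inv(1)[OF g[OF w]] by (simp add: holcurve_def T_def)
      have "norm (euler_inv j (g w i) 0) \<le> 0 / real (j + 1)" for i
        by (rule euler_inv_bound[OF g[OF w]]) (use r w F in \<open>auto simp: g_def X_def bb_good_def\<close>)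
      then show "T w 0 = 0" by (simp add: T_def vec_eq_iff)
      fix x :: complex assume x: "x \<in> ball 0 r"
      have "norm (T w x $ i) \<le> (K + 2) * (\<delta>/2) / ?N" for i
        unfolding T_def vec_lambda_beta by (rule euler_inv_bound[OF g[OF w] x gb[OF w sx[OF _ x]]])
      then have "norm (T w x) \<le> (K + 2) * (\<delta>/2) / ?N + (K + 2) * (\<delta>/2) / ?N"
        by (intro order_trans[OF norm_vec2_le] add_mono)
      also have "\<dots> = (2 * (K + 2)) * (\<delta>/2) / ?N" by (simp only: mult_2 add_divide_distrib distrib_right)
      also have "\<dots> \<le> ?N * (\<delta>/2) / ?N" using N' \<delta> K by (intro divide_right_mono mult_right_mono) auto
      also have "\<dots> = \<delta>/2" by (rule nonzero_mult_div_cancel_left) (use N'(2) in linarith)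
      finally show "norm (T w x) \<le> \<delta>/2" .
    qed
    show "norm (T (\<lambda>_. 0) q - 0) \<le> \<delta>/2 * 1" if "q \<in> ball 0 r" for q
      using TX[OF w0] that by (simp add: X_def)
    show "norm (T u q - T v q) \<le> 1/2 * k * 1"
      if u: "u \<in> X" and v: "v \<in> X" and k: "k \<ge> 0" "\<And>q. q \<in> ball 0 r \<Longrightarrow> norm (u q - v q) \<le> k * 1" and x: "q \<in> ball 0 r" for u v k q
    proof -
      have gd: "norm (g u i x - g v i x) \<le> (K + 1) * k" if x: "x \<in> ball 0 r" for x i
      proof -
        have "norm (F x (u x) $ i - F x (v x) $ i) \<le> 1 * norm (u x - v x)"
          by (rule lipw_D[OF \<delta>(3) x\<delta>[OF x] Xs[OF u x] Xs[OF v x]])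
        moreover have "norm ((M *v (u x - v x)) $ i) \<le> K * norm (u x - v x)" by (rule K(2))
        moreover have "g u i x - g v i x = (M *v (u x - v x)) $ i + (F x (u x) $ i - F x (v x) $ i)"
          by (simp add: g_def Mi algebra_simps)
        ultimately have "norm (g u i x - g v i x) \<le> K * norm (u x - v x) + norm (u x - v x)"
          using norm_triangle_ineq[of "(M *v (u x - v x)) $ i" "F x (u x) $ i - F x (v x) $ i"] by simp
        also have "\<dots> = (K + 1) * norm (u x - v x)" by (simp add: algebra_simps)
        also have "\<dots> \<le> (K + 1) * k" using k(2)[OF x] K(1) by (intro mult_left_mono) auto
        finally show ?thesis .
      qed
      have "norm (T u q $ i - T v q $ i) \<le> (K + 1) * k / ?N" for i
      proof -
        have ci: "(\<lambda>s. of_real (s ^ j) * g w i (of_real s * q)) integrable_on {0..1}" if "w \<in> X" for w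
          using sx x by (intro integrable_continuous_interval continuous_intros
            continuous_on_compose2[OF holomorphic_on_imp_continuous_on[OF g[OF that]]]) auto
        have "T u q $ i - T v q $ i = euler_inv j (\<lambda>x. g u i x - g v i x) q"
          using integral_diff[OF ci[OF u] ci[OF v]] by (simp add: T_def euler_inv_def algebra_simps)
        also have "norm \<dots> \<le> (K + 1) * k / ?N"
          by (rule euler_inv_bound[where r=r]) (use g u v x gd sx in \<open>auto intro!: holomorphic_intros\<close>)
        finally show ?thesis .
      qed
      then have "norm (T u q - T v q) \<le> (K + 1) * k / ?N + (K + 1) * k / ?N"
        by (intro order_trans[OF norm_vec2_le] add_mono) auto
      also have "\<dots> = (2 * (K + 1)) * k / ?N" by (simp only: mult_2 add_divide_distrib distrib_right)
      also have "(2 * (K + 1)) * k = (4 * (K + 1)) * (k/2)" by simp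
      also have "(4 * (K + 1)) * (k/2) / ?N \<le> ?N * (k/2) / ?N" using N' k K by (intro divide_right_mono mult_right_mono) auto
      also have "\<dots> = k/2" by (rule nonzero_mult_div_cancel_left) (use N'(2) in linarith)
      also have "\<dots> = 1/2 * k * 1" by simp
      finally show ?thesis .
    qed
    show "w \<in> X" if s: "\<And>n. s n \<in> X" and lim: "uniform_limit (ball 0 r) s w sequentially" for s w
      unfolding X_def
    proof (intro CollectI conjI ballI)
      have pt: "(\<lambda>n. s n x) \<longlonglongrightarrow> w x" if "x \<in> ball 0 r" for x by (rule tendsto_uniform_limitI[OF lim that])
      show "w 0 = 0"
      proof (rule LIMSEQ_unique[OF pt])
        show "(\<lambda>n. s n 0) \<longlonglongrightarrow> 0" using s by (simp add: X_def)
      qed (use r in simp)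
      show "norm (w x) \<le> \<delta>/2" if "x \<in> ball 0 r" for x
        by (rule Lim_bounded[OF tendsto_norm[OF pt[OF that]], of 0]) (use s that in \<open>auto simp: X_def\<close>)
      show "holcurve r w"
        unfolding holcurve_def
      proof
        fix i
        have li: "uniform_limit (ball 0 r) (\<lambda>n x. s n x $ i) (\<lambda>x. w x $ i) sequentially"
          using bounded_linear.uniform_limit[OF bounded_linear_vec_nth lim] .
        show "(\<lambda>x. w x $ i) holomorphic_on ball 0 r"
        proof (rule holomorphic_uniform_sequence[OF open_ball, where f="\<lambda>n x. s n x $ i"])
          show "(\<lambda>x. s n x $ i) holomorphic_on ball 0 r" for n using s[of n] by (simp add: X_def holcurve_def)
          fix x :: complex assume "x \<in> ball 0 r"
          then obtain d where "d > 0" "cball x d \<subseteq> ball 0 r" using open_contains_cball_eq[OF open_ball] by blast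
          then show "\<exists>d>0. cball x d \<subseteq> ball 0 r \<and> uniform_limit (cball x d) (\<lambda>n x. s n x $ i) (\<lambda>x. w x $ i) sequentially"
            using uniform_limit_on_subset[OF li] by blast
        qed
      qed
    qed
  qed auto
  have "x * deriv (\<lambda>x. w x $ i) x = x * a $ i + ((M - mat (of_nat N)) *v w x) $ i + F x (w x) $ i" if x: "x \<in> ball 0 r" for x i
  proof -
    have e: "w y $ i = euler_inv j (g w i) y" if "y \<in> ball 0 r" for y using arg_cong[OF w(2)[OF that], of "\<lambda>v. v $ i"] by (simp add: T_def)
    have "(euler_inv j (g w i) has_field_derivative deriv (euler_inv j (g w i)) x) (at x)"
      by (rule holomorphic_derivI[OF euler_inv(1)[OF g[OF w(1)]] open_ball x])
    then have "((\<lambda>x. w x $ i) has_field_derivative deriv (euler_inv j (g w i)) x) (at x)"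
      by (rule has_field_derivative_transform_within_open[OF _ open_ball x]) (simp add: e)
    then have "deriv (\<lambda>x. w x $ i) x = deriv (euler_inv j (g w i)) x" by (rule DERIV_imp_deriv)
    then have "x * deriv (\<lambda>x. w x $ i) x + of_nat N * w x $ i = g w i x"
      using euler_inv(2)[OF g[OF w(1)] x, where j=j] e[OF x] j by simp
    moreover have "(mat (of_nat N) *v w x) $ i = of_nat N * w x $ i"
      by (simp add: matrix_vector_mult_def mat_def if_distrib[where f="\<lambda>z. z * _"] sum.delta cong: if_cong)
    ultimately show ?thesis
      by (simp add: g_def matrix_vector_mult_diff_rdistrib algebra_simps)
  qed
  then have "bbsol (a, M - mat (of_nat N), F) w"
    unfolding bbsol_def using r(1) w(1) by (auto simp: X_def)
  then show ?thesis by (rule exI[of _ w])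
qed

section \<open>Nonresonance and iterated reduction\<close>

text \<open>Each \<open>n\<close> in \<open>I\<close> stands for the Taylor order at which the
  eigenvalue n would obstruct a solution. A reduction step lowers all eigenvalues, and with them the
  relevant orders, by one.\<close>

definition nonres :: "nat set \<Rightarrow> complex^2^2 \<Rightarrow> bool" where
  "nonres I M \<longleftrightarrow> (\<forall>n\<in>I. \<forall>v. M *v v = of_nat n *s v \<longrightarrow> v = 0)"

lemma mat_Suc: "(M :: complex^2^2) - mat 1 - mat (of_nat n) = M - mat (of_nat (Suc n))"
  by (simp add: mat_def vec_eq_iff)

lemma nonres_reduce:
  assumes "nonres I M" "\<And>n. n \<in> J \<Longrightarrow> Suc n \<in> I" shows "nonres J (M - mat 1)"
  unfolding nonres_def
proof (intro ballI allI impI)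
  fix n v assume n: "n \<in> J" and "(M - mat 1) *v v = of_nat n *s v"
  then have "M *v v = of_nat (Suc n) *s v"
    by (simp add: matrix_vector_mult_diff_rdistrib vec_eq_iff algebra_simps)
  then show "v = 0" using assms(1) assms(2)[OF n] unfolding nonres_def by blast
qed

lemma nonres_solvable:
  assumes "nonres I M" "1 \<in> I" shows "\<exists>!c. (mat 1 - M) *v c = a"
proof -
  have inj: "x = 0" if "(mat 1 - M) *v x = 0" for x
  proof -
    have "M *v x = of_nat 1 *s x" using that by (simp add: matrix_vector_mult_diff_rdistrib)
    then show ?thesis using assms unfolding nonres_def by blast
  qed
  then obtain B where "B ** (mat 1 - M) = mat 1"
    using matrix_left_invertible_ker[of "mat 1 - M"] by blast
  then have "(mat 1 - M) ** B = mat 1" using matrix_left_right_inverse by blast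
  then have "(mat 1 - M) *v (B *v a) = a" by (simp add: matrix_vector_mul_assoc)
  moreover have "c = c'" if "(mat 1 - M) *v c = a" "(mat 1 - M) *v c' = a" for c c'
  proof -
    have "(mat 1 - M) *v (c - c') = 0" using that by (simp only: matrix_vector_mult_diff_distrib diff_self)
    then show ?thesis using inj by (metis right_minus_eq)
  qed
  ultimately show ?thesis by blast
qed

lemma matrix_bound:
  obtains K where "K \<ge> 0" "\<And>v i. norm (((M::complex^2^2) *v v) $ i) \<le> K * norm v"
proof (rule that)
  let ?K = "norm (M $ 1 $ 1) + norm (M $ 1 $ 2) + norm (M $ 2 $ 1) + norm (M $ 2 $ 2)"
  show "0 \<le> ?K" by simp
  fix v :: "complex^2" and i :: 2
  have vj: "norm (v $ j) \<le> norm v" for j by (rule Finite_Cartesian_Product.norm_nth_le)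
  have "norm ((M *v v) $ i) = norm (M $ i $ 1 * v $ 1 + M $ i $ 2 * v $ 2)"
    by (simp add: matrix_vector_mult_def sum_2)
  also have "\<dots> \<le> norm (M $ i $ 1) * norm (v $ 1) + norm (M $ i $ 2) * norm (v $ 2)"
    by (metis norm_mult norm_triangle_ineq)
  also have "\<dots> \<le> norm (M $ i $ 1) * norm v + norm (M $ i $ 2) * norm v"
    by (intro add_mono mult_left_mono vj) auto
  also have "\<dots> = (norm (M $ i $ 1) + norm (M $ i $ 2)) * norm v" by (simp add: algebra_simps)
  also have "\<dots> \<le> ?K * norm v"
    using exhaust_2[of i] by (intro mult_right_mono) auto
  finally show "norm ((M *v v) $ i) \<le> ?K * norm v" .
qed

text \<open>Solvability of the shifted system is assumed for all good nonlinearities and all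
  constant vectors, because each step replaces both \<open>a\<close> and \<open>F\<close>, and only
  the matrix is known in advance.\<close>

lemma bb_exists_if_reduced:
  assumes "nonres {1..N} M" "bb_good F" "\<And>a F. bb_good F \<Longrightarrow> \<exists>w. bbsol (a, M - mat (of_nat N), F) w"
  shows "\<exists>w. bbsol (a, M, F) w"
  using assms
proof (induction N arbitrary: M a F)
  case 0
  have "M - mat (of_nat 0) = M" by (simp add: mat_def vec_eq_iff)
  then show ?case using 0 by simp
next
  case (Suc N)
  obtain c where c: "(mat 1 - M) *v c = a" using nonres_solvable[OF Suc.prems(1)] by fastforce
  obtain a' F' where red: "redc c (a, M, F) = (a', M - mat 1, F')" unfolding redc_def by simp
  have F': "bb_good F'" by (rule redc_good[OF Suc.prems(2) red])
  have "\<exists>w. bbsol (a', M - mat 1, F') w"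
  proof (rule Suc.IH[OF nonres_reduce[OF Suc.prems(1)] F'])
    show "\<exists>w. bbsol (a, M - mat 1 - mat (of_nat N), F) w" if "bb_good F" for a F
      unfolding mat_Suc by (rule Suc.prems(3)[OF that])
  qed auto
  then obtain w where "bbsol (redc c (a, M, F)) w" using red by auto
  from bbsol_lift[OF c this] Suc.prems(2) show ?case by (auto simp: bb_good_def)
qed

text \<open>The same \<open>N\<close> counts the reductions and measures the resulting shift, so it
  need only be large compared with the bound of the original matrix.\<close>

lemma bb_exists:
  assumes "nonres {1..} M" "bb_good F" shows "\<exists>w. bbsol (a, M, F) w"
proof -
  obtain K where K: "K \<ge> 0" "\<And>v i. norm ((M *v v) $ i) \<le> K * norm v" using matrix_bound by blast
  obtain N where N: "real N \<ge> 4 * (K + 2)" using real_arch_simple by blast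
  show ?thesis
  proof (rule bb_exists_if_reduced[of N])
    show "nonres {1..N} M" using assms(1) by (auto simp: nonres_def)
    show "\<exists>w. bbsol (a, M - mat (of_nat N), F) w" if "bb_good F" for a F
      by (rule bb_contraction[OF that K N])
  qed fact
qed

section \<open>Uniqueness of solutions\<close>

definition cgerm_eq :: "(complex \<Rightarrow> complex^2) \<Rightarrow> (complex \<Rightarrow> complex^2) \<Rightarrow> bool" where
  "cgerm_eq w w' \<longleftrightarrow> (\<exists>r>0. \<forall>x\<in>ball 0 r. w x = w' x)"

text \<open>Under nonresonance both solutions have the same first coefficient, so both descend to
  the same reduced system and their difference is divided by x. Repeating this shows contact of
  every finite order.\<close>

lemma bb_difference_order:
  assumes "nonres {1..} M" "bb_good F" "bbsol (a, M, F) w" "bbsol (a, M, F) w'"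
  shows "\<exists>r>0. \<exists>C. \<forall>x\<in>ball 0 r. norm (w x - w' x) \<le> C * norm x ^ n"
  using assms
proof (induction n arbitrary: M a F w w')
  case 0
  have "\<exists>r>0. \<forall>x\<in>ball 0 r. norm (w x) < 1" if sol: "bbsol (a, M, F) w" for w
  proof -
    obtain r where "r > 0" "holcurve r w" "w 0 = 0" using sol unfolding bbsol_def by auto
    from holcurve_small[OF this(2,1,3), of 1] show ?thesis by (metis zero_less_one)
  qed
  from this[OF 0(3)] this[OF 0(4)] obtain r r' where r: "r > 0" "r' > 0" "\<forall>x\<in>ball 0 r. norm (w x) < 1" "\<forall>x\<in>ball 0 r'. norm (w' x) < 1"
    by blast
  have "norm (w x - w' x) \<le> 2 * norm x ^ 0" if "x \<in> ball 0 (min r r')" for x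
  proof -
    have "norm (w x) < 1" "norm (w' x) < 1" using r that by auto
    then show ?thesis using norm_triangle_ineq4[of "w x" "w' x"] by simp
  qed
  then show ?case using r(1,2) by (intro exI[of _ "min r r'"] conjI exI[of _ 2]) auto
next
  case (Suc n)
  let ?d = "\<lambda>w::complex \<Rightarrow> complex^2. \<chi> i. deriv (\<lambda>x. w x $ i) 0"
  have c: "(mat 1 - M) *v ?d w = a" "(mat 1 - M) *v ?d w' = a"
    by (rule bbsol_drop(1)[OF Suc.prems(2) Suc.prems(3)], rule bbsol_drop(1)[OF Suc.prems(2) Suc.prems(4)])
  have "\<exists>!c. (mat 1 - M) *v c = a" by (rule nonres_solvable[OF Suc.prems(1)]) simp
  then have eq: "?d w' = ?d w" using c by blast
  define c where "c = ?d w"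
  obtain a' F' where red: "redc c (a, M, F) = (a', M - mat 1, F')" unfolding redc_def by simp
  have F': "bb_good F'" by (rule redc_good[OF Suc.prems(2) red])
  let ?w = "\<lambda>w::complex \<Rightarrow> complex^2. \<lambda>x. if x = 0 then 0 else inverse x *s w x - c"
  have s: "bbsol (a', M - mat 1, F') (?w w)" "bbsol (a', M - mat 1, F') (?w w')"
    using bbsol_drop(2)[OF Suc.prems(2) Suc.prems(3)] bbsol_drop(2)[OF Suc.prems(2) Suc.prems(4)]
    unfolding eq c_def[symmetric] red by auto
  have "nonres {1..} (M - mat 1)" by (rule nonres_reduce[OF Suc.prems(1)]) auto
  from Suc.IH[OF this F' s] obtain r C where r: "r > 0" "\<And>x. x \<in> ball 0 r \<Longrightarrow> norm (?w w x - ?w w' x) \<le> C * norm x ^ n"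
    by blast
  have 0: "w 0 = 0" "w' 0 = 0" using Suc.prems(3,4) by (auto simp: bbsol_def)
  have "norm (w x - w' x) \<le> C * norm x ^ Suc n" if x: "x \<in> ball 0 r" for x
  proof (cases "x = 0")
    case True then show ?thesis using 0 by simp
  next
    case False
    have "w x - w' x = x *s (?w w x - ?w w' x)" using False by (simp add: vec_eq_iff algebra_simps)
    then have "norm (w x - w' x) = norm x * norm (?w w x - ?w w' x)" by (simp only: norm_vs)
    also have "\<dots> \<le> norm x * (C * norm x ^ n)" by (intro mult_left_mono r(2)[OF x]) auto
    finally show ?thesis by (simp add: mult_ac)
  qed
  then show ?case using r(1) by blast
qed

text \<open>A nonconstant holomorphic function has a zero of some finite order n; the bound of order
  n + 1 would make the nonvanishing cofactor vanish at 0.\<close>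

lemma holomorphic_flat_eq_0:
  fixes d :: "complex \<Rightarrow> complex"
  assumes d: "d holomorphic_on ball 0 r" "r > 0" and b: "\<And>n. \<exists>r>0. \<exists>C. \<forall>x\<in>ball 0 r. norm (d x) \<le> C * norm x ^ n"
  shows "\<forall>x\<in>ball 0 r. d x = 0"
proof -
  have d0: "d 0 = 0"
  proof -
    obtain s C where s: "s > 0" "\<And>x. x \<in> ball 0 s \<Longrightarrow> norm (d x) \<le> C * norm x ^ 1" using b[of 1] by blast
    from s(2)[of 0] s(1) show ?thesis by simp
  qed
  have "d constant_on ball 0 r"
  proof (rule ccontr)
    assume nc: "\<not> d constant_on ball 0 r"
    have z: "0 \<in> ball 0 r" using d by simp
    obtain g s n where g: "0 < n" "0 < s" "ball (0::complex) s \<subseteq> ball 0 r" "g holomorphic_on ball 0 s"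
      "\<And>w. w \<in> ball 0 s \<Longrightarrow> d w = (w - 0) ^ n * g w" "\<And>w. w \<in> ball 0 s \<Longrightarrow> g w \<noteq> 0"
      by (rule holomorphic_factor_zero_nonconstant[OF d(1) open_ball connected_ball z d0 nc], rule that)
    obtain t C where t: "t > 0" "\<And>x. x \<in> ball 0 t \<Longrightarrow> norm (d x) \<le> C * norm x ^ Suc n" using b[of "Suc n"] by blast
    have gb: "norm (g x) \<le> C * norm x" if "x \<noteq> 0" "x \<in> ball 0 (min s t)" for x
    proof -
      have "norm x ^ n * norm (g x) \<le> norm x ^ n * (C * norm x)"
        using g(5)[of x] t(2)[of x] that by (simp add: norm_mult norm_power mult_ac)
      then show ?thesis using that by simp
    qed
    have "continuous_on (ball 0 s) g" using g(4) by (rule holomorphic_on_imp_continuous_on)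
    then have "isCont g 0" using g(2) continuous_on_eq_continuous_at[OF open_ball] centre_in_ball by blast
    then have lim: "(g \<longlongrightarrow> g 0) (at 0)" by (simp add: isCont_def)
    have "(g \<longlongrightarrow> 0) (at 0)"
    proof (rule Lim_null_comparison)
      show "\<forall>\<^sub>F x in at 0. norm (g x) \<le> C * norm x"
        unfolding eventually_at using gb g(2) t(1) by (intro exI[of _ "min s t"]) auto
      show "((\<lambda>x. C * norm x) \<longlongrightarrow> 0) (at (0::complex))" by (intro tendsto_eq_intros refl) auto
    qed
    then have "g 0 = 0" using tendsto_unique[OF _ lim] by auto
    then show False using g(6)[of 0] g(2) by simp
  qed
  then show ?thesis using d0 d(2) unfolding constant_on_def by (metis centre_in_ball)
qed

lemma bb_unique:
  assumes "nonres {1..} M" "bb_good F" "bbsol (a, M, F) w" "bbsol (a, M, F) w'"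
  shows "cgerm_eq w w'"
proof -
  obtain r1 where r1: "r1 > 0" "holcurve r1 w" using assms(3) unfolding bbsol_def by auto
  obtain r2 where r2: "r2 > 0" "holcurve r2 w'" using assms(4) unfolding bbsol_def by auto
  define r where "r = min r1 r2"
  have r: "r > 0" "holcurve r w" "holcurve r w'" using r1 r2 by (auto simp: r_def intro: holcurve_mono)
  have "\<forall>x\<in>ball 0 r. w x $ i - w' x $ i = 0" for i
  proof (rule holomorphic_flat_eq_0)
    show "(\<lambda>x. w x $ i - w' x $ i) holomorphic_on ball 0 r" using r by (intro holomorphic_intros) (auto simp: holcurve_def)
    fix n
    obtain s C where s: "s > 0" "\<And>x. x \<in> ball 0 s \<Longrightarrow> norm (w x - w' x) \<le> C * norm x ^ n"
      using bb_difference_order[OF assms] by blast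
    have "norm (w x $ i - w' x $ i) \<le> norm (w x - w' x)" for x
      using Finite_Cartesian_Product.norm_nth_le[of "w x - w' x" i] by simp
    then show "\<exists>s>0. \<exists>C. \<forall>x\<in>ball 0 s. norm (w x $ i - w' x $ i) \<le> C * norm x ^ n"
      using s order_trans by blast
  qed (rule r)
  then show ?thesis unfolding cgerm_eq_def using r(1) by (auto simp: vec_eq_iff)
qed

section \<open>Resonant systems\<close>

text \<open>One induction carries two transfers in opposite directions: existence of a solution
  passes down to the reduced system, for the nonexistence claim, and sequences of distinct solution
  germs pass back up, for the existence claim. Nonresonance at the first m orders makes each
  \<open>THE\<close> in \<open>reduce\<close> meaningful.\<close>

lemma reduce_funpow:
  assumes "nonres {1..m} M" "bb_good F"
  shows "\<exists>a' F'. (reduce ^^ m) (a, M, F) = (a', M - mat (of_nat m), F') \<and> bb_good F' \<and>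
    (\<forall>w. bbsol (a, M, F) w \<longrightarrow> (\<exists>w'. bbsol (a', M - mat (of_nat m), F') w')) \<and>
    (\<forall>w'::nat \<Rightarrow> complex \<Rightarrow> complex^2. (\<forall>n. bbsol (a', M - mat (of_nat m), F') (w' n)) \<longrightarrow> (\<forall>k n. k \<noteq> n \<longrightarrow> \<not> cgerm_eq (w' k) (w' n)) \<longrightarrow>
       (\<exists>w :: nat \<Rightarrow> complex \<Rightarrow> complex^2. (\<forall>n. bbsol (a, M, F) (w n)) \<and> (\<forall>k n. k \<noteq> n \<longrightarrow> \<not> cgerm_eq (w k) (w n))))"
    using assms
  proof (induction m arbitrary: a M F)
    case 0
    have M0: "M - mat (of_nat 0) = M" by (simp add: mat_def vec_eq_iff)
    show ?case
    proof (intro exI[of _ a] exI[of _ F] conjI allI impI)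
      show "(reduce ^^ 0) (a, M, F) = (a, M - mat (of_nat 0), F)" by (simp only: M0 funpow_0)
      show "\<exists>w'. bbsol (a, M - mat (of_nat 0), F) w'" if "bbsol (a, M, F) w" for w
        unfolding M0 using that by (rule exI[of _ w])
      show "\<exists>w :: nat \<Rightarrow> complex \<Rightarrow> complex^2. (\<forall>n. bbsol (a, M, F) (w n)) \<and> (\<forall>k n. k \<noteq> n \<longrightarrow> \<not> cgerm_eq (w k) (w n))"
        if "\<forall>n. bbsol (a, M - mat (of_nat 0), F) (w' n)" "\<forall>k n. k \<noteq> n \<longrightarrow> \<not> cgerm_eq (w' k) (w' n)" for w' :: "nat \<Rightarrow> complex \<Rightarrow> complex^2"
        using that unfolding M0 by (intro exI[of _ w'] conjI)
    qed (rule 0(2))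
  next
    case (Suc m)
    define c where "c = (THE c. (mat 1 - M) *v c = a)"
    have ex1: "\<exists>!c. (mat 1 - M) *v c = a" by (rule nonres_solvable[OF Suc.prems(1)]) simp
    then have c: "(mat 1 - M) *v c = a" unfolding c_def by (rule theI')
    obtain a1 F1 where red: "redc c (a, M, F) = (a1, M - mat 1, F1)" unfolding redc_def by simp
    have F1: "bb_good F1" by (rule redc_good[OF Suc.prems(2) red])
    have nr: "nonres {1..m} (M - mat 1)" by (rule nonres_reduce[OF Suc.prems(1)]) auto
    obtain a' F' where IH: "(reduce ^^ m) (a1, M - mat 1, F1) = (a', M - mat 1 - mat (of_nat m), F')" "bb_good F'"
      "\<And>w. bbsol (a1, M - mat 1, F1) w \<Longrightarrow> (\<exists>w'. bbsol (a', M - mat 1 - mat (of_nat m), F') w')"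
      "\<And>w'::nat \<Rightarrow> complex \<Rightarrow> complex^2. (\<forall>n. bbsol (a', M - mat 1 - mat (of_nat m), F') (w' n)) \<Longrightarrow> (\<forall>k n. k \<noteq> n \<longrightarrow> \<not> cgerm_eq (w' k) (w' n)) \<Longrightarrow>
       (\<exists>w :: nat \<Rightarrow> complex \<Rightarrow> complex^2. (\<forall>n. bbsol (a1, M - mat 1, F1) (w n)) \<and> (\<forall>k n. k \<noteq> n \<longrightarrow> \<not> cgerm_eq (w k) (w n)))"
      using Suc.IH[OF nr F1, of a1] by blast
    note IH' = IH[unfolded mat_Suc]
    \<comment> \<open>The iterate is split at its first application, so that the induction
      hypothesis speaks about the system reduced once.\<close>
    have "(reduce ^^ Suc m) (a, M, F) = (a', M - mat (of_nat (Suc m)), F')"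
      using IH'(1) red unfolding funpow_Suc_right o_def reduce_redc c_def[symmetric] by simp
    moreover have "\<exists>w'. bbsol (a', M - mat (of_nat (Suc m)), F') w'" if w: "bbsol (a, M, F) w" for w
    proof -
      let ?c = "\<chi> i. deriv (\<lambda>x. w x $ i) 0"
      have "?c = c" using bbsol_drop(1)[OF Suc.prems(2) w] ex1 c by blast
      then have "bbsol (a1, M - mat 1, F1) (\<lambda>x. if x = 0 then 0 else inverse x *s w x - c)"
        using bbsol_drop(2)[OF Suc.prems(2) w] red by (simp only:)
      then show ?thesis by (rule IH'(3))
    qed
    moreover have "\<exists>w :: nat \<Rightarrow> complex \<Rightarrow> complex^2. (\<forall>n. bbsol (a, M, F) (w n)) \<and> (\<forall>k n. k \<noteq> n \<longrightarrow> \<not> cgerm_eq (w k) (w n))"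
      if w': "\<forall>n. bbsol (a', M - mat (of_nat (Suc m)), F') (w' n)" "\<forall>k n. k \<noteq> n \<longrightarrow> \<not> cgerm_eq (w' k) (w' n)"
      for w' :: "nat \<Rightarrow> complex \<Rightarrow> complex^2"
    proof -
      from IH'(4)[OF w'] obtain w :: "nat \<Rightarrow> complex \<Rightarrow> complex^2"
        where w0: "(\<forall>n. bbsol (a1, M - mat 1, F1) (w n)) \<and> (\<forall>k n. k \<noteq> n \<longrightarrow> \<not> cgerm_eq (w k) (w n))" by (rule exE)
      note w = w0[THEN conjunct1, rule_format] w0[THEN conjunct2, rule_format]
      let ?W = "\<lambda>n x. x *s (w n x + c)"
      have W1: "bbsol (a, M, F) (?W n)" for n
        by (rule bbsol_lift[OF c]) (use w(1) red Suc.prems(2) in \<open>auto simp: bb_good_def\<close>)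
      have W2: "\<not> cgerm_eq (?W k) (?W n)" if "k \<noteq> n" for k n
      proof
        assume "cgerm_eq (?W k) (?W n)"
        then obtain r where r: "r > 0" "\<And>x. x \<in> ball 0 r \<Longrightarrow> ?W k x = ?W n x" unfolding cgerm_eq_def by blast
        have "w k x = w n x" if "x \<in> ball 0 r" for x
        proof (cases "x = 0")
          case True
          then show ?thesis using w(1)[of k] w(1)[of n] by (auto simp: bbsol_def)
        next
          case False
          then show ?thesis using r(2)[OF that] by (simp only: vector_mul_lcancel add_right_cancel simp_thms)
        qed
        then have "cgerm_eq (w k) (w n)" unfolding cgerm_eq_def using r(1) by blast
        with w(2)[OF that] show False by blast
      qed
      show ?thesis by (rule exI[of _ ?W]) (intro conjI allI impI W1 W2)
    qed
    ultimately show ?case using IH'(2) by blast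
  qed

text \<open>Each admissible coefficient \<open>c n\<close> may be chosen at the critical order,
  after which a nonresonant system remains. Different coefficients give different germs, because
  \<open>c n\<close> is recovered as the limit of the lifted solution divided by x.\<close>

lemma bb_resonant_family:
  fixes c :: "nat \<Rightarrow> complex^2"
  assumes F: "bb_good F" and nr: "nonres {2..} M" and c: "\<And>n. (mat 1 - M) *v c n = a" and inj: "inj c"
  shows "\<exists>w :: nat \<Rightarrow> complex \<Rightarrow> complex^2. (\<forall>n. bbsol (a, M, F) (w n)) \<and> (\<forall>k n. k \<noteq> n \<longrightarrow> \<not> cgerm_eq (w k) (w n))"
proof -
  \<comment> \<open>Excluding the eigenvalues from 2 on becomes, after the shift, exclusion of all
    positive integers; an eigenvalue 1 of \<open>M\<close> itself is moved to 0.\<close>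
  have nr': "nonres {1..} (M - mat 1)" by (rule nonres_reduce[OF nr]) auto
  have "\<exists>w. bbsol (redc (c n) (a, M, F)) w" for n
  proof -
    obtain a' F' where red: "redc (c n) (a, M, F) = (a', M - mat 1, F')" unfolding redc_def by simp
    show ?thesis unfolding red by (rule bb_exists[OF nr' redc_good[OF F red]])
  qed
  then obtain u where u: "\<And>n. bbsol (redc (c n) (a, M, F)) (u n)" by metis
  let ?W = "\<lambda>n x. x *s (u n x + c n)"
  have W1: "bbsol (a, M, F) (?W n)" for n
    by (rule bbsol_lift[OF c u]) (use F in \<open>simp add: bb_good_def\<close>)
  have W2: "\<not> cgerm_eq (?W k) (?W n)" if "k \<noteq> n" for k n
  proof
    assume "cgerm_eq (?W k) (?W n)"
    then obtain r where r: "r > 0" "\<And>x. x \<in> ball 0 r \<Longrightarrow> ?W k x = ?W n x" unfolding cgerm_eq_def by blast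
    have cont: "isCont (u n) 0 \<and> u n 0 = 0" for n
      using u[of n] holcurve_isCont unfolding bbsol_def redc_def by auto
    have lim: "((\<lambda>x. u n x + c n) \<longlongrightarrow> c n) (at 0)" for n
      using tendsto_add[OF isContD tendsto_const, of 0 "u n" "c n"] cont[of n] by simp
    have ev: "\<forall>\<^sub>F x in at 0. u k x + c k = u n x + c n"
      unfolding eventually_at
    proof (intro exI[of _ r] conjI ballI impI r(1))
      fix x :: complex assume "x \<noteq> 0 \<and> dist x 0 < r"
      then show "u k x + c k = u n x + c n" using r(2)[of x] by (simp add: vector_mul_lcancel del: vector_add_ldistrib)
    qed
    have "((\<lambda>x. u n x + c n) \<longlongrightarrow> c k) (at 0)"
      by (rule Lim_transform_eventually[OF lim[of k] ev])
    from tendsto_unique[OF _ this lim[of n]] have "c k = c n" by simp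
    then show False using that inj by (simp add: inj_eq)
  qed
  show ?thesis by (rule exI[of _ ?W]) (intro conjI allI impI W1 W2)
qed

section \<open>The Briot--Bouquet system of a vector field\<close>

definition tame :: "(complex \<Rightarrow> complex^2 \<Rightarrow> complex) \<Rightarrow> bool" where
  "tame \<phi> \<longleftrightarrow> \<phi> 0 0 = 0 \<and> (\<exists>\<delta>>0. cholo \<delta> \<phi>) \<and> (\<exists>C. \<exists>\<delta>>0. lipw \<delta> C \<phi>)"

text \<open>Flatness concerns the dependence on \<open>w\<close> only: a term \<open>k * x\<close>
  is flat. That is why \<open>bb_good\<close> also imposes a condition on the derivative in
  x.\<close>

definition flat :: "(complex \<Rightarrow> complex^2 \<Rightarrow> complex) \<Rightarrow> bool" where
  "flat \<phi> \<longleftrightarrow> \<phi> 0 0 = 0 \<and> (\<exists>\<delta>>0. cholo \<delta> \<phi>) \<and> (\<forall>e>0. \<exists>\<delta>>0. lipw \<delta> e \<phi>)"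

lemma flat_imp_tame: "flat \<phi> \<Longrightarrow> tame \<phi>"
  unfolding flat_def tame_def using zero_less_one by blast

lemma tame_E:
  assumes "tame \<phi>"
  obtains \<delta> C where "\<delta> > 0" "C > 0" "cholo \<delta> \<phi>" "lipw \<delta> C \<phi>" "\<phi> 0 0 = 0"
proof -
  obtain d1 where d1: "d1 > 0" "cholo d1 \<phi>" using assms unfolding tame_def by blast
  obtain d2 C where d2: "d2 > 0" "lipw d2 C \<phi>" using assms unfolding tame_def by blast
  show thesis
    by (rule that[of "min d1 d2" "max C 1"])
      (use d1 d2 assms in \<open>auto intro: cholo_mono[OF d1(2)] lipw_mono[OF d2(2)] simp: tame_def\<close>)
qed

text \<open>Joint continuity at the origin, obtained from continuity of the one-variable slice
  \<open>w = 0\<close> and the Lipschitz bound in \<open>w\<close>.\<close>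

lemma tame_small:
  assumes "tame \<phi>" "e > 0"
  obtains \<delta> where "\<delta> > 0" "\<And>x w. norm x < \<delta> \<Longrightarrow> norm w < \<delta> \<Longrightarrow> norm (\<phi> x w) \<le> e"
proof -
  obtain \<delta> C where \<delta>: "\<delta> > 0" "C > 0" "cholo \<delta> \<phi>" "lipw \<delta> C \<phi>" "\<phi> 0 0 = 0" using tame_E[OF assms(1)] by blast
  have "(\<lambda>x. \<phi> x 0) holomorphic_on ball 0 \<delta>"
    by (rule cholo_D[OF \<delta>(3,1) order_refl holcurve_const]) (use \<delta> in auto)
  then have "isCont (\<lambda>x. \<phi> x 0) 0"
    using \<delta>(1) continuous_on_eq_continuous_at[OF open_ball] holomorphic_on_imp_continuous_on centre_in_ball by blast
  then have "\<exists>d>0. \<forall>x. dist x 0 < d \<longrightarrow> dist (\<phi> x 0) (\<phi> 0 0) < e/2"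
    unfolding continuous_at_eps_delta using assms(2) half_gt_zero by blast
  then obtain d where d: "d > 0" "\<And>x. norm x < d \<Longrightarrow> norm (\<phi> x 0) < e/2" using \<delta>(5) by (auto simp: dist_norm)
  define s where "s = min (min d \<delta>) (e / (2 * C))"
  have s: "s > 0" using d \<delta> assms(2) by (simp add: s_def)
  show thesis
  proof (rule that[OF s])
    fix x :: complex and w :: "complex^2" assume x: "norm x < s" "norm w < s"
    have "norm (\<phi> x w - \<phi> x 0) \<le> C * norm (w - 0)"
      by (rule lipw_D[OF \<delta>(4)]) (use x \<delta>(1) in \<open>auto simp: s_def\<close>)
    also have "\<dots> \<le> C * (e / (2 * C))" using x \<delta>(2) by (intro mult_left_mono) (auto simp: s_def)
    also have "\<dots> = e/2" using \<delta>(2) by simp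
    finally have "norm (\<phi> x w - \<phi> x 0) \<le> e/2" .
    moreover have "norm (\<phi> x 0) < e/2" using d(2)[of x] x by (simp add: s_def)
    ultimately show "norm (\<phi> x w) \<le> e" using norm_triangle_sub[of "\<phi> x w" "\<phi> x 0"] by linarith
  qed
qed

lemma cholo_cong:
  assumes "cholo \<delta> \<phi>" "\<And>x w. norm x < \<delta> \<Longrightarrow> norm w < \<delta> \<Longrightarrow> \<phi> x w = \<psi> x w"
  shows "cholo \<delta> \<psi>"
  unfolding cholo_def
proof (intro allI impI)
  fix r w assume r: "0 < r" "r \<le> \<delta>" "holcurve r w" "\<forall>x\<in>ball 0 r. norm (w x) < \<delta>"
  have "(\<lambda>x. \<phi> x (w x)) holomorphic_on ball 0 r" by (rule cholo_D[OF assms(1) r(1-3)]) (use r(4) in blast)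
  then show "(\<lambda>x. \<psi> x (w x)) holomorphic_on ball 0 r"
    by (rule holomorphic_transform) (use r assms(2) in auto)
qed

lemma flat_cong:
  assumes "flat \<phi>" "\<delta> > 0" "\<And>x w. norm x < \<delta> \<Longrightarrow> norm w < \<delta> \<Longrightarrow> \<phi> x w = \<psi> x w"
  shows "flat \<psi>"
  unfolding flat_def
proof (intro conjI allI impI)
  have "\<phi> 0 0 = \<psi> 0 0" by (rule assms(3)) (use assms(2) in auto)
  then show "\<psi> 0 0 = 0" using assms(1) by (simp add: flat_def)
  obtain d where d: "d > 0" "cholo d \<phi>" using assms(1) unfolding flat_def by blast
  have "cholo (min d \<delta>) \<psi>" by (rule cholo_cong[OF cholo_mono[OF d(2)]]) (use assms(3) in auto)
  then show "\<exists>\<delta>>0. cholo \<delta> \<psi>" using d(1) assms(2) by (intro exI[of _ "min d \<delta>"]) auto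
  fix e :: real assume "e > 0"
  then obtain d where d: "d > 0" "lipw d e \<phi>" using assms(1) unfolding flat_def by blast
  have "lipw (min d \<delta>) e \<psi>"
    unfolding lipw_def
  proof (intro allI impI)
    fix x :: complex and w w' :: "complex^2" assume x: "norm x < min d \<delta>" "norm w < min d \<delta>" "norm w' < min d \<delta>"
    have "norm (\<phi> x w - \<phi> x w') \<le> e * norm (w - w')" by (rule lipw_D[OF d(2)]) (use x in auto)
    moreover have "\<phi> x w = \<psi> x w" "\<phi> x w' = \<psi> x w'" using x by (auto intro: assms(3))
    ultimately show "norm (\<psi> x w - \<psi> x w') \<le> e * norm (w - w')" by simp
  qed
  then show "\<exists>\<delta>>0. lipw \<delta> e \<psi>" using d(1) assms(2) by (intro exI[of _ "min d \<delta>"]) auto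
qed

lemma cholo_combine:
  assumes "cholo d1 \<phi>" "cholo d2 \<psi>"
    and "\<And>r a b. a holomorphic_on ball 0 r \<Longrightarrow> b holomorphic_on ball 0 r \<Longrightarrow> (\<lambda>x. f (a x) (b x)) holomorphic_on ball (0::complex) r"
  shows "cholo (min d1 d2) (\<lambda>x w. f (\<phi> x w) (\<psi> x w))"
  unfolding cholo_def
proof (intro allI impI)
  fix r w assume r: "0 < r" "r \<le> min d1 d2" "holcurve r w" "\<forall>x\<in>ball 0 r. norm (w x) < min d1 d2"
  have "(\<lambda>x. \<phi> x (w x)) holomorphic_on ball 0 r" by (rule cholo_D[OF assms(1) r(1)]) (use r in auto)
  moreover have "(\<lambda>x. \<psi> x (w x)) holomorphic_on ball 0 r" by (rule cholo_D[OF assms(2) r(1)]) (use r in auto)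
  ultimately show "(\<lambda>x. f (\<phi> x (w x)) (\<psi> x (w x))) holomorphic_on ball 0 r" by (rule assms(3))
qed

lemma lipw_add: "lipw d1 C \<phi> \<Longrightarrow> lipw d2 D \<psi> \<Longrightarrow> lipw (min d1 d2) (C + D) (\<lambda>x w. \<phi> x w + \<psi> x w)"
proof -
  assume a: "lipw d1 C \<phi>" "lipw d2 D \<psi>"
  show ?thesis
    unfolding lipw_def
  proof (intro allI impI)
    fix x :: complex and w w' :: "complex^2" assume x: "norm x < min d1 d2" "norm w < min d1 d2" "norm w' < min d1 d2"
    have "\<phi> x w + \<psi> x w - (\<phi> x w' + \<psi> x w') = (\<phi> x w - \<phi> x w') + (\<psi> x w - \<psi> x w')" by simp
    also have "norm \<dots> \<le> C * norm (w - w') + D * norm (w - w')"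
      by (intro norm_triangle_le add_mono lipw_D[OF a(1)] lipw_D[OF a(2)]) (use x in auto)
    finally show "norm (\<phi> x w + \<psi> x w - (\<phi> x w' + \<psi> x w')) \<le> (C + D) * norm (w - w')" by (simp add: algebra_simps)
  qed
qed

lemma tame_add:
  assumes "tame \<phi>" "tame \<psi>" shows "tame (\<lambda>x w. \<phi> x w + \<psi> x w)"
proof -
  obtain d1 C where 1: "d1 > 0" "C > 0" "cholo d1 \<phi>" "lipw d1 C \<phi>" "\<phi> 0 0 = 0" using tame_E[OF assms(1)] by blast
  obtain d2 D where 2: "d2 > 0" "D > 0" "cholo d2 \<psi>" "lipw d2 D \<psi>" "\<psi> 0 0 = 0" using tame_E[OF assms(2)] by blast
  have "cholo (min d1 d2) (\<lambda>x w. \<phi> x w + \<psi> x w)" by (rule cholo_combine[OF 1(3) 2(3)]) (intro holomorphic_intros)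
  then show ?thesis unfolding tame_def
    using 1 2 lipw_add[OF 1(4) 2(4)] by (intro conjI exI[of _ "min d1 d2"] exI[of _ "C + D"]) auto
qed

lemma flat_add:
  assumes "flat \<phi>" "flat \<psi>" shows "flat (\<lambda>x w. \<phi> x w + \<psi> x w)"
  unfolding flat_def
proof (intro conjI allI impI)
  show "\<phi> 0 0 + \<psi> 0 0 = 0" using assms by (simp add: flat_def)
  obtain d1 d2 where d: "d1 > 0" "cholo d1 \<phi>" "d2 > 0" "cholo d2 \<psi>" using assms unfolding flat_def by blast
  have "cholo (min d1 d2) (\<lambda>x w. \<phi> x w + \<psi> x w)" by (rule cholo_combine[OF d(2,4)]) (intro holomorphic_intros)
  then show "\<exists>\<delta>>0. cholo \<delta> (\<lambda>x w. \<phi> x w + \<psi> x w)" using d by (intro exI[of _ "min d1 d2"]) auto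
  fix e :: real assume "e > 0"
  then obtain d1 d2 where d: "d1 > 0" "lipw d1 (e/2) \<phi>" "d2 > 0" "lipw d2 (e/2) \<psi>" using assms unfolding flat_def by (meson half_gt_zero)
  then show "\<exists>\<delta>>0. lipw \<delta> e (\<lambda>x w. \<phi> x w + \<psi> x w)"
    using lipw_add[OF d(2,4)] by (intro exI[of _ "min d1 d2"]) auto
qed

lemma tame_cmult:
  assumes "tame \<phi>" shows "tame (\<lambda>x w. k * \<phi> x w)"
proof -
  obtain d1 C where 1: "d1 > 0" "C > 0" "cholo d1 \<phi>" "lipw d1 C \<phi>" "\<phi> 0 0 = 0" using tame_E[OF assms(1)] by blast
  have "cholo (min d1 d1) (\<lambda>x w. k * \<phi> x w)" by (rule cholo_combine[OF 1(3) 1(3)]) (intro holomorphic_intros)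
  moreover have "lipw d1 (norm k * C) (\<lambda>x w. k * \<phi> x w)"
    unfolding lipw_def
  proof (intro allI impI)
    fix x :: complex and w w' :: "complex^2" assume x: "norm x < d1" "norm w < d1" "norm w' < d1"
    have "norm (k * \<phi> x w - k * \<phi> x w') = norm k * norm (\<phi> x w - \<phi> x w')" by (simp flip: norm_mult right_diff_distrib)
    also have "\<dots> \<le> norm k * (C * norm (w - w'))" by (intro mult_left_mono lipw_D[OF 1(4)]) (use x in auto)
    finally show "norm (k * \<phi> x w - k * \<phi> x w') \<le> norm k * C * norm (w - w')" by (simp add: mult.assoc)
  qed
  ultimately show ?thesis unfolding tame_def using 1 by auto
qed

text \<open>By the product rule for differences, the Lipschitz constant of each factor is multiplied
  by the size of the other factor, which tends to 0 at the origin.\<close>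

lemma flat_mult:
  assumes "tame \<phi>" "tame \<psi>" shows "flat (\<lambda>x w. \<phi> x w * \<psi> x w)"
proof -
  obtain d1 C where 1: "d1 > 0" "C > 0" "cholo d1 \<phi>" "lipw d1 C \<phi>" "\<phi> 0 0 = 0" using tame_E[OF assms(1)] by blast
  obtain d2 D where 2: "d2 > 0" "D > 0" "cholo d2 \<psi>" "lipw d2 D \<psi>" "\<psi> 0 0 = 0" using tame_E[OF assms(2)] by blast
  show ?thesis unfolding flat_def
  proof (intro conjI allI impI)
    have "cholo (min d1 d2) (\<lambda>x w. \<phi> x w * \<psi> x w)" by (rule cholo_combine[OF 1(3) 2(3)]) (intro holomorphic_intros)
    then show "\<exists>\<delta>>0. cholo \<delta> (\<lambda>x w. \<phi> x w * \<psi> x w)" using 1 2 by (intro exI[of _ "min d1 d2"]) auto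
    fix e :: real assume e: "e > 0"
    obtain e1 where e1: "e1 > 0" "\<And>x w. norm x < e1 \<Longrightarrow> norm w < e1 \<Longrightarrow> norm (\<phi> x w) \<le> e / (2 * D)"
      using tame_small[OF assms(1), of "e / (2 * D)"] e 2(2) by auto
    obtain e2 where e2: "e2 > 0" "\<And>x w. norm x < e2 \<Longrightarrow> norm w < e2 \<Longrightarrow> norm (\<psi> x w) \<le> e / (2 * C)"
      using tame_small[OF assms(2), of "e / (2 * C)"] e 1(2) by auto
    define d where "d = min (min d1 d2) (min e1 e2)"
    have "lipw d e (\<lambda>x w. \<phi> x w * \<psi> x w)"
      unfolding lipw_def
    proof (intro allI impI)
      fix x :: complex and w w' :: "complex^2" assume x: "norm x < d" "norm w < d" "norm w' < d"
      have "\<phi> x w * \<psi> x w - \<phi> x w' * \<psi> x w' = \<phi> x w * (\<psi> x w - \<psi> x w') + (\<phi> x w - \<phi> x w') * \<psi> x w'" by (simp add: algebra_simps)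
      also have "norm \<dots> \<le> norm (\<phi> x w) * norm (\<psi> x w - \<psi> x w') + norm (\<phi> x w - \<phi> x w') * norm (\<psi> x w')"
        by (metis norm_mult norm_triangle_ineq)
      also have "\<dots> \<le> e / (2 * D) * (D * norm (w - w')) + (C * norm (w - w')) * (e / (2 * C))"
        using e 1(2) 2(2) by (intro add_mono mult_mono e1(2) e2(2) lipw_D[OF 1(4)] lipw_D[OF 2(4)]) (use x in \<open>auto simp: d_def\<close>)
      also have "\<dots> = e * norm (w - w')" using 1(2) 2(2) by simp
      finally show "norm (\<phi> x w * \<psi> x w - \<phi> x w' * \<psi> x w') \<le> e * norm (w - w')" .
    qed
    then show "\<exists>\<delta>>0. lipw \<delta> e (\<lambda>x w. \<phi> x w * \<psi> x w)" using 1 2 e1 e2 by (intro exI[of _ d]) (auto simp: d_def)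
  qed (use 1 in simp)
qed

lemma flat_cmult:
  assumes "flat \<phi>" shows "flat (\<lambda>x w. k * \<phi> x w)"
  unfolding flat_def
proof (intro conjI allI impI)
  show "k * \<phi> 0 0 = 0" using assms by (simp add: flat_def)
  obtain d where d: "d > 0" "cholo d \<phi>" using assms unfolding flat_def by blast
  have "cholo (min d d) (\<lambda>x w. k * \<phi> x w)" by (rule cholo_combine[OF d(2) d(2)]) (intro holomorphic_intros)
  then show "\<exists>\<delta>>0. cholo \<delta> (\<lambda>x w. k * \<phi> x w)" using d by auto
  fix e :: real assume e: "e > 0"
  have k: "norm k + 1 > 0" by (simp add: add_nonneg_pos)
  then have "e / (norm k + 1) > 0" using e by simp
  then obtain d where d: "d > 0" "lipw d (e / (norm k + 1)) \<phi>" using assms unfolding flat_def by blast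
  have "lipw d e (\<lambda>x w. k * \<phi> x w)"
    unfolding lipw_def
  proof (intro allI impI)
    fix x :: complex and w w' :: "complex^2" assume x: "norm x < d" "norm w < d" "norm w' < d"
    have "norm (k * \<phi> x w - k * \<phi> x w') = norm k * norm (\<phi> x w - \<phi> x w')" by (simp flip: norm_mult right_diff_distrib)
    also have "\<dots> \<le> (norm k + 1) * (e / (norm k + 1) * norm (w - w'))"
      by (intro mult_mono lipw_D[OF d(2)]) (use x in auto)
    also have "\<dots> = e * norm (w - w')" using k by simp
    finally show "norm (k * \<phi> x w - k * \<phi> x w') \<le> e * norm (w - w')" .
  qed
  then show "\<exists>\<delta>>0. lipw \<delta> e (\<lambda>x w. k * \<phi> x w)" using d(1) by blast
qed

text \<open>Near the origin the denominator stays between half and twice the norm of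
  \<open>l\<close>. The difference of two quotients therefore costs one difference of numerators,
  which is flat, and one difference of denominators, multiplied by a small numerator.\<close>

lemma flat_divide:
  assumes \<phi>: "flat \<phi>" and \<psi>: "tame \<psi>" and l: "l \<noteq> 0" shows "flat (\<lambda>x w. \<phi> x w / (l + \<psi> x w))"
proof -
  define L where "L = norm l"
  have L: "L > 0" using l by (simp add: L_def)
  obtain d2 D where 2: "d2 > 0" "D > 0" "cholo d2 \<psi>" "lipw d2 D \<psi>" "\<psi> 0 0 = 0" using tame_E[OF \<psi>] by blast
  obtain d3 where d3: "d3 > 0" "\<And>x w. norm x < d3 \<Longrightarrow> norm w < d3 \<Longrightarrow> norm (\<psi> x w) \<le> L/2"
    using tame_small[OF \<psi>, of "L/2"] L by auto
  have lo: "norm (l + \<psi> x w) \<ge> L/2" if "norm x < d3" "norm w < d3" for x w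
    using d3(2)[OF that] norm_diff_ineq[of l "\<psi> x w"] by (simp add: L_def)
  have hi: "norm (l + \<psi> x w) \<le> 2 * L" if "norm x < d3" "norm w < d3" for x w
    using d3(2)[OF that] norm_triangle_ineq[of l "\<psi> x w"] L L_def by linarith
  show ?thesis unfolding flat_def
  proof (intro conjI allI impI)
    show "\<phi> 0 0 / (l + \<psi> 0 0) = 0" using \<phi> by (simp add: flat_def)
    obtain d1 where d1: "d1 > 0" "cholo d1 \<phi>" using \<phi> unfolding flat_def by blast
    define d where "d = min d1 (min d2 d3)"
    have "cholo d (\<lambda>x w. \<phi> x w / (l + \<psi> x w))"
      unfolding cholo_def
    proof (intro allI impI)
      fix r w assume r: "0 < r" "r \<le> d" "holcurve r w" "\<forall>x\<in>ball 0 r. norm (w x) < d"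
      have "(\<lambda>x. \<phi> x (w x)) holomorphic_on ball 0 r" by (rule cholo_D[OF d1(2) r(1)]) (use r in \<open>auto simp: d_def\<close>)
      moreover have "(\<lambda>x. \<psi> x (w x)) holomorphic_on ball 0 r" by (rule cholo_D[OF 2(3) r(1)]) (use r in \<open>auto simp: d_def\<close>)
      moreover have "l + \<psi> x (w x) \<noteq> 0" if "x \<in> ball 0 r" for x
      proof -
        have "norm (l + \<psi> x (w x)) \<ge> L/2" by (rule lo) (use r that in \<open>auto simp: d_def\<close>)
        then show ?thesis using L by auto
      qed
      ultimately show "(\<lambda>x. \<phi> x (w x) / (l + \<psi> x (w x))) holomorphic_on ball 0 r" by (intro holomorphic_intros) auto
    qed
    then show "\<exists>\<delta>>0. cholo \<delta> (\<lambda>x w. \<phi> x w / (l + \<psi> x w))" using d1 2 d3 by (intro exI[of _ d]) (auto simp: d_def)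
    fix e :: real assume e: "e > 0"
    \<comment> \<open>The numerator of the difference is then at most
      \<open>e1 * 2L + e2 * D\<close>, with each term equal to \<open>e * L^2 / 8\<close>; dividing
      by the lower bound \<open>(L/2)^2\<close> of the denominators gives exactly
      \<open>e\<close>.\<close>
    define e1 where "e1 = e * L / 16"
    define e2 where "e2 = e * L^2 / (8 * D)"
    have e12: "e1 > 0" "e2 > 0" using e L 2(2) by (auto simp: e1_def e2_def)
    obtain d4 where d4: "d4 > 0" "lipw d4 e1 \<phi>" using \<phi> e12(1) unfolding flat_def by blast
    obtain d5 where d5: "d5 > 0" "\<And>x w. norm x < d5 \<Longrightarrow> norm w < d5 \<Longrightarrow> norm (\<phi> x w) \<le> e2"
      using tame_small[OF flat_imp_tame[OF \<phi>] e12(2)] by blast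
    define s where "s = min (min d2 d3) (min d4 d5)"
    have "lipw s e (\<lambda>x w. \<phi> x w / (l + \<psi> x w))"
      unfolding lipw_def
    proof (intro allI impI)
      fix x :: complex and w w' :: "complex^2" assume x: "norm x < s" "norm w < s" "norm w' < s"
      have lo1: "norm (l + \<psi> x w) \<ge> L/2" "norm (l + \<psi> x w') \<ge> L/2" and hi1: "norm (l + \<psi> x w') \<le> 2 * L"
        using x by (intro lo hi; simp add: s_def)+
      then have nz: "l + \<psi> x w \<noteq> 0" "l + \<psi> x w' \<noteq> 0" using L by auto
      have "\<phi> x w / (l + \<psi> x w) - \<phi> x w' / (l + \<psi> x w') =
         ((\<phi> x w - \<phi> x w') * (l + \<psi> x w') + \<phi> x w' * (\<psi> x w' - \<psi> x w)) / ((l + \<psi> x w) * (l + \<psi> x w'))"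
        using nz by (simp add: divide_simps) (simp add: algebra_simps)
      then have "norm (\<phi> x w / (l + \<psi> x w) - \<phi> x w' / (l + \<psi> x w')) =
         norm ((\<phi> x w - \<phi> x w') * (l + \<psi> x w') + \<phi> x w' * (\<psi> x w' - \<psi> x w)) / (norm (l + \<psi> x w) * norm (l + \<psi> x w'))"
        by (simp only: norm_divide norm_mult)
      also have "\<dots> \<le> (e * L^2 / 4 * norm (w - w')) / (L/2 * (L/2))"
      proof (rule frac_le)
        show "L/2 * (L/2) \<le> norm (l + \<psi> x w) * norm (l + \<psi> x w')" using lo1 L by (intro mult_mono) auto
        have "norm ((\<phi> x w - \<phi> x w') * (l + \<psi> x w') + \<phi> x w' * (\<psi> x w' - \<psi> x w)) \<le>
           norm (\<phi> x w - \<phi> x w') * norm (l + \<psi> x w') + norm (\<phi> x w') * norm (\<psi> x w' - \<psi> x w)"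
          by (metis norm_mult norm_triangle_ineq)
        also have "\<dots> \<le> (e1 * norm (w - w')) * (2 * L) + e2 * (D * norm (w' - w))"
          using e12 by (intro add_mono mult_mono lipw_D[OF d4(2)] lipw_D[OF 2(4)] d5(2) hi1) (use x in \<open>auto simp: s_def\<close>)
        also have "\<dots> = e * L^2 / 4 * norm (w - w')" using 2(2)
          by (simp add: e1_def e2_def norm_minus_commute[of w' w] power2_eq_square field_simps)
        finally show "norm ((\<phi> x w - \<phi> x w') * (l + \<psi> x w') + \<phi> x w' * (\<psi> x w' - \<psi> x w)) \<le> e * L^2 / 4 * norm (w - w')" .
      qed (use L e in auto)
      also have "\<dots> = e * norm (w - w')" using L by (simp add: power2_eq_square)
      finally show "norm (\<phi> x w / (l + \<psi> x w) - \<phi> x w' / (l + \<psi> x w')) \<le> e * norm (w - w')" .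
    qed
    then show "\<exists>\<delta>>0. lipw \<delta> e (\<lambda>x w. \<phi> x w / (l + \<psi> x w))" using 2 d3 d4 d5 by (intro exI[of _ s]) (auto simp: s_def)
  qed
qed

lemma tame_comp: "tame (\<lambda>x w. w $ i)"
proof -
  have "cholo 1 (\<lambda>x w. w $ i)" by (simp add: cholo_def holcurve_def)
  moreover have "lipw 1 1 (\<lambda>x w. w $ i)"
    unfolding lipw_def
  proof (intro allI impI)
    fix w w' :: "complex^2"
    show "norm (w $ i - w' $ i) \<le> 1 * norm (w - w')"
      using Finite_Cartesian_Product.norm_nth_le[of "w - w'" i] by simp
  qed
  ultimately show ?thesis unfolding tame_def
    by (intro conjI exI[of _ "1::real"]) simp_all
qed

lemma flat_x: "flat (\<lambda>x w. k * x)"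
proof -
  have "cholo 1 (\<lambda>x w. k * x)" by (auto simp: cholo_def intro!: holomorphic_intros)
  moreover have "lipw 1 e (\<lambda>x w. k * x)" if "e > 0" for e using that by (simp add: lipw_def)
  ultimately show ?thesis unfolding flat_def by (meson mult_zero_right zero_less_one)
qed

section \<open>Blowing up the vector field\<close>

text \<open>The chart of the blow-up of the origin around the direction of the x-axis:
  \<open>w\<close> is the pair of slopes and x = 0 is the exceptional divisor.\<close>

definition blow :: "complex \<Rightarrow> complex^2 \<Rightarrow> C3" where
  "blow x w = (x, x * w $ 1, x * w $ 2)"

lemma norm3_le: "norm (a, b, c) \<le> norm a + norm b + norm c"
  using norm_Pair_le[of a "(b, c)"] norm_Pair_le[of b c] by linarith

lemma norm_blow: "norm (blow x w) \<le> norm x * (1 + 2 * norm w)"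
proof -
  have "norm (w $ 1) \<le> norm w" "norm (w $ 2) \<le> norm w" by (rule Finite_Cartesian_Product.norm_nth_le)+
  then have "norm x * norm (w $ 1) \<le> norm x * norm w" "norm x * norm (w $ 2) \<le> norm x * norm w" by (auto intro: mult_left_mono)
  then show ?thesis unfolding blow_def
    using norm3_le[of x "x * w $ 1" "x * w $ 2"] by (simp add: norm_mult algebra_simps)
qed

lemma norm_blow_diff: "norm (blow x w - blow x w') \<le> 2 * (norm x * norm (w - w'))"
proof -
  have "norm (w $ i - w' $ i) \<le> norm (w - w')" for i using Finite_Cartesian_Product.norm_nth_le[of "w - w'" i] by simp
  then have "norm x * norm (w $ i - w' $ i) \<le> norm x * norm (w - w')" for i by (intro mult_left_mono) auto
  from this[of 1] this[of 2]
  have "norm (0::complex, x * (w $ 1 - w' $ 1), x * (w $ 2 - w' $ 2)) \<le> 2 * (norm x * norm (w - w'))"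
    using norm3_le[of "0::complex" "x * (w $ 1 - w' $ 1)" "x * (w $ 2 - w' $ 2)"] unfolding norm_mult norm_zero by linarith
  moreover have "blow x w - blow x w' = (0, x * (w $ 1 - w' $ 1), x * (w $ 2 - w' $ 2))"
    by (simp add: blow_def right_diff_distrib)
  ultimately show ?thesis by simp
qed

text \<open>The value 0 at x = 0 is the correct limit for the functions in use, which vanish at the
  origin together with their derivative.\<close>

definition blowdiv :: "(C3 \<Rightarrow> complex) \<Rightarrow> complex \<Rightarrow> complex^2 \<Rightarrow> complex" where
  "blowdiv f x w = (if x = 0 then 0 else f (blow x w) / x)"

text \<open>On a ball of radius d the function has Lipschitz constant \<open>C * d\<close>. Blowing
  up multiplies w-differences by at most \<open>2 * norm x\<close> and the division by x removes
  \<open>norm x\<close>, so the constant becomes \<open>2 * C * d\<close>, arbitrarily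
  small.\<close>

lemma blowdiv_flat:
  assumes f: "holo3 W f" and 0: "0 \<in> W" "f 0 = 0" "(f has_derivative (\<lambda>_. 0)) (at 0)"
  shows "flat (blowdiv f)"
proof -
  obtain r C where r: "r > 0" "C \<ge> 0" "ball 0 r \<subseteq> W"
    "\<And>d p q. d \<le> r \<Longrightarrow> p \<in> ball 0 d \<Longrightarrow> q \<in> ball 0 d \<Longrightarrow> norm (f p - f q) \<le> C * d * norm (p - q)"
    using holo3_flat_bounds[OF f 0] by metis
  \<comment> \<open>For \<open>norm w < 1\<close> the blown-up point has norm at most
    \<open>3 * norm x\<close>, which is the origin of the radius d/3.\<close>
  have bl: "blow x w \<in> ball 0 d" if "d \<le> r" "norm x < min 1 (d/3)" "norm w < min 1 (d/3)" for x w d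
  proof -
    have "norm x * (1 + 2 * norm w) \<le> norm x * 3" using that by (intro mult_left_mono) auto
    also have "\<dots> < d" using that by simp
    finally have "norm x * (1 + 2 * norm w) < d" .
    then show ?thesis using norm_blow[of x w] by simp
  qed
  show ?thesis unfolding flat_def
  proof (intro conjI allI impI)
    show "blowdiv f 0 0 = 0" by (simp add: blowdiv_def)
    have "cholo (min 1 (r/3)) (blowdiv f)"
      unfolding cholo_def
    proof (intro allI impI)
      fix s w assume s: "0 < s" "s \<le> min 1 (r/3)" "holcurve s w" "\<forall>x\<in>ball 0 s. norm (w x) < min 1 (r/3)"
      have hw: "(\<lambda>x. w x $ i) holomorphic_on ball 0 s" for i using s by (simp add: holcurve_def)
      have inW: "(x, x * w x $ 1, x * w x $ 2) \<in> W" if "x \<in> ball 0 s" for x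
        using bl[OF order_refl, of x "w x"] that s r(3) by (auto simp: blow_def)
      have k: "(\<lambda>x. f (x, x * w x $ 1, x * w x $ 2)) holomorphic_on ball 0 s"
        by (rule holo3_curve_holomorphic[OF f open_ball]) (use inW hw in \<open>auto intro!: holomorphic_intros\<close>)
      have "((\<lambda>x. f (x, x * w x $ 1, x * w x $ 2)) has_field_derivative D3 f (0, 0 * w 0 $ 1, 0 * w 0 $ 2)
          (1, 1 * w 0 $ 1 + deriv (\<lambda>x. w x $ 1) 0 * 0, 1 * w 0 $ 2 + deriv (\<lambda>x. w x $ 2) 0 * 0)) (at 0)"
        by (rule holo3_curve[OF f _ DERIV_ident DERIV_mult[OF DERIV_ident holomorphic_derivI[OF hw]] DERIV_mult[OF DERIV_ident holomorphic_derivI[OF hw]]])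
          (use inW[of 0] s(1) in auto)
      then have d0: "((\<lambda>x. f (x, x * w x $ 1, x * w x $ 2)) has_field_derivative 0) (at 0)"
        using D3_eq[OF 0(3)] by (simp add: zero_prod_def)
      have "(\<lambda>x. if x = 0 then 0 else f (x, x * w x $ 1, x * w x $ 2) / x) holomorphic_on ball 0 s"
        by (rule holomorphic_div_x[OF k d0]) (use 0(2) in \<open>simp add: zero_prod_def\<close>)
      then show "(\<lambda>x. blowdiv f x (w x)) holomorphic_on ball 0 s" unfolding blowdiv_def blow_def .
    qed
    then show "\<exists>\<delta>>0. cholo \<delta> (blowdiv f)" using r(1) by (intro exI[of _ "min 1 (r/3)"]) auto
    fix e :: real assume e: "e > 0"
    define d where "d = min r (e / (2 * (C + 1)))"
    have d: "d > 0" "d \<le> r" "2 * C * d \<le> e"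
    proof -
      show "d > 0" "d \<le> r" using r e by (auto simp: d_def)
      have "2 * C * d \<le> 2 * (C + 1) * d" using \<open>d > 0\<close> by simp
      also have "\<dots> \<le> 2 * (C + 1) * (e / (2 * (C + 1)))" using r(2) by (intro mult_left_mono) (auto simp: d_def)
      also have "\<dots> = e" using r(2) by simp
      finally show "2 * C * d \<le> e" .
    qed
    have "lipw (min 1 (d/3)) e (blowdiv f)"
      unfolding lipw_def
    proof (intro allI impI)
      fix x :: complex and w w' :: "complex^2" assume x: "norm x < min 1 (d/3)" "norm w < min 1 (d/3)" "norm w' < min 1 (d/3)"
      show "norm (blowdiv f x w - blowdiv f x w') \<le> e * norm (w - w')"
      proof (cases "x = 0")
        case False
        have "norm (f (blow x w) - f (blow x w')) \<le> C * d * norm (blow x w - blow x w')"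
          by (rule r(4)[OF d(2)]) (use bl[OF d(2)] x in auto)
        also have "\<dots> \<le> C * d * (2 * (norm x * norm (w - w')))" using r(2) d(1) by (intro mult_left_mono norm_blow_diff) auto
        also have "\<dots> = (2 * C * d) * norm (w - w') * norm x" by simp
        also have "\<dots> \<le> e * norm (w - w') * norm x" by (intro mult_right_mono d(3)) auto
        finally have "norm (f (blow x w) - f (blow x w')) / norm x \<le> e * norm (w - w')" using False by (simp add: divide_le_eq)
        then show ?thesis using False by (simp add: blowdiv_def norm_divide flip: diff_divide_distrib)
      qed (use e in \<open>simp add: blowdiv_def\<close>)
    qed
    then show "\<exists>\<delta>>0. lipw \<delta> e (blowdiv f)" using d(1) by (intro exI[of _ "min 1 (d/3)"]) auto
  qed
qed

lemma bb_goodI: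
  assumes "\<And>i. flat (\<lambda>x w. F x w $ i)" "\<And>i. deriv (\<lambda>x. F x 0 $ i) 0 = 0"
  shows "bb_good F"
  unfolding bb_good_def
proof (intro conjI allI impI)
  have ex2: "\<exists>d>0. \<forall>i::2. Q d i" if ex: "\<And>i. \<exists>d>0. Q d i" and mono: "\<And>d d' i. Q d i \<Longrightarrow> d' \<le> d \<Longrightarrow> Q d' i" for Q :: "real \<Rightarrow> 2 \<Rightarrow> bool"
  proof -
    obtain d1 d2 where d: "d1 > 0" "Q d1 1" "d2 > 0" "Q d2 2" using ex by meson
    have "Q (min d1 d2) i" for i
      using exhaust_2[of i] mono[OF d(2), of "min d1 d2"] mono[OF d(4), of "min d1 d2"] by auto
    then show ?thesis using d(1,3) by (intro exI[of _ "min d1 d2"]) auto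
  qed
  show "\<exists>\<delta>>0. \<forall>i. cholo \<delta> (\<lambda>x w. F x w $ i)"
    by (rule ex2) (use assms(1) in \<open>auto simp: flat_def intro: cholo_mono\<close>)
  show "\<exists>\<delta>>0. \<forall>i. lipw \<delta> e (\<lambda>x w. F x w $ i)" if "e > 0" for e
    by (rule ex2) (use assms(1) that in \<open>auto simp: flat_def intro: lipw_mono\<close>)
  show "F 0 0 = 0" using assms(1) by (simp add: flat_def vec_eq_iff)
qed (rule assms(2))

lemma flat_slice:
  assumes "flat \<phi>" obtains r where "r > 0" "(\<lambda>x. \<phi> x 0) holomorphic_on ball 0 r"
proof -
  obtain d where d: "d > 0" "cholo d \<phi>" using assms unfolding flat_def by blast
  show thesis by (rule that[OF d(1) cholo_D[OF d(2) d(1) order_refl holcurve_const]]) (use d in auto)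
qed

text \<open>The parameters cover both directions. The x-direction has \<kappa> = 1, b12 = 0, b11 =
  l. The z-direction, with coordinates reordered to (z, x, y), has \<kappa> = 0, b12 = 1, b11 = b22.
  In both, the first coordinate has eigenvalue \<open>l\<close> and the remaining two form an upper
  triangular block.\<close>

locale bb_field =
  fixes l \<kappa> b11 b12 b22 :: complex and f g h :: "C3 \<Rightarrow> complex" and W :: "C3 set"
  assumes l: "l \<noteq> 0" and W: "0 \<in> W" and hf: "holo3 W f" and hg: "holo3 W g" and hh: "holo3 W h"
    and f0: "f 0 = 0" and g0: "g 0 = 0" and h0: "h 0 = 0"
    and Df: "(f has_derivative (\<lambda>_. 0)) (at 0)" and Dg: "(g has_derivative (\<lambda>_. 0)) (at 0)"
    and Dh: "(h has_derivative (\<lambda>_. 0)) (at 0)"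
begin

definition P :: "C3 \<Rightarrow> complex" where "P p = l * fst p + \<kappa> * fst (snd p) + f p"
definition Q :: "C3 \<Rightarrow> complex" where "Q p = b11 * fst (snd p) + b12 * snd (snd p) + g p"
definition R :: "C3 \<Rightarrow> complex" where "R p = b22 * snd (snd p) + h p"

abbreviation "Phi \<equiv> bbx_rhs P Q R"

text \<open>Substituting \<open>blow x w\<close> and dividing by x turns \<open>P\<close> into
  \<open>l + den\<close>, and \<open>Q\<close> and \<open>R\<close> into \<open>lin + hot\<close>
  for the indices 1 and 2; the factor x cancels in the quotients.\<close>

definition den :: "complex \<Rightarrow> complex^2 \<Rightarrow> complex" where "den x w = \<kappa> * w $ 1 + blowdiv f x w"
definition lin :: "2 \<Rightarrow> complex \<Rightarrow> complex^2 \<Rightarrow> complex" where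
  "lin i x w = (if i = 1 then b11 * w $ 1 + b12 * w $ 2 else b22 * w $ 2)"
definition hot :: "2 \<Rightarrow> complex \<Rightarrow> complex^2 \<Rightarrow> complex" where
  "hot i x w = (if i = 1 then blowdiv g x w else blowdiv h x w)"
definition Mx :: "complex^2^2" where "Mx = vector [vector [b11 / l - 1, b12 / l], vector [0, b22 / l - 1]]"
text \<open>This is (lin + hot)/(l + den) - lin/l over a common denominator: what remains of the
  quotient once its part linear in \<open>w\<close> is removed. The product \<open>lin * den\<close>
  of two tame functions is flat.\<close>

definition rest :: "2 \<Rightarrow> complex \<Rightarrow> complex^2 \<Rightarrow> complex" where
  "rest i x w = (hot i x w + (- inverse l) * (lin i x w * den x w)) / (l + den x w)"

lemma tame_den: "tame den"
  unfolding den_def[abs_def]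
  by (intro tame_add tame_cmult tame_comp flat_imp_tame blowdiv_flat[OF hf W f0 Df])

lemma tame_lin: "tame (lin i)"
proof (cases "i = 1")
  case True
  then have "lin i = (\<lambda>x w. b11 * w $ 1 + b12 * w $ 2)" by (simp add: lin_def fun_eq_iff)
  then show ?thesis by (simp only:) (intro tame_add tame_cmult tame_comp)
next
  case False
  then have "lin i = (\<lambda>x w. b22 * w $ 2)" by (simp add: lin_def fun_eq_iff)
  then show ?thesis by (simp only:) (intro tame_cmult tame_comp)
qed

lemma flat_hot: "flat (hot i)"
proof (cases "i = 1")
  case True
  then have "hot i = blowdiv g" by (simp add: hot_def fun_eq_iff)
  then show ?thesis using blowdiv_flat[OF hg W g0 Dg] by simp
next
  case False
  then have "hot i = blowdiv h" by (simp add: hot_def fun_eq_iff)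
  then show ?thesis using blowdiv_flat[OF hh W h0 Dh] by simp
qed

lemma flat_rest: "flat (rest i)"
  unfolding rest_def[abs_def]
  by (intro flat_divide flat_add flat_hot flat_cmult flat_mult tame_lin tame_den l)

lemma Mx_nth: "Mx $ 1 $ 1 = b11 / l - 1" "Mx $ 1 $ 2 = b12 / l" "Mx $ 2 $ 1 = 0" "Mx $ 2 $ 2 = b22 / l - 1"
  by (simp_all add: Mx_def)

lemma Mx_vec: "(Mx *v w) $ i = lin i x w / l - w $ i"
  using exhaust_2[of i] by (auto simp: matrix_vector_mult_def sum_2 Mx_nth lin_def field_simps l)

text \<open>Near the origin the limit in the definition of the right-hand side agrees with the quotient of the
  blown-up components, which is regular at \<open>x = 0\<close>.\<close>

lemma Phi_formula:
  obtains \<delta> where "\<delta> > 0" "\<And>x w. norm x < \<delta> \<Longrightarrow> norm w < \<delta> \<Longrightarrow> l + den x w \<noteq> 0"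
    "\<And>x w i. norm x < \<delta> \<Longrightarrow> norm w < \<delta> \<Longrightarrow> Phi x w $ i = (lin i x w + hot i x w) / (l + den x w) - w $ i"
    "\<And>x w. x \<noteq> 0 \<Longrightarrow> norm x < \<delta> \<Longrightarrow> norm w < \<delta> \<Longrightarrow> P (blow x w) \<noteq> 0 \<and> Phi x w $ 1 = Q (blow x w) / P (blow x w) - w $ 1
         \<and> Phi x w $ 2 = R (blow x w) / P (blow x w) - w $ 2"
proof -
  obtain d1 where d1: "d1 > 0" "\<And>x w. norm x < d1 \<Longrightarrow> norm w < d1 \<Longrightarrow> norm (den x w) \<le> norm l / 2"
    using tame_small[OF tame_den, of "norm l / 2"] l by auto
  have nz: "l + den x w \<noteq> 0" if "norm x < d1" "norm w < d1" for x w
  proof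
    assume "l + den x w = 0"
    then have "norm l = norm (den x w)" by (metis add_eq_0_iff norm_minus_cancel)
    then show False using d1(2)[OF that] l by simp
  qed
  obtain df where df: "df > 0" "cholo df (blowdiv f)" using blowdiv_flat[OF hf W f0 Df] unfolding flat_def by blast
  obtain dg where dg: "dg > 0" "cholo dg (blowdiv g)" using blowdiv_flat[OF hg W g0 Dg] unfolding flat_def by blast
  obtain dh where dh: "dh > 0" "cholo dh (blowdiv h)" using blowdiv_flat[OF hh W h0 Dh] unfolding flat_def by blast
  define \<delta> where "\<delta> = min d1 (min df (min dg dh))"
  have PQR: "P (blow x w) = x * (l + den x w)" "Q (blow x w) = x * (lin 1 x w + hot 1 x w)"
    "R (blow x w) = x * (lin 2 x w + hot 2 x w)" if "x \<noteq> 0" for x w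
    using that by (auto simp: P_def Q_def R_def blow_def den_def lin_def hot_def blowdiv_def algebra_simps)
  have raw: "bbx_raw P Q R x w $ i = (lin i x w + hot i x w) / (l + den x w) - w $ i" if "x \<noteq> 0" for x w i
  proof -
    have "bbx_raw P Q R x w $ 1 = Q (blow x w) / P (blow x w) - w $ 1" "bbx_raw P Q R x w $ 2 = R (blow x w) / P (blow x w) - w $ 2"
      by (simp_all add: bbx_raw_def Let_def blow_def)
    then show ?thesis using exhaust_2[of i] that by (auto simp: PQR[OF that])
  qed
  have form: "Phi x w $ i = (lin i x w + hot i x w) / (l + den x w) - w $ i" if "norm x < \<delta>" "norm w < \<delta>" for x w i
  proof (cases "x = 0")
    case False
    then show ?thesis using raw[OF False] by (simp add: bbx_rhs_def)
  next
    case True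
    have t: "((\<lambda>x. blowdiv k x w) \<longlongrightarrow> blowdiv k 0 w) (at 0)" if "cholo d (blowdiv k)" "d > 0" "\<delta> \<le> d" for k d
    proof -
      have "norm w < d" using that \<open>norm w < \<delta>\<close> by simp
      then have "(\<lambda>x. blowdiv k x w) holomorphic_on ball 0 d"
        by (intro cholo_D[OF that(1,2) order_refl holcurve_const])
      then have "isCont (\<lambda>x. blowdiv k x w) 0"
        using that(2) continuous_on_eq_continuous_at[OF open_ball] holomorphic_on_imp_continuous_on centre_in_ball by blast
      then show ?thesis by (simp add: isCont_def)
    qed
    have tf: "((\<lambda>x. blowdiv f x w) \<longlongrightarrow> blowdiv f 0 w) (at 0)" by (rule t[OF df(2,1)]) (simp add: \<delta>_def)
    have tg: "((\<lambda>x. blowdiv g x w) \<longlongrightarrow> blowdiv g 0 w) (at 0)" by (rule t[OF dg(2,1)]) (simp add: \<delta>_def)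
    have th: "((\<lambda>x. blowdiv h x w) \<longlongrightarrow> blowdiv h 0 w) (at 0)" by (rule t[OF dh(2,1)]) (simp add: \<delta>_def)
    have nz0: "l + den 0 w \<noteq> 0" using nz[of 0 w] that d1(1) by (simp add: \<delta>_def)
    have lim: "((\<lambda>s. (lin j s w + hot j s w) / (l + den s w) - w $ j) \<longlongrightarrow> (lin j 0 w + hot j 0 w) / (l + den 0 w) - w $ j) (at 0)" for j
    proof -
      have "((\<lambda>s. hot j s w) \<longlongrightarrow> hot j 0 w) (at 0)" using tg th by (simp add: hot_def)
      moreover have "((\<lambda>s. den s w) \<longlongrightarrow> den 0 w) (at 0)" unfolding den_def by (intro tendsto_intros tf)
      moreover have "((\<lambda>s. lin j s w) \<longlongrightarrow> lin j 0 w) (at 0)" by (simp add: lin_def)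
      ultimately show ?thesis using nz0 by (intro tendsto_diff tendsto_divide tendsto_add tendsto_const)
    qed
    have "((\<lambda>s. bbx_raw P Q R s w) \<longlongrightarrow> (\<chi> j. (lin j 0 w + hot j 0 w) / (l + den 0 w) - w $ j)) (at 0)"
    proof (rule vec_tendstoI)
      fix j
      have "\<forall>\<^sub>F s in at 0. (lin j s w + hot j s w) / (l + den s w) - w $ j = bbx_raw P Q R s w $ j"
        unfolding eventually_at using raw by (intro exI[of _ 1]) auto
      from Lim_transform_eventually[OF lim this]
      show "((\<lambda>s. bbx_raw P Q R s w $ j) \<longlongrightarrow> (\<chi> j. (lin j 0 w + hot j 0 w) / (l + den 0 w) - w $ j) $ j) (at 0)" by simp
    qed
    then have "Lim (at 0) (\<lambda>s. bbx_raw P Q R s w) = (\<chi> j. (lin j 0 w + hot j 0 w) / (l + den 0 w) - w $ j)"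
      by (intro tendsto_Lim) auto
    then show ?thesis using True by (simp add: bbx_rhs_def)
  qed
  show thesis
  proof (rule that[of \<delta>])
    show "\<delta> > 0" using d1 df dg dh by (simp add: \<delta>_def)
    show nz': "l + den x w \<noteq> 0" if "norm x < \<delta>" "norm w < \<delta>" for x w using nz that by (simp add: \<delta>_def)
    show "P (blow x w) \<noteq> 0 \<and> Phi x w $ 1 = Q (blow x w) / P (blow x w) - w $ 1 \<and> Phi x w $ 2 = R (blow x w) / P (blow x w) - w $ 2"
      if "x \<noteq> 0" "norm x < \<delta>" "norm w < \<delta>" for x w
      using form[OF that(2,3)] nz'[OF that(2,3)] that(1) by (simp add: PQR[OF that(1)])
  qed (rule form)
qed

lemma Phi_M: "(\<chi> i j. deriv (\<lambda>s. Phi 0 (s *s axis j 1) $ i) 0) = Mx"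
proof -
  obtain \<delta> where \<delta>: "\<delta> > 0" "\<And>x w. norm x < \<delta> \<Longrightarrow> norm w < \<delta> \<Longrightarrow> l + den x w \<noteq> 0"
    "\<And>x w i. norm x < \<delta> \<Longrightarrow> norm w < \<delta> \<Longrightarrow> Phi x w $ i = (lin i x w + hot i x w) / (l + den x w) - w $ i"
    using Phi_formula by metis
  have "deriv (\<lambda>s. Phi 0 (s *s axis j 1) $ i) 0 = Mx $ i $ j" for i j
  proof -
    let ?e = "axis j 1 :: complex^2"
    \<comment> \<open>On x = 0 all \<open>blowdiv\<close> terms vanish, which leaves a rational
      function of s whose derivative at 0 can be read off.\<close>
    have ev: "Phi 0 (s *s ?e) $ i = s * lin i 0 ?e / (l + s * (\<kappa> * ?e $ 1)) - s * ?e $ i" if "s \<in> ball 0 \<delta>" for s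
    proof -
      have "norm (s *s ?e) < \<delta>" using that norm_vec2_le[of "s *s ?e"] exhaust_2[of j] by (auto simp: axis_def)
      then have "Phi 0 (s *s ?e) $ i = (lin i 0 (s *s ?e) + hot i 0 (s *s ?e)) / (l + den 0 (s *s ?e)) - (s *s ?e) $ i"
        by (intro \<delta>(3)) (use \<delta>(1) in auto)
      also have "lin i 0 (s *s ?e) = s * lin i 0 ?e" by (simp add: lin_def algebra_simps)
      also have "hot i 0 (s *s ?e) = 0" by (simp add: hot_def blowdiv_def)
      also have "den 0 (s *s ?e) = s * (\<kappa> * ?e $ 1)" by (simp add: den_def blowdiv_def)
      finally show ?thesis by simp
    qed
    have "((\<lambda>s. s * lin i 0 ?e / (l + s * (\<kappa> * ?e $ 1)) - s * ?e $ i) has_field_derivative (lin i 0 ?e / l - ?e $ i)) (at 0)"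
      by (auto intro!: derivative_eq_intros simp: l)
    then have "((\<lambda>s. Phi 0 (s *s ?e) $ i) has_field_derivative (lin i 0 ?e / l - ?e $ i)) (at 0)"
      by (rule has_field_derivative_transform_within_open[OF _ open_ball[of 0 \<delta>]]) (use \<delta>(1) in \<open>auto simp: ev\<close>)
    then have "deriv (\<lambda>s. Phi 0 (s *s ?e) $ i) 0 = lin i 0 ?e / l - ?e $ i" by (rule DERIV_imp_deriv)
    also have "\<dots> = (Mx *v ?e) $ i" by (rule Mx_vec[symmetric])
    also have "\<dots> = Mx $ i $ j"
      using exhaust_2[of j] by (auto simp: matrix_vector_mult_def sum_2 axis_def)
    finally show ?thesis .
  qed
  then show ?thesis by (simp add: vec_eq_iff)
qed

text \<open>Up to the linear part, \<open>Phi\<close> is the flat function \<open>rest\<close>,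
  which may still contain a term linear in x. Subtracting \<open>x *s a\<close>, with
  \<open>a\<close> the slope of \<open>Phi x 0\<close>, removes precisely that term.\<close>

lemma bb_of_Phi:
  obtains a F where "bb_of Phi = (a, Mx, F)" "bb_good F" "\<And>x w. x *s a + Mx *v w + F x w = Phi x w"
proof -
  define a where "a = (\<chi> i. deriv (\<lambda>x. Phi x 0 $ i) 0)"
  define F where "F = (\<lambda>x w. Phi x w - x *s a - Mx *v w)"
  have bb: "bb_of Phi = (a, Mx, F)" unfolding bb_of_def Let_def Phi_M a_def F_def by simp
  obtain \<delta> where \<delta>: "\<delta> > 0" "\<And>x w. norm x < \<delta> \<Longrightarrow> norm w < \<delta> \<Longrightarrow> l + den x w \<noteq> 0"
    "\<And>x w i. norm x < \<delta> \<Longrightarrow> norm w < \<delta> \<Longrightarrow> Phi x w $ i = (lin i x w + hot i x w) / (l + den x w) - w $ i"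
    using Phi_formula by metis
  have rest: "Phi x w $ i - (Mx *v w) $ i = rest i x w" if "norm x < \<delta>" "norm w < \<delta>" for x w i
  proof -
    have "Phi x w $ i - (Mx *v w) $ i = (lin i x w + hot i x w) / (l + den x w) - lin i x w / l"
      using \<delta>(3)[OF that] Mx_vec[of w i x] by simp
    also have "\<dots> = rest i x w" using \<delta>(2)[OF that] l by (simp add: rest_def divide_simps) (simp add: algebra_simps)
    finally show ?thesis .
  qed
  have "flat (\<lambda>x w. F x w $ i)" for i
  proof (rule flat_cong[OF flat_add[OF flat_rest[of i] flat_x[of "- (a $ i)"]] \<delta>(1)])
    show "rest i x w + - (a $ i) * x = F x w $ i" if "norm x < \<delta>" "norm w < \<delta>" for x w
      using rest[OF that, of i] by (simp add: F_def algebra_simps)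
  qed
  moreover have "deriv (\<lambda>x. F x 0 $ i) 0 = 0" for i
  proof -
    obtain r where r: "r > 0" "(\<lambda>x. rest i x 0) holomorphic_on ball 0 r" using flat_slice[OF flat_rest] by blast
    have "((\<lambda>x. rest i x 0) has_field_derivative deriv (\<lambda>x. rest i x 0) 0) (at 0)"
      using holomorphic_derivI[OF r(2) open_ball] r(1) by simp
    then have "((\<lambda>x. Phi x 0 $ i) has_field_derivative deriv (\<lambda>x. rest i x 0) 0) (at 0)"
      by (rule has_field_derivative_transform_within_open[OF _ open_ball[of 0 \<delta>]]) (use \<delta>(1) rest[of _ 0 i] in auto)
    then have d: "((\<lambda>x. Phi x 0 $ i) has_field_derivative a $ i) (at 0)" by (simp add: a_def DERIV_imp_deriv)
    have "((\<lambda>x. Phi x 0 $ i - x * a $ i) has_field_derivative (a $ i - 1 * a $ i)) (at 0)"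
      by (intro DERIV_diff d DERIV_cmult_right DERIV_ident)
    then show ?thesis by (simp add: F_def DERIV_imp_deriv)
  qed
  ultimately have "bb_good F" by (rule bb_goodI)
  then show thesis by (rule that[OF bb]) (simp add: F_def)
qed

end

section \<open>Invariant curves\<close>

lemma exp_rotation_periodic:
  fixes \<omega> t :: real assumes "\<omega> \<noteq> 0"
  shows "exp (\<i> * of_real \<omega> * of_real (t + 2 * pi / \<bar>\<omega>\<bar>)) = exp (\<i> * of_real \<omega> * of_real t)"
proof -
  have "\<i> * of_real \<omega> * of_real (t + 2 * pi / \<bar>\<omega>\<bar>) = \<i> * of_real \<omega> * of_real t + of_int (if \<omega> > 0 then 1 else -1) * (of_real (2 * pi) * \<i>)"
    using assms by (auto simp: algebra_simps)
  then show ?thesis using exp_integer_2pi[of "of_int (if \<omega> > 0 then 1 else -1)"]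
    by (simp add: exp_add exp_eq_1)
qed

text \<open>Supplies the minimality of the period, the last clause of
  \<open>iso_family\<close>.\<close>

lemma exp_rotation_neq_1:
  fixes \<omega> s :: real assumes w: "\<omega> \<noteq> 0" and s: "0 < s" "s < 2 * pi / \<bar>\<omega>\<bar>"
  shows "exp (\<i> * of_real \<omega> * of_real s) \<noteq> 1"
proof
  assume "exp (\<i> * of_real \<omega> * of_real s) = 1"
  then obtain n :: int where "\<omega> * s = of_int (2 * n) * pi" by (auto simp: exp_eq_1)
  then have "\<bar>\<omega> * s\<bar> = \<bar>of_int (2 * n) * pi\<bar>" by (rule arg_cong)
  then have n: "\<bar>\<omega>\<bar> * s = \<bar>of_int n\<bar> * (2 * pi)" using s by (simp add: abs_mult)
  have "\<bar>\<omega>\<bar> * s < 2 * pi" using s w by (simp add: field_simps)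
  moreover have "0 < \<bar>\<omega>\<bar> * s" using s w by simp
  ultimately have "\<bar>of_int n\<bar> < (1::real)" "0 < \<bar>of_int n :: real\<bar>" using n by (auto simp: zero_less_mult_iff)
  then have "real_of_int \<bar>n\<bar> < real_of_int 1" "n \<noteq> 0" by auto
  then show False by simp
qed

lemma curve_cmI:
  assumes "0 \<in> S" and G: "open U" "0 \<in> U" "holo3 U G1" "holo3 U G2" "S \<inter> U = {p \<in> U. G1 p = 0 \<and> G2 p = 0}"
    "\<forall>p\<in>U. surj (\<lambda>v. (D3 G1 p v, D3 G2 p v))" "{v. D3 G1 0 v = 0 \<and> D3 G2 0 v = 0} = E"
    "\<forall>p \<in> S \<inter> U. D3 G1 p (V p) = 0 \<and> D3 G2 p (V p) = 0"
  shows "curve_cm V E S"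
  unfolding curve_cm_def
  by (rule conjI[OF assms(1)], rule exI[of _ U], rule exI[of _ G1], rule exI[of _ G2],
      rule conjI[OF G(1) conjI[OF G(2) conjI[OF G(3) conjI[OF G(4) conjI[OF G(5) conjI[OF G(6) conjI[OF G(7,8)]]]]]]])

lemma graph_curve_cm:
  assumes hol: "\<alpha> holomorphic_on ball 0 r" "\<beta> holomorphic_on ball 0 r" and r: "r > 0"
    and z: "\<alpha> 0 = 0" "\<beta> 0 = 0" "deriv \<alpha> 0 = 0" "deriv \<beta> 0 = 0"
    and tan: "\<And>x. x \<in> ball 0 r \<Longrightarrow> V (x, \<alpha> x, \<beta> x) = cmul3 (fst (V (x, \<alpha> x, \<beta> x))) (1, deriv \<alpha> x, deriv \<beta> x)"
  shows "curve_cm V xaxis {(x, \<alpha> x, \<beta> x) | x. x \<in> ball 0 r}"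
proof -
  define U :: "C3 set" where "U = fst -` ball 0 r"
  have U: "open U" unfolding U_def by (intro open_vimage continuous_intros) auto
  define G1 where "G1 = (\<lambda>p::C3. fst (snd p) - \<alpha> (fst p))"
  define G2 where "G2 = (\<lambda>p::C3. snd (snd p) - \<beta> (fst p))"
  have G: "holo3 U G1" "holo3 U G2" unfolding G1_def G2_def
    by (rule holo3_diff[OF holo3_fst_snd[OF U] holo3_compose_holomorphic[OF holo3_fst[OF U] hol(1) open_ball]], force simp: U_def)
      (rule holo3_diff[OF holo3_snd_snd[OF U] holo3_compose_holomorphic[OF holo3_fst[OF U] hol(2) open_ball]], force simp: U_def)
  have D: "D3 (\<lambda>p::C3. fst (snd p) - \<gamma> (fst p)) p = (\<lambda>v. fst (snd v) - fst v * deriv \<gamma> (fst p))"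
    "D3 (\<lambda>p::C3. snd (snd p) - \<gamma> (fst p)) p = (\<lambda>v. snd (snd v) - fst v * deriv \<gamma> (fst p))"
    if p: "p \<in> U" and "\<gamma> holomorphic_on ball 0 r" for p \<gamma>
  proof -
    have "(\<gamma> has_field_derivative deriv \<gamma> (fst p)) (at (fst p))"
      using holomorphic_derivI[OF that(2) open_ball] p by (simp add: U_def)
    then have "(\<gamma> has_derivative (\<lambda>u. u * deriv \<gamma> (fst p))) (at (fst p))"
      unfolding has_field_derivative_def by (simp add: mult.commute[of _ "deriv \<gamma> (fst p)"])
    from has_derivative_compose[OF has_derivative_fst[OF has_derivative_ident] this]
    have g: "((\<lambda>p::C3. \<gamma> (fst p)) has_derivative (\<lambda>v. fst v * deriv \<gamma> (fst p))) (at p)" .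
    show "D3 (\<lambda>p::C3. fst (snd p) - \<gamma> (fst p)) p = (\<lambda>v. fst (snd v) - fst v * deriv \<gamma> (fst p))"
      by (intro D3_eq has_derivative_diff has_derivative_fst has_derivative_snd has_derivative_ident g)
    show "D3 (\<lambda>p::C3. snd (snd p) - \<gamma> (fst p)) p = (\<lambda>v. snd (snd v) - fst v * deriv \<gamma> (fst p))"
      by (intro D3_eq has_derivative_diff has_derivative_snd has_derivative_ident g)
  qed
  have DG: "D3 G1 p v = fst (snd v) - fst v * deriv \<alpha> (fst p)" "D3 G2 p v = snd (snd v) - fst v * deriv \<beta> (fst p)"
    if "p \<in> U" for p v
    unfolding G1_def G2_def by (simp_all add: D[OF that hol(1)] D[OF that hol(2)])
  let ?S = "{(x, \<alpha> x, \<beta> x) | x. x \<in> ball 0 r}"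
  have 0: "0 \<in> U" using r by (simp add: U_def)
  have S0: "0 \<in> ?S" using r z by (force simp: zero_prod_def)
  have SU: "?S \<inter> U = {p \<in> U. G1 p = 0 \<and> G2 p = 0}"
    by (force simp: U_def G1_def G2_def)
  have sj: "surj (\<lambda>v. (D3 G1 p v, D3 G2 p v))" if "p \<in> U" for p
    by (rule surjI[where f="\<lambda>q. (0, fst q, snd q)"]) (simp add: DG[OF that])
  have ker: "{v. D3 G1 0 v = 0 \<and> D3 G2 0 v = 0} = xaxis"
    unfolding DG[OF 0] using z by (auto simp: xaxis_def)
  have inv: "D3 G1 p (V p) = 0 \<and> D3 G2 p (V p) = 0" if pS: "p \<in> ?S \<inter> U" for p
  proof -
    obtain x where x: "x \<in> ball 0 r" "p = (x, \<alpha> x, \<beta> x)" and p: "p \<in> U" using pS by blast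
    have "V p = cmul3 (fst (V p)) (1, deriv \<alpha> x, deriv \<beta> x)" using tan[OF x(1)] x(2) by simp
    then have "fst (snd (V p)) = fst (V p) * deriv \<alpha> x" "snd (snd (V p)) = fst (V p) * deriv \<beta> x"
      by (metis cmul3_simps(1) fst_conv snd_conv)+
    then show ?thesis unfolding DG[OF p] using x(2) by auto
  qed
  show ?thesis by (rule curve_cmI[OF S0 U 0 G SU _ ker]) (use sj inv in blast)+
qed

text \<open>The coordinate \<open>\<xi>\<close> straightens the one-dimensional field \<open>p\<close>: its derivative along \<open>p\<close> is \<open>l \<xi>\<close>.\<close>

lemma linearizing_coordinate:
  assumes p: "p holomorphic_on ball 0 r" "r > 0" "p 0 = 0" and l: "deriv p 0 = l" "l \<noteq> 0"
  obtains s \<rho> \<xi> g where "0 < s" "s \<le> r" "\<xi> holomorphic_on ball 0 s" "\<xi> 0 = 0" "0 < \<rho>" "ball 0 \<rho> \<subseteq> \<xi> ` ball 0 s"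
    "g holomorphic_on ball 0 \<rho>" "\<And>x. x \<in> ball 0 s \<Longrightarrow> g (\<xi> x) = x" "\<And>\<zeta>. \<zeta> \<in> ball 0 \<rho> \<Longrightarrow> g \<zeta> \<in> ball 0 s \<and> \<xi> (g \<zeta>) = \<zeta>"
    "\<And>\<zeta>. \<zeta> \<in> ball 0 \<rho> \<Longrightarrow> deriv g \<zeta> * (l * \<zeta>) = p (g \<zeta>)"
proof -
  \<comment> \<open>Factors the field as \<open>p x = x * m x\<close> with \<open>m 0 = l\<close>;
    near 0 the factor \<open>m\<close> has no zero.\<close>
  define m where "m = (\<lambda>x. if x = 0 then l else p x / x)"
  have m: "m holomorphic_on ball 0 r"
    using pole_lemma_open[OF p(1) open_ball, of 0] p(3) l(1) unfolding m_def by (simp cong: if_cong)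
  have px: "p x = x * m x" for x using p(3) by (simp add: m_def)
  have "isCont m 0" using m p(2) continuous_on_eq_continuous_at[OF open_ball] holomorphic_on_imp_continuous_on centre_in_ball by blast
  moreover have "m 0 \<noteq> 0" using l by (simp add: m_def)
  ultimately obtain e where e: "e > 0" "\<forall>y. dist 0 y < e \<longrightarrow> m y \<noteq> 0" using continuous_at_avoid by blast
  define t where "t = min e r"
  have t: "t > 0" "t \<le> r" "\<And>x. x \<in> ball 0 t \<Longrightarrow> m x \<noteq> 0" using e p(2) by (auto simp: t_def)
  have mt: "m holomorphic_on ball 0 t" by (rule holomorphic_on_subset[OF m]) (use t in auto)
  \<comment> \<open>For \<xi> = x exp(H) the condition \<xi>' p = l \<xi> becomes 1 + x H' = l/m.
    Hence H must be a primitive of (l/m - 1)/x, which is holomorphic because l/m - 1 vanishes at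
    0.\<close>
  define k where "k = (\<lambda>x. l / m x - 1)"
  have k: "k holomorphic_on ball 0 t" unfolding k_def by (intro holomorphic_intros mt t(3))
  have k0: "k 0 = 0" using l by (simp add: k_def m_def)
  define k' where "k' = (\<lambda>x. if x = 0 then deriv k 0 else k x / x)"
  have k': "k' holomorphic_on ball 0 t"
    using pole_lemma_open[OF k open_ball, of 0] k0 unfolding k'_def by (simp cong: if_cong)
  have kx: "k x = x * k' x" for x using k0 by (simp add: k'_def)
  obtain H where H: "\<And>x. x \<in> ball 0 t \<Longrightarrow> (H has_field_derivative k' x) (at x within ball 0 t)"
    using holomorphic_convex_primitive'[OF convex_ball open_ball k'] by blast
  have H': "(H has_field_derivative k' x) (at x)" if "x \<in> ball 0 t" for x
    using H[OF that] at_within_open[OF that open_ball] by simp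
  define \<xi> where "\<xi> = (\<lambda>x. x * exp (H x))"
  have dxi: "(\<xi> has_field_derivative exp (H x) * (l / m x)) (at x)" if x: "x \<in> ball 0 t" for x
  proof -
    have "(\<xi> has_field_derivative 1 * exp (H x) + (exp (H x) * k' x) * x) (at x)"
      unfolding \<xi>_def by (intro DERIV_mult DERIV_ident DERIV_chain2[OF DERIV_exp] H'[OF x])
    moreover have "1 * exp (H x) + (exp (H x) * k' x) * x = exp (H x) * (1 + k x)" by (simp add: kx algebra_simps)
    ultimately show ?thesis by (simp add: k_def)
  qed
  have hxi: "\<xi> holomorphic_on ball 0 t"
    using dxi by (intro holomorphic_onI) (meson field_differentiable_at_within field_differentiable_def)
  have t0: "0 \<in> ball 0 t" using t by simp
  have "deriv \<xi> 0 \<noteq> 0" using DERIV_imp_deriv[OF dxi[OF t0]] l t(3)[OF t0] by simp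
  then obtain s where s: "s > 0" "ball (0::complex) s \<subseteq> ball 0 t" "open (\<xi> ` ball 0 s)" "inj_on \<xi> (ball 0 s)"
    using has_complex_derivative_locally_invertible[OF hxi t0 open_ball] by metis
  have hxs: "\<xi> holomorphic_on ball 0 s" by (rule holomorphic_on_subset[OF hxi s(2)])
  obtain g where g: "g holomorphic_on (\<xi> ` ball 0 s)" "\<And>z. z \<in> ball 0 s \<Longrightarrow> deriv \<xi> z * deriv g (\<xi> z) = 1" "\<And>z. z \<in> ball 0 s \<Longrightarrow> g (\<xi> z) = z"
    using holomorphic_has_inverse[OF hxs open_ball s(4)] by metis
  have xi0: "\<xi> 0 = 0" by (simp add: \<xi>_def)
  have "0 \<in> \<xi> ` ball 0 s" using s(1) xi0 by (metis centre_in_ball image_eqI)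
  then obtain \<rho> where \<rho>: "\<rho> > 0" "ball 0 \<rho> \<subseteq> \<xi> ` ball 0 s" using s(3) open_contains_ball by blast
  have sr: "s \<le> r"
  proof -
    have "s \<le> t" using s(1,2) by (simp add: ball_subset_ball_iff)
    then show ?thesis using t(2) by simp
  qed
  show thesis
  proof (rule that[OF s(1) sr hxs xi0 \<rho> _ g(3)])
    show "g holomorphic_on ball 0 \<rho>" by (rule holomorphic_on_subset[OF g(1) \<rho>(2)])
    show gz: "g \<zeta> \<in> ball 0 s \<and> \<xi> (g \<zeta>) = \<zeta>" if "\<zeta> \<in> ball 0 \<rho>" for \<zeta>
      using \<rho>(2) that g(3) by force
    show "deriv g \<zeta> * (l * \<zeta>) = p (g \<zeta>)" if "\<zeta> \<in> ball 0 \<rho>" for \<zeta>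
    proof -
      define x where "x = g \<zeta>"
      have x: "x \<in> ball 0 s" "\<xi> x = \<zeta>" using gz[OF that] by (auto simp: x_def)
      have xt: "x \<in> ball 0 t" using x(1) s(2) by blast
      have d: "exp (H x) * (l / m x) * deriv g \<zeta> = 1" using g(2)[OF x(1)] DERIV_imp_deriv[OF dxi[OF xt]] x(2) by simp
      have "deriv g \<zeta> * (l * \<zeta>) = x * m x * (exp (H x) * (l / m x) * deriv g \<zeta>)"
        using t(3)[OF xt] x(2) by (simp add: \<xi>_def mult_ac flip: x(2))
      also have "\<dots> = x * m x" unfolding d by simp
      finally show ?thesis unfolding px[of "g \<zeta>"] x_def .
    qed
  qed
qed

text \<open>On the graph the motion is governed by the scalar field \<open>p\<close>. In the
  coordinate \<xi> it is a rotation, which preserves the disc of radius \<rho>, so orbits exist for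
  all real time; since \<xi> is injective on the disc of radius \<open>s\<close>, the orbit returns
  exactly when the rotation does.\<close>

lemma graph_iso_family:
  assumes hol: "\<alpha> holomorphic_on ball 0 r" "\<beta> holomorphic_on ball 0 r" and r: "r > 0"
    and z: "\<alpha> 0 = 0" "\<beta> 0 = 0" and W: "\<And>x. x \<in> ball 0 r \<Longrightarrow> (x, \<alpha> x, \<beta> x) \<in> W"
    and tan: "\<And>x. x \<in> ball 0 r \<Longrightarrow> V (x, \<alpha> x, \<beta> x) = cmul3 (p x) (1, deriv \<alpha> x, deriv \<beta> x)"
    and p: "p holomorphic_on ball 0 r" "p 0 = 0" "deriv p 0 = \<i> * of_real \<omega>" and \<omega>: "\<omega> \<noteq> 0"
  shows "iso_family V W {(x, \<alpha> x, \<beta> x) | x. x \<in> ball 0 r} (2 * pi / \<bar>\<omega>\<bar>)"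
proof -
  have l: "\<i> * of_real \<omega> \<noteq> 0" using \<omega> by simp
  obtain s \<rho> \<xi> g where g: "0 < s" "s \<le> r" "\<xi> holomorphic_on ball 0 s" "\<xi> 0 = 0" "0 < \<rho>" "ball 0 \<rho> \<subseteq> \<xi> ` ball 0 s"
    "g holomorphic_on ball 0 \<rho>" "\<And>x. x \<in> ball 0 s \<Longrightarrow> g (\<xi> x) = x" "\<And>\<zeta>. \<zeta> \<in> ball 0 \<rho> \<Longrightarrow> g \<zeta> \<in> ball 0 s \<and> \<xi> (g \<zeta>) = \<zeta>"
    "\<And>\<zeta>. \<zeta> \<in> ball 0 \<rho> \<Longrightarrow> deriv g \<zeta> * (\<i> * of_real \<omega> * \<zeta>) = p (g \<zeta>)"
    using linearizing_coordinate[OF p(1) r p(2,3) l] by metis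
  have "isCont \<xi> 0" using g(1,3) continuous_on_eq_continuous_at[OF open_ball] holomorphic_on_imp_continuous_on centre_in_ball by blast
  then obtain d where d: "d > 0" "\<And>x. dist x 0 < d \<Longrightarrow> dist (\<xi> x) (\<xi> 0) < \<rho>"
    unfolding continuous_at_eps_delta using g(5) by blast
  define T where "T = 2 * pi / \<bar>\<omega>\<bar>"
  show ?thesis
    unfolding iso_family_def T_def[symmetric]
  proof (intro exI[of _ "min d s"] conjI ballI impI)
    show "min d s > 0" using d g by simp
    fix q assume q: "q \<in> {(x, \<alpha> x, \<beta> x) | x. x \<in> ball 0 r}" "q \<noteq> 0 \<and> norm q < min d s"
    then obtain x0 where x0: "q = (x0, \<alpha> x0, \<beta> x0)" by blast
    have "norm x0 \<le> norm q" unfolding x0 by (metis fst_conv norm_fst_le)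
    then have x0s: "x0 \<in> ball 0 s" "dist x0 0 < d" using q by auto
    have x0nz: "x0 \<noteq> 0" using q(2) x0 z by (auto simp: zero_prod_def)
    define \<zeta>0 where "\<zeta>0 = \<xi> x0"
    have \<zeta>0: "norm \<zeta>0 < \<rho>" using d(2)[OF x0s(2)] g(4) by (simp add: \<zeta>0_def)
    have \<zeta>0nz: "\<zeta>0 \<noteq> 0"
    proof
      assume "\<zeta>0 = 0"
      then have "g (\<xi> x0) = g (\<xi> 0)" using g(4) by (simp add: \<zeta>0_def)
      then show False using g(8)[OF x0s(1)] g(8)[of 0] g(1) x0nz by simp
    qed
    define c where "c = (\<lambda>t::real. \<zeta>0 * exp (\<i> * of_real \<omega> * of_real t))"
    have cn: "c t \<in> ball 0 \<rho>" for t using \<zeta>0 by (simp add: c_def norm_mult)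
    define x where "x = (\<lambda>t. g (c t))"
    have xb: "x t \<in> ball 0 s" "\<xi> (x t) = c t" for t using g(9)[OF cn] by (auto simp: x_def)
    have xr: "x t \<in> ball 0 r" for t using xb(1)[of t] g(2) by auto
    have dc: "(c has_vector_derivative \<i> * of_real \<omega> * c t) (at t)" for t
    proof -
      have "((\<lambda>u. \<zeta>0 * exp (\<i> * of_real \<omega> * u)) has_field_derivative \<i> * of_real \<omega> * c t) (at (of_real t))"
        unfolding c_def by (auto intro!: derivative_eq_intros)
      from has_vector_derivative_real_field[OF this] show ?thesis unfolding c_def .
    qed
    have dx: "(x has_vector_derivative p (x t)) (at t)" for t
    proof -
      have "(g has_field_derivative deriv g (c t)) (at (c t))" by (rule holomorphic_derivI[OF g(7) open_ball cn])
      from field_vector_diff_chain_at[OF dc this]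
      show ?thesis using g(10)[OF cn[of t]] by (simp add: o_def x_def[abs_def] mult.commute)
    qed
    have dcomp: "((\<lambda>t. \<gamma> (x t)) has_vector_derivative p (x t) * deriv \<gamma> (x t)) (at t)" if "\<gamma> holomorphic_on ball 0 r" for \<gamma> t
      using field_vector_diff_chain_at[OF dx holomorphic_derivI[OF that open_ball xr]] by (simp add: o_def)
    define \<gamma> where "\<gamma> = (\<lambda>t. (x t, \<alpha> (x t), \<beta> (x t)))"
    have c0: "c 0 = \<zeta>0" by (simp add: c_def)
    show "\<exists>\<gamma>. \<gamma> 0 = q \<and> (\<forall>t. \<gamma> t \<in> W) \<and> (\<forall>t. (\<gamma> has_vector_derivative V (\<gamma> t)) (at t)) \<and>
        (\<forall>t. \<gamma> (t + T) = \<gamma> t) \<and> (\<forall>s. 0 < s \<and> s < T \<longrightarrow> \<gamma> s \<noteq> q)"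
    proof (intro exI[of _ \<gamma>] conjI allI impI)
      have "x 0 = x0" using g(8)[OF x0s(1)] by (simp add: x_def c0 \<zeta>0_def)
      then show "\<gamma> 0 = q" by (simp add: \<gamma>_def x0)
      show "\<gamma> t \<in> W" for t using W[OF xr] by (simp add: \<gamma>_def)
      show "(\<gamma> has_vector_derivative V (\<gamma> t)) (at t)" for t
      proof -
        have "(\<gamma> has_vector_derivative (p (x t), p (x t) * deriv \<alpha> (x t), p (x t) * deriv \<beta> (x t))) (at t)"
          unfolding \<gamma>_def by (intro has_vector_derivative_Pair dx dcomp hol)
        then show ?thesis using tan[OF xr[of t]] by (simp add: \<gamma>_def)
      qed
      show "\<gamma> (t + T) = \<gamma> t" for t
        using exp_rotation_periodic[OF \<omega>, of t] by (simp only: \<gamma>_def x_def c_def T_def)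
      fix u assume u: "0 < u \<and> u < T"
      show "\<gamma> u \<noteq> q"
      proof
        assume "\<gamma> u = q"
        then have "x u = x0" by (simp add: \<gamma>_def x0)
        then have "c u = \<zeta>0" using xb(2)[of u] by (simp add: \<zeta>0_def)
        then have "exp (\<i> * of_real \<omega> * of_real u) = 1" using \<zeta>0nz by (simp add: c_def)
        then show False using exp_rotation_neq_1[OF \<omega>, of u] u by (simp add: T_def)
      qed
    qed
  qed
qed

context bb_field begin

abbreviation "V \<equiv> field3 P Q R"

text \<open>Tangency to the x-axis makes \<alpha> and \<beta> vanish to second order, so the slopes
  \<open>\<alpha> x / x\<close> and \<open>\<beta> x / x\<close> extend holomorphically by 0. They
  form the solution \<open>w\<close>.\<close>

lemma curve_cm_imp_bbsol:
  assumes S: "curve_cm V xaxis S"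
  obtains w r N where "bbsol (bb_of Phi) w" "r > 0" "open N" "0 \<in> N" "S \<inter> N = {blow x (w x) | x. x \<in> ball 0 r}"
proof -
  obtain r \<alpha> \<beta> N where r: "r > 0" and hol: "\<alpha> holomorphic_on ball 0 r" "\<beta> holomorphic_on ball 0 r"
    and z: "\<alpha> 0 = 0" "\<beta> 0 = 0" "deriv \<alpha> 0 = 0" "deriv \<beta> 0 = 0" and N: "open N" "0 \<in> N"
    "S \<inter> N = {(x, \<alpha> x, \<beta> x) | x. x \<in> ball 0 r}"
    and tan: "\<And>x. x \<in> ball 0 r \<Longrightarrow> V (x, \<alpha> x, \<beta> x) = cmul3 (fst (V (x, \<alpha> x, \<beta> x))) (1, deriv \<alpha> x, deriv \<beta> x)"
    by (rule curve_cm_graph[OF S], rule that)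
  define w :: "complex \<Rightarrow> complex^2" where "w = (\<lambda>x. if x = 0 then 0 else vector [\<alpha> x / x, \<beta> x / x])"
  have bw: "blow x (w x) = (x, \<alpha> x, \<beta> x)" for x
    using z by (cases "x = 0") (auto simp: w_def blow_def)
  have w1: "(\<lambda>x. w x $ 1) = (\<lambda>x. if x = 0 then 0 else \<alpha> x / x)" and w2: "(\<lambda>x. w x $ 2) = (\<lambda>x. if x = 0 then 0 else \<beta> x / x)"
    by (auto simp: w_def fun_eq_iff)
  have 0: "0 \<in> ball 0 r" using r by simp
  have d0: "(\<alpha> has_field_derivative 0) (at 0)" "(\<beta> has_field_derivative 0) (at 0)"
    using holomorphic_derivI[OF hol(1) open_ball 0] holomorphic_derivI[OF hol(2) open_ball 0] z by auto
  have h1: "(\<lambda>x. w x $ 1) holomorphic_on ball 0 r" unfolding w1 by (rule holomorphic_div_x[OF hol(1) d0(1) z(1)])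
  have h2: "(\<lambda>x. w x $ 2) holomorphic_on ball 0 r" unfolding w2 by (rule holomorphic_div_x[OF hol(2) d0(2) z(2)])
  have hw: "holcurve r w" unfolding holcurve_def using h1 h2 exhaust_2 by metis
  have w0: "w 0 = 0" by (simp add: w_def)
  obtain \<delta> where \<delta>: "\<delta> > 0"
    "\<And>x w. x \<noteq> 0 \<Longrightarrow> norm x < \<delta> \<Longrightarrow> norm w < \<delta> \<Longrightarrow> P (blow x w) \<noteq> 0 \<and> Phi x w $ 1 = Q (blow x w) / P (blow x w) - w $ 1
         \<and> Phi x w $ 2 = R (blow x w) / P (blow x w) - w $ 2"
    using Phi_formula by metis
  obtain r' where r': "0 < r'" "r' \<le> r" "r' \<le> \<delta>" "\<And>x. x \<in> ball 0 r' \<Longrightarrow> norm (w x) < \<delta>"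
    using holcurve_small[OF hw r w0 \<delta>(1)] by metis
  obtain a F where bb: "bb_of Phi = (a, Mx, F)" "bb_good F" "\<And>x w. x *s a + Mx *v w + F x w = Phi x w" using bb_of_Phi by blast
  have Phi0: "Phi 0 0 = 0" using bb(2) bb(3)[of 0 0] by (simp add: bb_good_def)
  have eq: "x * deriv (\<lambda>x. w x $ i) x = Phi x (w x) $ i" if x: "x \<in> ball 0 r'" for x i
  proof (cases "x = 0")
    case True then show ?thesis using w0 Phi0 by simp
  next
    case False
    have xr: "x \<in> ball 0 r" using x r' by auto
    have x\<delta>: "norm x < \<delta>" using x r' by auto
    note f = \<delta>(2)[OF False x\<delta> r'(4)[OF x]]
    \<comment> \<open>The identity x (\<gamma>/x)' = \<gamma>' - \<gamma>/x turns the tangency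
      relations \<alpha>' = Q/P and \<beta>' = R/P into the Briot--Bouquet equations.\<close>
    have der: "x * deriv (\<lambda>x. if x = 0 then 0 else \<gamma> x / x) x = deriv \<gamma> x - \<gamma> x / x" if "\<gamma> holomorphic_on ball 0 r" for \<gamma>
    proof -
      have "((\<lambda>x. \<gamma> x / x) has_field_derivative (deriv \<gamma> x * x - \<gamma> x * 1) / (x * x)) (at x)"
        by (rule DERIV_divide[OF holomorphic_derivI[OF that open_ball xr] DERIV_ident False])
      then have "((\<lambda>x. if x = 0 then 0 else \<gamma> x / x) has_field_derivative (deriv \<gamma> x * x - \<gamma> x * 1) / (x * x)) (at x)"
        by (rule has_field_derivative_transform_within_open[OF _ open_delete[OF open_ball[of 0 r], of 0]]) (use xr False in auto)
      then show ?thesis using False by (simp add: DERIV_imp_deriv field_simps)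
    qed
    have "V (x, \<alpha> x, \<beta> x) = cmul3 (fst (V (x, \<alpha> x, \<beta> x))) (1, deriv \<alpha> x, deriv \<beta> x)" by (rule tan[OF xr])
    then have "Q (x, \<alpha> x, \<beta> x) = P (x, \<alpha> x, \<beta> x) * deriv \<alpha> x" "R (x, \<alpha> x, \<beta> x) = P (x, \<alpha> x, \<beta> x) * deriv \<beta> x"
      by (auto simp: field3_def)
    then have "deriv \<alpha> x = Q (blow x (w x)) / P (blow x (w x))" "deriv \<beta> x = R (blow x (w x)) / P (blow x (w x))"
      using f unfolding bw by auto
    moreover have "w x $ 1 = \<alpha> x / x" "w x $ 2 = \<beta> x / x" using False by (auto simp: w_def)
    ultimately have "x * deriv (\<lambda>x. w x $ 1) x = Phi x (w x) $ 1" "x * deriv (\<lambda>x. w x $ 2) x = Phi x (w x) $ 2"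
      unfolding w1 w2 using f der[OF hol(1)] der[OF hol(2)] by auto
    then show ?thesis using exhaust_2[of i] by auto
  qed
  have "bbsol (a, Mx, F) w"
    unfolding bbsol_def prod.case
  proof (intro exI[of _ r'] conjI r'(1) ballI allI holcurve_mono[OF hw r'(2)] w0)
    fix x :: complex and i assume "x \<in> ball 0 r'"
    from eq[OF this, of i] show "x * deriv (\<lambda>x. w x $ i) x = x * a $ i + (Mx *v w x) $ i + F x (w x) $ i"
      by (simp flip: bb(3))
  qed
  then have "bbsol (bb_of Phi) w" by (simp only: bb)
  then show thesis
    by (rule that[OF _ r N(1,2)]) (simp only: N(3) bw)
qed

text \<open>Multiplying the slopes by x recovers the graph. Along it the x-component of the field
  has derivative \<open>l\<close> at 0, since the slopes vanish there and \<open>f\<close> is of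
  second order; its value \<open>\<i> * of_real \<omega>\<close> determines the period.\<close>

lemma bbsol_imp_curve_cm:
  assumes w: "bbsol (bb_of Phi) w" and l\<omega>: "l = \<i> * of_real \<omega>"
  obtains r where "r > 0" "curve_cm V xaxis {blow x (w x) | x. x \<in> ball 0 r}"
    "iso_family V W {blow x (w x) | x. x \<in> ball 0 r} (2 * pi / \<bar>\<omega>\<bar>)"
proof -
  obtain a F where bb: "bb_of Phi = (a, Mx, F)" "bb_good F" "\<And>x w. x *s a + Mx *v w + F x w = Phi x w" using bb_of_Phi by blast
  obtain r0 where r0: "r0 > 0" "holcurve r0 w" "w 0 = 0"
    "\<And>x i. x \<in> ball 0 r0 \<Longrightarrow> x * deriv (\<lambda>x. w x $ i) x = x * a $ i + (Mx *v w x) $ i + F x (w x) $ i"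
    using w unfolding bb(1) bbsol_def prod.case by blast
  have eq: "x * deriv (\<lambda>x. w x $ i) x = Phi x (w x) $ i" if "x \<in> ball 0 r0" for x i
    using r0(4)[OF that, of i] by (simp flip: bb(3))
  obtain \<delta> where \<delta>: "\<delta> > 0"
    "\<And>x w. x \<noteq> 0 \<Longrightarrow> norm x < \<delta> \<Longrightarrow> norm w < \<delta> \<Longrightarrow> P (blow x w) \<noteq> 0 \<and> Phi x w $ 1 = Q (blow x w) / P (blow x w) - w $ 1
         \<and> Phi x w $ 2 = R (blow x w) / P (blow x w) - w $ 2"
    using Phi_formula by metis
  obtain e where e: "e > 0" "ball 0 e \<subseteq> W" using holo3_open[OF hf] W open_contains_ball by blast
  \<comment> \<open>With slopes below 1 and x below e/3, \<open>norm_blow\<close> keeps the curve in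
    the ball of radius e inside \<open>W\<close>.\<close>
  define \<delta>' where "\<delta>' = min (min \<delta> 1) (e/3)"
  have \<delta>': "\<delta>' > 0" using \<delta> e by (simp add: \<delta>'_def)
  obtain r where r: "0 < r" "r \<le> r0" "r \<le> \<delta>'" "\<And>x. x \<in> ball 0 r \<Longrightarrow> norm (w x) < \<delta>'"
    using holcurve_small[OF r0(2,1,3) \<delta>'] by metis
  have hw: "(\<lambda>x. w x $ i) holomorphic_on ball 0 r" for i
    using holcurve_mono[OF r0(2) r(2)] by (simp add: holcurve_def)
  define \<alpha> where "\<alpha> = (\<lambda>x. x * w x $ 1)"
  define \<beta> where "\<beta> = (\<lambda>x. x * w x $ 2)"
  have bw: "blow x (w x) = (x, \<alpha> x, \<beta> x)" for x by (simp add: blow_def \<alpha>_def \<beta>_def)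
  have hol: "\<alpha> holomorphic_on ball 0 r" "\<beta> holomorphic_on ball 0 r" unfolding \<alpha>_def \<beta>_def by (intro holomorphic_intros hw)+
  have d\<alpha>: "deriv \<alpha> x = w x $ 1 + x * deriv (\<lambda>x. w x $ 1) x" and d\<beta>: "deriv \<beta> x = w x $ 2 + x * deriv (\<lambda>x. w x $ 2) x" if "x \<in> ball 0 r" for x
  proof -
    have "((\<lambda>x. x * w x $ i) has_field_derivative 1 * w x $ i + deriv (\<lambda>x. w x $ i) x * x) (at x)" for i
      by (intro DERIV_mult DERIV_ident holomorphic_derivI[OF hw open_ball that])
    from DERIV_imp_deriv[OF this] show "deriv \<alpha> x = w x $ 1 + x * deriv (\<lambda>x. w x $ 1) x" "deriv \<beta> x = w x $ 2 + x * deriv (\<lambda>x. w x $ 2) x"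
      by (simp_all add: \<alpha>_def \<beta>_def mult.commute)
  qed
  have inW: "(x, \<alpha> x, \<beta> x) \<in> W" if "x \<in> ball 0 r" for x
  proof -
    have "norm (blow x (w x)) \<le> norm x * (1 + 2 * norm (w x))" by (rule norm_blow)
    also have "\<dots> \<le> norm x * 3" using r(4)[OF that] by (intro mult_left_mono) (auto simp: \<delta>'_def)
    also have "\<dots> < e" using that r(3) by (simp add: \<delta>'_def)
    finally show ?thesis using e(2) unfolding bw by auto
  qed
  have P0: "P 0 = 0" "Q 0 = 0" "R 0 = 0" by (simp_all add: P_def Q_def R_def f0 g0 h0)
  have tan: "V (x, \<alpha> x, \<beta> x) = cmul3 (P (x, \<alpha> x, \<beta> x)) (1, deriv \<alpha> x, deriv \<beta> x)" if x: "x \<in> ball 0 r" for x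
  proof (cases "x = 0")
    case True
    then have "(x, \<alpha> x, \<beta> x) = 0" by (simp add: \<alpha>_def \<beta>_def zero_prod_def)
    then show ?thesis using P0 by (simp add: field3_def)
  next
    case False
    have "norm x < \<delta>" "norm (w x) < \<delta>" using x r(3) r(4)[OF x] by (auto simp: \<delta>'_def)
    note f = \<delta>(2)[OF False this]
    have "x \<in> ball 0 r0" using x r(2) by auto
    then have "deriv \<alpha> x = Q (blow x (w x)) / P (blow x (w x))" "deriv \<beta> x = R (blow x (w x)) / P (blow x (w x))"
      using d\<alpha>[OF x] d\<beta>[OF x] eq[of x] f by auto
    then show ?thesis using f unfolding bw by (simp add: field3_def)
  qed
  have z: "\<alpha> 0 = 0" "\<beta> 0 = 0" "deriv \<alpha> 0 = 0" "deriv \<beta> 0 = 0"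
    using d\<alpha>[of 0] d\<beta>[of 0] r(1) r0(3) by (auto simp: \<alpha>_def \<beta>_def)
  have "curve_cm V xaxis {(x, \<alpha> x, \<beta> x) | x. x \<in> ball 0 r}"
    by (rule graph_curve_cm[OF hol r(1) z]) (use tan in \<open>simp add: field3_def\<close>)
  moreover have "iso_family V W {(x, \<alpha> x, \<beta> x) | x. x \<in> ball 0 r} (2 * pi / \<bar>\<omega>\<bar>)"
  proof (rule graph_iso_family[OF hol r(1) z(1,2) inW tan])
    have r0: "0 \<in> ball 0 r" using r(1) by simp
    have ff: "(\<lambda>x. f (x, \<alpha> x, \<beta> x)) holomorphic_on ball 0 r"
      by (rule holo3_curve_holomorphic[OF hf open_ball _ hol inW]) (auto intro: holomorphic_intros)
    show "(\<lambda>x. P (x, \<alpha> x, \<beta> x)) holomorphic_on ball 0 r"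
      unfolding P_def using ff hol by (auto intro!: holomorphic_intros)
    show "P (0, \<alpha> 0, \<beta> 0) = 0" using P0 z by (simp add: zero_prod_def)
    have "((\<lambda>x. f (x, \<alpha> x, \<beta> x)) has_field_derivative D3 f (0, \<alpha> 0, \<beta> 0) (1, deriv \<alpha> 0, deriv \<beta> 0)) (at 0)"
      by (rule holo3_curve[OF hf inW[OF r0] DERIV_ident holomorphic_derivI[OF hol(1) open_ball r0] holomorphic_derivI[OF hol(2) open_ball r0]])
    then have "((\<lambda>x. f (x, \<alpha> x, \<beta> x)) has_field_derivative 0) (at 0)"
      using D3_eq[OF Df] z by (simp add: zero_prod_def)
    then have "((\<lambda>x. l * x + \<kappa> * \<alpha> x + f (x, \<alpha> x, \<beta> x)) has_field_derivative l * 1 + \<kappa> * deriv \<alpha> 0 + 0) (at 0)"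
      by (intro DERIV_add DERIV_cmult DERIV_ident holomorphic_derivI[OF hol(1) open_ball r0])
    then show "deriv (\<lambda>x. P (x, \<alpha> x, \<beta> x)) 0 = \<i> * of_real \<omega>"
      using z(3) unfolding l\<omega>[symmetric] P_def by (simp add: DERIV_imp_deriv)
    show "\<omega> \<noteq> 0" using l l\<omega> by auto
  qed
  ultimately show thesis using that[OF r(1)] by (simp only: bw)
qed

end

lemma blow_graph_germ_eq:
  assumes S: "r > 0" "open N" "0 \<in> N" "S \<inter> N = {blow x (w x) | x. x \<in> ball 0 r}"
    and S': "r' > 0" "open N'" "0 \<in> N'" "S' \<inter> N' = {blow x (w' x) | x. x \<in> ball 0 r'}" and eq: "cgerm_eq w w'"
  shows "germ_eq S S'"
proof -
  obtain s where s: "s > 0" "\<And>x. x \<in> ball 0 s \<Longrightarrow> w x = w' x" using eq unfolding cgerm_eq_def by blast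
  define t where "t = min s (min r r')"
  define M where "M = N \<inter> N' \<inter> (fst :: C3 \<Rightarrow> complex) -` ball 0 t"
  have "open ((fst :: C3 \<Rightarrow> complex) -` ball 0 t)" by (intro open_vimage continuous_intros) auto
  then have M: "open M" unfolding M_def using S S' by (intro open_Int)
  have M0: "0 \<in> M" using S S' s by (simp add: M_def t_def)
  have fb: "fst (blow x v) = x" for x v by (simp add: blow_def)
  have "S \<inter> M = S' \<inter> M"
  proof (intro equalityI subsetI)
    fix p assume p: "p \<in> S \<inter> M"
    then have "p \<in> S \<inter> N" by (auto simp: M_def)
    then obtain x where x: "p = blow x (w x)" using S(4) by blast
    then have "x \<in> ball 0 t" using p fb by (auto simp: M_def)
    then have "p = blow x (w' x)" "x \<in> ball 0 r'" using x s(2)[of x] by (auto simp: t_def)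
    then have "p \<in> S' \<inter> N'" using S'(4) by blast
    then show "p \<in> S' \<inter> M" using p by blast
  next
    fix p assume p: "p \<in> S' \<inter> M"
    then have "p \<in> S' \<inter> N'" by (auto simp: M_def)
    then obtain x where x: "p = blow x (w' x)" using S'(4) by blast
    then have "x \<in> ball 0 t" using p fb by (auto simp: M_def)
    then have "p = blow x (w x)" "x \<in> ball 0 r" using x s(2)[of x] by (auto simp: t_def)
    then have "p \<in> S \<inter> N" using S(4) by blast
    then show "p \<in> S \<inter> M" using p by blast
  qed
  then show ?thesis unfolding germ_eq_def using M M0 by blast
qed

text \<open>Ensures that distinct solution germs give distinct curve germs: the first coordinate
  identifies the parameters of a common point, and dividing by x recovers the slopes.\<close>

lemma germ_eq_blow_graph:
  assumes g: "germ_eq {blow x (w x) | x. x \<in> ball 0 r} {blow x (w' x) | x. x \<in> ball 0 r'}" and r: "r > 0"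
    and w: "holcurve t w" "t > 0" "w 0 = 0" "w' 0 = 0"
  shows "cgerm_eq w w'"
proof -
  obtain N where N: "open N" "0 \<in> N" "{blow x (w x) | x. x \<in> ball 0 r} \<inter> N = {blow x (w' x) | x. x \<in> ball 0 r'} \<inter> N"
    using g unfolding germ_eq_def by blast
  obtain e where e: "e > 0" "ball 0 e \<subseteq> N" using N open_contains_ball by blast
  obtain s where s: "0 < s" "\<And>x. x \<in> ball 0 s \<Longrightarrow> norm (w x) < 1" using holcurve_small[OF w(1-3), of 1] by (metis zero_less_one)
  define u where "u = min (min s r) (e/3)"
  have "w x = w' x" if x: "x \<in> ball 0 u" for x
  proof (cases "x = 0")
    case True then show ?thesis using w by simp
  next
    case False
    have "norm (blow x (w x)) \<le> norm x * (1 + 2 * norm (w x))" by (rule norm_blow)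
    also have "\<dots> \<le> norm x * 3" using s(2)[of x] x by (intro mult_left_mono) (auto simp: u_def)
    also have "\<dots> < e" using x by (simp add: u_def)
    finally have "blow x (w x) \<in> N" using e(2) by auto
    moreover have "x \<in> ball 0 r" using x by (simp add: u_def)
    ultimately have "blow x (w x) \<in> {blow x (w' x) | x. x \<in> ball 0 r'}" using N(3) by blast
    then obtain y where "blow x (w x) = blow y (w' y)" by blast
    then have "y = x" "x * w x $ 1 = x * w' x $ 1" "x * w x $ 2 = x * w' x $ 2" by (auto simp: blow_def)
    then have "w x $ i = w' x $ i" for i using False exhaust_2[of i] by auto
    then show ?thesis by (simp add: vec_eq_iff)
  qed
  then show ?thesis unfolding cgerm_eq_def using s(1) r e(1) by (intro exI[of _ u]) (auto simp: u_def)
qed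

section \<open>Transport by a linear change of coordinates\<close>

text \<open>Defining functions are pulled back along \<open>\<tau>\<close>, whence its complex
  linearity; preservation of the norm lets the radius in \<open>iso_family\<close> be reused
  unchanged.\<close>

definition lin_iso :: "(C3 \<Rightarrow> C3) \<Rightarrow> (C3 \<Rightarrow> C3) \<Rightarrow> bool" where
  "lin_iso \<sigma> \<tau> \<longleftrightarrow> bounded_linear \<sigma> \<and> bounded_linear \<tau> \<and> (\<forall>c p. \<tau> (cmul3 c p) = cmul3 c (\<tau> p)) \<and>
     (\<forall>p. \<sigma> (\<tau> p) = p) \<and> (\<forall>p. \<tau> (\<sigma> p) = p) \<and> (\<forall>p. norm (\<sigma> p) = norm p)"

lemma lin_iso_image: "lin_iso \<sigma> \<tau> \<Longrightarrow> \<sigma> ` S = \<tau> -` S"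
proof (intro equalityI subsetI)
  assume iso: "lin_iso \<sigma> \<tau>"
  show "x \<in> \<tau> -` S" if "x \<in> \<sigma> ` S" for x using that iso by (auto simp: lin_iso_def)
  show "x \<in> \<sigma> ` S" if "x \<in> \<tau> -` S" for x
  proof (rule image_eqI[of _ _ "\<tau> x"])
    show "x = \<sigma> (\<tau> x)" using iso unfolding lin_iso_def by metis
  qed (use that in simp)
qed

lemma lin_iso_open: "lin_iso \<sigma> \<tau> \<Longrightarrow> open S \<Longrightarrow> open (\<sigma> ` S)"
  by (simp only: lin_iso_image, rule open_vimage) (simp_all add: lin_iso_def linear_continuous_on)

lemma curve_cm_transport:
  assumes iso: "lin_iso \<sigma> \<tau>" and S: "curve_cm V E S"
  shows "curve_cm (\<lambda>p. \<sigma> (V (\<tau> p))) (\<sigma> ` E) (\<sigma> ` S)"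
proof -
  obtain U G1 G2 where U: "open U" "0 \<in> U" and G: "holo3 U G1" "holo3 U G2"
    and SU: "S \<inter> U = {p \<in> U. G1 p = 0 \<and> G2 p = 0}" and sj: "\<And>p. p \<in> U \<Longrightarrow> surj (\<lambda>v. (D3 G1 p v, D3 G2 p v))"
    and ker: "{v. D3 G1 0 v = 0 \<and> D3 G2 0 v = 0} = E"
    and inv: "\<And>p. p \<in> S \<inter> U \<Longrightarrow> D3 G1 p (V p) = 0 \<and> D3 G2 p (V p) = 0"
    and S0: "0 \<in> S"
    using S unfolding curve_cm_def by blast
  have bl: "bounded_linear \<tau>" "bounded_linear \<sigma>" and c: "\<And>c p. \<tau> (cmul3 c p) = cmul3 c (\<tau> p)"
    and st: "\<And>p. \<sigma> (\<tau> p) = p" and ts: "\<And>p. \<tau> (\<sigma> p) = p"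
    using iso unfolding lin_iso_def by auto
  have im: "\<sigma> ` X = \<tau> -` X" for X using lin_iso_image[OF iso] .
  have U': "open (\<sigma> ` U)" using lin_iso_open[OF iso U(1)] .
  have z: "\<tau> 0 = 0" "\<sigma> 0 = 0" using bl by (simp_all add: linear_simps)
  have h: "hmap (\<sigma> ` U) \<tau>" by (rule hmapI[OF U' bounded_linear_imp_has_derivative[OF bl(1)] c])
  have DMt: "DM \<tau> p = \<tau>" for p by (rule DM_eq[OF bounded_linear_imp_has_derivative[OF bl(1)]])
  have sub: "\<tau> p \<in> U" if "p \<in> \<sigma> ` U" for p using that ts by auto
  have H: "holo3 (\<sigma> ` U) (\<lambda>p. G1 (\<tau> p))" "holo3 (\<sigma> ` U) (\<lambda>p. G2 (\<tau> p))"
    by (rule holo3_compose_hmap(1)[OF G(1) h sub] holo3_compose_hmap(1)[OF G(2) h sub]; assumption)+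
  have D1: "D3 (\<lambda>p. G1 (\<tau> p)) p v = D3 G1 (\<tau> p) (\<tau> v)" if "p \<in> \<sigma> ` U" for p v
    using holo3_compose_hmap(2)[OF G(1) h sub that] by (simp add: DMt)
  have D2: "D3 (\<lambda>p. G2 (\<tau> p)) p v = D3 G2 (\<tau> p) (\<tau> v)" if "p \<in> \<sigma> ` U" for p v
    using holo3_compose_hmap(2)[OF G(2) h sub that] by (simp add: DMt)
  have 0: "0 \<in> \<sigma> ` U" "0 \<in> \<sigma> ` S" using U(2) S0 z by (force simp: im)+
  have a1: "\<sigma> ` S \<inter> \<sigma> ` U = {p \<in> \<sigma> ` U. G1 (\<tau> p) = 0 \<and> G2 (\<tau> p) = 0}"
    using SU unfolding im by blast
  have a2: "surj (\<lambda>v. (D3 (\<lambda>p. G1 (\<tau> p)) p v, D3 (\<lambda>p. G2 (\<tau> p)) p v))" if p: "p \<in> \<sigma> ` U" for p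
  proof -
    have "\<exists>v. y = (D3 G1 (\<tau> p) (\<tau> v), D3 G2 (\<tau> p) (\<tau> v))" for y
    proof -
      obtain u where "y = (D3 G1 (\<tau> p) u, D3 G2 (\<tau> p) u)" using sj[OF sub[OF p]] unfolding surj_def by blast
      then show ?thesis by (intro exI[of _ "\<sigma> u"]) (simp add: ts)
    qed
    then show ?thesis unfolding surj_def D1[OF p] D2[OF p] by blast
  qed
  have a3: "{v. D3 (\<lambda>p. G1 (\<tau> p)) 0 v = 0 \<and> D3 (\<lambda>p. G2 (\<tau> p)) 0 v = 0} = \<sigma> ` E"
    unfolding D1[OF 0(1)] D2[OF 0(1)] z im ker[symmetric] by auto
  have a4: "D3 (\<lambda>p. G1 (\<tau> p)) p (\<sigma> (V (\<tau> p))) = 0 \<and> D3 (\<lambda>p. G2 (\<tau> p)) p (\<sigma> (V (\<tau> p))) = 0" if "p \<in> \<sigma> ` S \<inter> \<sigma> ` U" for p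
  proof -
    have p: "p \<in> \<sigma> ` U" "\<tau> p \<in> S \<inter> U" using that unfolding im by auto
    show ?thesis unfolding D1[OF p(1)] D2[OF p(1)] ts using inv[OF p(2)] .
  qed
  show ?thesis by (rule curve_cmI[OF 0(2) U' 0(1) H a1 _ a3]) (use a2 a4 in blast)+
qed

lemma iso_family_transport:
  assumes iso: "lin_iso \<sigma> \<tau>" and S: "iso_family V W S T"
  shows "iso_family (\<lambda>p. \<sigma> (V (\<tau> p))) (\<sigma> ` W) (\<sigma> ` S) T"
proof -
  obtain r where r': "r > 0" "\<forall>p\<in>S. p \<noteq> 0 \<and> norm p < r \<longrightarrow>
     (\<exists>\<gamma> :: real \<Rightarrow> C3. \<gamma> 0 = p \<and> (\<forall>t. \<gamma> t \<in> W) \<and> (\<forall>t. (\<gamma> has_vector_derivative V (\<gamma> t)) (at t)) \<and>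
        (\<forall>t. \<gamma> (t + T) = \<gamma> t) \<and> (\<forall>s. 0 < s \<and> s < T \<longrightarrow> \<gamma> s \<noteq> p))"
    using S unfolding iso_family_def by (elim exE conjE)
  note r = r'(1) r'(2)[rule_format]
  have bl: "bounded_linear \<tau>" "bounded_linear \<sigma>" and st: "\<And>p. \<sigma> (\<tau> p) = p" and ts: "\<And>p. \<tau> (\<sigma> p) = p"
    and n: "\<And>p. norm (\<sigma> p) = norm p"
    using iso unfolding lin_iso_def by auto
  show ?thesis unfolding iso_family_def
  proof (intro exI[of _ r] conjI r(1) ballI impI)
    fix q assume q: "q \<in> \<sigma> ` S" "q \<noteq> 0 \<and> norm q < r"
    then obtain p where p: "p \<in> S" "q = \<sigma> p" by blast
    have "p \<noteq> 0 \<and> norm p < r" using q p n[of p] by auto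
    from r(2)[OF p(1) this] obtain \<gamma> where g: "\<gamma> 0 = p" "\<And>t. \<gamma> t \<in> W" "\<And>t. (\<gamma> has_vector_derivative V (\<gamma> t)) (at t)"
      "\<And>t. \<gamma> (t + T) = \<gamma> t" "\<And>s. 0 < s \<and> s < T \<Longrightarrow> \<gamma> s \<noteq> p" by blast
    show "\<exists>\<gamma>. \<gamma> 0 = q \<and> (\<forall>t. \<gamma> t \<in> \<sigma> ` W) \<and> (\<forall>t. (\<gamma> has_vector_derivative \<sigma> (V (\<tau> (\<gamma> t)))) (at t)) \<and>
        (\<forall>t. \<gamma> (t + T) = \<gamma> t) \<and> (\<forall>s. 0 < s \<and> s < T \<longrightarrow> \<gamma> s \<noteq> q)"
    proof (intro exI[of _ "\<lambda>t. \<sigma> (\<gamma> t)"] conjI allI impI)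
      show "((\<lambda>t. \<sigma> (\<gamma> t)) has_vector_derivative \<sigma> (V (\<tau> (\<sigma> (\<gamma> t))))) (at t)" for t
        unfolding ts by (rule bounded_linear.has_vector_derivative[OF bl(2) g(3)])
      show "\<sigma> (\<gamma> s) \<noteq> q" if "0 < s \<and> s < T" for s
        using g(5)[OF that] p(2) ts by metis
    qed (use g p in auto)
  qed
qed

lemma germ_eq_transport:
  assumes iso: "lin_iso \<sigma> \<tau>" and S: "germ_eq S S'" shows "germ_eq (\<sigma> ` S) (\<sigma> ` S')"
proof -
  obtain N where N: "open N" "0 \<in> N" "S \<inter> N = S' \<inter> N" using S unfolding germ_eq_def by blast
  have im: "\<sigma> ` X = \<tau> -` X" for X using lin_iso_image[OF iso] .
  have "\<sigma> ` S \<inter> \<sigma> ` N = \<sigma> ` S' \<inter> \<sigma> ` N" using N(3) unfolding im by blast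
  moreover have "0 \<in> \<sigma> ` N" using N(2) iso unfolding im by (simp add: lin_iso_def linear_simps)
  ultimately show ?thesis unfolding germ_eq_def using lin_iso_open[OF iso N(1)] by blast
qed

text \<open>A cyclic permutation of order three, so its square is its inverse. It brings the y-axis
  to the first position, its square the z-axis.\<close>

definition rot :: "C3 \<Rightarrow> C3" where "rot p = (fst (snd p), snd (snd p), fst p)"

lemma rot_simps [simp]: "rot (a, b, c) = (b, c, a)" by (simp add: rot_def)

lemma rot_linear: "bounded_linear rot" "bounded_linear (\<lambda>p. rot (rot p))"
proof -
  show 1: "bounded_linear rot" unfolding rot_def
    by (intro bounded_linear_Pair bounded_linear_fst_comp bounded_linear_snd_comp bounded_linear_ident)
  show "bounded_linear (\<lambda>p. rot (rot p))" by (rule bounded_linear_compose[OF 1 1])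
qed

lemma rot_iso: "lin_iso rot (\<lambda>p. rot (rot p))" "lin_iso (\<lambda>p. rot (rot p)) rot"
  using rot_linear by (auto simp: lin_iso_def norm_Pair add_ac)

section \<open>Existence, uniqueness and resonance of invariant curves\<close>

lemma upper_triangular_nonres:
  fixes M :: "complex^2^2"
  assumes "M $ 2 $ 1 = 0" "\<And>n. n \<in> I \<Longrightarrow> M $ 1 $ 1 \<noteq> of_nat n" "\<And>n. n \<in> I \<Longrightarrow> M $ 2 $ 2 \<noteq> of_nat n"
  shows "nonres I M"
  unfolding nonres_def
proof (intro ballI allI impI)
  fix n v assume n: "n \<in> I" and v: "M *v v = of_nat n *s v"
  have "(M *v v) $ 2 = of_nat n * v $ 2" "(M *v v) $ 1 = of_nat n * v $ 1" using v by simp_all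
  then have e: "M $ 2 $ 2 * v $ 2 = of_nat n * v $ 2" "M $ 1 $ 1 * v $ 1 + M $ 1 $ 2 * v $ 2 = of_nat n * v $ 1"
    using assms(1) by (simp_all add: matrix_vector_mult_def sum_2)
  have v2: "v $ 2 = 0" using e(1) assms(3)[OF n] by simp
  then have v1: "v $ 1 = 0" using e(2) assms(2)[OF n] by simp
  show "v = 0" using v1 v2 by (simp add: vec_eq_iff forall_2)
qed

context bb_field begin

lemma nonres_curve:
  assumes nr: "nonres {1..} Mx" and l\<omega>: "l = \<i> * of_real \<omega>"
  shows "\<exists>S. curve_cm V xaxis S \<and> iso_family V W S (2 * pi / \<bar>\<omega>\<bar>)"
    "curve_cm V xaxis S \<Longrightarrow> curve_cm V xaxis S' \<Longrightarrow> germ_eq S S'"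
proof -
  obtain a F where bb: "bb_of Phi = (a, Mx, F)" "bb_good F" by (rule bb_of_Phi)
  obtain w where "bbsol (bb_of Phi) w" using bb_exists[OF nr bb(2)] bb(1) by auto
  from bbsol_imp_curve_cm[OF this l\<omega>] show "\<exists>S. curve_cm V xaxis S \<and> iso_family V W S (2 * pi / \<bar>\<omega>\<bar>)" by blast
  assume S: "curve_cm V xaxis S" and S': "curve_cm V xaxis S'"
  obtain w r N where w: "bbsol (bb_of Phi) w" "r > 0" "open N" "0 \<in> N" "S \<inter> N = {blow x (w x) | x. x \<in> ball 0 r}"
    by (rule curve_cm_imp_bbsol[OF S])
  obtain w' r' N' where w': "bbsol (bb_of Phi) w'" "r' > 0" "open N'" "0 \<in> N'" "S' \<inter> N' = {blow x (w' x) | x. x \<in> ball 0 r'}"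
    by (rule curve_cm_imp_bbsol[OF S'])
  have "cgerm_eq w w'" using bb_unique[OF nr bb(2)] w(1) w'(1) bb(1) by simp
  then show "germ_eq S S'" by (rule blow_graph_germ_eq[OF w(2-5) w'(2-5)])
qed

text \<open>The eigenvalue \<open>b22 / l - 1\<close> equals k - 1, so the first k - 2 reductions
  are nonresonant and lower it to 1. The alternative b11 = l then leaves the other eigenvalue at
  most 0; in the alternative b11 = k l both eigenvalues are 1 and the nonzero b12 makes a Jordan
  block. In either case only one critical order occurs and larger orders are unobstructed.\<close>

lemma resonant_curve:
  assumes k: "k \<ge> 2" "b22 = of_nat k * l" and b: "b11 = l \<or> b11 = of_nat k * l \<and> b12 \<noteq> 0" and l\<omega>: "l = \<i> * of_real \<omega>"
  defines "\<rho> \<equiv> bb_const ((reduce ^^ (k - 2)) (bb_of Phi)) $ 2"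
  shows "\<rho> = 0 \<Longrightarrow> \<exists>Sf :: nat \<Rightarrow> C3 set. (\<forall>n. curve_cm V xaxis (Sf n) \<and> iso_family V W (Sf n) (2 * pi / \<bar>\<omega>\<bar>)) \<and>
              (\<forall>m n. m \<noteq> n \<longrightarrow> \<not> germ_eq (Sf m) (Sf n))"
    "\<rho> \<noteq> 0 \<Longrightarrow> \<not> (\<exists>S. curve_cm V xaxis S)"
proof -
  obtain a F where bb: "bb_of Phi = (a, Mx, F)" "bb_good F" by (rule bb_of_Phi)
  obtain m where m: "k = m + 2" using k(1) by (metis add.commute le_Suc_ex)
  have "b22 / l = of_nat k" using k(2) l by (metis nonzero_mult_div_cancel_right)
  then have M22: "Mx $ 2 $ 2 = of_nat m + 1" unfolding Mx_nth using m by simp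
  have "b11 / l = 1 \<or> b11 / l = of_nat k \<and> b12 / l \<noteq> 0" using b l by (metis divide_eq_0_iff divide_self nonzero_mult_div_cancel_right)
  then have M11: "Mx $ 1 $ 1 = 0 \<or> Mx $ 1 $ 1 = of_nat m + 1 \<and> Mx $ 1 $ 2 \<noteq> 0" unfolding Mx_nth using m by auto
  have nr1: "nonres {1..m} Mx"
  proof (rule upper_triangular_nonres)
    fix n assume n: "n \<in> {1..m}"
    have ne: "of_nat m + 1 \<noteq> (of_nat n :: complex)"
    proof
      assume "of_nat m + 1 = (of_nat n :: complex)"
      then have "of_nat (m + 1) = (of_nat n :: complex)" by (simp only: of_nat_add of_nat_1)
      then show False using n by (simp only: of_nat_eq_iff) auto
    qed
    show "Mx $ 2 $ 2 \<noteq> of_nat n" using M22 ne by simp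
    show "Mx $ 1 $ 1 \<noteq> of_nat n" using M11 ne n by auto
  qed (simp add: Mx_nth)
  define M' where "M' = Mx - mat (of_nat m)"
  have M': "M' $ 2 $ 1 = 0" "M' $ 2 $ 2 = 1" "M' $ 1 $ 1 = - of_nat m \<or> M' $ 1 $ 1 = 1 \<and> M' $ 1 $ 2 \<noteq> 0"
    using M11 M22 by (auto simp: M'_def mat_def Mx_nth)
  have nr2: "nonres {2..} M'"
  proof (rule upper_triangular_nonres[OF M'(1)])
    fix n :: nat assume n: "n \<in> {2..}"
    have ne: "1 \<noteq> (of_nat n :: complex)" using n by (metis atLeast_iff numeral_le_one_iff of_nat_1 of_nat_eq_iff semiring_norm(69))
    show "M' $ 2 $ 2 \<noteq> of_nat n" using M'(2) ne by simp
    have "- of_nat m \<noteq> (of_nat n :: complex)"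
    proof
      assume "- of_nat m = (of_nat n :: complex)"
      then have "of_nat (n + m) = (0 :: complex)" by (simp add: neg_eq_iff_add_eq_0 add.commute)
      then show False using n by (simp only: of_nat_eq_0_iff) auto
    qed
    then show "M' $ 1 $ 1 \<noteq> of_nat n" using M'(3) ne by auto
  qed
  from reduce_funpow[OF nr1 bb(2), of a, folded M'_def]
  obtain a' F' where red: "(reduce ^^ m) (a, Mx, F) = (a', M', F')" "bb_good F'"
    "\<forall>w. bbsol (a, Mx, F) w \<longrightarrow> (\<exists>w'. bbsol (a', M', F') w')"
    "\<forall>w'::nat \<Rightarrow> complex \<Rightarrow> complex^2. (\<forall>n. bbsol (a', M', F') (w' n)) \<longrightarrow> (\<forall>k n. k \<noteq> n \<longrightarrow> \<not> cgerm_eq (w' k) (w' n)) \<longrightarrow>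
       (\<exists>w :: nat \<Rightarrow> complex \<Rightarrow> complex^2. (\<forall>n. bbsol (a, Mx, F) (w n)) \<and> (\<forall>k n. k \<noteq> n \<longrightarrow> \<not> cgerm_eq (w k) (w n)))"
    by (elim exE conjE)
  have \<rho>: "\<rho> = a' $ 2" using red(1) by (simp add: \<rho>_def bb_const_def bb(1) m)
  \<comment> \<open>The second row of \<open>mat 1 - M'\<close> is zero, so the linear equation
    forces the second entry of the constant vector to vanish and otherwise constrains
    \<open>c\<close> by a single equation.\<close>
  have c1: "((mat 1 - M') *v c) $ 1 = (1 - M' $ 1 $ 1) * c $ 1 - M' $ 1 $ 2 * c $ 2" and c2: "((mat 1 - M') *v c) $ 2 = 0" for c
    using M' by (simp_all add: matrix_vector_mult_def sum_2 mat_def)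
  show "\<not> (\<exists>S. curve_cm V xaxis S)" if "\<rho> \<noteq> 0"
  proof
    assume "\<exists>S. curve_cm V xaxis S"
    then obtain S where S: "curve_cm V xaxis S" by blast
    obtain w where "bbsol (bb_of Phi) w" by (rule curve_cm_imp_bbsol[OF S])
    then obtain w' where "bbsol (a', M', F') w'" using red(3) bb(1) by auto
    from bbsol_drop(1)[OF red(2) this] have "a' $ 2 = 0" using c2 by metis
    then show False using that \<rho> by simp
  qed
  show "\<exists>Sf :: nat \<Rightarrow> C3 set. (\<forall>n. curve_cm V xaxis (Sf n) \<and> iso_family V W (Sf n) (2 * pi / \<bar>\<omega>\<bar>)) \<and>
              (\<forall>m n. m \<noteq> n \<longrightarrow> \<not> germ_eq (Sf m) (Sf n))" if r0: "\<rho> = 0"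
  proof -
    have a2: "a' $ 2 = 0" using \<rho> r0 by simp
    obtain c :: "nat \<Rightarrow> complex^2" where c: "\<And>n. (mat 1 - M') *v c n = a'" "inj c"
    proof (cases "M' $ 1 $ 1 = 1")
      case True
      \<comment> \<open>Since \<open>- of_nat m\<close> is never 1, this is the Jordan case: the
        first row fixes the second coefficient and leaves the first one free.\<close>
      then have nz: "M' $ 1 $ 2 \<noteq> 0" using M'(3) by (auto simp: eq_neg_iff_add_eq_0 simp flip: of_nat_Suc)
      define c :: "nat \<Rightarrow> complex^2" where "c = (\<lambda>n. vector [of_nat n, - (a' $ 1) / M' $ 1 $ 2])"
      show thesis
      proof (rule that[of c])
        show "(mat 1 - M') *v c n = a'" for n
          unfolding vec_eq_iff forall_2 c1 c2 using a2 True nz by (simp add: c_def)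
        show "inj c" by (rule injI) (metis c_def of_nat_eq_iff vector_2(1))
      qed
    next
      case False
      \<comment> \<open>Here the first row can be solved for the first coefficient and the second
        one is free.\<close>
      then have nz: "1 - M' $ 1 $ 1 \<noteq> 0" by simp
      define c :: "nat \<Rightarrow> complex^2" where "c = (\<lambda>n. vector [(a' $ 1 + M' $ 1 $ 2 * of_nat n) / (1 - M' $ 1 $ 1), of_nat n])"
      show thesis
      proof (rule that[of c])
        show "(mat 1 - M') *v c n = a'" for n
          unfolding vec_eq_iff forall_2 c1 c2 using a2 nz by (simp add: c_def)
        show "inj c" by (rule injI) (metis c_def of_nat_eq_iff vector_2(2))
      qed
    qed
    obtain w' :: "nat \<Rightarrow> complex \<Rightarrow> complex^2" where w': "\<forall>n. bbsol (a', M', F') (w' n)" "\<forall>k n. k \<noteq> n \<longrightarrow> \<not> cgerm_eq (w' k) (w' n)"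
      using bb_resonant_family[OF red(2) nr2 c] by blast
    obtain w :: "nat \<Rightarrow> complex \<Rightarrow> complex^2" where w: "\<forall>n. bbsol (a, Mx, F) (w n)" "\<forall>k n. k \<noteq> n \<longrightarrow> \<not> cgerm_eq (w k) (w n)"
      using red(4)[rule_format, of w'] w' by blast
    have "\<exists>r. r > 0 \<and> curve_cm V xaxis {blow x (w n x) | x. x \<in> ball 0 r} \<and>
      iso_family V W {blow x (w n x) | x. x \<in> ball 0 r} (2 * pi / \<bar>\<omega>\<bar>)" for n
    proof -
      have "bbsol (bb_of Phi) (w n)" using w(1) bb(1) by simp
      from bbsol_imp_curve_cm[OF this l\<omega>] show ?thesis by blast
    qed
    then have "\<exists>r. \<forall>n. r n > 0 \<and> curve_cm V xaxis {blow x (w n x) | x. x \<in> ball 0 (r n)} \<and>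
      iso_family V W {blow x (w n x) | x. x \<in> ball 0 (r n)} (2 * pi / \<bar>\<omega>\<bar>)" by (intro choice allI)
    then obtain r where r': "\<forall>n. r n > 0 \<and> curve_cm V xaxis {blow x (w n x) | x. x \<in> ball 0 (r n)} \<and>
      iso_family V W {blow x (w n x) | x. x \<in> ball 0 (r n)} (2 * pi / \<bar>\<omega>\<bar>)" by (rule exE)
    have r: "\<And>n. r n > 0" "\<And>n. curve_cm V xaxis {blow x (w n x) | x. x \<in> ball 0 (r n)}"
      "\<And>n. iso_family V W {blow x (w n x) | x. x \<in> ball 0 (r n)} (2 * pi / \<bar>\<omega>\<bar>)" using r' by blast+
    have "\<not> germ_eq {blow x (w j x) | x. x \<in> ball 0 (r j)} {blow x (w n x) | x. x \<in> ball 0 (r n)}" if "j \<noteq> n" for j n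
    proof
      assume g: "germ_eq {blow x (w j x) | x. x \<in> ball 0 (r j)} {blow x (w n x) | x. x \<in> ball 0 (r n)}"
      obtain t where "t > 0" "holcurve t (w j)" "w j 0 = 0" using w(1)[rule_format, of j] unfolding bbsol_def prod.case by blast
      moreover have "w n 0 = 0" using w(1)[rule_format, of n] unfolding bbsol_def prod.case by blast
      ultimately have "cgerm_eq (w j) (w n)" using germ_eq_blow_graph[OF g r(1)] by blast
      then show False using w(2) that by blast
    qed
    then show ?thesis using r(2,3) by (intro exI[of _ "\<lambda>n. {blow x (w n x) | x. x \<in> ball 0 (r n)}"] conjI allI impI)
  qed
qed

end

section \<open>Invariant surfaces\<close>

lemma quadratic_flat:
  fixes G :: "'a::real_normed_vector \<Rightarrow> 'b::real_normed_vector"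
  assumes r: "r > 0" and B: "\<And>q. q \<in> ball 0 r \<Longrightarrow> norm (G q) \<le> B * norm q ^ 2"
  shows "G 0 = 0" "(G has_derivative (\<lambda>_. 0)) (at 0)"
proof -
  show G0: "G 0 = 0" using B[of 0] r by simp
  show "(G has_derivative (\<lambda>_. 0)) (at 0)"
  proof (rule has_derivativeI_sandwich[of r])
    show "norm (G y - G 0 - 0) / norm (y - 0) \<le> B * norm y" if "y \<in> UNIV" "y \<noteq> 0" "dist y 0 < r" for y
    proof -
      have "norm (G y) \<le> B * norm y * norm y" using B[of y] that by (simp add: power2_eq_square mult.assoc)
      then have "norm (G y) / norm y \<le> B * norm y" using that by (simp add: divide_le_eq)
      then show ?thesis by (simp add: G0)
    qed
    show "((\<lambda>y. B * norm y) \<longlongrightarrow> 0) (at (0::'a))" by (intro tendsto_eq_intros refl) auto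
  qed (use r in auto)
qed

section \<open>Integration along rays\<close>

text \<open>On functions vanishing to second order this inverts the Euler derivative of u,
  \<open>DM u q q\<close>: a homogeneous part of degree d is divided by d.\<close>

definition ray_int :: "(C3 \<Rightarrow> C3) \<Rightarrow> C3 \<Rightarrow> C3" where
  "ray_int G q = integral {0..1} (\<lambda>s. inverse s *\<^sub>R G (s *\<^sub>R q))"

lemma scaleR_in_ball: "s \<in> {0..1} \<Longrightarrow> q \<in> ball 0 r \<Longrightarrow> s *\<^sub>R q \<in> ball (0::'a::real_normed_vector) r"
proof -
  assume s: "s \<in> {0..1}" "q \<in> ball 0 r"
  then have "norm (s *\<^sub>R q) \<le> norm q" by (simp add: mult_left_le_one_le)
  then show ?thesis using s by simp
qed

context
  fixes G :: "C3 \<Rightarrow> C3" and r B :: real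
  assumes G: "hmap (ball 0 r) G" and r: "r > 0" and B: "\<And>q. q \<in> ball 0 r \<Longrightarrow> norm (G q) \<le> B * norm q ^ 2"
begin

text \<open>Second order vanishing of \<open>G\<close> compensates the factor 1/s. The convention
  \<open>inverse 0 = 0\<close> makes the integrand 0 at s = 0, which is also its limit.\<close>

lemma ray_cont:
  assumes q: "q \<in> ball 0 r" shows "continuous_on {0..1} (\<lambda>s. inverse s *\<^sub>R G (s *\<^sub>R q))"
  unfolding continuous_on_def
proof
  fix s :: real assume s: "s \<in> {0..1}"
  show "((\<lambda>s. inverse s *\<^sub>R G (s *\<^sub>R q)) \<longlongrightarrow> inverse s *\<^sub>R G (s *\<^sub>R q)) (at s within {0..1})"
  proof (cases "s = 0")
    case False
    have "isCont G (s *\<^sub>R q)"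
      using hmap_D(1)[OF G scaleR_in_ball[OF s q]] has_derivative_continuous by blast
    then have "(G \<longlongrightarrow> G (s *\<^sub>R q)) (at (s *\<^sub>R q))" by (simp add: isCont_def)
    moreover have "isCont (\<lambda>s. G (s *\<^sub>R q)) s"
      by (rule isCont_o2[where f="\<lambda>s. s *\<^sub>R q" and g=G]) (use \<open>isCont G (s *\<^sub>R q)\<close> in \<open>auto intro!: continuous_intros\<close>)
    ultimately have "((\<lambda>s. G (s *\<^sub>R q)) \<longlongrightarrow> G (s *\<^sub>R q)) (at s within {0..1})"
      by (meson isCont_def tendsto_within_subset subset_UNIV)
    then show ?thesis using False by (intro tendsto_intros)
  next
    case True
    have "((\<lambda>s. inverse s *\<^sub>R G (s *\<^sub>R q)) \<longlongrightarrow> 0) (at s within {0..1})"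
    proof (rule Lim_null_comparison)
      show "\<forall>\<^sub>F t in at s within {0..1}. norm (inverse t *\<^sub>R G (t *\<^sub>R q)) \<le> B * norm q ^ 2 * t"
        unfolding eventually_at
      proof (intro exI[of _ 1] conjI ballI impI)
        fix t :: real assume t: "t \<in> {0..1}" "t \<noteq> s \<and> dist t s < 1"
        then have t0: "t > 0" using True by simp
        have "norm (inverse t *\<^sub>R G (t *\<^sub>R q)) = inverse t * norm (G (t *\<^sub>R q))" using t0 by simp
        also have "\<dots> \<le> inverse t * (B * norm (t *\<^sub>R q) ^ 2)" using t0 by (intro mult_left_mono B scaleR_in_ball[OF t(1) q]) auto
        also have "\<dots> = B * norm q ^ 2 * t" using t0 by (simp add: power2_eq_square)
        finally show "norm (inverse t *\<^sub>R G (t *\<^sub>R q)) \<le> B * norm q ^ 2 * t" .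
      qed simp
      show "((\<lambda>t. B * norm q ^ 2 * t) \<longlongrightarrow> 0) (at s within {0..1})"
        unfolding True by (intro tendsto_eq_intros refl) auto
    qed
    then show ?thesis using True by simp
  qed
qed

text \<open>The factor 1/2 is the integral of s over the unit interval; it is the gain that drives
  the contraction for the surface.\<close>

lemma ray_int_bound:
  assumes q: "q \<in> ball 0 r" shows "norm (ray_int G q) \<le> B / 2 * norm q ^ 2"
proof -
  have hi: "((\<lambda>s. B * norm q ^ 2 * s) has_integral B / 2 * norm q ^ 2) {0..1}"
  proof -
    have "((\<lambda>s. B * norm q ^ 2 * s) has_integral (B * norm q ^ 2 * (1\<^sup>2 / 2) - B * norm q ^ 2 * (0\<^sup>2 / 2))) {0..1::real}"
    proof (rule fundamental_theorem_of_calculus)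
      fix s :: real assume "s \<in> {0..1}"
      have "((\<lambda>s. B * norm q ^ 2 * (s\<^sup>2 / 2)) has_field_derivative B * norm q ^ 2 * s) (at s within {0..1})"
        by (auto intro!: derivative_eq_intros)
      then show "((\<lambda>s. B * norm q ^ 2 * (s\<^sup>2 / 2)) has_vector_derivative B * norm q ^ 2 * s) (at s within {0..1})"
        by (rule has_real_derivative_iff_has_vector_derivative[THEN iffD1])
    qed simp
    then show ?thesis by simp
  qed
  have "norm (integral {0..1} (\<lambda>s. inverse s *\<^sub>R G (s *\<^sub>R q))) \<le> integral {0..1} (\<lambda>s. B * norm q ^ 2 * s)"
  proof (rule integral_norm_bound_integral)
    show "(\<lambda>s. inverse s *\<^sub>R G (s *\<^sub>R q)) integrable_on {0..1}" by (rule integrable_continuous_interval[OF ray_cont[OF q]])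
    show "(\<lambda>s. B * norm q ^ 2 * s) integrable_on {0..1}" using hi by blast
    fix s :: real assume s: "s \<in> {0..1}"
    show "norm (inverse s *\<^sub>R G (s *\<^sub>R q)) \<le> B * norm q ^ 2 * s"
    proof (cases "s = 0")
      case False
      then have t0: "s > 0" using s by simp
      have "norm (inverse s *\<^sub>R G (s *\<^sub>R q)) = inverse s * norm (G (s *\<^sub>R q))" using t0 by simp
      also have "\<dots> \<le> inverse s * (B * norm (s *\<^sub>R q) ^ 2)" using t0 by (intro mult_left_mono B scaleR_in_ball[OF s q]) auto
      also have "\<dots> = B * norm q ^ 2 * s" using t0 by (simp add: power2_eq_square)
      finally show ?thesis .
    qed simp
  qed
  then show ?thesis unfolding ray_int_def integral_unique[OF hi] .
qed

text \<open>Differentiating under the integral, the inner factor s cancels 1/s and leaves the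
  continuous kernel \<open>G' (s q)\<close>. In the radial direction \<open>q\<close> this kernel is
  the derivative of \<open>G (s q)\<close> in s, so the fundamental theorem returns
  \<open>G q\<close>.\<close>

lemma ray_int_hmap: "hmap (ball 0 r) (ray_int G)"
  and ray_int_euler: "q \<in> ball 0 r \<Longrightarrow> DM (ray_int G) q q = G q"
proof -
  obtain G' where G': "\<And>p. p \<in> ball 0 r \<Longrightarrow> blinfun_apply (G' p) = DM G p" "continuous_on (ball 0 r) G'"
    using hmap_blinfun[OF G] by blast
  note G0 = quadratic_flat[OF r B]
  \<comment> \<open>At s = 0 the integrand is identically 0 by \<open>inverse 0 = 0\<close>, so the
    kernel has to vanish there for the Leibniz rule to hold at that endpoint too.\<close>
  have G'0: "G' 0 = 0"
    by (rule blinfun_eqI) (use G'(1)[of 0] DM_eq[OF G0(2)] r in simp)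
  have derG: "(G has_derivative blinfun_apply (G' p)) (at p)" if "p \<in> ball 0 r" for p
    using hmap_D(1)[OF G that] G'(1)[OF that] by simp
  have cont2: "continuous_on (ball 0 r \<times> cbox (0::real) 1) (\<lambda>(q, s). G' (s *\<^sub>R q))"
  proof -
    have "continuous_on (ball 0 r \<times> cbox (0::real) 1) (\<lambda>z. G' (snd z *\<^sub>R fst z))"
    proof (rule continuous_on_compose2[OF G'(2)])
      show "(\<lambda>z. snd z *\<^sub>R fst z) ` (ball 0 r \<times> cbox (0::real) 1) \<subseteq> ball (0::C3) r"
      proof (rule image_subsetI)
        fix z :: "C3 \<times> real" assume "z \<in> ball 0 r \<times> cbox 0 1"
        then show "snd z *\<^sub>R fst z \<in> ball 0 r" by (intro scaleR_in_ball) (auto simp del: mem_ball)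
      qed
    qed (intro continuous_intros)
    then show ?thesis by (simp add: case_prod_unfold)
  qed
  have der: "(ray_int G has_derivative blinfun_apply (integral {0..1} (\<lambda>s. G' (s *\<^sub>R q)))) (at q)" if q: "q \<in> ball 0 r" for q
  proof -
    have "((\<lambda>q. integral (cbox 0 1) (\<lambda>s. inverse s *\<^sub>R G (s *\<^sub>R q))) has_derivative
        blinfun_apply (integral (cbox 0 1) ((\<lambda>q s. G' (s *\<^sub>R q)) q))) (at q within ball 0 r)"
    proof (rule leibniz_rule[OF _ _ cont2 q convex_ball])
      fix y :: C3 and s :: real assume y: "y \<in> ball 0 r" and s: "s \<in> cbox 0 1"
      show "((\<lambda>q. inverse s *\<^sub>R G (s *\<^sub>R q)) has_derivative blinfun_apply (G' (s *\<^sub>R y))) (at y within ball 0 r)"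
      proof (cases "s = 0")
        case True
        have "blinfun_apply (G' (s *\<^sub>R y)) = (\<lambda>_. 0)" using True G'0 by (simp add: fun_eq_iff)
        then show ?thesis using True by simp
      next
        case False
        have "((\<lambda>q. s *\<^sub>R q) has_derivative (\<lambda>v. s *\<^sub>R v)) (at y within ball 0 r)" by (auto intro!: derivative_eq_intros)
        from has_derivative_compose[OF this derG[OF scaleR_in_ball[of s y r]]] s y
        have "((\<lambda>q. G (s *\<^sub>R q)) has_derivative (\<lambda>v. blinfun_apply (G' (s *\<^sub>R y)) (s *\<^sub>R v))) (at y within ball 0 r)" by simp
        from has_derivative_scaleR_right[OF this, of "inverse s"] show ?thesis using False by (simp add: blinfun.scaleR_right)
      qed
    next
      show "(\<lambda>s. inverse s *\<^sub>R G (s *\<^sub>R y)) integrable_on cbox 0 1" if "y \<in> ball 0 r" for y :: C3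
        using integrable_continuous_interval[OF ray_cont[OF that]] by simp
    qed
    then show ?thesis unfolding at_within_open[OF q open_ball] cbox_interval ray_int_def[abs_def] .
  qed
  have int: "(\<lambda>s. G' (s *\<^sub>R q)) integrable_on {0..1}" if q: "q \<in> ball 0 r" for q
    by (rule integrable_continuous_interval, rule continuous_on_compose2[OF G'(2)])
      (use scaleR_in_ball[OF _ q] in \<open>auto intro!: continuous_intros\<close>)
  have app: "blinfun_apply (integral {0..1} (\<lambda>s. G' (s *\<^sub>R q))) v = integral {0..1} (\<lambda>s. DM G (s *\<^sub>R q) v)" if q: "q \<in> ball 0 r" for q v
  proof -
    have "blinfun_apply (integral {0..1} (\<lambda>s. G' (s *\<^sub>R q))) v = integral {0..1} (\<lambda>s. blinfun_apply (G' (s *\<^sub>R q)) v)"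
      using integral_linear[OF int[OF q] blinfun.bounded_linear_left[of v]] by (simp add: o_def)
    also have "\<dots> = integral {0..1} (\<lambda>s. DM G (s *\<^sub>R q) v)"
      by (rule integral_cong) (use G'(1) scaleR_in_ball[OF _ q] in auto)
    finally show ?thesis .
  qed
  show "hmap (ball 0 r) (ray_int G)"
  proof (rule hmapI[OF open_ball der])
    fix q v :: C3 and c assume q: "q \<in> ball 0 r"
    have bl: "bounded_linear (cmul3 c)" using bounded_bilinear.bounded_linear_right[OF bounded_bilinear_cmul3] .
    have i: "(\<lambda>s. DM G (s *\<^sub>R q) v) integrable_on {0..1}"
    proof -
      have "(\<lambda>s. blinfun_apply (G' (s *\<^sub>R q)) v) integrable_on {0..1}"
        using integrable_linear[OF int[OF q] blinfun.bounded_linear_left[of v]] by (simp add: o_def)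
      then show ?thesis by (rule integrable_eq) (use G'(1) scaleR_in_ball[OF _ q] in auto)
    qed
    have "integral {0..1} (\<lambda>s. DM G (s *\<^sub>R q) (cmul3 c v)) = integral {0..1} (\<lambda>s. cmul3 c (DM G (s *\<^sub>R q) v))"
      by (rule integral_cong) (rule hmap_D(2)[OF G scaleR_in_ball[OF _ q]])
    also have "\<dots> = cmul3 c (integral {0..1} (\<lambda>s. DM G (s *\<^sub>R q) v))"
      using integral_linear[OF i bl] by (simp add: o_def)
    finally show "blinfun_apply (integral {0..1} (\<lambda>s. G' (s *\<^sub>R q))) (cmul3 c v) = cmul3 c (blinfun_apply (integral {0..1} (\<lambda>s. G' (s *\<^sub>R q))) v)"
      by (simp only: app[OF q])
  qed
  assume q: "q \<in> ball 0 r"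
  have "((\<lambda>s. DM G (s *\<^sub>R q) q) has_integral (G (1 *\<^sub>R q) - G (0 *\<^sub>R q))) {0..1}"
  proof (rule fundamental_theorem_of_calculus)
    fix s :: real assume s: "s \<in> {0..1}"
    have "((\<lambda>s. s *\<^sub>R q) has_derivative (\<lambda>t. t *\<^sub>R q)) (at s within {0..1})" by (auto intro!: derivative_eq_intros)
    from has_derivative_compose[OF this hmap_D(1)[OF G scaleR_in_ball[OF s q]]]
    have "((\<lambda>s. G (s *\<^sub>R q)) has_derivative (\<lambda>t. DM G (s *\<^sub>R q) (t *\<^sub>R q))) (at s within {0..1})" .
    moreover have "DM G (s *\<^sub>R q) (t *\<^sub>R q) = t *\<^sub>R DM G (s *\<^sub>R q) q" for t
      using has_derivative_linear[OF hmap_D(1)[OF G scaleR_in_ball[OF s q]]] by (simp add: linear_scale)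
    ultimately show "((\<lambda>s. G (s *\<^sub>R q)) has_vector_derivative DM G (s *\<^sub>R q) q) (at s within {0..1})"
      by (simp add: has_vector_derivative_def)
  qed simp
  then have "integral {0..1} (\<lambda>s. DM G (s *\<^sub>R q) q) = G q" using G0(1) by (simp add: integral_unique)
  then show "DM (ray_int G) q q = G q" using DM_eq[OF der[OF q]] app[OF q] by simp
qed

end

lemma hmap_diff:
  assumes "hmap W F" "hmap W G" shows "hmap W (\<lambda>p. F p - G p)"
proof (rule hmapI)
  show "open W" using assms by (simp add: hmap_def)
  show "((\<lambda>p. F p - G p) has_derivative (\<lambda>v. DM F p v - DM G p v)) (at p)" if "p \<in> W" for p
    by (intro has_derivative_diff hmap_D(1)[OF assms(1) that] hmap_D(1)[OF assms(2) that])
  show "DM F p (cmul3 c v) - DM G p (cmul3 c v) = cmul3 c (DM F p v - DM G p v)" if "p \<in> W" for p c v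
    using hmap_D(2)[OF assms(1) that] hmap_D(2)[OF assms(2) that] by (simp add: cmul3_def algebra_simps)
qed

lemma ray_int_diff_bound:
  assumes F: "hmap (ball 0 r) F" "\<And>q. q \<in> ball 0 r \<Longrightarrow> norm (F q) \<le> B * norm q ^ 2"
    and G: "hmap (ball 0 r) G" "\<And>q. q \<in> ball 0 r \<Longrightarrow> norm (G q) \<le> B * norm q ^ 2"
    and d: "\<And>q. q \<in> ball 0 r \<Longrightarrow> norm (F q - G q) \<le> K * norm q ^ 2" and r: "r > 0" and q: "q \<in> ball 0 r"
  shows "norm (ray_int F q - ray_int G q) \<le> K / 2 * norm q ^ 2"
proof -
  have iF: "(\<lambda>s. inverse s *\<^sub>R F (s *\<^sub>R q)) integrable_on {0..1}" by (rule integrable_continuous_interval[OF ray_cont[OF F(1) r F(2) q]])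
  have iG: "(\<lambda>s. inverse s *\<^sub>R G (s *\<^sub>R q)) integrable_on {0..1}" by (rule integrable_continuous_interval[OF ray_cont[OF G(1) r G(2) q]])
  have "ray_int F q - ray_int G q = ray_int (\<lambda>q. F q - G q) q"
    unfolding ray_int_def using integral_diff[OF iF iG] by (simp add: scaleR_right_diff_distrib)
  also have "norm \<dots> \<le> K / 2 * norm q ^ 2"
    by (rule ray_int_bound[OF hmap_diff[OF F(1) G(1)] r d q])
  finally show ?thesis .
qed

lemma hmap_uniform_limit:
  assumes h: "\<And>n::nat. hmap W (F n)" and u: "uniform_limit W F G sequentially"
  shows "hmap W G"
proof -
  have c: "uniform_limit W (\<lambda>n p. L (F n p)) (\<lambda>p. L (G p)) sequentially" if "bounded_linear L" for L :: "C3 \<Rightarrow> complex"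
    by (rule bounded_linear.uniform_limit[OF that u])
  have "holo3 W (\<lambda>p. fst (G p))"
    by (rule holo3_uniform_limit[OF hmap_components(1)[OF h]]) (rule c[OF bounded_linear_fst])
  moreover have "holo3 W (\<lambda>p. fst (snd (G p)))"
    by (rule holo3_uniform_limit[OF hmap_components(2)[OF h]]) (rule c[OF bounded_linear_fst_comp[OF bounded_linear_snd]])
  moreover have "holo3 W (\<lambda>p. snd (snd (G p)))"
    by (rule holo3_uniform_limit[OF hmap_components(3)[OF h]]) (rule c[OF bounded_linear_snd_comp[OF bounded_linear_snd]])
  ultimately have "hmap W (\<lambda>p. (fst (G p), fst (snd (G p)), snd (snd (G p))))" by (rule hmap_triple(1))
  then show ?thesis by simp
qed

section \<open>Existence of the invariant surface\<close>

lemma norm_mid_le: "norm (fst (snd w)) \<le> norm (w :: C3)"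
  by (cases w) (auto intro: order_trans[OF norm_fst_le norm_snd_le])

lemma surf_cmI:
  assumes "0 \<in> S" and G: "open U" "0 \<in> U" "holo3 U G" "S \<inter> U = {p \<in> U. G p = 0}"
    "\<forall>p\<in>U. surj (D3 G p)" "{v. D3 G 0 v = 0} = E" "\<forall>p \<in> S \<inter> U. D3 G p (V p) = 0"
  shows "surf_cm V E S"
  unfolding surf_cm_def
  by (rule conjI[OF assms(1)], rule exI[of _ U], rule exI[of _ G],
      rule conjI[OF G(1) conjI[OF G(2) conjI[OF G(3) conjI[OF G(4) conjI[OF G(5) conjI[OF G(6,7)]]]]]])

text \<open>\<open>\<Phi>\<close> conjugates the field to the scaling field \<open>l q\<close> on the plane \<open>y = 0\<close>. The unknown \<open>w\<close> below is the
  quadratic remainder of \<open>\<Phi>\<close>, with the \<open>y\<close>-component divided by \<open>k = l/4\<close> so that the nilpotent part of the linear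
  field becomes small.\<close>

lemma linearizing_surface:
  assumes l: "l \<noteq> 0" and W: "0 \<in> W" and hf: "holo3 W f" and hg: "holo3 W g" and hh: "holo3 W h"
    and z: "f 0 = 0" "g 0 = 0" "h 0 = 0" and Df: "(f has_derivative (\<lambda>_. 0)) (at 0)" and Dg: "(g has_derivative (\<lambda>_. 0)) (at 0)"
    and Dh: "(h has_derivative (\<lambda>_. 0)) (at 0)"
  obtains r \<Phi> where "r > 0" "hmap (ball 0 r) \<Phi>" "\<Phi> 0 = 0" "\<And>v. DM \<Phi> 0 v = (fst v, 0, snd (snd v))"
    "\<And>q. q \<in> ball 0 r \<Longrightarrow> \<Phi> q \<in> W"
    "\<And>q. q \<in> ball 0 r \<Longrightarrow> DM \<Phi> q (cmul3 l q) = (l * fst (\<Phi> q) + fst (snd (\<Phi> q)) + f (\<Phi> q), l * fst (snd (\<Phi> q)) + g (\<Phi> q), l * snd (snd (\<Phi> q)) + h (\<Phi> q))"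
proof -
  define k where "k = l / 4"
  have k: "k \<noteq> 0" using l by (simp add: k_def)
  obtain rf Cf where F: "rf > 0" "Cf \<ge> 0" "ball 0 rf \<subseteq> W"
    "\<And>d p q. d \<le> rf \<Longrightarrow> p \<in> ball 0 d \<Longrightarrow> q \<in> ball 0 d \<Longrightarrow> norm (f p - f q) \<le> Cf * d * norm (p - q)"
    "\<And>p. p \<in> ball 0 rf \<Longrightarrow> norm (f p) \<le> Cf * norm p ^ 2" using holo3_flat_bounds[OF hf W z(1) Df] by blast
  obtain rg Cg where Gb: "rg > 0" "Cg \<ge> 0" "ball 0 rg \<subseteq> W"
    "\<And>d p q. d \<le> rg \<Longrightarrow> p \<in> ball 0 d \<Longrightarrow> q \<in> ball 0 d \<Longrightarrow> norm (g p - g q) \<le> Cg * d * norm (p - q)"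
    "\<And>p. p \<in> ball 0 rg \<Longrightarrow> norm (g p) \<le> Cg * norm p ^ 2" using holo3_flat_bounds[OF hg W z(2) Dg] by blast
  obtain rh Ch where H: "rh > 0" "Ch \<ge> 0" "ball 0 rh \<subseteq> W"
    "\<And>d p q. d \<le> rh \<Longrightarrow> p \<in> ball 0 d \<Longrightarrow> q \<in> ball 0 d \<Longrightarrow> norm (h p - h q) \<le> Ch * d * norm (p - q)"
    "\<And>p. p \<in> ball 0 rh \<Longrightarrow> norm (h p) \<le> Ch * norm p ^ 2" using holo3_flat_bounds[OF hh W z(3) Dh] by blast
  \<comment> \<open>The nonlinear part of the field divided by \<open>l\<close>; its second entry is
    divided by \<open>k\<close> as well, because the y-component of the map is \<open>k\<close>
    times that of the unknown.\<close>
  define N where "N = (\<lambda>p. (inverse l * f p, inverse (l * k) * g p, inverse l * h p))"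
  define rN where "rN = min rf (min rg rh)"
  define C where "C = norm (inverse l) * Cf + norm (inverse (l * k)) * Cg + norm (inverse l) * Ch"
  have rN: "rN > 0" and C: "C \<ge> 0" using F(1,2) Gb(1,2) H(1,2) by (auto simp: rN_def C_def)
  have NW: "ball 0 rN \<subseteq> W" using F(3) by (auto simp: rN_def)
  have Nb: "norm (N p) \<le> C * norm p ^ 2" if "p \<in> ball 0 rN" for p
  proof -
    have "norm (N p) \<le> norm (inverse l) * norm (f p) + norm (inverse (l * k)) * norm (g p) + norm (inverse l) * norm (h p)"
      unfolding N_def using norm3_le by (metis norm_mult)
    also have "\<dots> \<le> norm (inverse l) * (Cf * norm p ^ 2) + norm (inverse (l * k)) * (Cg * norm p ^ 2) + norm (inverse l) * (Ch * norm p ^ 2)"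
      using that by (intro add_mono mult_left_mono F(5) Gb(5) H(5)) (auto simp: rN_def)
    finally show ?thesis by (simp add: C_def algebra_simps)
  qed
  have NL: "norm (N p - N q) \<le> C * d * norm (p - q)" if "d \<le> rN" "p \<in> ball 0 d" "q \<in> ball 0 d" for d p q
  proof -
    have "N p - N q = (inverse l * (f p - f q), inverse (l * k) * (g p - g q), inverse l * (h p - h q))"
      unfolding N_def by (simp only: diff_Pair right_diff_distrib)
    then have "norm (N p - N q) \<le> norm (inverse l) * norm (f p - f q) + norm (inverse (l * k)) * norm (g p - g q) + norm (inverse l) * norm (h p - h q)"
      using norm3_le by (metis norm_mult)
    also have "\<dots> \<le> norm (inverse l) * (Cf * d * norm (p - q)) + norm (inverse (l * k)) * (Cg * d * norm (p - q)) + norm (inverse l) * (Ch * d * norm (p - q))"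
      using that by (intro add_mono mult_left_mono F(4) Gb(4) H(4)) (auto simp: rN_def)
    finally show ?thesis by (simp add: C_def algebra_simps)
  qed
  have hN: "hmap W N" unfolding N_def
    by (intro hmap_triple(1) holo3_mult holo3_const holo3_open[OF hf] hf hg hh)
  \<comment> \<open>Reassembles the map: the inclusion of the plane y = 0 plus the remainder
    \<open>w\<close> with its y-component scaled back.\<close>
  define D where "D = (\<lambda>(q :: C3) (w :: C3). (fst q + fst w, k * fst (snd w), snd (snd q) + snd (snd w)))"
  define c where "c = 1 + norm k"
  have c: "c \<ge> 1" by (simp add: c_def)
  have Dw: "norm (D q w - D q w') \<le> c * norm (w - w')" for q w w'
  proof -
    let ?u = "w - w'"
    have "D q w - D q w' = (fst ?u, k * fst (snd ?u), snd (snd ?u))"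
      by (simp add: D_def algebra_simps)
    also have "\<dots> = (fst ?u, 0, snd (snd ?u)) + (0, k * fst (snd ?u), 0)" by simp
    also have "norm \<dots> \<le> norm (fst ?u, 0::complex, snd (snd ?u)) + norm (0::complex, k * fst (snd ?u), 0::complex)" by (rule norm_triangle_ineq)
    also have "norm (fst ?u, 0::complex, snd (snd ?u)) \<le> norm ?u" by (cases ?u) (simp add: norm_Pair)
    also have "norm (0::complex, k * fst (snd ?u), 0::complex) = norm k * norm (fst (snd ?u))" by (simp add: norm_Pair norm_mult)
    also have "\<dots> \<le> norm k * norm ?u" by (intro mult_left_mono norm_mid_le) auto
    finally show ?thesis by (simp add: c_def algebra_simps)
  qed
  have D0: "norm (D q 0) \<le> norm q" for q by (cases q) (simp add: D_def norm_Pair)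
  have Db: "norm (D q w) \<le> norm q + c * norm w" for q w
    using Dw[of q w 0] D0[of q] norm_triangle_sub[of "D q w" "D q 0"] by simp
  \<comment> \<open>The linear part of the equation for \<open>w\<close>. The nilpotent entry y/l
    appears as k/l = 1/4 times the second component, so \<open>L\<close> has norm at most 5/4, well
    below the bound 2 that halving along rays can absorb.\<close>
  define L where "L = (\<lambda>w :: C3. (fst w + fst (snd w) / 4, fst (snd w), snd (snd w)))"
  have Lb: "norm (L w) \<le> 5/4 * norm w" for w
  proof -
    have "L w = w + (fst (snd w) / 4, 0, 0)" by (cases w) (simp add: L_def)
    then have "norm (L w) \<le> norm w + norm (fst (snd w) / 4, 0::complex, 0::complex)" by (metis norm_triangle_ineq)
    also have "norm (fst (snd w) / 4, 0::complex, 0::complex) = norm (fst (snd w)) / 4" by (simp add: norm_Pair norm_divide)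
    also have "\<dots> \<le> norm w / 4" by (intro divide_right_mono norm_mid_le) auto
    finally show ?thesis by simp
  qed
  have Ld: "L w - L w' = L (w - w')" for w w' by (simp add: L_def diff_divide_distrib)
  \<comment> \<open>The right side is bounded by \<open>5/4 * A + 4 * C\<close> times
    \<open>norm q ^ 2\<close>. This choice makes that at most \<open>2 * A\<close>, which the
    integration along rays halves back to \<open>A\<close>.\<close>
  define A where "A = 8 * C + 1"
  have A: "A > 0" using C by (simp add: A_def)
  \<comment> \<open>The three bounds serve in turn to keep the image in the domain of
    \<open>N\<close>, to make the remainder at most \<open>norm q\<close> so that the image is at
    most \<open>2 * norm q\<close>, and to limit the Lipschitz constant of the nonlinear term to
    1/4.\<close>
  define r where "r = min (min (rN / 3) (1 / (c * A))) (1 / (12 * (C + 1) * c))"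
  have r: "r > 0" using rN c A C by (simp add: r_def)
  have rA: "c * (A * norm q ^ 2) \<le> norm q" if "q \<in> ball 0 r" for q
  proof -
    have "c * A * norm q \<le> c * A * (1 / (c * A))" using that c A by (intro mult_left_mono) (auto simp: r_def)
    also have "\<dots> = 1" using c A by simp
    finally have "c * A * norm q * norm q \<le> 1 * norm q" by (intro mult_right_mono) auto
    then show ?thesis by (simp add: power2_eq_square mult.assoc)
  qed
  have D2: "norm (D q w) \<le> 2 * norm q" "D q w \<in> ball 0 (3 * r)" "D q w \<in> ball 0 rN"
    if "q \<in> ball 0 r" "norm w \<le> A * norm q ^ 2" for q w
  proof -
    have "c * norm w \<le> c * (A * norm q ^ 2)" using that(2) c by (intro mult_left_mono) auto
    then show a: "norm (D q w) \<le> 2 * norm q" using Db[of q w] rA[OF that(1)] by linarith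
    then show "D q w \<in> ball 0 (3 * r)" using that(1) r by simp
    then show "D q w \<in> ball 0 rN" by (auto simp: r_def)
  qed
  define G where "G = (\<lambda>w q. L (w q) + N (D q (w q)))"
  define X where "X = {w. hmap (ball 0 r) w \<and> (\<forall>q\<in>ball 0 r. norm (w q) \<le> A * norm q ^ 2)}"
  have Xb: "norm (w q) \<le> A * norm q ^ 2" if "w \<in> X" "q \<in> ball 0 r" for w q using that unfolding X_def by blast
  have hG: "hmap (ball 0 r) (G w)" if w: "w \<in> X" for w
  proof -
    have hw: "holo3 (ball 0 r) (\<lambda>q. fst (w q))" "holo3 (ball 0 r) (\<lambda>q. fst (snd (w q)))" "holo3 (ball 0 r) (\<lambda>q. snd (snd (w q)))"
      using w hmap_components[of "ball 0 r" w] by (auto simp: X_def)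
    have hD: "hmap (ball 0 r) (\<lambda>q. D q (w q))" unfolding D_def
      by (intro hmap_triple(1) holo3_add holo3_mult holo3_const holo3_fst holo3_snd_snd open_ball hw)
    have sub: "D q (w q) \<in> W" if "q \<in> ball 0 r" for q using D2(3)[OF that Xb[OF w that]] NW by blast
    have hNc: "holo3 (ball 0 r) (\<lambda>q. fst (N (D q (w q))))" "holo3 (ball 0 r) (\<lambda>q. fst (snd (N (D q (w q)))))" "holo3 (ball 0 r) (\<lambda>q. snd (snd (N (D q (w q)))))"
      using hmap_components[OF hN] by (auto intro: holo3_compose_hmap(1)[OF _ hD sub])
    have "hmap (ball 0 r) (\<lambda>q. (fst (w q) + fst (snd (w q)) * (1/4) + fst (N (D q (w q))), fst (snd (w q)) + fst (snd (N (D q (w q)))), snd (snd (w q)) + snd (snd (N (D q (w q))))))"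
      by (intro hmap_triple(1) holo3_add holo3_mult holo3_const open_ball hw hNc)
    moreover have "(\<lambda>q. (fst (w q) + fst (snd (w q)) * (1/4) + fst (N (D q (w q))), fst (snd (w q)) + fst (snd (N (D q (w q)))), snd (snd (w q)) + snd (snd (N (D q (w q)))))) = G w"
      by (auto simp: G_def L_def prod_eq_iff)
    ultimately show ?thesis by simp
  qed
  have Gbd: "norm (G w q) \<le> (2 * A) * norm q ^ 2" if w: "w \<in> X" and q: "q \<in> ball 0 r" for w q
  proof -
    have "norm (G w q) \<le> norm (L (w q)) + norm (N (D q (w q)))" unfolding G_def by (rule norm_triangle_ineq)
    also have "\<dots> \<le> 5/4 * norm (w q) + C * norm (D q (w q)) ^ 2" by (intro add_mono Lb Nb D2(3)[OF q Xb[OF w q]])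
    also have "\<dots> \<le> 5/4 * (A * norm q ^ 2) + C * (2 * norm q) ^ 2"
      using C by (intro add_mono mult_left_mono power_mono D2(1)[OF q Xb[OF w q]] Xb[OF w q]) auto
    also have "\<dots> = (5/4 * A + 4 * C) * norm q ^ 2" by (simp add: power_mult_distrib algebra_simps)
    also have "\<dots> \<le> (2 * A) * norm q ^ 2" using C by (intro mult_right_mono) (auto simp: A_def)
    finally show ?thesis .
  qed
  \<comment> \<open>The constant is 5/4 from \<open>L\<close> plus 1/4 from \<open>N\<close>;
    halving along rays gives the contraction factor 3/4.\<close>
  have Gd: "norm (G u q - G v q) \<le> 3/2 * norm (u q - v q)" if u: "u \<in> X" and v: "v \<in> X" and q: "q \<in> ball 0 r" for u v q
  proof -
    have "G u q - G v q = L (u q - v q) + (N (D q (u q)) - N (D q (v q)))" by (simp add: G_def flip: Ld)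
    then have "norm (G u q - G v q) \<le> norm (L (u q - v q)) + norm (N (D q (u q)) - N (D q (v q)))" by (metis norm_triangle_ineq)
    also have "\<dots> \<le> 5/4 * norm (u q - v q) + C * (3 * r) * norm (D q (u q) - D q (v q))"
      by (intro add_mono Lb NL D2(2)[OF q Xb[OF u q]] D2(2)[OF q Xb[OF v q]]) (simp add: r_def)
    also have "\<dots> \<le> 5/4 * norm (u q - v q) + C * (3 * r) * (c * norm (u q - v q))"
      using C r by (intro add_mono order_refl mult_left_mono Dw) auto
    also have "C * (3 * r) * (c * norm (u q - v q)) \<le> 1/4 * norm (u q - v q)"
    proof -
      have "C * (3 * r) * c \<le> (C + 1) * (3 * r) * c" using r c by (intro mult_right_mono) auto
      also have "\<dots> \<le> (C + 1) * (3 * (1 / (12 * (C + 1) * c))) * c" using C c by (intro mult_right_mono mult_left_mono) (auto simp: r_def)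
      also have "\<dots> = 1/4"
      proof -
        have "a * (3 * (1 / (12 * a * b))) * b = 1/4" if "a \<noteq> 0" "b \<noteq> 0" for a b :: real
          using that by (simp add: field_simps)
        then show ?thesis using C c by simp
      qed
      finally have "C * (3 * r) * c * norm (u q - v q) \<le> 1/4 * norm (u q - v q)" by (intro mult_right_mono) auto
      then show ?thesis by (simp add: mult.assoc)
    qed
    finally show ?thesis by simp
  qed
  obtain w where w: "w \<in> X" "\<And>q. q \<in> ball 0 r \<Longrightarrow> ray_int (G w) q = w q"
  proof (rule picard_fixed_point[where \<theta>="3/4" and B="ball 0 r" and \<rho>="\<lambda>q::C3. norm q ^ 2" and R="r^2" and wz="\<lambda>_. 0" and X=X and T="\<lambda>w. ray_int (G w)" and Kz=A])
    show w0: "(\<lambda>_. 0) \<in> X"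
      using A by (auto simp: X_def intro!: hmapI[where L="\<lambda>_ _. 0"])
    show TX: "ray_int (G w) \<in> X" if w: "w \<in> X" for w
      unfolding X_def
    proof (intro CollectI conjI ballI)
      show "hmap (ball 0 r) (ray_int (G w))" by (rule ray_int_hmap[OF hG[OF w] r Gbd[OF w]])
      show "norm (ray_int (G w) q) \<le> A * norm q ^ 2" if "q \<in> ball 0 r" for q
        using ray_int_bound[OF hG[OF w] r Gbd[OF w] that] by simp
    qed
    show "norm (ray_int (G (\<lambda>_. 0)) q - 0) \<le> A * norm q ^ 2" if "q \<in> ball 0 r" for q
      using Xb[OF TX[OF w0] that] by simp
    show "norm (ray_int (G u) q - ray_int (G v) q) \<le> 3/4 * K * norm q ^ 2"
      if u: "u \<in> X" and v: "v \<in> X" and K: "K \<ge> 0" "\<And>q. q \<in> ball 0 r \<Longrightarrow> norm (u q - v q) \<le> K * norm q ^ 2" and q: "q \<in> ball 0 r" for u v K q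
    proof -
      have "norm (G u q - G v q) \<le> (3/2 * K) * norm q ^ 2" if q: "q \<in> ball 0 r" for q
        using Gd[OF u v q] K(2)[OF q] by simp
      from ray_int_diff_bound[OF hG[OF u] Gbd[OF u] hG[OF v] Gbd[OF v] this r q] show ?thesis by simp
    qed
    show "w \<in> X" if s: "\<And>n. s n \<in> X" and lim: "uniform_limit (ball 0 r) s w sequentially" for s w
      unfolding X_def
    proof (intro CollectI conjI ballI)
      show "hmap (ball 0 r) w" by (rule hmap_uniform_limit[OF _ lim]) (use s in \<open>auto simp: X_def\<close>)
      show "norm (w q) \<le> A * norm q ^ 2" if "q \<in> ball 0 r" for q
        by (rule Lim_bounded[OF tendsto_norm[OF tendsto_uniform_limitI[OF lim that]], of 0]) (use Xb[OF s that] in auto)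
    qed
  qed (auto intro: power_mono)
  have hw: "hmap (ball 0 r) w" using w(1) by (simp add: X_def)
  define \<Phi> where "\<Phi> = (\<lambda>q. D q (w q))"
  have hwc: "holo3 (ball 0 r) (\<lambda>q. fst (w q))" "holo3 (ball 0 r) (\<lambda>q. fst (snd (w q)))" "holo3 (ball 0 r) (\<lambda>q. snd (snd (w q)))"
    using hmap_components[OF hw] by auto
  have h\<Phi>: "hmap (ball 0 r) \<Phi>" unfolding D_def \<Phi>_def
    by (intro hmap_triple(1) holo3_add holo3_mult holo3_const holo3_fst holo3_snd_snd open_ball hwc)
  have D\<Phi>: "DM \<Phi> q v = D v (DM w q v)" if q: "q \<in> ball 0 r" for q v
  proof -
    have "(\<Phi> has_derivative (\<lambda>v. (fst v + fst (DM w q v), k * fst (snd (DM w q v)), snd (snd v) + snd (snd (DM w q v))))) (at q)"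
      unfolding D_def \<Phi>_def
      by (intro has_derivative_Pair has_derivative_add has_derivative_fst has_derivative_snd has_derivative_ident has_derivative_mult_right hmap_D(1)[OF hw q])
    from DM_eq[OF this] show ?thesis by (simp add: D_def)
  qed
  have w0: "w 0 = 0" "DM w 0 = (\<lambda>_. 0)"
    using quadratic_flat[OF r Xb[OF w(1)]] DM_eq by auto
  show thesis
  proof (rule that[OF r h\<Phi>])
    show "\<Phi> 0 = 0" by (simp add: \<Phi>_def D_def w0 flip: zero_prod_def)
    show "DM \<Phi> 0 v = (fst v, 0, snd (snd v))" for v using D\<Phi>[of 0 v] r by (simp add: w0 D_def)
    show "\<Phi> q \<in> W" if "q \<in> ball 0 r" for q
      using D2(3)[OF that Xb[OF w(1) that]] NW by (auto simp: \<Phi>_def)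
    fix q :: C3 assume q: "q \<in> ball 0 r"
    \<comment> \<open>The fixed point equation is differentiated radially; it holds on the whole
      open ball, so the derivatives agree as well.\<close>
    have e: "DM w q q = G w q"
    proof -
      have "(ray_int (G w) has_derivative DM (ray_int (G w)) q) (at q)" by (rule hmap_D(1)[OF ray_int_hmap[OF hG[OF w(1)] r Gbd[OF w(1)]] q])
      then have "(w has_derivative DM (ray_int (G w)) q) (at q)"
        by (rule has_derivative_transform_within_open[OF _ open_ball q]) (rule w(2))
      then have "DM w q = DM (ray_int (G w)) q" by (rule DM_eq)
      then show ?thesis using ray_int_euler[OF hG[OF w(1)] r Gbd[OF w(1)] q] by simp
    qed
    have p: "N (\<Phi> q) = (inverse l * f (\<Phi> q), inverse (l * k) * g (\<Phi> q), inverse l * h (\<Phi> q))" by (simp add: N_def)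
    have "DM \<Phi> q (cmul3 l q) = cmul3 l (DM \<Phi> q q)" by (rule hmap_D(2)[OF h\<Phi> q])
    also have "DM \<Phi> q q = D q (G w q)" using D\<Phi>[OF q, of q] e by simp
    also have "D q (G w q) = (fst q + (fst (w q) + fst (snd (w q)) / 4 + inverse l * f (\<Phi> q)), k * (fst (snd (w q)) + inverse (l * k) * g (\<Phi> q)),
        snd (snd q) + (snd (snd (w q)) + inverse l * h (\<Phi> q)))"
    proof -
      have "G w q = L (w q) + N (\<Phi> q)" by (simp add: G_def \<Phi>_def)
      then show ?thesis unfolding p by (simp add: D_def L_def)
    qed
    also have "cmul3 l \<dots> = (l * (fst q + fst (w q)) + k * fst (snd (w q)) + f (\<Phi> q), l * (k * fst (snd (w q))) + g (\<Phi> q), l * (snd (snd q) + snd (snd (w q))) + h (\<Phi> q))"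
      using l k by (simp add: k_def algebra_simps)
    also have "\<dots> = (l * fst (\<Phi> q) + fst (snd (\<Phi> q)) + f (\<Phi> q), l * fst (snd (\<Phi> q)) + g (\<Phi> q), l * snd (snd (\<Phi> q)) + h (\<Phi> q))"
      by (simp add: \<Phi>_def D_def)
    finally show "DM \<Phi> q (cmul3 l q) = (l * fst (\<Phi> q) + fst (snd (\<Phi> q)) + f (\<Phi> q), l * fst (snd (\<Phi> q)) + g (\<Phi> q), l * snd (snd (\<Phi> q)) + h (\<Phi> q))" .
  qed
qed

text \<open>The parametrisation of the surface is thickened to a local biholomorphism of the ambient
  space. Its inverse supplies a defining function, namely the y-coordinate, and carries the surface
  to the plane, where the field is the linear one \<open>l q\<close>.\<close>

lemma surface_exists:
  fixes \<omega> :: real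
  assumes \<omega>: "\<omega> \<noteq> 0" and W: "0 \<in> W" and hf: "holo3 W f" and hg: "holo3 W g" and hh: "holo3 W h"
    and z: "f 0 = 0" "g 0 = 0" "h 0 = 0" and Df: "(f has_derivative (\<lambda>_. 0)) (at 0)" and Dg: "(g has_derivative (\<lambda>_. 0)) (at 0)"
    and Dh: "(h has_derivative (\<lambda>_. 0)) (at 0)"
  defines "V \<equiv> field3 (sysP \<omega> f) (sysQ \<omega> g) (sysR \<omega> h)"
  shows "\<exists>S. surf_cm V xzplane S \<and> iso_family V W S (2 * pi / \<bar>\<omega>\<bar>)"
proof -
  define l where "l = \<i> * of_real \<omega>"
  have l: "l \<noteq> 0" using \<omega> by (simp add: l_def)
  obtain r \<Phi> where r: "r > 0" and h\<Phi>: "hmap (ball 0 r) \<Phi>" and \<Phi>0: "\<Phi> 0 = 0" "\<And>v. DM \<Phi> 0 v = (fst v, 0, snd (snd v))"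
    and \<Phi>W: "\<And>q. q \<in> ball 0 r \<Longrightarrow> \<Phi> q \<in> W"
    and eqv: "\<And>q. q \<in> ball 0 r \<Longrightarrow> DM \<Phi> q (cmul3 l q) = (l * fst (\<Phi> q) + fst (snd (\<Phi> q)) + f (\<Phi> q), l * fst (snd (\<Phi> q)) + g (\<Phi> q), l * snd (snd (\<Phi> q)) + h (\<Phi> q))"
    by (rule linearizing_surface[OF l W hf hg hh z Df Dg Dh], rule that)
  have eqV: "DM \<Phi> q (cmul3 l q) = V (\<Phi> q)" if "q \<in> ball 0 r" for q
    using eqv[OF that] by (simp add: V_def field3_def sysP_def sysQ_def sysR_def l_def)
  define pr :: "C3 \<Rightarrow> C3" where "pr = (\<lambda>p. (fst p, 0, snd (snd p)))"
  have prb: "pr p \<in> ball 0 r" if "p \<in> ball 0 r" for p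
  proof -
    have "norm (pr p) \<le> norm p" by (cases p) (simp add: pr_def norm_Pair)
    then show ?thesis using that by simp
  qed
  have dpr: "(pr has_derivative pr) (at p)" for p unfolding pr_def
    by (intro has_derivative_Pair has_derivative_fst has_derivative_snd has_derivative_ident has_derivative_const)
  \<comment> \<open>Moving in the y-direction off the image of the plane gives a map whose
    derivative at 0 is the identity.\<close>
  define \<Theta> where "\<Theta> = (\<lambda>q. \<Phi> (pr q) + (0, fst (snd q), 0))"
  have d\<Theta>: "(\<Theta> has_derivative (\<lambda>v. DM \<Phi> (pr q) (pr v) + (0, fst (snd v), 0))) (at q)" if q: "q \<in> ball 0 r" for q
    unfolding \<Theta>_def
    by (intro has_derivative_add has_derivative_compose[OF dpr hmap_D(1)[OF h\<Phi> prb[OF q]]] has_derivative_Pair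
        has_derivative_fst has_derivative_snd has_derivative_ident has_derivative_const)
  have D\<Theta>: "DM \<Theta> q v = DM \<Phi> (pr q) (pr v) + (0, fst (snd v), 0)" if "q \<in> ball 0 r" for q v
    using DM_eq[OF d\<Theta>[OF that]] by simp
  have h\<Theta>: "hmap (ball 0 r) \<Theta>"
  proof (rule hmapI[OF open_ball d\<Theta>])
    fix q v :: C3 and c assume q: "q \<in> ball 0 r"
    have "pr (cmul3 c v) = cmul3 c (pr v)" by (simp add: pr_def cmul3_def)
    then show "DM \<Phi> (pr q) (pr (cmul3 c v)) + (0, fst (snd (cmul3 c v)), 0) = cmul3 c (DM \<Phi> (pr q) (pr v) + (0, fst (snd v), 0))"
      using hmap_D(2)[OF h\<Phi> prb[OF q]] by (simp add: cmul3_def algebra_simps)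
  qed
  have r0: "0 \<in> ball 0 r" using r by simp
  have pr0: "pr 0 = 0" by (simp add: pr_def zero_prod_def)
  have id0: "DM \<Theta> 0 v = v" for v
    unfolding D\<Theta>[OF r0] pr0 \<Phi>0(2) by (cases v) (simp add: pr_def)
  have \<Theta>0: "\<Theta> 0 = 0" by (simp add: \<Theta>_def pr0 \<Phi>0(1) flip: zero_prod_def)
  obtain U Y gi where U: "open U" "U \<subseteq> ball 0 r" "0 \<in> U" "open Y" "\<Theta> 0 \<in> Y" "homeomorphism U Y \<Theta> gi" "hmap Y gi"
    and injU: "\<And>p. p \<in> U \<Longrightarrow> inj (DM \<Theta> p)" and Dgi: "\<And>q v. q \<in> Y \<Longrightarrow> DM \<Theta> (gi q) (DM gi q v) = v"
  proof (rule hmap_local_inverse[OF h\<Theta> r0])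
    show "v = 0" if "DM \<Theta> 0 v = 0" for v using that id0 by simp
  qed (rule that)
  have gF: "gi (\<Theta> p) = p" "\<Theta> p \<in> Y" if "p \<in> U" for p using U(6) that by (auto simp: homeomorphism_def)
  have Fg: "\<Theta> (gi q) = q" "gi q \<in> U" if "q \<in> Y" for q using U(6) that by (auto simp: homeomorphism_def)
  have Dgi2: "DM gi p (DM \<Theta> (gi p) v) = v" if "p \<in> Y" for p v
    by (rule inj_linear_eq[OF injU[OF Fg(2)[OF that]]]) (rule Dgi[OF that])
  have Y0: "0 \<in> Y" using U(5) \<Theta>0 by simp
  have gi0: "gi 0 = 0" using gF(1)[OF U(3)] \<Theta>0 by simp
  define G where "G = (\<lambda>p. fst (snd (gi p)))"
  have hG: "holo3 Y G" unfolding G_def by (rule hmap_components(2)[OF U(7)])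
  have DG: "D3 G p v = fst (snd (DM gi p v))" if "p \<in> Y" for p v
  proof -
    have "(G has_derivative (\<lambda>v. fst (snd (DM gi p v)))) (at p)" unfolding G_def
      by (intro has_derivative_fst has_derivative_snd hmap_D(1)[OF U(7) that])
    from D3_eq[OF this] show ?thesis by simp
  qed
  define S where "S = {p \<in> Y. G p = 0}"
  \<comment> \<open>Only on the plane y = 0 does the thickened map carry the linear field to the
    given one; there it coincides with \<open>\<Phi>\<close>.\<close>
  have flow: "DM \<Theta> u (cmul3 l u) = V (\<Theta> u)" if "u \<in> U" "fst (snd u) = 0" for u
  proof -
    have ub: "u \<in> ball 0 r" using that U(2) by blast
    have pu: "pr u = u" using that(2) by (cases u) (simp add: pr_def)
    have pu2: "pr (cmul3 l u) = cmul3 l u" using that(2) by (cases u) (simp add: pr_def)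
    have "\<Theta> u = \<Phi> u" using that(2) pu by (simp add: \<Theta>_def flip: zero_prod_def)
    then show ?thesis using eqV[OF ub] that(2) unfolding D\<Theta>[OF ub] pu pu2 by (simp add: cmul3_def flip: zero_prod_def)
  qed
  have "surf_cm V xzplane S"
  proof (rule surf_cmI[where U=Y and G=G])
    show "0 \<in> S" using Y0 gi0 by (simp add: S_def G_def)
    show "S \<inter> Y = {p \<in> Y. G p = 0}" by (auto simp: S_def)
    show "\<forall>p\<in>Y. surj (D3 G p)"
    proof
      fix p assume p: "p \<in> Y"
      show "surj (D3 G p)"
        by (rule surjI[where f="\<lambda>y. DM \<Theta> (gi p) (0, y, 0)"]) (simp add: DG[OF p] Dgi2[OF p])
    qed
    have "DM gi 0 v = v" for v using Dgi[OF Y0, of v] gi0 id0 by simp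
    then show "{v. D3 G 0 v = 0} = xzplane" unfolding DG[OF Y0] by (auto simp: xzplane_def)
    show "\<forall>p\<in>S \<inter> Y. D3 G p (V p) = 0"
    proof
      fix p assume "p \<in> S \<inter> Y"
      then have p: "p \<in> Y" "fst (snd (gi p)) = 0" by (auto simp: S_def G_def)
      have "V p = DM \<Theta> (gi p) (cmul3 l (gi p))" using flow[OF Fg(2)[OF p(1)] p(2)] Fg(1)[OF p(1)] by simp
      then show "D3 G p (V p) = 0" using p by (simp add: DG[OF p(1)] Dgi2[OF p(1)] cmul3_def)
    qed
  qed (use U(4) Y0 hG in auto)
  moreover have "iso_family V W S (2 * pi / \<bar>\<omega>\<bar>)"
  proof -
    obtain \<rho> where \<rho>: "\<rho> > 0" "ball 0 \<rho> \<subseteq> U" using U(1,3) open_contains_ball by blast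
    have "isCont gi 0" using has_derivative_continuous[OF hmap_D(1)[OF U(7) Y0]] .
    then obtain d where d: "d > 0" "\<And>p. dist p 0 < d \<Longrightarrow> dist (gi p) (gi 0) < \<rho>"
      unfolding continuous_at_eps_delta using \<rho>(1) by blast
    define T where "T = 2 * pi / \<bar>\<omega>\<bar>"
    show ?thesis
      unfolding iso_family_def T_def[symmetric]
    proof (intro exI[of _ d] conjI d(1) ballI impI)
      fix p assume pS: "p \<in> S" and p: "p \<noteq> 0 \<and> norm p < d"
      define u where "u = gi p"
      have pY: "p \<in> Y" "fst (snd u) = 0" using pS by (auto simp: S_def G_def u_def)
      have un: "norm u < \<rho>" using d(2)[of p] p gi0 by (simp add: u_def)
      have \<Theta>u: "\<Theta> u = p" using Fg(1)[OF pY(1)] by (simp add: u_def)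
      have u0: "u \<noteq> 0" using \<Theta>u \<Theta>0 p by auto
      \<comment> \<open>The exponent is imaginary, so multiplication by \<open>c t\<close> is an
        isometry and the linear orbit stays in the ball inside \<open>U\<close> for all
        times.\<close>
      define c where "c = (\<lambda>t::real. exp (l * of_real t))"
      have c1: "norm (c t) = 1" for t by (simp add: c_def l_def)
      define x where "x = (\<lambda>t. cmul3 (c t) u)"
      have xU: "x t \<in> U" for t using un \<rho>(2) c1 by (auto simp: x_def)
      have x2: "fst (snd (x t)) = 0" for t using pY(2) by (simp add: x_def cmul3_def)
      have dc: "(c has_vector_derivative l * c t) (at t)" for t
      proof -
        have "((\<lambda>s. exp (l * s)) has_field_derivative l * c t) (at (of_real t))"
          unfolding c_def by (auto intro!: derivative_eq_intros)
        from has_vector_derivative_real_field[OF this] show ?thesis unfolding c_def .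
      qed
      have dx: "(x has_vector_derivative cmul3 l (x t)) (at t)" for t
        using bounded_linear.has_vector_derivative[OF bounded_bilinear.bounded_linear_left[OF bounded_bilinear_cmul3] dc, of u t]
        by (simp add: x_def[abs_def])
      have d\<gamma>: "((\<lambda>t. \<Theta> (x t)) has_vector_derivative V (\<Theta> (x t))) (at t)" for t
      proof -
        have xr: "x t \<in> ball 0 r" using xU U(2) by blast
        from has_derivative_compose[OF dx[unfolded has_vector_derivative_def] hmap_D(1)[OF h\<Theta> xr]]
        have "((\<lambda>t. \<Theta> (x t)) has_derivative (\<lambda>s. DM \<Theta> (x t) (s *\<^sub>R cmul3 l (x t)))) (at t)" .
        moreover have "DM \<Theta> (x t) (s *\<^sub>R cmul3 l (x t)) = s *\<^sub>R V (\<Theta> (x t))" for s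
          using has_derivative_linear[OF hmap_D(1)[OF h\<Theta> xr]] flow[OF xU x2] by (simp add: linear_scale)
        ultimately show ?thesis by (simp add: has_vector_derivative_def)
      qed
      show "\<exists>\<gamma>. \<gamma> 0 = p \<and> (\<forall>t. \<gamma> t \<in> W) \<and> (\<forall>t. (\<gamma> has_vector_derivative V (\<gamma> t)) (at t)) \<and>
        (\<forall>t. \<gamma> (t + T) = \<gamma> t) \<and> (\<forall>s. 0 < s \<and> s < T \<longrightarrow> \<gamma> s \<noteq> p)"
      proof (intro exI[of _ "\<lambda>t. \<Theta> (x t)"] conjI allI impI d\<gamma>)
        show "\<Theta> (x 0) = p" using \<Theta>u by (simp add: x_def c_def)
        show "\<Theta> (x t) \<in> W" for t
        proof -
          have "pr (x t) = x t" using x2[of t] by (cases "x t") (simp add: pr_def)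
          then have "\<Theta> (x t) = \<Phi> (x t)" using x2[of t] by (simp add: \<Theta>_def flip: zero_prod_def)
          then show ?thesis using \<Phi>W[of "x t"] xU[of t] U(2) by (metis subsetD)
        qed
        show "\<Theta> (x (t + T)) = \<Theta> (x t)" for t
          using exp_rotation_periodic[OF \<omega>, of t] by (simp only: x_def c_def l_def T_def)
        fix s assume s: "0 < s \<and> s < T"
        show "\<Theta> (x s) \<noteq> p"
        proof
          assume "\<Theta> (x s) = p"
          then have "gi (\<Theta> (x s)) = gi p" by simp
          then have xs: "cmul3 (c s) u = u" using gF(1)[OF xU] by (simp add: u_def x_def)
          have "cmul3 (c s - 1) u = 0" using xs by (cases u) (simp add: algebra_simps zero_prod_def)
          then have "norm (c s - 1) * norm u = 0" by (metis norm_cmul3 norm_zero)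
          then have "c s = 1" using u0 by simp
          then show False using exp_rotation_neq_1[OF \<omega>, of s] s by (simp add: c_def l_def T_def)
        qed
      qed
    qed
  qed
  ultimately show ?thesis by blast
qed

section \<open>Uniqueness of the invariant surface\<close>

lemma inner_complex_near:
  fixes d e :: complex assumes "norm (e - d) \<le> \<epsilon> * norm d" shows "d \<bullet> e \<le> (1 + \<epsilon>) * (norm d)\<^sup>2"
proof -
  have "d \<bullet> e = d \<bullet> d + d \<bullet> (e - d)" by (simp add: inner_diff_right)
  also have "d \<bullet> (e - d) \<le> norm d * norm (e - d)" by (rule norm_cauchy_schwarz)
  also have "\<dots> \<le> norm d * (\<epsilon> * norm d)" using assms by (intro mult_left_mono) auto
  finally show ?thesis by (simp add: power2_norm_eq_inner[symmetric] power2_eq_square algebra_simps)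
qed

lemma inner_near_lower:
  fixes q y :: "'a::real_inner" assumes "norm (y - q) \<le> \<epsilon> * norm q" shows "q \<bullet> y \<ge> (1 - \<epsilon>) * (norm q)\<^sup>2"
proof -
  have "q \<bullet> y = q \<bullet> q + q \<bullet> (y - q)" by (simp add: inner_diff_right)
  moreover have "q \<bullet> (y - q) \<ge> - (norm q * norm (y - q))" using Cauchy_Schwarz_ineq2[of q "y - q"] by linarith
  moreover have "norm q * norm (y - q) \<le> norm q * (\<epsilon> * norm q)" using assms by (intro mult_left_mono) auto
  ultimately show ?thesis by (simp add: power2_norm_eq_inner[symmetric] power2_eq_square algebra_simps)
qed

text \<open>Moving inwards along \<open>- Y\<close> from a maximum point of \<open>\<bar>\<delta>\<bar>^4 / \<bar>q\<bar>^6\<close> would increase this quotient, because \<open>\<delta>\<close> is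
  almost an eigenfunction of \<open>Y\<close> with eigenvalue \<open>1\<close> while \<open>Y\<close> is close to the Euler field.\<close>

lemma near_eigenfunction_vanishes:
  fixes \<delta> :: "C3 \<Rightarrow> complex" and E :: "C3 set"
  assumes \<rho>: "\<rho> > 0" and E: "subspace E" and h: "\<And>q. q \<in> E \<Longrightarrow> norm q < r \<Longrightarrow> (\<delta> has_derivative \<delta>' q) (at q)"
    and quad: "\<And>q. q \<in> E \<Longrightarrow> norm q < r \<Longrightarrow> norm (\<delta> q) \<le> C * norm q ^ 2" and \<rho>r: "\<rho> < r"
    and Y: "\<And>q. q \<in> E \<Longrightarrow> norm q < r \<Longrightarrow> Y q \<in> E" "\<And>q. q \<in> E \<Longrightarrow> norm q < r \<Longrightarrow> norm (Y q - q) \<le> 1/10 * norm q"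
    and eig: "\<And>q. q \<in> E \<Longrightarrow> norm q < r \<Longrightarrow> norm (\<delta>' q (Y q) - \<delta> q) \<le> 1/10 * norm (\<delta> q)"
    and q: "q \<in> E" "norm q \<le> \<rho>"
  shows "\<delta> q = 0"
proof (rule ccontr)
  assume dq: "\<delta> q \<noteq> 0"
  have C0: "C \<ge> 0"
  proof -
    have q0: "q \<noteq> 0"
    proof
      assume "q = 0" then show False using quad[of q] dq q \<rho>r \<rho> by simp
    qed
    have "0 < C * norm q ^ 2" using quad[of q] q \<rho>r dq by (metis less_le_trans le_less_trans zero_less_norm_iff)
    then show ?thesis using q0 by (simp add: zero_less_mult_iff)
  qed
  define a where "a = (\<lambda>q. (norm (\<delta> q))\<^sup>2)"
  define b where "b = (\<lambda>q::C3. (norm q)\<^sup>2)"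
  \<comment> \<open>This is the fourth power of the norm of \<delta> over the sixth power of the
    norm of q. Along - Y the numerator decays with logarithmic rate at most 4 * 11/10 and the
    denominator with rate at least 6 * 9/10, so the quotient grows. Since \<delta> is of second
    order, \<nu> is still of order \<open>norm q ^ 2\<close> at the origin.\<close>
  define \<nu> where "\<nu> = (\<lambda>q. (a q)\<^sup>2 / (b q) ^ 3)"
  have q0: "q \<noteq> 0" using quad[of q] dq q \<rho>r \<rho> by auto
  have nuq: "\<nu> q > 0" using dq q0 by (simp add: \<nu>_def a_def b_def)
  have nu_le: "\<nu> p \<le> C ^ 4 * norm p ^ 2" if "p \<in> E" "norm p < r" "p \<noteq> 0" for p
  proof -
    have "norm (\<delta> p) ^ 4 \<le> (C * norm p ^ 2) ^ 4" by (rule power_mono[OF quad[OF that(1,2)]]) simp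
    also have "\<dots> = (C ^ 4 * norm p ^ 2) * norm p ^ 6" by (simp add: power_mult_distrib flip: power_mult power_add)
    finally have "norm (\<delta> p) ^ 4 / norm p ^ 6 \<le> C ^ 4 * norm p ^ 2" using that by (simp add: divide_le_eq)
    then show ?thesis by (simp add: \<nu>_def a_def b_def flip: power_mult)
  qed
  \<comment> \<open>Inside radius \<sigma> the values of \<nu> lie below \<nu>(q), so a maximum over
    the compact shell is a maximum over the whole punctured ball in \<open>E\<close>.\<close>
  obtain \<sigma> where \<sigma>: "\<sigma> > 0" "\<sigma> \<le> norm q" "C ^ 4 * \<sigma> ^ 2 < \<nu> q"
  proof -
    have "((\<lambda>s. C ^ 4 * s ^ 2) \<longlongrightarrow> C ^ 4 * 0 ^ 2) (at_right (0::real))" by (intro tendsto_intros)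
    then have "\<forall>\<^sub>F s in at_right 0. C ^ 4 * s ^ 2 < \<nu> q" using nuq by (intro order_tendstoD(2)) auto
    moreover have "\<forall>\<^sub>F s in at_right 0. s \<in> {0<..<norm q}" using q0 by (intro eventually_at_right_real) simp
    ultimately have "\<forall>\<^sub>F s in at_right 0. C ^ 4 * s ^ 2 < \<nu> q \<and> s \<in> {0<..<norm q}" by (rule eventually_conj)
    then obtain s where "C ^ 4 * s ^ 2 < \<nu> q \<and> s \<in> {0<..<norm q}" using eventually_happens[of _ "at_right (0::real)"] by auto
    then show thesis using that by auto
  qed
  define K where "K = {p \<in> E. \<sigma> \<le> norm p \<and> norm p \<le> \<rho>}"
  have cd: "continuous_on K \<delta>"
    by (rule continuous_at_imp_continuous_on) (use h \<rho>r in \<open>force simp: K_def intro: has_derivative_continuous\<close>)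
  have cn: "continuous_on K \<nu>" unfolding \<nu>_def a_def b_def
    using \<sigma>(1) by (intro continuous_intros cd) (auto simp: K_def)
  have "compact K"
  proof -
    have "K = E \<inter> (cball 0 \<rho> \<inter> {p. \<sigma> \<le> norm p})" by (auto simp: K_def)
    moreover have "compact (E \<inter> (cball 0 \<rho> \<inter> {p. \<sigma> \<le> norm p}))"
      by (intro closed_Int_compact compact_Int_closed compact_cball closed_subspace[OF E] closed_Collect_le continuous_intros)
    ultimately show ?thesis by simp
  qed
  moreover have qK: "q \<in> K" using q \<sigma> by (simp add: K_def)
  ultimately obtain p where p: "p \<in> K" "\<And>y. y \<in> K \<Longrightarrow> \<nu> y \<le> \<nu> p" using continuous_attains_sup[OF _ _ cn] by blast
  have pE: "p \<in> E" "norm p < r" "norm p \<le> \<rho>" "p \<noteq> 0" using p(1) \<rho>r \<sigma>(1) by (auto simp: K_def)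
  have max: "\<nu> y \<le> \<nu> p" if y: "y \<in> E" "norm y \<le> \<rho>" "y \<noteq> 0" for y
  proof (cases "\<sigma> \<le> norm y")
    case True then show ?thesis using p(2) y by (simp add: K_def)
  next
    case False
    have "\<nu> y \<le> C ^ 4 * norm y ^ 2" by (rule nu_le) (use y \<rho>r in auto)
    also have "\<dots> \<le> C ^ 4 * \<sigma> ^ 2" using False C0 by (intro mult_left_mono power_mono) auto
    also have "\<dots> \<le> \<nu> p" using \<sigma>(3) p(2)[OF qK] by linarith
    finally show ?thesis .
  qed
  have nup: "\<nu> p > 0" using nuq p(2)[OF qK] by linarith
  have ap: "a p > 0"
  proof -
    have "\<delta> p \<noteq> 0" using nup by (auto simp: \<nu>_def a_def)
    then show ?thesis by (simp add: a_def)
  qed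
  have bp: "b p > 0" using pE(4) by (simp add: b_def)
  \<comment> \<open>A straight line replaces the flow of - Y: only first-order behaviour at t = 0
    enters, and the line remains in the subspace.\<close>
  define c where "c = (\<lambda>t::real. p - t *\<^sub>R Y p)"
  have c0: "c 0 = p" by (simp add: c_def)
  have cE: "c t \<in> E" for t unfolding c_def using E pE(1) Y(1)[OF pE(1,2)] by (intro subspace_diff subspace_scale)
  have dc: "(c has_vector_derivative - Y p) (at 0)" unfolding c_def by (auto intro!: derivative_eq_intros)
  have dd: "((\<lambda>t. \<delta> (c t)) has_vector_derivative - \<delta>' p (Y p)) (at 0)"
  proof -
    have "(\<delta> has_derivative \<delta>' p) (at (c 0))" using h[OF pE(1,2)] c0 by simp
    from has_derivative_compose[OF dc[unfolded has_vector_derivative_def] this]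
    have "((\<lambda>t. \<delta> (c t)) has_derivative (\<lambda>s. \<delta>' p (s *\<^sub>R - Y p))) (at 0)" .
    moreover have "\<delta>' p (s *\<^sub>R - Y p) = s *\<^sub>R - \<delta>' p (Y p)" for s
      using has_derivative_linear[OF h[OF pE(1,2)]] by (metis linear_neg linear_scale scaleR_minus_right)
    ultimately show ?thesis by (simp add: has_vector_derivative_def)
  qed
  have sq: "((\<lambda>t. (norm (u t))\<^sup>2) has_real_derivative 2 * (u 0 \<bullet> u')) (at 0)" if "(u has_vector_derivative u') (at 0)"
    for u :: "real \<Rightarrow> 'x::real_inner" and u'
  proof -
    have "((\<lambda>t. u t \<bullet> u t) has_derivative (\<lambda>s. u 0 \<bullet> (s *\<^sub>R u') + (s *\<^sub>R u') \<bullet> u 0)) (at 0)"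
      using that unfolding has_vector_derivative_def by (intro has_derivative_inner)
    moreover have "(\<lambda>s. u 0 \<bullet> (s *\<^sub>R u') + (s *\<^sub>R u') \<bullet> u 0) = (*) (2 * (u 0 \<bullet> u'))" by (auto simp: inner_commute)
    ultimately show ?thesis unfolding has_field_derivative_def power2_norm_eq_inner by simp
  qed
  define A' where "A' = 2 * (\<delta> p \<bullet> - \<delta>' p (Y p))"
  define B' where "B' = 2 * (p \<bullet> - Y p)"
  have da: "((\<lambda>t. a (c t)) has_real_derivative A') (at 0)" using sq[OF dd] by (simp add: a_def A'_def c0)
  have db: "((\<lambda>t. b (c t)) has_real_derivative B') (at 0)" using sq[OF dc] by (simp add: b_def B'_def c0)
  have A': "A' \<ge> - (11/5) * a p" using inner_complex_near[OF eig[OF pE(1,2)]] by (simp add: A'_def a_def)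
  have B': "B' \<le> - (9/5) * b p" using inner_near_lower[OF Y(2)[OF pE(1,2)]] by (simp add: B'_def b_def)
  \<comment> \<open>Its sign is that of \<nu>(c t) - \<nu>(p), with the denominators
    cleared.\<close>
  define m where "m = (\<lambda>t. (a (c t))\<^sup>2 * b p ^ 3 - (a p)\<^sup>2 * (b (c t)) ^ 3)"
  have dm: "(m has_real_derivative (2 * a p * A') * b p ^ 3 - (a p)\<^sup>2 * (3 * b p ^ 2 * B')) (at 0)"
    unfolding m_def using da db by (auto intro!: derivative_eq_intros simp: c0)
  have "0 < (2 * a p * A') * b p ^ 3 - (a p)\<^sup>2 * (3 * b p ^ 2 * B')"
  proof -
    have "(2 * a p * A') * b p ^ 3 - (a p)\<^sup>2 * (3 * b p ^ 2 * B') = (a p * b p ^ 2) * (2 * A' * b p - 3 * a p * B')"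
      by (simp add: power2_eq_square power3_eq_cube algebra_simps)
    moreover have "2 * A' * b p - 3 * a p * B' > 0"
    proof -
      have "2 * b p * A' \<ge> 2 * b p * (- (11/5) * a p)" using A' bp by (intro mult_left_mono) auto
      moreover have "3 * a p * B' \<le> 3 * a p * (- (9/5) * b p)" using B' ap by (intro mult_left_mono) auto
      moreover have "a p * b p > 0" using ap bp by simp
      ultimately show ?thesis by (simp add: algebra_simps)
    qed
    ultimately show ?thesis using ap bp by simp
  qed
  from DERIV_pos_inc_right[OF dm this] obtain s where s: "s > 0" "\<And>t. t > 0 \<Longrightarrow> t < s \<Longrightarrow> m 0 < m t" by auto
  \<comment> \<open>The line also moves inwards, so its points for small t remain in the ball on
    which the maximum is known.\<close>
  have "B' < 0" using B' bp by (simp add: less_le_trans mult_neg_pos)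
  from DERIV_neg_dec_right[OF db this] obtain s' where s': "s' > 0" "\<And>t. t > 0 \<Longrightarrow> t < s' \<Longrightarrow> b (c 0) > b (c t)" by auto
  have "isCont c 0" unfolding c_def by (intro continuous_intros)
  then have "\<exists>e>0. \<forall>y. dist 0 y < e \<longrightarrow> c y \<noteq> 0" using continuous_at_avoid[of 0 c 0] c0 pE(4) by simp
  then obtain e where e: "e > 0" "\<And>y. dist 0 y < e \<Longrightarrow> c y \<noteq> 0" by blast
  define t where "t = min s (min s' e) / 2"
  have t: "t > 0" "t < s" "t < s'" "t < e" using s(1) s'(1) e(1) by (auto simp: t_def min_def)
  have "b (c t) < b p" using s'(2)[OF t(1,3)] c0 by simp
  then have "norm (c t) \<le> norm p" unfolding b_def by (metis less_imp_le norm_ge_zero power2_le_imp_le)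
  then have ct: "norm (c t) \<le> \<rho>" using pE(3) by simp
  have ct0: "c t \<noteq> 0" using e(2)[of t] t by simp
  have "\<nu> (c t) \<le> \<nu> p" by (rule max[OF cE ct ct0])
  moreover have "b (c t) > 0" using ct0 by (simp add: b_def)
  ultimately have "(a (c t))\<^sup>2 * b p ^ 3 \<le> (a p)\<^sup>2 * b (c t) ^ 3" using bp by (simp add: \<nu>_def divide_simps mult_ac)
  then have "m t \<le> 0" by (simp add: m_def)
  moreover have "m 0 = 0" by (simp add: m_def c0)
  ultimately show False using s(2)[OF t(1,2)] by simp
qed

lemma subspace_xzplane: "subspace xzplane"
  unfolding subspace_def xzplane_def by (auto simp: zero_prod_def)

text \<open>Each graph function satisfies a first-order equation along the field projected to the
  plane. Subtracting the two equations shows that their difference is nearly an eigenfunction of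
  that field divided by \<open>l\<close>, with relative errors proportional to the radius, so it
  vanishes.\<close>

lemma surface_unique:
  fixes \<omega> :: real
  assumes \<omega>: "\<omega> \<noteq> 0" and W: "0 \<in> W" and hf: "holo3 W f" and hg: "holo3 W g" and hh: "holo3 W h"
    and z: "f 0 = 0" "g 0 = 0" "h 0 = 0" and Df: "(f has_derivative (\<lambda>_. 0)) (at 0)" and Dg: "(g has_derivative (\<lambda>_. 0)) (at 0)"
    and Dh: "(h has_derivative (\<lambda>_. 0)) (at 0)"
  defines "V \<equiv> field3 (sysP \<omega> f) (sysQ \<omega> g) (sysR \<omega> h)"
  assumes S: "surf_cm V xzplane S" and S': "surf_cm V xzplane S'"
  shows "germ_eq S S'"
proof -
  define l where "l = \<i> * of_real \<omega>"
  define L where "L = norm l"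
  have l: "l \<noteq> 0" "L > 0" using \<omega> by (simp_all add: l_def L_def)
  have Veq: "V p = (l * fst p + fst (snd p) + f p, l * fst (snd p) + g p, l * snd (snd p) + h p)" for p
    by (simp add: V_def field3_def sysP_def sysQ_def sysR_def l_def)
  obtain r1 \<phi> N where p1: "r1 > 0" "holo3 (ball 0 r1) \<phi>" "\<phi> 0 = 0" "(\<phi> has_derivative (\<lambda>_. 0)) (at 0)" and N: "open N" "0 \<in> N"
    "S \<inter> N = {(x, \<phi> (x, 0, z), z) | x z. (x, 0::complex, z) \<in> ball 0 r1}"
    and inv1: "\<And>x z. (x, 0::complex, z) \<in> ball 0 r1 \<Longrightarrow>
       fst (snd (V (x, \<phi> (x, 0, z), z))) = D3 \<phi> (x, 0, z) (fst (V (x, \<phi> (x, 0, z), z)), 0, snd (snd (V (x, \<phi> (x, 0, z), z))))"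
    by (rule surf_cm_graph[OF S], rule that)
  obtain r2 \<psi> N' where p2: "r2 > 0" "holo3 (ball 0 r2) \<psi>" "\<psi> 0 = 0" "(\<psi> has_derivative (\<lambda>_. 0)) (at 0)" and N': "open N'" "0 \<in> N'"
    "S' \<inter> N' = {(x, \<psi> (x, 0, z), z) | x z. (x, 0::complex, z) \<in> ball 0 r2}"
    and inv2: "\<And>x z. (x, 0::complex, z) \<in> ball 0 r2 \<Longrightarrow>
       fst (snd (V (x, \<psi> (x, 0, z), z))) = D3 \<psi> (x, 0, z) (fst (V (x, \<psi> (x, 0, z), z)), 0, snd (snd (V (x, \<psi> (x, 0, z), z))))"
    by (rule surf_cm_graph[OF S'], rule that)
  obtain rf Cf where F: "rf > 0" "Cf \<ge> 0"
    "\<And>d p q. d \<le> rf \<Longrightarrow> p \<in> ball 0 d \<Longrightarrow> q \<in> ball 0 d \<Longrightarrow> norm (f p - f q) \<le> Cf * d * norm (p - q)"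
    "\<And>p. p \<in> ball 0 rf \<Longrightarrow> norm (f p) \<le> Cf * norm p ^ 2" by (rule holo3_flat_bounds[OF hf W z(1) Df], rule that)
  obtain rg Cg where G: "rg > 0" "Cg \<ge> 0"
    "\<And>d p q. d \<le> rg \<Longrightarrow> p \<in> ball 0 d \<Longrightarrow> q \<in> ball 0 d \<Longrightarrow> norm (g p - g q) \<le> Cg * d * norm (p - q)"
    by (rule holo3_flat_bounds[OF hg W z(2) Dg], rule that)
  obtain rh Ch where H: "rh > 0" "Ch \<ge> 0"
    "\<And>d p q. d \<le> rh \<Longrightarrow> p \<in> ball 0 d \<Longrightarrow> q \<in> ball 0 d \<Longrightarrow> norm (h p - h q) \<le> Ch * d * norm (p - q)"
    "\<And>p. p \<in> ball 0 rh \<Longrightarrow> norm (h p) \<le> Ch * norm p ^ 2" by (rule holo3_flat_bounds[OF hh W z(3) Dh], rule that)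
  have b1: "0 \<in> ball 0 r1" and b2: "0 \<in> ball 0 r2" using p1(1) p2(1) by auto
  obtain ra Ca where A: "ra > 0" "Ca \<ge> 0" "\<And>p. p \<in> ball 0 ra \<Longrightarrow> norm (\<phi> p) \<le> Ca * norm p ^ 2"
    by (rule holo3_flat_bounds[OF p1(2) b1 p1(3,4)], rule that)
  obtain rb Cb where B: "rb > 0" "Cb \<ge> 0" "\<And>p. p \<in> ball 0 rb \<Longrightarrow> norm (\<psi> p) \<le> Cb * norm p ^ 2"
    by (rule holo3_flat_bounds[OF p2(2) b2 p2(3,4)], rule that)
  obtain rd Cd where D: "rd > 0" "Cd \<ge> 0" "\<And>q v. q \<in> ball 0 rd \<Longrightarrow> norm (D3 \<psi> q v) \<le> Cd * norm q * norm v"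
  proof -
    obtain s where s: "s > 0" "cball 0 (2 * s) \<subseteq> ball (0::C3) r2" using open_contains_cball2[OF open_ball b2] .
    obtain C where C: "C \<ge> 0" "\<forall>q\<in>cball 0 (s/2). \<forall>v. norm (D3 \<psi> q v - D3 \<psi> 0 v) \<le> C * norm (q - 0) * norm v"
      using holo3_D_lipschitz[OF p2(2) s] by blast
    show thesis
    proof (rule that[of "s/2" C])
      show "norm (D3 \<psi> q v) \<le> C * norm q * norm v" if "q \<in> ball 0 (s/2)" for q v
        using C(2)[rule_format, of q v] that D3_eq[OF p2(4)] by simp
    qed (use s(1) C(1) in auto)
  qed
  define C where "C = Cf + Cg + Ch + Ca + Cb + Cd + 1"
  have C: "C \<ge> 1" "Cf \<le> C" "Cg \<le> C" "Ch \<le> C" "Ca \<le> C" "Cb \<le> C" "Cd \<le> C" using F(2) G(2) H(2) A(2) B(2) D(2) by (auto simp: C_def)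
  \<comment> \<open>The thirds appear because lifted points have norm below \<open>3 * r0\<close>.
    The entry 1/C makes a graph value at most \<open>norm q\<close>, and L/(100 C) pushes the error
    factors, 9 and 10 times \<open>C * r0\<close>, below L/10.\<close>
  define r0 where "r0 = Min {r1, r2, rf / 3, rg / 3, rh / 3, ra, rb, rd, 1 / C, L / (100 * C)}"
  have "\<forall>x\<in>{r1, r2, rf / 3, rg / 3, rh / 3, ra, rb, rd, 1 / C, L / (100 * C)}. 0 < x"
    using p1(1) p2(1) F(1) G(1) H(1) A(1) B(1) D(1) C(1) l(2) by simp
  then have r0: "r0 > 0" unfolding r0_def by (subst Min_gr_iff) (rule finite.intros insert_not_empty | assumption)+
  have r0le: "r0 \<le> r1" "r0 \<le> r2" "3 * r0 \<le> rf" "3 * r0 \<le> rg" "3 * r0 \<le> rh" "r0 \<le> ra" "r0 \<le> rb" "r0 \<le> rd" "r0 \<le> 1 / C" "r0 \<le> L / (100 * C)"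
  proof -
    have m: "r0 \<le> x" if "x \<in> {r1, r2, rf / 3, rg / 3, rh / 3, ra, rb, rd, 1 / C, L / (100 * C)}" for x
      unfolding r0_def by (rule Min_le[OF _ that]) simp
    show "r0 \<le> r1" "r0 \<le> r2" "r0 \<le> ra" "r0 \<le> rb" "r0 \<le> rd" "r0 \<le> 1 / C" "r0 \<le> L / (100 * C)" by (rule m; simp)+
    show "3 * r0 \<le> rf" "3 * r0 \<le> rg" "3 * r0 \<le> rh" using m[of "rf/3"] m[of "rg/3"] m[of "rh/3"] by auto
  qed
  have Cr: "C * r0 \<le> 1" "100 * (C * r0) \<le> L" using r0le(9,10) C(1) by (simp_all add: field_simps)
  define lift where "lift = (\<lambda>\<phi> q :: C3. (fst q, \<phi> q :: complex, snd (snd q)))"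
  have small: "norm (\<phi> q) \<le> C * norm q ^ 2" "norm (\<psi> q) \<le> C * norm q ^ 2" if "norm q < r0" for q
  proof -
    have "norm (\<phi> q) \<le> Ca * norm q ^ 2" "norm (\<psi> q) \<le> Cb * norm q ^ 2" using that r0le by (auto intro!: A(3) B(3))
    moreover have "Ca * norm q ^ 2 \<le> C * norm q ^ 2" "Cb * norm q ^ 2 \<le> C * norm q ^ 2" using C by (auto intro: mult_right_mono)
    ultimately show "norm (\<phi> q) \<le> C * norm q ^ 2" "norm (\<psi> q) \<le> C * norm q ^ 2" by linarith+
  qed
  have Cq: "C * norm q ^ 2 \<le> norm q" if "norm q < r0" for q :: C3
  proof -
    have "C * norm q \<le> C * r0" using that C(1) by (intro mult_left_mono) auto
    then have "C * norm q * norm q \<le> 1 * norm q" using Cr(1) by (intro mult_right_mono) auto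
    then show ?thesis by (simp add: power2_eq_square mult.assoc)
  qed
  have liftn: "norm (lift u q) \<le> 2 * norm q" "lift u q \<in> ball 0 (3 * r0)" if "norm q < r0" "norm (u q) \<le> C * norm q ^ 2" for u q
  proof -
    have "lift u q = (fst q, 0, snd (snd q)) + (0, u q, 0)" by (simp add: lift_def)
    then have "norm (lift u q) \<le> norm (fst q, 0::complex, snd (snd q)) + norm (0::complex, u q, 0::complex)" by (metis norm_triangle_ineq)
    also have "norm (fst q, 0::complex, snd (snd q)) \<le> norm q" by (cases q) (simp add: norm_Pair)
    also have "norm (0::complex, u q, 0::complex) = norm (u q)" by (simp add: norm_Pair)
    finally show a: "norm (lift u q) \<le> 2 * norm q" using that Cq[OF that(1)] by linarith
    then have "norm (lift u q) < 3 * r0" using that(1) r0 by linarith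
    then show "lift u q \<in> ball 0 (3 * r0)" by simp
  qed
  define X where "X = (\<lambda>u q. (fst (V (lift u q)), 0::complex, snd (snd (V (lift u q)))))"
  \<comment> \<open>The field along the first graph, projected to the plane and normalised by
    \<open>l\<close> so that its linear part is the Euler field.\<close>
  define Y where "Y = (\<lambda>q. cmul3 (inverse l) (X \<phi> q))"
  have Xeq: "X u q = (l * fst q + u q + f (lift u q), 0, l * snd (snd q) + h (lift u q))" for u q
    by (simp add: X_def Veq lift_def)
  have inxz: "q = (fst q, 0, snd (snd q))" if "q \<in> xzplane" for q using that by (auto simp: xzplane_def)
  have I1: "l * \<phi> q + g (lift \<phi> q) = D3 \<phi> q (X \<phi> q)" if "q \<in> xzplane" "norm q < r0" for q
  proof -
    have "(fst q, 0::complex, snd (snd q)) \<in> ball 0 r1" using inxz[OF that(1)] that(2) r0le(1) by simp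
    from inv1[OF this] show ?thesis unfolding inxz[OF that(1), symmetric] lift_def[symmetric] X_def[symmetric]
      by (simp add: Veq lift_def X_def)
  qed
  have I2: "l * \<psi> q + g (lift \<psi> q) = D3 \<psi> q (X \<psi> q)" if "q \<in> xzplane" "norm q < r0" for q
  proof -
    have "(fst q, 0::complex, snd (snd q)) \<in> ball 0 r2" using inxz[OF that(1)] that(2) r0le(2) by simp
    from inv2[OF this] show ?thesis unfolding inxz[OF that(1), symmetric] lift_def[symmetric] X_def[symmetric]
      by (simp add: Veq lift_def X_def)
  qed
  define \<delta> where "\<delta> = (\<lambda>q. \<phi> q - \<psi> q)"
  define \<delta>' where "\<delta>' = (\<lambda>q v. D3 \<phi> q v - D3 \<psi> q v)"
  have fd: "norm (k (lift \<phi> q) - k (lift \<psi> q)) \<le> C * (3 * r0) * norm (\<delta> q)"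
    if "norm q < r0" "3 * r0 \<le> rk" "Ck \<le> C" "\<And>d p q. d \<le> rk \<Longrightarrow> p \<in> ball 0 d \<Longrightarrow> q \<in> ball 0 d \<Longrightarrow> norm (k p - k q) \<le> Ck * d * norm (p - q)"
    for q rk Ck and k :: "C3 \<Rightarrow> complex"
  proof -
    have "norm (k (lift \<phi> q) - k (lift \<psi> q)) \<le> Ck * (3 * r0) * norm (lift \<phi> q - lift \<psi> q)"
      by (rule that(4)[OF that(2)]) (use liftn(2)[of q] small[OF that(1)] that(1) in auto)
    also have "lift \<phi> q - lift \<psi> q = (0, \<delta> q, 0)" by (simp add: lift_def \<delta>_def)
    also have "norm (0::complex, \<delta> q, 0::complex) = norm (\<delta> q)" by (simp add: norm_Pair)
    also have "Ck * (3 * r0) * norm (\<delta> q) \<le> C * (3 * r0) * norm (\<delta> q)" using that(3) r0 by (intro mult_right_mono) auto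
    finally show ?thesis .
  qed
  have zero: "\<delta> q = 0" if q: "q \<in> xzplane" "norm q \<le> r0 / 2" for q
  proof (rule near_eigenfunction_vanishes[where E=xzplane and \<rho>="r0/2" and r=r0 and \<delta>=\<delta> and \<delta>'=\<delta>' and Y=Y and C="2 * C"])
    show "(\<delta> has_derivative \<delta>' q) (at q)" if "q \<in> xzplane" "norm q < r0" for q
      unfolding \<delta>_def \<delta>'_def using that r0le(1,2) by (intro has_derivative_diff holo3_D(1)[OF p1(2)] holo3_D(1)[OF p2(2)]) auto
    show "norm (\<delta> q) \<le> 2 * C * norm q ^ 2" if "q \<in> xzplane" "norm q < r0" for q
      using small[OF that(2)] norm_triangle_ineq4[of "\<phi> q" "\<psi> q"] by (simp add: \<delta>_def)
    show "Y q \<in> xzplane" if "q \<in> xzplane" "norm q < r0" for q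
      by (auto simp: Y_def X_def cmul3_def xzplane_def)
    show "norm (Y q - q) \<le> 1/10 * norm q" if "q \<in> xzplane" "norm q < r0" for q
    proof -
      have "Y q - q = cmul3 (inverse l) (\<phi> q + f (lift \<phi> q), 0, h (lift \<phi> q))"
        unfolding Y_def Xeq using l(1) inxz[OF that(1)] by (cases q) (simp add: field_simps)
      then have "norm (Y q - q) = inverse L * norm (\<phi> q + f (lift \<phi> q), 0::complex, h (lift \<phi> q))"
        by (simp only: norm_cmul3 norm_inverse L_def)
      \<comment> \<open>The factor 9 is 1 for the graph function plus 4 each for \<open>f\<close>
        and \<open>h\<close>, since the lifted point has norm at most
        \<open>2 * norm q\<close>.\<close>
      also have "norm (\<phi> q + f (lift \<phi> q), 0::complex, h (lift \<phi> q)) \<le> 9 * (C * norm q ^ 2)"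
      proof -
        have lb: "norm (lift \<phi> q) \<le> 2 * norm q" "lift \<phi> q \<in> ball 0 (3 * r0)"
          by (rule liftn(1), rule that(2), rule small(1)[OF that(2)]) (rule liftn(2), rule that(2), rule small(1)[OF that(2)])
        have "norm (lift \<phi> q) ^ 2 \<le> (2 * norm q) ^ 2" by (rule power_mono[OF lb(1)]) simp
        then have l4: "norm (lift \<phi> q) ^ 2 \<le> 4 * norm q ^ 2" by (simp add: power_mult_distrib)
        have "norm (f (lift \<phi> q)) \<le> Cf * norm (lift \<phi> q) ^ 2" by (rule F(4)) (use lb(2) r0le(3) in auto)
        also have "\<dots> \<le> C * (4 * norm q ^ 2)" using l4 C(1,2) by (intro mult_mono) auto
        finally have 1: "norm (f (lift \<phi> q)) \<le> 4 * (C * norm q ^ 2)" by simp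
        have "norm (h (lift \<phi> q)) \<le> Ch * norm (lift \<phi> q) ^ 2" by (rule H(4)) (use lb(2) r0le(5) in auto)
        also have "\<dots> \<le> C * (4 * norm q ^ 2)" using l4 C(1,4) by (intro mult_mono) auto
        finally have 2: "norm (h (lift \<phi> q)) \<le> 4 * (C * norm q ^ 2)" by simp
        show ?thesis using norm3_le[of "\<phi> q + f (lift \<phi> q)" "0::complex" "h (lift \<phi> q)"] norm_triangle_ineq[of "\<phi> q" "f (lift \<phi> q)"] 1 2 small(1)[OF that(2)]
          unfolding norm_zero by linarith
      qed
      also have "inverse L * (9 * (C * norm q ^ 2)) \<le> inverse L * (L / 10 * norm q)"
      proof (rule mult_left_mono)
        have "C * norm q \<le> C * r0" using that(2) C(1) by (intro mult_left_mono) auto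
        then have "9 * (C * norm q) \<le> L / 10" using Cr(2) l(2) by linarith
        then have "9 * (C * norm q) * norm q \<le> L / 10 * norm q" by (intro mult_right_mono) auto
        then show "9 * (C * norm q ^ 2) \<le> L / 10 * norm q" by (simp add: power2_eq_square mult.assoc)
      qed (use l(2) in simp)
      also have "inverse L * (L / 10 * norm q) = 1/10 * norm q" using l(2) by simp
      finally show ?thesis using l(2) by (simp add: mult_left_mono)
    qed
    show "norm (\<delta>' q (Y q) - \<delta> q) \<le> 1/10 * norm (\<delta> q)" if "q \<in> xzplane" "norm q < r0" for q
    proof -
      have qb: "q \<in> ball 0 r1" "q \<in> ball 0 r2" "q \<in> ball 0 rd" using that(2) r0le by auto
      have lin: "linear (D3 \<psi> q)" using has_derivative_linear[OF holo3_D(1)[OF p2(2) qb(2)]] .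
      have "\<delta>' q (Y q) = inverse l * (D3 \<phi> q (X \<phi> q) - D3 \<psi> q (X \<phi> q))"
        unfolding \<delta>'_def Y_def holo3_D(2)[OF p1(2) qb(1)] holo3_D(2)[OF p2(2) qb(2)] by (simp add: right_diff_distrib)
      \<comment> \<open>Both invariance equations enter; the second one holds along the projected
        field of the other graph, which costs the correction
        \<open>D3 \<psi> q (X \<phi> q - X \<psi> q)\<close>.\<close>
      also have "D3 \<phi> q (X \<phi> q) - D3 \<psi> q (X \<phi> q) = l * \<delta> q + ((g (lift \<phi> q) - g (lift \<psi> q)) - D3 \<psi> q (X \<phi> q - X \<psi> q))"
        unfolding linear_diff[OF lin] I1[OF that, symmetric] I2[OF that, symmetric] by (simp add: \<delta>_def algebra_simps)
      finally have "\<delta>' q (Y q) - \<delta> q = inverse l * ((g (lift \<phi> q) - g (lift \<psi> q)) - D3 \<psi> q (X \<phi> q - X \<psi> q))"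
        using l(1) by (simp add: distrib_left)
      then have "norm (\<delta>' q (Y q) - \<delta> q) = inverse L * norm ((g (lift \<phi> q) - g (lift \<psi> q)) - D3 \<psi> q (X \<phi> q - X \<psi> q))"
        by (simp only: norm_mult norm_inverse L_def)
      \<comment> \<open>The factor 10 is 3 for \<open>g\<close> plus 7 for the correction: the two
        projected fields differ by at most 1 + 3 + 3 times the norm of \<delta>.\<close>
      also have "norm ((g (lift \<phi> q) - g (lift \<psi> q)) - D3 \<psi> q (X \<phi> q - X \<psi> q)) \<le> 10 * (C * r0) * norm (\<delta> q)"
      proof -
        have fg: "norm (f (lift \<phi> q) - f (lift \<psi> q)) \<le> C * (3 * r0) * norm (\<delta> q)" by (rule fd[OF that(2) r0le(3) C(2) F(3)])
        have gg: "norm (g (lift \<phi> q) - g (lift \<psi> q)) \<le> C * (3 * r0) * norm (\<delta> q)" by (rule fd[OF that(2) r0le(4) C(3) G(3)])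
        have hg: "norm (h (lift \<phi> q) - h (lift \<psi> q)) \<le> C * (3 * r0) * norm (\<delta> q)" by (rule fd[OF that(2) r0le(5) C(4) H(3)])
        have le3: "C * (3 * r0) * norm (\<delta> q) \<le> 3 * norm (\<delta> q)" using Cr(1) by (intro mult_right_mono) auto
        have "X \<phi> q - X \<psi> q = (\<delta> q + (f (lift \<phi> q) - f (lift \<psi> q)), 0, h (lift \<phi> q) - h (lift \<psi> q))"
          unfolding Xeq by (simp add: \<delta>_def)
        then have Xd: "norm (X \<phi> q - X \<psi> q) \<le> 7 * norm (\<delta> q)"
          using norm3_le[of "\<delta> q + (f (lift \<phi> q) - f (lift \<psi> q))" "0::complex" "h (lift \<phi> q) - h (lift \<psi> q)"]
            norm_triangle_ineq[of "\<delta> q" "f (lift \<phi> q) - f (lift \<psi> q)"] fg hg le3 norm_zero[where 'a=complex] by simp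
        have "norm (D3 \<psi> q (X \<phi> q - X \<psi> q)) \<le> Cd * norm q * norm (X \<phi> q - X \<psi> q)" by (rule D(3)[OF qb(3)])
        also have "\<dots> \<le> C * r0 * (7 * norm (\<delta> q))" using C(1,7) D(2) that(2) Xd r0 by (intro mult_mono) auto
        finally have "norm (D3 \<psi> q (X \<phi> q - X \<psi> q)) \<le> 7 * (C * r0) * norm (\<delta> q)" by simp
        then show ?thesis using gg norm_triangle_ineq4[of "g (lift \<phi> q) - g (lift \<psi> q)" "D3 \<psi> q (X \<phi> q - X \<psi> q)"] by simp
      qed
      also have "inverse L * (10 * (C * r0) * norm (\<delta> q)) \<le> inverse L * (L / 10 * norm (\<delta> q))"
        using Cr(2) l(2) by (intro mult_left_mono mult_right_mono) auto
      also have "inverse L * (L / 10 * norm (\<delta> q)) = 1/10 * norm (\<delta> q)" using l(2) by simp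
      finally show ?thesis using l(2) by (simp add: mult_left_mono)
    qed
  qed (use r0 q subspace_xzplane in auto)
  define M where "M = N \<inter> N' \<inter> (\<lambda>p::C3. (fst p, 0::complex, snd (snd p))) -` ball 0 (r0/2)"
  have "open ((\<lambda>p::C3. (fst p, 0::complex, snd (snd p))) -` ball 0 (r0/2))" by (intro open_vimage continuous_intros) auto
  then have M: "open M" unfolding M_def using N(1) N'(1) by (intro open_Int)
  have M0: "0 \<in> M" using N(2) N'(2) r0 by (simp add: M_def flip: zero_prod_def)
  have eq: "\<phi> (x, 0, z) = \<psi> (x, 0, z)" if "(x, 0::complex, z) \<in> ball 0 (r0/2)" for x z
    using zero[of "(x, 0, z)"] that by (auto simp: \<delta>_def xzplane_def)
  have "S \<inter> M = S' \<inter> M"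
  proof (intro equalityI subsetI)
    fix p assume p: "p \<in> S \<inter> M"
    then have "p \<in> S \<inter> N" by (auto simp: M_def)
    then obtain x z where x: "p = (x, \<phi> (x, 0, z), z)" using N(3) by blast
    then have b: "(x, 0::complex, z) \<in> ball 0 (r0/2)" using p by (simp add: M_def)
    then have "p = (x, \<psi> (x, 0, z), z)" "(x, 0::complex, z) \<in> ball 0 r2" using x eq[OF b] r0le(2) r0 by auto
    then have "p \<in> S' \<inter> N'" using N'(3) by blast
    then show "p \<in> S' \<inter> M" using p by blast
  next
    fix p assume p: "p \<in> S' \<inter> M"
    then have "p \<in> S' \<inter> N'" by (auto simp: M_def)
    then obtain x z where x: "p = (x, \<psi> (x, 0, z), z)" using N'(3) by blast
    then have b: "(x, 0::complex, z) \<in> ball 0 (r0/2)" using p by (simp add: M_def)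
    then have "p = (x, \<phi> (x, 0, z), z)" "(x, 0::complex, z) \<in> ball 0 r1" using x eq[OF b] r0le(1) r0 by auto
    then have "p \<in> S \<inter> N" using N(3) by blast
    then show "p \<in> S \<inter> M" using p by blast
  qed
  then show ?thesis unfolding germ_eq_def using M M0 by blast
qed

section \<open>The remaining directions and the assembly\<close>

text \<open>In the coordinates (z, x, y) the z-direction becomes the x-direction, with the
  components of the field permuted accordingly; the extension to the exceptional divisor is the same
  limit.\<close>

lemma bbz_rhs_rot: "bbz_rhs P Q R = bbx_rhs (\<lambda>p. R (rot p)) (\<lambda>p. P (rot p)) (\<lambda>p. Q (rot p))"
  by (intro ext) (simp add: bbz_rhs_def bbx_rhs_def bbz_raw_def bbx_raw_def Let_def)

lemma rot_axis: "rot ` yaxis = xaxis" "(\<lambda>p. rot (rot p)) ` zaxis = xaxis" "rot ` xaxis = zaxis"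
proof -
  show "rot ` yaxis = xaxis" unfolding yaxis_def xaxis_def by (force simp: image_iff)
  show "(\<lambda>p. rot (rot p)) ` zaxis = xaxis" unfolding zaxis_def xaxis_def by (force simp: image_iff)
  show "rot ` xaxis = zaxis" unfolding zaxis_def xaxis_def by (force simp: image_iff)
qed

lemma rot3: "rot (rot (rot p)) = p" by (cases p) simp

text \<open>After rotation the curve is parametrised by y, with z = \<alpha> and x = \<beta> of
  second order. In the tangency relation P = Q \<beta>' the right side is of second order, while the
  nilpotent term y gives the left side derivative 1 at 0.\<close>

lemma no_y_curve:
  fixes w1 :: real
  assumes W: "0 \<in> W" and hf: "holo3 W f" and hg: "holo3 W g" and z: "f 0 = 0" "g 0 = 0"
    and Df: "(f has_derivative (\<lambda>_. 0)) (at 0)"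
  shows "\<not> curve_cm (field3 (sysP w1 f) (sysQ w1 g) R) yaxis S"
proof
  let ?V = "field3 (sysP w1 f) (sysQ w1 g) R"
  assume "curve_cm ?V yaxis S"
  from curve_cm_transport[OF rot_iso(1) this]
  have cm: "curve_cm (\<lambda>p. rot (?V (rot (rot p)))) xaxis (rot ` S)" by (simp only: rot_axis)
  obtain r \<alpha> \<beta> where r: "r > 0" and hol: "\<alpha> holomorphic_on ball 0 r" "\<beta> holomorphic_on ball 0 r"
    and ab: "\<alpha> 0 = 0" "\<beta> 0 = 0" "deriv \<alpha> 0 = 0" "deriv \<beta> 0 = 0"
    and tan: "\<And>x. x \<in> ball 0 r \<Longrightarrow> rot (?V (rot (rot (x, \<alpha> x, \<beta> x)))) = cmul3 (fst (rot (?V (rot (rot (x, \<alpha> x, \<beta> x)))))) (1, deriv \<alpha> x, deriv \<beta> x)"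
    by (rule curve_cm_graph[OF cm], rule that)
  have tan2: "sysP w1 f (\<beta> x, x, \<alpha> x) = sysQ w1 g (\<beta> x, x, \<alpha> x) * deriv \<beta> x" if "x \<in> ball 0 r" for x
    using tan[OF that] by (simp add: field3_def)
  have 0: "0 \<in> ball 0 r" using r by simp
  have W0: "(\<beta> 0, 0, \<alpha> 0) \<in> W" using W ab by (simp add: zero_prod_def)
  have k: "((\<lambda>x. k (\<beta> x, x, \<alpha> x)) has_field_derivative D3 k (\<beta> 0, 0, \<alpha> 0) (deriv \<beta> 0, 1, deriv \<alpha> 0)) (at 0)" if "holo3 W k" for k
    by (rule holo3_curve[OF that W0 holomorphic_derivI[OF hol(2) open_ball 0] DERIV_ident holomorphic_derivI[OF hol(1) open_ball 0]])
  have f': "((\<lambda>x. f (\<beta> x, x, \<alpha> x)) has_field_derivative 0) (at 0)"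
    using k[OF hf] D3_eq[OF Df] ab by (simp add: zero_prod_def)
  have "((\<lambda>x. \<i> * of_real w1 * \<beta> x + x + f (\<beta> x, x, \<alpha> x)) has_field_derivative (\<i> * of_real w1 * deriv \<beta> 0 + 1 + 0)) (at 0)"
    by (intro DERIV_add DERIV_cmult DERIV_ident f' holomorphic_derivI[OF hol(2) open_ball 0])
  then have 1: "((\<lambda>x. sysP w1 f (\<beta> x, x, \<alpha> x)) has_field_derivative 1) (at 0)" using ab by (simp add: sysP_def)
  obtain g' where "((\<lambda>x. g (\<beta> x, x, \<alpha> x)) has_field_derivative g') (at 0)" using k[OF hg] by blast
  then have "((\<lambda>x. \<i> * of_real w1 * x + g (\<beta> x, x, \<alpha> x)) has_field_derivative (\<i> * of_real w1 * 1 + g')) (at 0)"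
    by (intro DERIV_add DERIV_cmult DERIV_ident)
  then have "((\<lambda>x. sysQ w1 g (\<beta> x, x, \<alpha> x)) has_field_derivative (\<i> * of_real w1 * 1 + g')) (at 0)" by (simp add: sysQ_def)
  from DERIV_mult[OF this holomorphic_derivI[OF holomorphic_deriv[OF hol(2) open_ball] open_ball 0]]
  have "((\<lambda>x. sysQ w1 g (\<beta> x, x, \<alpha> x) * deriv \<beta> x) has_field_derivative 0) (at 0)"
    using ab z by (simp add: sysQ_def flip: zero_prod_def)
  then have "((\<lambda>x. sysP w1 f (\<beta> x, x, \<alpha> x)) has_field_derivative 0) (at 0)"
    by (rule has_field_derivative_transform_within_open[OF _ open_ball 0]) (simp add: tan2)
  from DERIV_unique[OF 1 this] show False by simp
qed

theorem theorem3p9: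
  fixes w1 w2 :: real and f g h :: "C3 \<Rightarrow> complex" and W :: "C3 set"
  assumes "w1 \<noteq> 0" and "w2 \<noteq> 0"
    and "open W" and "0 \<in> W"
    and "holo3 W f" and "holo3 W g" and "holo3 W h"
    and "f 0 = 0" and "g 0 = 0" and "h 0 = 0"
    and "(f has_derivative (\<lambda>_. 0)) (at 0)"
    and "(g has_derivative (\<lambda>_. 0)) (at 0)"
    and "(h has_derivative (\<lambda>_. 0)) (at 0)"
  defines "P \<equiv> sysP w1 f" and "Q \<equiv> sysQ w1 g" and "R \<equiv> sysR w2 h"
  defines "V \<equiv> field3 P Q R"
  shows
    "(\<not> (\<exists>S. curve_cm V yaxis S))
   \<and> ((\<not> (\<exists>k::nat. k \<ge> 1 \<and> w2 / w1 = real k)) \<longrightarrow>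
        (\<exists>S. curve_cm V xaxis S \<and> iso_family V W S (2 * pi / \<bar>w1\<bar>)) \<and>
        (\<forall>S S'. curve_cm V xaxis S \<and> curve_cm V xaxis S' \<longrightarrow> germ_eq S S'))
   \<and> ((\<not> (\<exists>k::nat. k \<ge> 1 \<and> w1 / w2 = real k)) \<longrightarrow>
        (\<exists>S. curve_cm V zaxis S \<and> iso_family V W S (2 * pi / \<bar>w2\<bar>)) \<and>
        (\<forall>S S'. curve_cm V zaxis S \<and> curve_cm V zaxis S' \<longrightarrow> germ_eq S S'))
   \<and> (w1 = w2 \<longrightarrow>
        (\<exists>S. surf_cm V xzplane S \<and> iso_family V W S (2 * pi / \<bar>w1\<bar>)) \<and>
        (\<forall>S S'. surf_cm V xzplane S \<and> surf_cm V xzplane S' \<longrightarrow> germ_eq S S'))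
   \<and> (\<forall>k::nat. k \<ge> 2 \<and> w2 / w1 = real k \<longrightarrow>
        (let r = bb_const ((reduce ^^ (k - 2)) (bb_of (bbx_rhs P Q R))) $ 2 in
          (r = 0 \<longrightarrow> (\<exists>Sf :: nat \<Rightarrow> C3 set.
              (\<forall>n. curve_cm V xaxis (Sf n) \<and> iso_family V W (Sf n) (2 * pi / \<bar>w1\<bar>)) \<and>
              (\<forall>m n. m \<noteq> n \<longrightarrow> \<not> germ_eq (Sf m) (Sf n))))
        \<and> (r \<noteq> 0 \<longrightarrow> \<not> (\<exists>S. curve_cm V xaxis S))))
   \<and> (\<forall>k::nat. k \<ge> 2 \<and> w1 / w2 = real k \<longrightarrow>
        (let r = bb_const ((reduce ^^ (k - 2)) (bb_of (bbz_rhs P Q R))) $ 2 in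
          (r = 0 \<longrightarrow> (\<exists>Sf :: nat \<Rightarrow> C3 set.
              (\<forall>n. curve_cm V zaxis (Sf n) \<and> iso_family V W (Sf n) (2 * pi / \<bar>w2\<bar>)) \<and>
              (\<forall>m n. m \<noteq> n \<longrightarrow> \<not> germ_eq (Sf m) (Sf n))))
        \<and> (r \<noteq> 0 \<longrightarrow> \<not> (\<exists>S. curve_cm V zaxis S))))"
proof -
  note w = assms(1,2) and W = assms(4) and hol = assms(5-7) and z = assms(8-10) and D = assms(11-13)
  define l1 where "l1 = \<i> * complex_of_real w1"
  define l2 where "l2 = \<i> * complex_of_real w2"
  have l: "l1 \<noteq> 0" "l2 \<noteq> 0" using w by (simp_all add: l1_def l2_def)
  \<comment> \<open>This sends (x, y, z) to (z, x, y), so that the z-axis becomes the first axis;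
    \<open>rot\<close> undoes it.\<close>
  define \<sigma> where "\<sigma> = (\<lambda>p. rot (rot p))"
  have iso: "lin_iso \<sigma> rot" "lin_iso rot \<sigma>" unfolding \<sigma>_def by (rule rot_iso)+
  have \<sigma>rot: "\<sigma> (rot p) = p" "rot (\<sigma> p) = p" for p by (simp_all add: \<sigma>_def rot3)
  interpret x: bb_field l1 1 l1 0 l2 f g h W
    using l W hol z D by unfold_locales
  have xP: "x.P = P" "x.Q = Q" "x.R = R"
    by (rule ext, simp add: x.P_def x.Q_def x.R_def P_def Q_def R_def sysP_def sysQ_def sysR_def l1_def[symmetric] l2_def[symmetric])+
  have rotd: "((\<lambda>p. k (rot p)) has_derivative (\<lambda>_. 0)) (at 0)" if "(k has_derivative (\<lambda>_. 0)) (at 0)" for k :: "C3 \<Rightarrow> complex"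
  proof -
    have "rot 0 = 0" by (simp add: rot_def zero_prod_def)
    then show ?thesis
      using has_derivative_compose[OF bounded_linear_imp_has_derivative[OF rot_linear(1)], of k "\<lambda>_. 0" 0 UNIV] that by simp
  qed
  have rot0: "rot 0 = 0" by (simp add: rot_def zero_prod_def)
  have W\<sigma>: "open (\<sigma> ` W)" by (rule lin_iso_open[OF iso(1) assms(3)])
  have roth: "hmap (\<sigma> ` W) rot"
    by (rule hmapI[OF W\<sigma> bounded_linear_imp_has_derivative[OF rot_linear(1)]]) (simp add: rot_def cmul3_def)
  have holr: "holo3 (\<sigma> ` W) (\<lambda>p. k (rot p))" if "holo3 W k" for k
    by (rule holo3_compose_hmap(1)[OF that roth]) (auto simp: \<sigma>rot)
  have W\<sigma>0: "0 \<in> \<sigma> ` W" using W rot0 by (metis \<sigma>rot(1) image_eqI)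
  \<comment> \<open>In the coordinates (z, x, y) the first equation is decoupled at linear order, so
    \<kappa> = 0, and the entry y in the equation for x becomes b12 = 1.\<close>
  interpret z: bb_field l2 0 l1 1 l1 "\<lambda>p. h (rot p)" "\<lambda>p. f (rot p)" "\<lambda>p. g (rot p)" "\<sigma> ` W"
    using l W\<sigma>0 z rot0 by unfold_locales (auto intro: holr rotd hol D)
  have zP: "z.P = (\<lambda>p. R (rot p))" "z.Q = (\<lambda>p. P (rot p))" "z.R = (\<lambda>p. Q (rot p))"
    by (unfold z.P_def z.Q_def z.R_def P_def Q_def R_def sysP_def sysQ_def sysR_def l1_def[symmetric] l2_def[symmetric])
      (simp_all add: rot_def)
  have zV: "field3 z.P z.Q z.R = (\<lambda>p. \<sigma> (V (rot p)))"
    by (simp add: zP V_def field3_def \<sigma>_def fun_eq_iff)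
  have Vz: "(\<lambda>p. rot (\<sigma> (V (rot (\<sigma> p))))) = V" by (simp add: \<sigma>rot)
  have WW: "rot ` \<sigma> ` W = W" by (simp add: image_image \<sigma>rot)
  have ax: "\<sigma> ` zaxis = xaxis" "rot ` xaxis = zaxis" unfolding \<sigma>_def by (rule rot_axis)+
  have to_x: "curve_cm (\<lambda>p. \<sigma> (V (rot p))) xaxis (\<sigma> ` S)" if "curve_cm V zaxis S" for S
    using curve_cm_transport[OF iso(1) that] by (simp only: ax)
  have to_z: "curve_cm V zaxis (rot ` S)" if "curve_cm (\<lambda>p. \<sigma> (V (rot p))) xaxis S" for S
    using curve_cm_transport[OF iso(2) that] by (simp only: ax Vz)
  have iso_z: "iso_family V W (rot ` S) T" if "iso_family (\<lambda>p. \<sigma> (V (rot p))) (\<sigma> ` W) S T" for S T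
    using iso_family_transport[OF iso(2) that] by (simp only: Vz WW)
  have germ_z: "germ_eq S S'" if "germ_eq (\<sigma> ` S) (\<sigma> ` S')" for S S'
    using germ_eq_transport[OF iso(2) that] by (simp add: image_image \<sigma>rot)
  have germ_x: "germ_eq S S'" if "germ_eq (rot ` S) (rot ` S')" for S S'
    using germ_eq_transport[OF iso(1) that] by (simp add: image_image \<sigma>rot)
  have ratio: "l2 / l1 = of_real (w2 / w1)" "l1 / l2 = of_real (w1 / w2)" by (simp_all add: l1_def l2_def)
  have part1: "\<not> (\<exists>S. curve_cm V yaxis S)"
    unfolding V_def P_def Q_def using no_y_curve[OF W hol(1,2) z(1,2) D(1)] by blast
  \<comment> \<open>The linear matrix has the eigenvalue t - 1 for the frequency ratio t; the shift
    by one explains \<open>Suc n\<close>.\<close>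
  have nat_ne: "of_real t - 1 \<noteq> (of_nat n :: complex)" if "\<not> (\<exists>k::nat. k \<ge> 1 \<and> t = real k)" for t :: real and n
  proof
    assume "of_real t - 1 = (of_nat n :: complex)"
    then have "of_real t = (of_real (real (Suc n)) :: complex)" by (simp add: algebra_simps)
    then have "t = real (Suc n)" by (simp only: of_real_eq_iff)
    then show False using that by (metis le_add1 plus_1_eq_Suc)
  qed
  have part2: "(\<exists>S. curve_cm V xaxis S \<and> iso_family V W S (2 * pi / \<bar>w1\<bar>)) \<and>
        (\<forall>S S'. curve_cm V xaxis S \<and> curve_cm V xaxis S' \<longrightarrow> germ_eq S S')" if no: "\<not> (\<exists>k::nat. k \<ge> 1 \<and> w2 / w1 = real k)"
  proof -
    have nr: "nonres {1..} x.Mx"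
      by (rule upper_triangular_nonres) (use nat_ne[OF no] l in \<open>auto simp: x.Mx_nth ratio\<close>)
    note c = x.nonres_curve[OF nr l1_def, unfolded xP, folded V_def]
    show ?thesis using c(1) c(2) by blast
  qed
  have part3: "(\<exists>S. curve_cm V zaxis S \<and> iso_family V W S (2 * pi / \<bar>w2\<bar>)) \<and>
        (\<forall>S S'. curve_cm V zaxis S \<and> curve_cm V zaxis S' \<longrightarrow> germ_eq S S')" if no: "\<not> (\<exists>k::nat. k \<ge> 1 \<and> w1 / w2 = real k)"
  proof -
    have nr: "nonres {1..} z.Mx"
      by (rule upper_triangular_nonres) (use nat_ne[OF no] l in \<open>auto simp: z.Mx_nth ratio\<close>)
    note c = z.nonres_curve[OF nr l2_def, unfolded zV]
    show ?thesis using c(1) c(2) to_x to_z iso_z germ_z by meson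
  qed
  have part4: "(\<exists>S. surf_cm V xzplane S \<and> iso_family V W S (2 * pi / \<bar>w1\<bar>)) \<and>
        (\<forall>S S'. surf_cm V xzplane S \<and> surf_cm V xzplane S' \<longrightarrow> germ_eq S S')" if eq: "w1 = w2"
  proof -
    have V: "V = field3 (sysP w1 f) (sysQ w1 g) (sysR w1 h)" using eq by (simp add: V_def P_def Q_def R_def)
    show ?thesis unfolding V
      using surface_exists[OF w(1) W hol z D] surface_unique[OF w(1) W hol z D] by blast
  qed
  have lk: "l' = of_nat k * l''" if "l' / l'' = of_real (real k)" "l'' \<noteq> 0" for k and l' l'' :: complex
  proof -
    have "l' = (l' / l'') * l''" using that(2) by simp
    then show ?thesis unfolding that(1) by simp
  qed
  have part5: "let r = bb_const ((reduce ^^ (k - 2)) (bb_of (bbx_rhs P Q R))) $ 2 in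
          (r = 0 \<longrightarrow> (\<exists>Sf :: nat \<Rightarrow> C3 set.
              (\<forall>n. curve_cm V xaxis (Sf n) \<and> iso_family V W (Sf n) (2 * pi / \<bar>w1\<bar>)) \<and>
              (\<forall>m n. m \<noteq> n \<longrightarrow> \<not> germ_eq (Sf m) (Sf n))))
        \<and> (r \<noteq> 0 \<longrightarrow> \<not> (\<exists>S. curve_cm V xaxis S))" if k: "k \<ge> 2" "w2 / w1 = real k" for k
  proof -
    have "l2 = of_nat k * l1" using lk[of l2 l1 k] ratio(1) k(2) l by simp
    note c = x.resonant_curve[OF k(1) this disjI1[OF refl] l1_def, unfolded xP, folded V_def]
    show ?thesis unfolding Let_def using c by (intro conjI impI)
  qed
  have part6: "let r = bb_const ((reduce ^^ (k - 2)) (bb_of (bbz_rhs P Q R))) $ 2 in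
          (r = 0 \<longrightarrow> (\<exists>Sf :: nat \<Rightarrow> C3 set.
              (\<forall>n. curve_cm V zaxis (Sf n) \<and> iso_family V W (Sf n) (2 * pi / \<bar>w2\<bar>)) \<and>
              (\<forall>m n. m \<noteq> n \<longrightarrow> \<not> germ_eq (Sf m) (Sf n))))
        \<and> (r \<noteq> 0 \<longrightarrow> \<not> (\<exists>S. curve_cm V zaxis S))" if k: "k \<ge> 2" "w1 / w2 = real k" for k
  proof -
    have l12: "l1 = of_nat k * l2" using lk[of l1 l2 k] ratio(2) k(2) l by simp
    \<comment> \<open>Selects the Jordan alternative of \<open>resonant_curve\<close>: here both
      eigenvalues of the transverse block are \<open>l1\<close> and its off-diagonal entry is
      1.\<close>
    have "l1 = l2 \<or> l1 = of_nat k * l2 \<and> (1::complex) \<noteq> 0" using l12 by simp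
    note c = z.resonant_curve[OF k(1) l12 this l2_def, unfolded zV, unfolded zP, folded bbz_rhs_rot]
    show ?thesis unfolding Let_def
    proof (intro conjI impI)
      assume "bb_const ((reduce ^^ (k - 2)) (bb_of (bbz_rhs P Q R))) $ 2 = 0"
      from c(1)[OF this] obtain Sf :: "nat \<Rightarrow> C3 set" where Sf:
        "(\<forall>n. curve_cm (\<lambda>p. \<sigma> (V (rot p))) xaxis (Sf n) \<and> iso_family (\<lambda>p. \<sigma> (V (rot p))) (\<sigma> ` W) (Sf n) (2 * pi / \<bar>w2\<bar>)) \<and>
              (\<forall>m n. m \<noteq> n \<longrightarrow> \<not> germ_eq (Sf m) (Sf n))" by (rule exE)
      show "\<exists>Sf :: nat \<Rightarrow> C3 set. (\<forall>n. curve_cm V zaxis (Sf n) \<and> iso_family V W (Sf n) (2 * pi / \<bar>w2\<bar>)) \<and>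
              (\<forall>m n. m \<noteq> n \<longrightarrow> \<not> germ_eq (Sf m) (Sf n))"
      proof (rule exI[of _ "\<lambda>n. rot ` Sf n"], intro conjI allI impI)
        show "curve_cm V zaxis (rot ` Sf n)" for n using Sf to_z by blast
        show "iso_family V W (rot ` Sf n) (2 * pi / \<bar>w2\<bar>)" for n using Sf iso_z by blast
        show "\<not> germ_eq (rot ` Sf m) (rot ` Sf n)" if "m \<noteq> n" for m n using Sf germ_x that by blast
      qed
    next
      assume "bb_const ((reduce ^^ (k - 2)) (bb_of (bbz_rhs P Q R))) $ 2 \<noteq> 0"
      from c(2)[OF this] show "\<not> (\<exists>S. curve_cm V zaxis S)" using to_x by blast
    qed
  qed
  show ?thesis
    by (intro conjI impI allI part1 part2 part3 part4 part5 part6; (elim conjE)?; assumption)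
qed

end
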